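(* Let $a$ be weakly degenerate (WD) or strongly degenerate (SD) at $0$. Let $f\in L^2_{loc}[0,+\infty)$ and $(u_0,u_1)\in L^2_{\frac1a}(0,1)\times\bigl(H^2_{\frac1a}(0,1)\bigr)^*$. Then there exists a unique solution by transposition $$u\in C^1\bigl([0,+\infty);(H^2_{\frac1a}(0,1))^*\bigr)\cap C\bigl([0,+\infty);L^2_{\frac1a}(0,1)\bigr)$$ of the problem $u_{tt}+a(x)u_{xxxx}=0$ for $t>0$, $x\in(0,1)$, with $u(t,0)=u_x(t,0)=0$, $u(t,1)=0$, $u_x(t,1)=f(t)$ for $t>0$, and $u(0,x)=u_0(x)$, $u_t(0,x)=u_1(x)$ for $x\in(0,1)$.
   Context: Degeneracy: for $a:[0,1]\to\mathbb R$ with $a(0)=0$, $a>0$ on $(0,1]$, put $K:=\sup_{x\in(0,1]}\frac{x|a'(x)|}{a(x)}$. $a$ is weakly degenerate at $0$ (WD) if $a\in C[0,1]\cap C^1(0,1]$, $a(0)=0$, $a>0$ on $(0,1]$ and $K\in(0,1)$. $a$ is strongly degenerate at $0$ (SD) if $a\in C^1[0,1]$, $a(0)=0$, $a>0$ on $(0,1]$ and $K\in[1,2)$. Spaces: $L^2_{\frac1a}(0,1):=\{u\in L^2(0,1):\int_0^1\frac{u^2}{a}dx<\infty\}$ with norm$^2$ $\int_0^1\frac{u^2}{a}dx$; $H^2_{\frac1a}(0,1):=L^2_{\frac1a}(0,1)\cap H^2_0(0,1)$ with norm$^2$ $\|u\|^2_{L^2_{1/a}}+\|u'\|^2_{L^2}+\|u''\|^2_{L^2}$;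 $(H^2_{\frac1a}(0,1))^*$ is its dual with respect to the pivot space $L^2_{\frac1a}(0,1)$ (so $w\in L^2_{\frac1a}$ acts by $v\mapsto\int_0^1\frac{wv}{a}dx$); $\langle\cdot,\cdot\rangle$ denotes the duality pairing between $(H^2_{\frac1a}(0,1))^*$ and $H^2_{\frac1a}(0,1)$. $\mathcal H_0:=H^2_{\frac1a}(0,1)\times L^2_{\frac1a}(0,1)$ with norm$^2$ $\|(u,v)\|^2_{\mathcal H_0}=\int_0^1(u'')^2dx+\int_0^1\frac{v^2}{a}dx$. Operators: $Au:=au''''$ on $D(A):=\{u\in H^2_{\frac1a}(0,1):au''''\in L^2_{\frac1a}(0,1)\}$; $\mathcal A(u,v):=(v,-Au)$ on $D(\mathcal A):=D(A)\times H^2_{\frac1a}(0,1)\subset\mathcal H_0$. Backward problem with final time $T>0$ and data $(v^0_T,v^1_T)\in\mathcal H_0$: $v_{tt}+av_{xxxx}=0$ in $(0,\infty)\times(0,1)$, $v(t,0)=v_x(t,0)=v(t,1)=v_x(t,1)=0$, $v(T,\cdot)=v^0_T$, $v_t(T,\cdot)=v^1_T$. Its solution is the mild solution, $v\in C^1([0,\infty);L^2_{\frac1a})\cap C([0,\infty);H^2_{\frac1a})$, i.e. $(v,v_t)$ is the mild solution of $\dot{\mathcal V}=\mathcal A\mathcal V$, $\mathcal V(T)=(v^0_T,v^1_T)$ (the equation is reversible in time). For mild solutions the trace $v_{xx}(\cdot,1)$ is understood as the limit in $L^2(0,T)$ of the traces of classical solutions with data in $D(\mathcal A)$ converging in $\mathcal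 H_0$. Solution by transposition: a function $u$ in the stated regularity class such that for all $T>0$ and all $(v^0_T,v^1_T)\in\mathcal H_0$, with $v$ the solution of the backward problem, $$\langle u_t(T),v^0_T\rangle-\int_0^1\frac{u(T)v^1_T}{a}dx=\langle u_1,v(0)\rangle-\int_0^1\frac{u_0v_t(0,x)}{a}dx-\int_0^Tf(t)v_{xx}(t,1)dt.$$ *)

theory Defs
  imports "HOL-Analysis.Analysis" "HOL-Library.Function_Algebras"
begin

text \<open>
  Pointwise vector space structure on functions. It is used for functions on the interval, for
  functionals on such functions, and (through the product instance) for pairs of functions.
\<close>

instantiation "fun" :: (type, real_vector) real_vector
begin

definition scaleR_fun :: "real \<Rightarrow> ('a \<Rightarrow> 'b) \<Rightarrow> 'a \<Rightarrow> 'b" where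
  "scaleR_fun c f = (\<lambda>x. c *\<^sub>R f x)"

instance
  by standard (auto simp: scaleR_fun_def fun_eq_iff algebra_simps)

end

type_synonym fn = "real \<Rightarrow> real"

text \<open>
  Elements of Lebesgue and Sobolev spaces are represented by functions; two functions represent
  the same element iff they agree almost everywhere. All norms below only depend on the class.
\<close>

abbreviation M01 :: "real measure" where
  "M01 \<equiv> lebesgue_on {0<..<1}"

definition ae_eq :: "fn \<Rightarrow> fn \<Rightarrow> bool" where
  "ae_eq u v \<longleftrightarrow> (AE x in M01. u x = v x)"

definition ae_eq2 :: "fn \<times> fn \<Rightarrow> fn \<times> fn \<Rightarrow> bool" where
  "ae_eq2 U V \<longleftrightarrow> ae_eq (fst U) (fst V) \<and> ae_eq (snd U) (snd V)"


section \<open>Degenerate coefficients\<close>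

text \<open>The supremum is taken in \<^typ>\<open>ereal\<close>, so that an unbounded quotient has \<open>K = \<infinity>\<close>.\<close>

definition degeneracy_const :: "fn \<Rightarrow> fn \<Rightarrow> ereal" where
  "degeneracy_const a a' = (SUP x\<in>{0<..1}. ereal (x * \<bar>a' x\<bar> / a x))"

definition weakly_degenerate :: "fn \<Rightarrow> bool" where
  "weakly_degenerate a \<longleftrightarrow>
     continuous_on {0..1} a \<and> a 0 = 0 \<and> (\<forall>x\<in>{0<..1}. 0 < a x) \<and>
     (\<exists>a'. (\<forall>x\<in>{0<..1}. (a has_real_derivative a' x) (at x within {0..1})) \<and>
           continuous_on {0<..1} a' \<and>
           0 < degeneracy_const a a' \<and> degeneracy_const a a' < 1)"

definition strongly_degenerate :: "fn \<Rightarrow> bool" where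
  "strongly_degenerate a \<longleftrightarrow>
     a 0 = 0 \<and> (\<forall>x\<in>{0<..1}. 0 < a x) \<and>
     (\<exists>a'. (\<forall>x\<in>{0..1}. (a has_real_derivative a' x) (at x within {0..1})) \<and>
           continuous_on {0..1} a' \<and>
           1 \<le> degeneracy_const a a' \<and> degeneracy_const a a' < 2)"


section \<open>Function spaces\<close>

definition L2_on :: "real set \<Rightarrow> fn set" where
  "L2_on S = {u. u \<in> borel_measurable (lebesgue_on S) \<and> integrable (lebesgue_on S) (\<lambda>x. (u x)\<^sup>2)}"

definition L2_norm :: "real set \<Rightarrow> fn \<Rightarrow> real" where
  "L2_norm S u = sqrt (LINT x|lebesgue_on S. (u x)\<^sup>2)"

definition L2_loc :: "fn set" where
  "L2_loc = {f. \<forall>T>0. f \<in> L2_on {0..T}}"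

definition L2w :: "fn \<Rightarrow> fn set" where
  "L2w a = {u \<in> L2_on {0<..<1}. integrable M01 (\<lambda>x. (u x)\<^sup>2 / a x)}"

definition L2w_inner :: "fn \<Rightarrow> fn \<Rightarrow> fn \<Rightarrow> real" where
  "L2w_inner a u v = (LINT x|M01. u x * v x / a x)"

definition L2w_norm :: "fn \<Rightarrow> fn \<Rightarrow> real" where
  "L2w_norm a u = sqrt (LINT x|M01. (u x)\<^sup>2 / a x)"

definition test_functions :: "fn set" where
  "test_functions =
     {\<phi>. (\<forall>k x. (deriv ^^ k) \<phi> differentiable (at x)) \<and>
         (\<exists>c d. 0 < c \<and> d < 1 \<and> (\<forall>x. x \<notin> {c..d} \<longrightarrow> \<phi> x = 0))}"

definition locally_integrable :: "fn \<Rightarrow> bool" where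
  "locally_integrable u \<longleftrightarrow> (\<forall>c d. 0 < c \<and> d < 1 \<longrightarrow> integrable (lebesgue_on {c..d}) u)"

definition has_weak_deriv :: "nat \<Rightarrow> fn \<Rightarrow> fn \<Rightarrow> bool" where
  "has_weak_deriv k u g \<longleftrightarrow> locally_integrable u \<and> locally_integrable g \<and>
     (\<forall>\<phi>\<in>test_functions.
        (LINT x|M01. u x * (deriv ^^ k) \<phi> x) = (- 1) ^ k * (LINT x|M01. g x * \<phi> x))"

text \<open>A representative of the weak derivative of order \<open>k\<close>; only meaningful if one exists.\<close>

definition weak_deriv :: "nat \<Rightarrow> fn \<Rightarrow> fn" where
  "weak_deriv k u = (SOME g. has_weak_deriv k u g)"

definition H2 :: "fn set" where
  "H2 = {u \<in> L2_on {0<..<1}. \<forall>k\<in>{1, 2}. \<exists>g\<in>L2_on {0<..<1}. has_weak_deriv k u g}"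

definition H2_norm :: "fn \<Rightarrow> real" where
  "H2_norm u = sqrt ((L2_norm {0<..<1} u)\<^sup>2 + (L2_norm {0<..<1} (weak_deriv 1 u))\<^sup>2
                      + (L2_norm {0<..<1} (weak_deriv 2 u))\<^sup>2)"

definition H2_0 :: "fn set" where
  "H2_0 = {u \<in> H2. \<exists>\<phi>. (\<forall>n. \<phi> n \<in> test_functions) \<and> (\<lambda>n. H2_norm (\<phi> n - u)) \<longlonglongrightarrow> 0}"

definition H2w :: "fn \<Rightarrow> fn set" where
  "H2w a = L2w a \<inter> H2_0"

definition H2w_norm :: "fn \<Rightarrow> fn \<Rightarrow> real" where
  "H2w_norm a u = sqrt ((L2w_norm a u)\<^sup>2 + (L2_norm {0<..<1} (weak_deriv 1 u))\<^sup>2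
                         + (L2_norm {0<..<1} (weak_deriv 2 u))\<^sup>2)"

text \<open>
  The dual of \<^term>\<open>H2w a\<close>: functionals whose values outside \<^term>\<open>H2w a\<close> are irrelevant.
  Boundedness makes them compatible with almost everywhere equality.
\<close>

definition H2w_dual :: "fn \<Rightarrow> (fn \<Rightarrow> real) set" where
  "H2w_dual a =
     {\<xi>. (\<forall>u\<in>H2w a. \<forall>v\<in>H2w a. \<xi> (u + v) = \<xi> u + \<xi> v) \<and>
         (\<forall>c. \<forall>u\<in>H2w a. \<xi> (c *\<^sub>R u) = c * \<xi> u) \<and>
         (\<exists>C. \<forall>u\<in>H2w a. \<bar>\<xi> u\<bar> \<le> C * H2w_norm a u)}"

definition H2w_dual_norm :: "fn \<Rightarrow> (fn \<Rightarrow> real) \<Rightarrow> real" where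
  "H2w_dual_norm a \<xi> = (SUP v\<in>{v \<in> H2w a. H2w_norm a v \<le> 1}. \<bar>\<xi> v\<bar>)"

definition H0 :: "fn \<Rightarrow> (fn \<times> fn) set" where
  "H0 a = H2w a \<times> L2w a"

definition H0_norm :: "fn \<Rightarrow> fn \<times> fn \<Rightarrow> real" where
  "H0_norm a U = sqrt ((L2_norm {0<..<1} (weak_deriv 2 (fst U)))\<^sup>2 + (L2w_norm a (snd U))\<^sup>2)"


section \<open>Curves on the half-line with values in a normed space\<close>

text \<open>\<open>N\<close> is the norm of the space; one-sided limits are taken at \<open>t = 0\<close>.\<close>

definition curve_continuous :: "('v::real_vector \<Rightarrow> real) \<Rightarrow> (real \<Rightarrow> 'v) \<Rightarrow> bool" where
  "curve_continuous N \<phi> \<longleftrightarrow>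
     (\<forall>t\<ge>0. ((\<lambda>s. N (\<phi> s - \<phi> t)) \<longlongrightarrow> 0) (at t within {0..}))"

definition curve_has_deriv ::
    "('v::real_vector \<Rightarrow> real) \<Rightarrow> (real \<Rightarrow> 'v) \<Rightarrow> (real \<Rightarrow> 'v) \<Rightarrow> bool" where
  "curve_has_deriv N \<phi> \<psi> \<longleftrightarrow>
     (\<forall>t\<ge>0. ((\<lambda>s. N ((\<phi> s - \<phi> t) /\<^sub>R (s - t) - \<psi> t)) \<longlongrightarrow> 0) (at t within {0..}))"


section \<open>The operators and the backward problem\<close>

definition A_op :: "fn \<Rightarrow> fn \<Rightarrow> fn" where
  "A_op a u = (\<lambda>x. a x * weak_deriv 4 u x)"

definition A_dom :: "fn \<Rightarrow> fn set" where
  "A_dom a = {u \<in> H2w a. (\<exists>g. has_weak_deriv 4 u g) \<and> A_op a u \<in> L2w a}"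

definition AA_op :: "fn \<Rightarrow> fn \<times> fn \<Rightarrow> fn \<times> fn" where
  "AA_op a U = (snd U, - A_op a (fst U))"

definition AA_dom :: "fn \<Rightarrow> (fn \<times> fn) set" where
  "AA_dom a = A_dom a \<times> H2w a"

definition classical_solution :: "fn \<Rightarrow> real \<Rightarrow> fn \<times> fn \<Rightarrow> (real \<Rightarrow> fn \<times> fn) \<Rightarrow> bool" where
  "classical_solution a T VT V \<longleftrightarrow>
     (\<forall>t\<ge>0. V t \<in> AA_dom a) \<and>
     curve_has_deriv (H0_norm a) V (\<lambda>t. AA_op a (V t)) \<and>
     curve_continuous (H0_norm a) (\<lambda>t. AA_op a (V t)) \<and>
     ae_eq2 (V T) VT"

text \<open>
  Mild solutions satisfy \<open>V t = VT + AA (\<integral>\<^sub>T\<^sup>t V s ds)\<close>, where the integral lies in the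
  domain of the generator. Since \<open>V\<close> is continuous, the curve \<open>P t = \<integral>\<^sub>T\<^sup>t V s ds\<close> is
  the primitive of \<open>V\<close> in \<^term>\<open>H0 a\<close> that vanishes at \<open>T\<close>.
\<close>

definition mild_solution :: "fn \<Rightarrow> real \<Rightarrow> fn \<times> fn \<Rightarrow> (real \<Rightarrow> fn \<times> fn) \<Rightarrow> bool" where
  "mild_solution a T VT V \<longleftrightarrow>
     (\<forall>t\<ge>0. V t \<in> H0 a) \<and> curve_continuous (H0_norm a) V \<and>
     (\<exists>P. (\<forall>t\<ge>0. P t \<in> AA_dom a) \<and> ae_eq2 (P T) 0 \<and>
          curve_has_deriv (H0_norm a) P V \<and>
          (\<forall>t\<ge>0. ae_eq2 (V t) (VT + AA_op a (P t))))"

text \<open>The value \<open>u''(1)\<close>, taken from the representative of \<open>u''\<close> that is continuous up to \<open>1\<close>.\<close>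

definition second_deriv_trace :: "fn \<Rightarrow> real \<Rightarrow> bool" where
  "second_deriv_trace u r \<longleftrightarrow>
     (\<exists>g. has_weak_deriv 2 u g \<and> continuous_on {0<..1} g \<and> g 1 = r)"

text \<open>\<open>g\<close> is the trace \<open>v\<^sub>x\<^sub>x(\<cdot>, 1)\<close> on \<open>(0, T)\<close> of the mild solution with data \<open>VT\<close> at time \<open>T\<close>.\<close>

definition mild_trace :: "fn \<Rightarrow> real \<Rightarrow> fn \<times> fn \<Rightarrow> fn \<Rightarrow> bool" where
  "mild_trace a T VT g \<longleftrightarrow> g \<in> L2_on {0..T} \<and>
     (\<exists>X V r.
        (\<forall>n::nat. X n \<in> AA_dom a \<and> classical_solution a T (X n) (V n) \<and>
             r n \<in> L2_on {0..T} \<and> (\<forall>t\<in>{0..T}. second_deriv_trace (fst (V n t)) (r n t))) \<and>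
        (\<lambda>n. H0_norm a (X n - VT)) \<longlonglongrightarrow> 0 \<and>
        (\<lambda>n. L2_norm {0..T} (r n - g)) \<longlonglongrightarrow> 0)"


section \<open>Solutions by transposition\<close>

text \<open>
  \<^term>\<open>ut\<close> is the derivative of \<^term>\<open>u\<close> in the dual space, where \<open>u t\<close> acts through the
  pivot space as \<^term>\<open>L2w_inner a (u t)\<close>.
\<close>

definition transposition_solution ::
    "fn \<Rightarrow> fn \<Rightarrow> fn \<Rightarrow> (fn \<Rightarrow> real) \<Rightarrow> (real \<Rightarrow> fn) \<Rightarrow> bool" where
  "transposition_solution a f u0 u1 u \<longleftrightarrow>
     (\<forall>t\<ge>0. u t \<in> L2w a) \<and> curve_continuous (L2w_norm a) u \<and>
     (\<exists>ut. (\<forall>t\<ge>0. ut t \<in> H2w_dual a) \<and>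
        curve_has_deriv (H2w_dual_norm a) (\<lambda>t. L2w_inner a (u t)) ut \<and>
        curve_continuous (H2w_dual_norm a) ut \<and>
        (\<forall>T>0. \<forall>vT0\<in>H2w a. \<forall>vT1\<in>L2w a. \<forall>V g.
           mild_solution a T (vT0, vT1) V \<longrightarrow> mild_trace a T (vT0, vT1) g \<longrightarrow>
             ut T vT0 - L2w_inner a (u T) vT1 =
             u1 (fst (V 0)) - L2w_inner a u0 (snd (V 0))
               - (LINT t|lebesgue_on {0..T}. f t * g t)))"

end

(*
  Encode a state (u, u_t) by (u'', u_t / sqrt a). The energy space becomes N x L^2, where N is the
  closure of the second derivatives of test functions, and everything is governed by the operator
  T : u'' |-> u / sqrt a from N to L^2 and its adjoint R: a solution is a curve v = R y in N with
  v' = w and (T w)' = - y. The degeneracy is mild enough for a(x) >= a(1) x^2, and then T is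
  compact and injective with dense range, so T R has an orthonormal eigenbasis, the modes.

  The multiplier (2x - 1)_+^2 u_x, which vanishes near the degenerate point, bounds the trace
  u_xx(., 1) in L^2(0,t) by the energy (hidden regularity). By duality the Duhamel integrals of f
  against the modes are square summable, which yields the solution as a series; the rotation of each
  mode is factored out, so that continuity in time reduces to that of the integral of f^2. The
  transposition identity is exact for finitely many modes and extends by hidden regularity. For
  uniqueness, the backward solution with a single mode as data determines the corresponding
  coefficient of u(T).
*)

theory Submission
  imports Defs "HOL-Complex_Analysis.Great_Picard"
begin

text \<open>All control near the degenerate endpoint rests on one estimate: if u(0) = u'(0) = 0 then
  |u(x)| <= x ||u''||, so u / sqrt a is bounded as soon as a(x) >= a(1) x^2. The latter holds
  because x a' <= 2 a makes a / x^2 nonincreasing; it uses only K < 2, so weak and strong degeneracy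
  are treated together. Beyond that, a' matters only on [1/2, 1], where the multiplier lives. T R is
  the inverse of A, transported from the weighted space to L^2 by division by sqrt a; hence its
  eigenvalues are written as 1 / freq^2. The eigenbasis comes from Zorn's lemma and is indexed by
  itself. No countability is established: every series is controlled by bounds that are uniform over
  finite index sets. The transposition identity must hold for every mild solution and every trace
  that some sequence of classical solutions produces, not just for those built from modes. Therefore
  energy conservation and hidden regularity are proved for arbitrary classical solutions, and finite
  mode sums are the solutions that these are compared with.\<close>

section \<open>Projection and Riesz representation in Hilbert spaces\<close>

text \<open>Near-minimisers of the distance to \<open>N\<close> form a Cauchy sequence by the
  parallelogram law, since midpoints stay in \<open>N\<close>.\<close>

lemma orthogonal_projection_exists:
  fixes N :: "'a::{real_inner,complete_space} set"
  assumes "closed N" "subspace N"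
  shows "\<exists>y\<in>N. \<forall>z\<in>N. (x - y) \<bullet> z = 0"
proof -
  have ne: "0 \<in> N" using assms subspace_0 by blast
  define D where "D = (\<lambda>z. (norm (x - z))\<^sup>2) ` N"
  have Dbd: "bdd_below D" unfolding D_def by (rule bdd_belowI[of _ 0]) auto
  have Dne: "D \<noteq> {}" using ne D_def by auto
  define d where "d = Inf D"
  have dle: "d \<le> (norm (x - z))\<^sup>2" if "z \<in> N" for z
    unfolding d_def by (rule cInf_lower) (use that D_def Dbd in auto)
  have "\<exists>z\<in>N. (norm (x - z))\<^sup>2 < d + 1 / (real n + 1)" for n
  proof -
    have "Inf D < d + 1 / (real n + 1)" unfolding d_def by simp
    then obtain y where "y \<in> D" "y < d + 1 / (real n + 1)" using cInf_lessD[OF Dne] by blast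
    then show ?thesis unfolding D_def by auto
  qed
  then obtain z where zN: "\<And>n. z n \<in> N" and zd: "\<And>n. (norm (x - z n))\<^sup>2 < d + 1 / (real n + 1)" by metis
  have key: "(norm (z n - z m))\<^sup>2 \<le> 2 / (real n + 1) + 2 / (real m + 1)" for n m
  proof -
    have mid: "(1/2) *\<^sub>R (z n + z m) \<in> N" using zN assms(2) by (simp add: subspace_add subspace_scale)
    have "(norm (z n - z m))\<^sup>2 = 2 * (norm (x - z n))\<^sup>2 + 2 * (norm (x - z m))\<^sup>2
        - 4 * (norm (x - (1/2) *\<^sub>R (z n + z m)))\<^sup>2"
      by (simp add: power2_norm_eq_inner algebra_simps inner_commute)
    moreover have h: "2 / (real k + 1) = 2 * (1 / (real k + 1))" for k by simp
    ultimately show ?thesis using dle[OF mid] zd[of n] zd[of m] unfolding h by linarith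
  qed
  have "Cauchy z"
  proof (rule CauchyI)
    fix e :: real assume e: "e > 0"
    obtain M :: nat where M: "4 / e\<^sup>2 < real M" using reals_Archimedean2 by blast
    show "\<exists>M. \<forall>m\<ge>M. \<forall>n\<ge>M. norm (z m - z n) < e"
    proof (intro exI allI impI)
      fix m n assume mn: "m \<ge> M" "n \<ge> M"
      have e4: "4 < e\<^sup>2 * real M" using M e by (simp add: field_simps)
      have b: "2 / (real k + 1) < e\<^sup>2 / 2" if "k \<ge> M" for k
      proof -
        have "e\<^sup>2 * real M \<le> e\<^sup>2 * (real k + 1)" using that e by (intro mult_left_mono) auto
        then have "4 < e\<^sup>2 * (real k + 1)" using e4 by linarith
        then show ?thesis by (simp add: field_simps)
      qed
      have "(norm (z m - z n))\<^sup>2 < e\<^sup>2" using key[of m n] b[OF mn(1)] b[OF mn(2)] by linarith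
      then show "norm (z m - z n) < e" using e by (simp add: power_less_imp_less_base)
    qed
  qed
  then obtain y where y: "z \<longlonglongrightarrow> y" using Cauchy_convergent convergent_def by blast
  have yN: "y \<in> N" using assms(1) zN y closed_sequentially by blast
  have "(norm (x - y))\<^sup>2 \<le> d"
  proof (rule LIMSEQ_le)
    show "(\<lambda>n. (norm (x - z n))\<^sup>2) \<longlonglongrightarrow> (norm (x - y))\<^sup>2" by (intro tendsto_intros y)
    show "(\<lambda>n. d + 1 / (real n + 1)) \<longlonglongrightarrow> d"
      using tendsto_add[OF tendsto_const LIMSEQ_inverse_real_of_nat, of d]
      by (simp add: inverse_eq_divide add.commute)
    show "\<exists>N. \<forall>n\<ge>N. (norm (x - z n))\<^sup>2 \<le> d + 1 / (real n + 1)" using zd less_imp_le by blast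
  qed
  have "(x - y) \<bullet> w = 0" if w: "w \<in> N" for w
  proof (cases "w = 0")
    case False
    \<comment> \<open>The minimiser of the distance from \<open>x\<close> to the line through
      \<open>y\<close> in direction \<open>w\<close>; moving there lowers the squared distance by
      the squared component of \<open>x - y\<close> along \<open>w\<close>.\<close>
    define t where "t = ((x - y) \<bullet> w) / (w \<bullet> w)"
    have ww: "w \<bullet> w > 0" using False by simp
    have "y + t *\<^sub>R w \<in> N" using yN w assms(2) by (simp add: subspace_add subspace_scale)
    then have "(norm (x - y))\<^sup>2 \<le> (norm (x - (y + t *\<^sub>R w)))\<^sup>2" using dle \<open>(norm (x - y))\<^sup>2 \<le> d\<close> order_trans by blast
    also have "\<dots> = (norm (x - y))\<^sup>2 - 2 * t * ((x - y) \<bullet> w) + t\<^sup>2 * (w \<bullet> w)"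
      unfolding power2_norm_eq_inner by (simp add: algebra_simps inner_commute power2_eq_square)
    also have "\<dots> = (norm (x - y))\<^sup>2 - ((x - y) \<bullet> w)\<^sup>2 / (w \<bullet> w)"
      using ww by (simp add: t_def field_simps power2_eq_square)
    finally have "((x - y) \<bullet> w)\<^sup>2 / (w \<bullet> w) \<le> 0" by simp
    then show ?thesis using ww by (simp add: divide_le_0_iff)
  qed simp
  then show ?thesis using yN by blast
qed

text \<open>Inside \<open>N\<close> the orthogonal complement of the kernel is spanned by the
  component \<open>q\<close> of any vector on which \<open>l\<close> does not vanish. Linearity and
  the bound are asked on \<open>N\<close> only, because the functionals to be represented are
  arbitrary elsewhere.\<close>

lemma riesz_representation:
  fixes N :: "'a::{real_inner,complete_space} set" and l :: "'a \<Rightarrow> real"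
  assumes N: "closed N" "subspace N"
    and add: "\<And>x y. x \<in> N \<Longrightarrow> y \<in> N \<Longrightarrow> l (x + y) = l x + l y"
    and scale: "\<And>c x. x \<in> N \<Longrightarrow> l (c *\<^sub>R x) = c * l x"
    and bd: "\<And>x. x \<in> N \<Longrightarrow> \<bar>l x\<bar> \<le> C * norm x"
  shows "\<exists>y\<in>N. \<forall>x\<in>N. l x = y \<bullet> x"
proof (cases "\<forall>x\<in>N. l x = 0")
  case True
  then show ?thesis using subspace_0[OF N(2)] by (intro bexI[of _ 0]) auto
next
  case False
  then obtain x where x: "x \<in> N" "l x \<noteq> 0" by blast
  define M where "M = {z \<in> N. l z = 0}"
  have lminus: "l (u - v) = l u - l v" if "u \<in> N" "v \<in> N" for u v
    using add[of u "(-1) *\<^sub>R v"] scale[of v "-1"] that N(2) by (simp add: subspace_neg)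
  have sM: "subspace M"
    using subspace_0[OF N(2)] scale[of 0 0] add scale N(2)
    by (auto simp: M_def subspace_def)
  have cM: "closed M" unfolding closed_sequential_limits
  proof (intro allI impI, elim conjE)
    fix s y assume s: "\<forall>n. s n \<in> M" "s \<longlonglongrightarrow> y"
    have yN: "y \<in> N" using s N(1) closed_sequentially[of N s y] M_def by auto
    have "(\<lambda>n. C * norm (y - s n)) \<longlonglongrightarrow> C * norm (y - y)" by (intro tendsto_intros s)
    moreover have "\<bar>l y\<bar> \<le> C * norm (y - s n)" for n
      using bd[of "y - s n"] lminus[of y "s n"] s(1) yN N(2) by (auto simp: M_def subspace_diff)
    ultimately have "\<bar>l y\<bar> \<le> 0" using LIMSEQ_le_const by fastforce
    then show "y \<in> M" using yN M_def by simp
  qed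
  obtain m where m: "m \<in> M" "\<forall>z\<in>M. (x - m) \<bullet> z = 0"
    using orthogonal_projection_exists[OF cM sM] by blast
  define q where "q = x - m"
  have qN: "q \<in> N" using m x N(2) by (simp add: q_def M_def subspace_diff)
  have lq: "l q = l x" using m x lminus by (simp add: q_def M_def)
  have q0: "q \<noteq> 0" using lq x scale[of 0 0] subspace_0[OF N(2)] by auto
  show ?thesis
  proof (intro bexI[of _ "(l q / (q \<bullet> q)) *\<^sub>R q"] ballI)
    show "(l q / (q \<bullet> q)) *\<^sub>R q \<in> N" using qN N(2) by (simp add: subspace_scale)
    fix z assume z: "z \<in> N"
    define r where "r = z - (l z / l q) *\<^sub>R q"
    have "r \<in> M" unfolding M_def r_def
      using z qN N(2) lminus[of z "(l z / l q) *\<^sub>R q"] scale[of q] lq x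
      by (simp add: subspace_diff subspace_scale)
    then have "q \<bullet> r = 0" using m q_def by simp
    then have "q \<bullet> z = (l z / l q) * (q \<bullet> q)" by (simp add: r_def inner_diff_right)
    then show "l z = (l q / (q \<bullet> q)) *\<^sub>R q \<bullet> z" using q0 lq x by simp
  qed
qed

section \<open>Orthonormal bases over arbitrary index sets\<close>

text \<open>Take for \<open>F\<close> a finite set whose sum is within \<open>\<epsilon>\<close> of
  the supremum of all finite sums; a disjoint finite set can then add less than
  \<open>\<epsilon>\<close>. This plays the role of summability without an enumeration of
  \<open>B\<close>.\<close>

lemma bounded_sums_tail:
  fixes c :: "'i \<Rightarrow> real"
  assumes bd: "\<And>F. finite F \<Longrightarrow> F \<subseteq> B \<Longrightarrow> (\<Sum>j\<in>F. c j) \<le> C" and "\<epsilon> > 0"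
  obtains F where "finite F" "F \<subseteq> B" "\<And>G. finite G \<Longrightarrow> G \<subseteq> B - F \<Longrightarrow> (\<Sum>j\<in>G. c j) < \<epsilon>"
proof -
  define S where "S = (\<lambda>F. \<Sum>j\<in>F. c j) ` {F. finite F \<and> F \<subseteq> B}"
  have Sne: "S \<noteq> {}" unfolding S_def by auto
  have Sbd: "bdd_above S" unfolding S_def by (rule bdd_aboveI[of _ C]) (use bd in auto)
  have "Sup S - \<epsilon> < Sup S" using assms(2) by simp
  then obtain y where "y \<in> S" "Sup S - \<epsilon> < y" using less_cSupD[OF Sne] by blast
  then obtain F where F: "finite F" "F \<subseteq> B" "Sup S - \<epsilon> < (\<Sum>j\<in>F. c j)" unfolding S_def by auto
  have "(\<Sum>j\<in>G. c j) < \<epsilon>" if "finite G" "G \<subseteq> B - F" for G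
  proof -
    have "(\<Sum>j\<in>F \<union> G. c j) = (\<Sum>j\<in>F. c j) + (\<Sum>j\<in>G. c j)"
      by (rule sum.union_disjoint) (use that F in auto)
    moreover have "(\<Sum>j\<in>F \<union> G. c j) \<le> Sup S"
      by (rule cSup_upper) (use that F Sbd in \<open>auto simp: S_def\<close>)
    ultimately show ?thesis using F by linarith
  qed
  then show ?thesis using that F by blast
qed

text \<open>Carrying the closed subspace \<open>N\<close> and the family \<open>e\<close> lets the
  same locale serve both the energy space with \<open>mode\<close> and all of L^2 with the
  eigenvectors themselves. Totality is the assumption; density of finite combinations is derived in
  \<open>approx\<close>.\<close>

locale orthonormal_basis =
  fixes N :: "'a::{real_inner,complete_space} set" and B :: "'i set" and e :: "'i \<Rightarrow> 'a"
  assumes N_closed: "closed N" and N_subspace: "subspace N"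
    and e_in: "\<And>i. i \<in> B \<Longrightarrow> e i \<in> N"
    and e_orth: "\<And>i j. i \<in> B \<Longrightarrow> j \<in> B \<Longrightarrow> e i \<bullet> e j = (if i = j then 1 else 0)"
    and e_total: "\<And>x. x \<in> N \<Longrightarrow> (\<And>i. i \<in> B \<Longrightarrow> x \<bullet> e i = 0) \<Longrightarrow> x = 0"
begin

lemma inner_sum_basis:
  assumes "finite F" "F \<subseteq> B" "i \<in> B"
  shows "(\<Sum>j\<in>F. c j *\<^sub>R e j) \<bullet> e i = (if i \<in> F then c i else 0)"
proof -
  have "(\<Sum>j\<in>F. c j *\<^sub>R e j) \<bullet> e i = (\<Sum>j\<in>F. if j = i then c j else 0)"
    unfolding inner_sum_left using assms e_orth by (intro sum.cong) auto
  then show ?thesis using assms by (simp add: sum.delta)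
qed

lemma norm_sum_basis:
  assumes "finite F" "F \<subseteq> B"
  shows "(norm (\<Sum>j\<in>F. c j *\<^sub>R e j))\<^sup>2 = (\<Sum>j\<in>F. (c j)\<^sup>2)"
  unfolding power2_norm_eq_inner inner_sum_right[of _ _ F]
  by (intro sum.cong) (use assms inner_sum_basis[OF assms] in \<open>auto simp: power2_eq_square subset_iff\<close>)

lemma sum_basis_in: "F \<subseteq> B \<Longrightarrow> (\<Sum>j\<in>F. c j *\<^sub>R e j) \<in> N"
  using N_subspace e_in by (intro subspace_sum subspace_scale) auto

lemma norm_minus_sum_basis:
  assumes "finite F" "F \<subseteq> B"
  shows "(norm (x - (\<Sum>j\<in>F. (x \<bullet> e j) *\<^sub>R e j)))\<^sup>2 = (norm x)\<^sup>2 - (\<Sum>j\<in>F. (x \<bullet> e j)\<^sup>2)"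
proof -
  have "x \<bullet> (\<Sum>j\<in>F. (x \<bullet> e j) *\<^sub>R e j) = (\<Sum>j\<in>F. (x \<bullet> e j)\<^sup>2)"
    by (simp add: inner_sum_right power2_eq_square)
  then show ?thesis
    using norm_sum_basis[OF assms, of "\<lambda>j. x \<bullet> e j"]
    by (simp add: power2_norm_eq_inner inner_diff_left inner_diff_right inner_commute)
qed

lemma bessel: "finite F \<Longrightarrow> F \<subseteq> B \<Longrightarrow> (\<Sum>j\<in>F. (x \<bullet> e j)\<^sup>2) \<le> (norm x)\<^sup>2"
  using norm_minus_sum_basis[of F x] zero_le_power2[of "norm (x - (\<Sum>j\<in>F. (x \<bullet> e j) *\<^sub>R e j))"] by linarith

text \<open>Choose finite sets \<open>F n\<close> with tails below 1 / (n + 1). Two partial sums are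
  compared through the sum over the union of their index sets, so they form a Cauchy sequence. The
  last clause records that \<open>x\<close> is a limit of finite sums, which its coefficients alone
  do not say.\<close>

lemma riesz_fischer:
  assumes bd: "\<And>F. finite F \<Longrightarrow> F \<subseteq> B \<Longrightarrow> (\<Sum>j\<in>F. (c j)\<^sup>2) \<le> C"
  shows "\<exists>x\<in>N. (\<forall>i\<in>B. x \<bullet> e i = c i) \<and>
          (\<forall>\<epsilon>>0. \<exists>F. finite F \<and> F \<subseteq> B \<and> norm (x - (\<Sum>j\<in>F. c j *\<^sub>R e j)) < \<epsilon>)"
proof -
  have "\<exists>F. finite F \<and> F \<subseteq> B \<and> (\<forall>G. finite G \<longrightarrow> G \<subseteq> B - F \<longrightarrow> (\<Sum>j\<in>G. (c j)\<^sup>2) < 1 / (real n + 1))" for n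
  proof (rule bounded_sums_tail[OF bd])
    show "0 < 1 / (real n + 1)" by simp
  qed auto
  then obtain F where F: "\<And>n. finite (F n)" "\<And>n. F n \<subseteq> B"
    and tail: "\<And>G n. finite G \<Longrightarrow> G \<subseteq> B - F n \<Longrightarrow> (\<Sum>j\<in>G. (c j)\<^sup>2) < 1 / (real n + 1)" by metis
  define y where "y n = (\<Sum>j\<in>F n. c j *\<^sub>R e j)" for n
  have half: "norm (y n - (\<Sum>j\<in>F n \<union> F m. c j *\<^sub>R e j)) \<le> sqrt (1 / (real n + 1))" for n m
  proof -
    have G: "finite (F m - F n)" "F m - F n \<subseteq> B" "F m - F n \<subseteq> B - F n" "F n \<inter> (F m - F n) = {}"
      using F(1)[of m] F(2)[of m] by (simp, blast+)
    have "(\<Sum>j\<in>F n \<union> F m. c j *\<^sub>R e j) = (\<Sum>j\<in>F n \<union> (F m - F n). c j *\<^sub>R e j)"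
      by simp
    also have "\<dots> = y n + (\<Sum>j\<in>F m - F n. c j *\<^sub>R e j)"
      unfolding y_def by (rule sum.union_disjoint[OF F(1) G(1) G(4)])
    finally have "(norm (y n - (\<Sum>j\<in>F n \<union> F m. c j *\<^sub>R e j)))\<^sup>2 = (norm (\<Sum>j\<in>F m - F n. c j *\<^sub>R e j))\<^sup>2"
      by simp
    also have "\<dots> = (\<Sum>j\<in>F m - F n. (c j)\<^sup>2)" by (rule norm_sum_basis[OF G(1,2)])
    also have "\<dots> \<le> 1 / (real n + 1)" by (intro less_imp_le tail[OF G(1,3)])
    finally show ?thesis by (rule real_le_rsqrt)
  qed
  have lim0: "(\<lambda>n. sqrt (1 / (real n + 1))) \<longlonglongrightarrow> 0"
    using tendsto_real_sqrt[OF LIMSEQ_inverse_real_of_nat] by (simp add: inverse_eq_divide add.commute)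
  have "Cauchy y"
  proof (rule CauchyI)
    fix \<epsilon> :: real assume "\<epsilon> > 0"
    then obtain M where M: "\<And>n. n \<ge> M \<Longrightarrow> sqrt (1 / (real n + 1)) < \<epsilon> / 2"
      using LIMSEQ_D[OF lim0, of "\<epsilon>/2"] by auto
    show "\<exists>M. \<forall>m\<ge>M. \<forall>n\<ge>M. norm (y m - y n) < \<epsilon>"
    proof (intro exI allI impI)
      fix m n assume mn: "m \<ge> M" "n \<ge> M"
      show "norm (y m - y n) < \<epsilon>"
        using norm_triangle_ineq4[of "y m - (\<Sum>j\<in>F m \<union> F n. c j *\<^sub>R e j)" "y n - (\<Sum>j\<in>F m \<union> F n. c j *\<^sub>R e j)"]
          half[of m n] half[of n m] M[OF mn(1)] M[OF mn(2)] by (simp add: Un_commute)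
    qed
  qed
  then obtain x where x: "y \<longlonglongrightarrow> x" using Cauchy_convergent convergent_def by blast
  have yN: "y n \<in> N" for n unfolding y_def by (rule sum_basis_in[OF F(2)])
  have xN: "x \<in> N" using closed_sequentially[OF N_closed, of y] yN x by blast
  have co: "x \<bullet> e i = c i" if i: "i \<in> B" for i
  proof -
    have "\<bar>y n \<bullet> e i - c i\<bar> \<le> sqrt (1 / (real n + 1))" for n
    proof (cases "i \<in> F n")
      case True
      then show ?thesis using inner_sum_basis[OF F i, of c n] by (simp add: y_def)
    next
      \<comment> \<open>Outside \<open>F n\<close> the single term (c i)^2 is itself a tail sum, so
        \<open>c i\<close> is already small.\<close>
      case False
      then have "(c i)\<^sup>2 \<le> 1 / (real n + 1)" using tail[of "{i}" n] i by auto
      then have "\<bar>c i\<bar> \<le> sqrt (1 / (real n + 1))" by (simp add: real_le_rsqrt)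
      then show ?thesis using inner_sum_basis[OF F i, of c n] False by (simp add: y_def)
    qed
    then have "(\<lambda>n. y n \<bullet> e i - c i) \<longlonglongrightarrow> 0"
      by (intro Lim_null_comparison[OF _ lim0]) (auto simp del: real_sqrt_divide)
    then have "(\<lambda>n. y n \<bullet> e i) \<longlonglongrightarrow> c i" by (simp add: LIM_zero_iff)
    moreover have "(\<lambda>n. y n \<bullet> e i) \<longlonglongrightarrow> x \<bullet> e i" by (intro tendsto_intros x)
    ultimately show ?thesis using LIMSEQ_unique by blast
  qed
  have "\<exists>F. finite F \<and> F \<subseteq> B \<and> norm (x - (\<Sum>j\<in>F. c j *\<^sub>R e j)) < \<epsilon>" if "\<epsilon> > 0" for \<epsilon>
  proof -
    obtain n where "norm (y n - x) < \<epsilon>" using LIMSEQ_D[OF x \<open>\<epsilon> > 0\<close>] by blast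
    then show ?thesis using F by (intro exI[of _ "F n"]) (simp add: y_def norm_minus_commute)
  qed
  then show ?thesis using xN co by blast
qed

text \<open>\<open>riesz_fischer\<close> for the coefficients of \<open>x\<close> produces a limit
  of finite sums with the same coefficients; totality identifies it with \<open>x\<close>.\<close>

lemma approx:
  assumes "x \<in> N" "\<epsilon> > 0"
  obtains F where "finite F" "F \<subseteq> B" "norm (x - (\<Sum>j\<in>F. (x \<bullet> e j) *\<^sub>R e j)) < \<epsilon>"
proof -
  obtain y where y: "y \<in> N" "\<forall>i\<in>B. y \<bullet> e i = x \<bullet> e i"
    "\<forall>\<epsilon>>0. \<exists>F. finite F \<and> F \<subseteq> B \<and> norm (y - (\<Sum>j\<in>F. (x \<bullet> e j) *\<^sub>R e j)) < \<epsilon>"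
    using riesz_fischer[of "\<lambda>j. x \<bullet> e j", OF bessel] by blast
  have "y - x = 0"
    by (rule e_total) (use y assms N_subspace in \<open>auto simp: subspace_diff inner_diff_left\<close>)
  then show ?thesis using y(3) assms(2) that by auto
qed

lemma norm_minus_sum_mono:
  assumes "finite G" "F \<subseteq> G" "G \<subseteq> B"
  shows "norm (x - (\<Sum>j\<in>G. (x \<bullet> e j) *\<^sub>R e j)) \<le> norm (x - (\<Sum>j\<in>F. (x \<bullet> e j) *\<^sub>R e j))"
proof -
  have "(\<Sum>j\<in>F. (x \<bullet> e j)\<^sup>2) \<le> (\<Sum>j\<in>G. (x \<bullet> e j)\<^sup>2)" by (rule sum_mono2) (use assms in auto)
  then have "(norm (x - (\<Sum>j\<in>G. (x \<bullet> e j) *\<^sub>R e j)))\<^sup>2 \<le> (norm (x - (\<Sum>j\<in>F. (x \<bullet> e j) *\<^sub>R e j)))\<^sup>2"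
    using norm_minus_sum_basis[of G x] norm_minus_sum_basis[of F x] assms finite_subset by force
  then show ?thesis using power2_le_imp_le norm_ge_zero by blast
qed

text \<open>Converse of \<open>bessel\<close>: it turns bounds that are uniform over finite sets of
  coefficients into norm bounds.\<close>

lemma norm_le_if_sums_le:
  assumes "x \<in> N" and bd: "\<And>F. finite F \<Longrightarrow> F \<subseteq> B \<Longrightarrow> (\<Sum>j\<in>F. (x \<bullet> e j)\<^sup>2) \<le> C\<^sup>2" and C: "C \<ge> 0"
  shows "norm x \<le> C"
proof (rule field_le_epsilon)
  fix \<epsilon> :: real assume "\<epsilon> > 0"
  then obtain F where F: "finite F" "F \<subseteq> B" "norm (x - (\<Sum>j\<in>F. (x \<bullet> e j) *\<^sub>R e j)) < \<epsilon>"
    using approx assms(1) by blast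
  have "(norm (\<Sum>j\<in>F. (x \<bullet> e j) *\<^sub>R e j))\<^sup>2 \<le> C\<^sup>2" using norm_sum_basis[OF F(1,2)] bd[OF F(1,2)] by simp
  then have "norm (\<Sum>j\<in>F. (x \<bullet> e j) *\<^sub>R e j) \<le> C" using power2_le_imp_le C by blast
  then show "norm x \<le> C + \<epsilon>" using F(3) norm_triangle_ineq2[of x "\<Sum>j\<in>F. (x \<bullet> e j) *\<^sub>R e j"] by linarith
qed

end

section \<open>Eigenbasis of a compact positive operator\<close>

text \<open>Let \<open>\<mu>\<close> be the supremum of \<open>norm (K x)\<close> over unit vectors
  of \<open>M\<close> and \<open>x n\<close> a maximising sequence. Symmetry makes K K x_n - mu^2
  x_n tend to 0, compactness extracts a limit \<open>v\<close> with K K v = mu^2 v, and positivity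
  improves this to K v = mu v.\<close>

lemma compact_operator_eigenvector:
  fixes K :: "'a::{real_inner,complete_space} \<Rightarrow> 'a"
  assumes K: "bounded_linear K" and sym: "\<And>x y. K x \<bullet> y = x \<bullet> K y"
    and pos: "\<And>x. x \<noteq> 0 \<Longrightarrow> x \<bullet> K x > 0"
    and cpt: "\<And>x :: nat \<Rightarrow> 'a. (\<And>n. norm (x n) \<le> 1) \<Longrightarrow> \<exists>r l. strict_mono r \<and> (\<lambda>n. K (x (r n))) \<longlonglongrightarrow> l"
    and M: "closed M" "subspace M" "\<And>x. x \<in> M \<Longrightarrow> K x \<in> M" and x0: "x0 \<in> M" "x0 \<noteq> 0"
  shows "\<exists>v\<in>M. norm v = 1 \<and> (\<exists>\<mu>>0. K v = \<mu> *\<^sub>R v)"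
proof -
  interpret K: bounded_linear K by fact
  define S where "S = (\<lambda>x. norm (K x)) ` {x \<in> M. norm x = 1}"
  obtain k where k: "\<And>x. norm (K x) \<le> norm x * k" using K.bounded by blast
  have "norm (K x) \<le> k" if "norm x = 1" for x using k[of x] that by simp
  then have bdd: "bdd_above S" unfolding S_def by (intro bdd_aboveI[of _ k]) auto
  define u where "u = (1 / norm x0) *\<^sub>R x0"
  have u: "u \<in> M" "norm u = 1" using x0 M(2) by (auto simp: u_def subspace_scale)
  have Sne: "S \<noteq> {}" using u S_def by auto
  define \<mu> where "\<mu> = Sup S"
  have le1: "norm (K x) \<le> \<mu>" if "x \<in> M" "norm x = 1" for x
    unfolding \<mu>_def by (rule cSup_upper) (use that S_def bdd in auto)
  have le: "norm (K x) \<le> \<mu> * norm x" if "x \<in> M" for x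
  proof (cases "x = 0")
    case False
    then have "norm (K ((1 / norm x) *\<^sub>R x)) \<le> \<mu>" using that M(2) by (intro le1) (auto simp: subspace_scale)
    then show ?thesis using False by (simp add: K.scale field_simps)
  qed (simp add: K.zero)
  have "K u \<noteq> 0" using pos[of u] u by force
  then have \<mu>: "\<mu> > 0" using le1[OF u] by (meson less_le_trans zero_less_norm_iff)
  have "\<exists>x\<in>M. norm x = 1 \<and> \<mu> - 1 / (real n + 1) < norm (K x)" for n
  proof -
    have "\<mu> - 1 / (real n + 1) < Sup S" unfolding \<mu>_def by simp
    then obtain y where "y \<in> S" "\<mu> - 1 / (real n + 1) < y" using less_cSupD[OF Sne] by blast
    then show ?thesis unfolding S_def by auto
  qed
  then obtain x where x: "\<And>n. x n \<in> M" "\<And>n. norm (x n) = 1" "\<And>n. \<mu> - 1 / (real n + 1) < norm (K (x n))"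
    by metis
  have lim: "(\<lambda>n. norm (K (x n))) \<longlonglongrightarrow> \<mu>"
  proof (rule tendsto_sandwich[OF _ _ _ tendsto_const])
    show "(\<lambda>n. \<mu> - 1 / (real n + 1)) \<longlonglongrightarrow> \<mu>"
      using tendsto_diff[OF tendsto_const LIMSEQ_inverse_real_of_nat, of \<mu>]
      by (simp add: inverse_eq_divide add.commute)
    show "\<forall>\<^sub>F n in sequentially. \<mu> - 1 / (real n + 1) \<le> norm (K (x n))"
      by (intro always_eventually allI less_imp_le x(3))
    show "\<forall>\<^sub>F n in sequentially. norm (K (x n)) \<le> \<mu>"
      by (intro always_eventually allI le1 x)
  qed
  \<comment> \<open>Expanding the square, symmetry reduces both mixed terms to the squared norm of
    \<open>K (x n)\<close>, which tends to mu^2.\<close>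
  have b: "(norm (K (K (x n)) - \<mu>\<^sup>2 *\<^sub>R x n))\<^sup>2 \<le> \<mu>\<^sup>2 * (\<mu>\<^sup>2 - (norm (K (x n)))\<^sup>2)" for n
  proof -
    have s1: "x n \<bullet> K (K (x n)) = K (x n) \<bullet> K (x n)" and s2: "K (K (x n)) \<bullet> x n = K (x n) \<bullet> K (x n)"
      by (rule sym[symmetric], rule sym)
    have "(norm (K (K (x n)) - \<mu>\<^sup>2 *\<^sub>R x n))\<^sup>2
        = (norm (K (K (x n))))\<^sup>2 - 2 * \<mu>\<^sup>2 * (norm (K (x n)))\<^sup>2 + \<mu>^4 * (norm (x n))\<^sup>2"
      unfolding power2_norm_eq_inner
      by (simp add: inner_diff_left inner_diff_right s1 s2 algebra_simps power4_eq_xxxx power2_eq_square)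
    moreover have "(norm (K (K (x n))))\<^sup>2 \<le> (\<mu> * norm (K (x n)))\<^sup>2"
      by (rule power_mono) (use le M(3) x in auto)
    ultimately show ?thesis using x(2) by (simp add: power_mult_distrib algebra_simps power4_eq_xxxx power2_eq_square)
  qed
  obtain r z where r: "strict_mono r" and z: "(\<lambda>n. K (x (r n))) \<longlonglongrightarrow> z"
    using cpt[of x] x(2) by auto
  have lim2: "(\<lambda>n. K (K (x n)) - \<mu>\<^sup>2 *\<^sub>R x n) \<longlonglongrightarrow> 0"
  proof -
    have "(\<lambda>n. \<mu>\<^sup>2 * (\<mu>\<^sup>2 - (norm (K (x n)))\<^sup>2)) \<longlonglongrightarrow> \<mu>\<^sup>2 * (\<mu>\<^sup>2 - \<mu>\<^sup>2)" by (intro tendsto_intros lim)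
    then have a: "(\<lambda>n. \<mu>\<^sup>2 * (\<mu>\<^sup>2 - (norm (K (x n)))\<^sup>2)) \<longlonglongrightarrow> 0" by simp
    have "(\<lambda>n. (norm (K (K (x n)) - \<mu>\<^sup>2 *\<^sub>R x n))\<^sup>2) \<longlonglongrightarrow> 0"
      by (rule Lim_null_comparison[OF always_eventually a]) (use b in simp)
    from tendsto_real_sqrt[OF this] have "(\<lambda>n. norm (K (K (x n)) - \<mu>\<^sup>2 *\<^sub>R x n)) \<longlonglongrightarrow> 0"
      by simp
    then show ?thesis by (simp add: tendsto_norm_zero_iff)
  qed
  have lim2r: "(\<lambda>n. K (K (x (r n))) - \<mu>\<^sup>2 *\<^sub>R x (r n)) \<longlonglongrightarrow> 0"
    using LIMSEQ_subseq_LIMSEQ[OF lim2 r] by (simp add: o_def)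
  have "(\<lambda>n. K (K (x (r n)))) \<longlonglongrightarrow> K z" by (rule K.tendsto[OF z])
  from tendsto_diff[OF this lim2r] have "(\<lambda>n. \<mu>\<^sup>2 *\<^sub>R x (r n)) \<longlonglongrightarrow> K z" by simp
  from tendsto_scaleR[OF tendsto_const this, of "1 / \<mu>\<^sup>2"]
  have xl: "(\<lambda>n. x (r n)) \<longlonglongrightarrow> (1 / \<mu>\<^sup>2) *\<^sub>R K z" using \<mu> by simp
  define v where "v = (1 / \<mu>\<^sup>2) *\<^sub>R K z"
  have xv: "(\<lambda>n. x (r n)) \<longlonglongrightarrow> v" using xl v_def by simp
  have vM: "v \<in> M" using closed_sequentially[OF M(1), of "\<lambda>n. x (r n)"] x(1) xv by blast
  have "(\<lambda>n. norm (x (r n))) \<longlonglongrightarrow> norm v" by (intro tendsto_intros xv)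
  then have v1: "norm v = 1" using x(2) by (simp add: LIMSEQ_const_iff)
  have "(\<lambda>n. K (K (x (r n))) - \<mu>\<^sup>2 *\<^sub>R x (r n)) \<longlonglongrightarrow> K (K v) - \<mu>\<^sup>2 *\<^sub>R v"
    by (intro tendsto_intros K.tendsto xv)
  then have kkv: "K (K v) = \<mu>\<^sup>2 *\<^sub>R v" using LIMSEQ_unique[OF lim2r] by (metis eq_iff_diff_eq_0)
  \<comment> \<open>K K v = mu^2 v gives K d = - mu d, and positivity of \<open>K\<close> leaves
    only \<open>d = 0\<close>.\<close>
  define d where "d = K v - \<mu> *\<^sub>R v"
  have "K d = - \<mu> *\<^sub>R d" by (simp add: d_def K.diff K.scale kkv algebra_simps power2_eq_square)
  then have "d \<bullet> K d \<le> 0" using \<mu> by (simp add: mult_nonneg_nonneg)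
  then have "d = 0" using pos[of d] by fastforce
  then have "K v = \<mu> *\<^sub>R v" by (simp add: d_def)
  then show ?thesis using vM v1 \<mu> by blast
qed

text \<open>Zorn's lemma gives a maximal orthonormal set of eigenvectors. Its orthogonal complement
  is closed and, by symmetry, invariant under \<open>K\<close>, so a nonzero element of it would
  yield a further eigenvector.\<close>

theorem compact_operator_eigenbasis:
  fixes K :: "'a::{real_inner,complete_space} \<Rightarrow> 'a"
  assumes K: "bounded_linear K" and sym: "\<And>x y. K x \<bullet> y = x \<bullet> K y"
    and pos: "\<And>x. x \<noteq> 0 \<Longrightarrow> x \<bullet> K x > 0"
    and cpt: "\<And>x :: nat \<Rightarrow> 'a. (\<And>n. norm (x n) \<le> 1) \<Longrightarrow> \<exists>r l. strict_mono r \<and> (\<lambda>n. K (x (r n))) \<longlonglongrightarrow> l"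
  shows "\<exists>B. orthonormal_basis UNIV B (\<lambda>v. v) \<and> (\<forall>v\<in>B. \<exists>\<mu>>0. K v = \<mu> *\<^sub>R v)"
proof -
  interpret K: bounded_linear K by fact
  define \<A> where "\<A> = {B. (\<forall>v\<in>B. norm v = 1 \<and> (\<exists>\<mu>>0. K v = \<mu> *\<^sub>R v)) \<and> (\<forall>v\<in>B. \<forall>w\<in>B. v \<noteq> w \<longrightarrow> v \<bullet> w = 0)}"
  have "\<exists>B\<in>\<A>. \<forall>X\<in>\<A>. B \<subseteq> X \<longrightarrow> X = B"
  proof (rule subset_Zorn_nonempty)
    show "\<A> \<noteq> {}" by (auto simp: \<A>_def intro!: exI[of _ "{}"])
    fix C assume C: "C \<noteq> {}" "subset.chain \<A> C"
    then have sub: "C \<subseteq> \<A>" by (simp add: subset_chain_def)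
    have "v \<bullet> w = 0" if vw: "v \<in> \<Union>C" "w \<in> \<Union>C" "v \<noteq> w" for v w
    proof -
      obtain X Y where "X \<in> C" "Y \<in> C" "v \<in> X" "w \<in> Y" using vw by blast
      moreover then have "X \<subseteq> Y \<or> Y \<subseteq> X" using C(2) by (auto simp: subset_chain_def)
      ultimately obtain Z where "Z \<in> C" "v \<in> Z" "w \<in> Z" by blast
      then show ?thesis using sub vw(3) unfolding \<A>_def by blast
    qed
    then show "\<Union>C \<in> \<A>" using sub unfolding \<A>_def by blast
  qed
  then obtain B where B: "B \<in> \<A>" and max: "\<And>X. X \<in> \<A> \<Longrightarrow> B \<subseteq> X \<Longrightarrow> X = B" by blast
  have B1: "\<And>v. v \<in> B \<Longrightarrow> norm v = 1" "\<And>v. v \<in> B \<Longrightarrow> \<exists>\<mu>>0. K v = \<mu> *\<^sub>R v"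
    "\<And>v w. v \<in> B \<Longrightarrow> w \<in> B \<Longrightarrow> v \<noteq> w \<Longrightarrow> v \<bullet> w = 0" using B unfolding \<A>_def by blast+
  define M where "M = {x. \<forall>v\<in>B. x \<bullet> v = 0}"
  have M_sub: "subspace M" unfolding M_def subspace_def by (auto simp: inner_add_left)
  have M_eq: "M = (\<Inter>v\<in>B. {x. x \<bullet> v = 0})" unfolding M_def by auto
  have M_cl: "closed M" unfolding M_eq
    by (intro closed_INT ballI closed_Collect_eq continuous_intros)
  have M_K: "K x \<in> M" if "x \<in> M" for x
  proof -
    have "K x \<bullet> v = 0" if v: "v \<in> B" for v
    proof -
      obtain \<mu> where "K v = \<mu> *\<^sub>R v" using B1(2)[OF v] by blast
      then show ?thesis using \<open>x \<in> M\<close> v by (simp add: sym M_def)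
    qed
    then show ?thesis by (simp add: M_def)
  qed
  have total: "x = 0" if x: "\<And>v. v \<in> B \<Longrightarrow> x \<bullet> v = 0" for x
  proof (rule ccontr)
    assume "x \<noteq> 0"
    moreover have "x \<in> M" using x M_def by simp
    ultimately obtain v where v: "v \<in> M" "norm v = 1" "\<exists>\<mu>>0. K v = \<mu> *\<^sub>R v"
      using compact_operator_eigenvector[OF K sym pos cpt M_cl M_sub M_K, of x] by blast
    have "insert v B \<in> \<A>" using v B1 unfolding \<A>_def M_def by (auto simp: inner_commute)
    then have "v \<in> B" using max[of "insert v B"] by blast
    then have "v \<bullet> v = 0" using v(1) M_def by blast
    then show False using v(2) by simp
  qed
  have "orthonormal_basis UNIV B (\<lambda>v. v)"
  proof
    fix i j assume "i \<in> B" "j \<in> B"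
    then show "i \<bullet> j = (if i = j then 1 else 0)" using B1(1)[of i] B1(3) by (auto simp: norm_eq_1)
  qed (use total in auto)
  then show ?thesis using B1(2) by blast
qed

abbreviation L2 :: "fn set" where "L2 \<equiv> L2_on {0<..<1}"

section \<open>The Hilbert space of square integrable functions\<close>

lemma L2_measurable [measurable_dest]: "u \<in> L2 \<Longrightarrow> u \<in> borel_measurable M01"
  and L2_integrable_square: "u \<in> L2 \<Longrightarrow> integrable M01 (\<lambda>x. (u x)\<^sup>2)"
  by (auto simp: L2_on_def)

lemma L2_I: "u \<in> borel_measurable M01 \<Longrightarrow> integrable M01 (\<lambda>x. (u x)\<^sup>2) \<Longrightarrow> u \<in> L2"
  by (auto simp: L2_on_def)

lemma finite_measure_M01: "finite_measure M01"
  by (rule finite_measureI) (simp add: emeasure_restrict_space space_restrict_space)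

lemma measure_M01_space: "measure M01 (space M01) = 1"
  by (simp add: measure_restrict_space space_restrict_space)

lemma L2_dominated:
  assumes "u \<in> borel_measurable M01" "w \<in> L2" "AE x in M01. \<bar>u x\<bar> \<le> C * \<bar>w x\<bar>"
  shows "u \<in> L2"
proof (rule L2_I[OF assms(1)], rule Bochner_Integration.integrable_bound)
  show "integrable M01 (\<lambda>x. C\<^sup>2 * (w x)\<^sup>2)" using L2_integrable_square[OF assms(2)] by simp
  show "(\<lambda>x. (u x)\<^sup>2) \<in> borel_measurable M01" using assms(1) by simp
  show "AE x in M01. norm ((u x)\<^sup>2) \<le> norm (C\<^sup>2 * (w x)\<^sup>2)"
    using assms(3)
  proof eventually_elim
    case (elim x)
    have "\<bar>u x\<bar>\<^sup>2 \<le> (C * \<bar>w x\<bar>)\<^sup>2" by (rule power_mono[OF elim]) auto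
    then show ?case by (simp add: power_mult_distrib)
  qed
qed

lemma L2_const [simp]: "(\<lambda>x. c) \<in> L2"
  using finite_measure.integrable_const[OF finite_measure_M01] by (auto intro!: L2_I)

lemma L2_mult_integrable:
  assumes "u \<in> L2" "v \<in> L2"
  shows "integrable M01 (\<lambda>x. u x * v x)"
proof (rule Bochner_Integration.integrable_bound)
  show "integrable M01 (\<lambda>x. (u x)\<^sup>2 + (v x)\<^sup>2)"
    using assms by (auto intro: L2_integrable_square)
  show "(\<lambda>x. u x * v x) \<in> borel_measurable M01" using assms by (auto dest: L2_measurable)
  show "AE x in M01. norm (u x * v x) \<le> norm ((u x)\<^sup>2 + (v x)\<^sup>2)"
  proof (rule AE_I2)
    fix x
    have "2 * (\<bar>u x\<bar> * \<bar>v x\<bar>) \<le> (u x)\<^sup>2 + (v x)\<^sup>2"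
      using zero_le_power2[of "\<bar>u x\<bar> - \<bar>v x\<bar>"] by (simp add: power2_diff)
    moreover have "0 \<le> \<bar>u x\<bar> * \<bar>v x\<bar>" by simp
    ultimately have "\<bar>u x\<bar> * \<bar>v x\<bar> \<le> (u x)\<^sup>2 + (v x)\<^sup>2" by linarith
    then show "norm (u x * v x) \<le> norm ((u x)\<^sup>2 + (v x)\<^sup>2)" by (simp add: abs_mult)
  qed
qed

lemma L2_integrable: "u \<in> L2 \<Longrightarrow> integrable M01 u"
  using L2_mult_integrable[OF _ L2_const[of 1]] by simp

lemma L2_add [simp]:
  assumes "u \<in> L2" "v \<in> L2"
  shows "(\<lambda>x. u x + v x) \<in> L2"
proof (rule L2_I)
  show "(\<lambda>x. u x + v x) \<in> borel_measurable M01" using assms by (auto dest: L2_measurable)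
  have "(\<lambda>x. (u x + v x)\<^sup>2) = (\<lambda>x. (u x)\<^sup>2 + 2 * (u x * v x) + (v x)\<^sup>2)"
    by (auto simp: power2_sum algebra_simps)
  moreover have "integrable M01 (\<lambda>x. (u x)\<^sup>2 + 2 * (u x * v x) + (v x)\<^sup>2)"
    by (intro Bochner_Integration.integrable_add Bochner_Integration.integrable_mult_right
        L2_mult_integrable L2_integrable_square assms)
  ultimately show "integrable M01 (\<lambda>x. (u x + v x)\<^sup>2)" by simp
qed

lemma L2_scale [simp]: "u \<in> L2 \<Longrightarrow> (\<lambda>x. c * u x) \<in> L2"
  by (rule L2_dominated[of _ u "\<bar>c\<bar>"]) (auto simp: abs_mult dest: L2_measurable)

lemma L2_diff [simp]: "u \<in> L2 \<Longrightarrow> v \<in> L2 \<Longrightarrow> (\<lambda>x. u x - v x) \<in> L2"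
  using L2_add[of u "\<lambda>x. (-1) * v x"] L2_scale[of v "-1"] by simp

lemma ae_eq_L2:
  assumes "u \<in> L2" "v \<in> borel_measurable M01" "ae_eq u v"
  shows "v \<in> L2"
  by (rule L2_dominated[OF assms(2,1), of 1]) (use assms(3) in \<open>auto simp: ae_eq_def\<close>)

lemma ae_eq_refl [simp]: "ae_eq u u"
  and ae_eq_sym: "ae_eq u v \<Longrightarrow> ae_eq v u"
  by (auto simp: ae_eq_def)

lemma ae_eq_trans: "ae_eq u v \<Longrightarrow> ae_eq v w \<Longrightarrow> ae_eq u w"
  unfolding ae_eq_def by (auto elim: AE_mp)

\<comment> \<open>A type of classes gives access to the limit calculus of inner product spaces. The
  relation is partial so that only square integrable functions represent elements.\<close>
quotient_type l2 = "real \<Rightarrow> real" / partial: "\<lambda>u v. u \<in> L2 \<and> v \<in> L2 \<and> ae_eq u v"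
proof (rule part_equivpI)
  show "\<exists>u. u \<in> L2 \<and> u \<in> L2 \<and> ae_eq u u" by (rule exI[of _ "\<lambda>x. 0"]) simp
  show "symp (\<lambda>u v. u \<in> L2 \<and> v \<in> L2 \<and> ae_eq u v)" by (auto intro!: sympI ae_eq_sym)
  show "transp (\<lambda>u v. u \<in> L2 \<and> v \<in> L2 \<and> ae_eq u v)" by (auto intro!: transpI elim: ae_eq_trans)
qed

lemma abs_l2_eq_iff: "u \<in> L2 \<Longrightarrow> v \<in> L2 \<Longrightarrow> abs_l2 u = abs_l2 v \<longleftrightarrow> ae_eq u v"
  using Quotient3_rel[OF Quotient3_l2, of u v] by auto

lemma rep_l2_L2 [simp]: "rep_l2 x \<in> L2"
  using Quotient3_rep_reflp[OF Quotient3_l2, of x] by auto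

lemma abs_rep_l2 [simp]: "abs_l2 (rep_l2 x) = x"
  by (rule Quotient3_abs_rep[OF Quotient3_l2])

lemma rep_abs_l2: "u \<in> L2 \<Longrightarrow> ae_eq (rep_l2 (abs_l2 u)) u"
  using abs_l2_eq_iff[of "rep_l2 (abs_l2 u)" u] by simp

instantiation l2 :: real_inner
begin

definition zero_l2 :: l2 where "zero_l2 = abs_l2 (\<lambda>x. 0)"
definition plus_l2 :: "l2 \<Rightarrow> l2 \<Rightarrow> l2" where "plus_l2 f g = abs_l2 (\<lambda>x. rep_l2 f x + rep_l2 g x)"
definition minus_l2 :: "l2 \<Rightarrow> l2 \<Rightarrow> l2" where "minus_l2 f g = abs_l2 (\<lambda>x. rep_l2 f x - rep_l2 g x)"
definition scaleR_l2 :: "real \<Rightarrow> l2 \<Rightarrow> l2" where "scaleR_l2 c f = abs_l2 (\<lambda>x. c * rep_l2 f x)"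
definition uminus_l2 :: "l2 \<Rightarrow> l2" where "uminus_l2 f = (-1) *\<^sub>R f"
definition inner_l2 :: "l2 \<Rightarrow> l2 \<Rightarrow> real" where "inner_l2 f g = (LINT x|M01. rep_l2 f x * rep_l2 g x)"
definition norm_l2 :: "l2 \<Rightarrow> real" where "norm_l2 f = sqrt (f \<bullet> f)"
definition sgn_l2 :: "l2 \<Rightarrow> l2" where "sgn_l2 f = inverse (norm f) *\<^sub>R f"
definition dist_l2 :: "l2 \<Rightarrow> l2 \<Rightarrow> real" where "dist_l2 f g = norm (f - g)"
definition uniformity_l2 :: "(l2 \<times> l2) filter" where
  "uniformity_l2 = (INF e\<in>{0<..}. principal {(x, y). dist x y < e})"
definition open_l2 :: "l2 set \<Rightarrow> bool" where
  "open_l2 U = (\<forall>x\<in>U. eventually (\<lambda>(x', y). x' = x \<longrightarrow> y \<in> U) uniformity)"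

lemma plus_abs_l2:
  assumes "u \<in> L2" "v \<in> L2" shows "abs_l2 u + abs_l2 v = abs_l2 (\<lambda>x. u x + v x)"
  unfolding plus_l2_def using assms rep_abs_l2[OF assms(1)] rep_abs_l2[OF assms(2)]
  by (subst abs_l2_eq_iff) (auto simp: ae_eq_def)

lemma minus_abs_l2:
  assumes "u \<in> L2" "v \<in> L2" shows "abs_l2 u - abs_l2 v = abs_l2 (\<lambda>x. u x - v x)"
  unfolding minus_l2_def using assms rep_abs_l2[OF assms(1)] rep_abs_l2[OF assms(2)]
  by (subst abs_l2_eq_iff) (auto simp: ae_eq_def)

lemma scaleR_abs_l2:
  assumes "u \<in> L2" shows "c *\<^sub>R abs_l2 u = abs_l2 (\<lambda>x. c * u x)"
  unfolding scaleR_l2_def using assms rep_abs_l2[OF assms(1)]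
  by (subst abs_l2_eq_iff) (auto simp: ae_eq_def)

lemma inner_abs_l2:
  assumes "u \<in> L2" "v \<in> L2" shows "abs_l2 u \<bullet> abs_l2 v = (LINT x|M01. u x * v x)"
  unfolding inner_l2_def using assms rep_abs_l2[OF assms(1)] rep_abs_l2[OF assms(2)]
  by (intro integral_cong_AE) (auto simp: ae_eq_def L2_measurable[OF rep_l2_L2] dest: L2_measurable intro!: borel_measurable_times)

lemma l2_cases: obtains u where "u \<in> L2" "x = abs_l2 u"
  using rep_l2_L2[of x] abs_rep_l2[of x] by metis

instance
proof
  fix x y z :: l2 and c d :: real
  obtain u where u: "u \<in> L2" "x = abs_l2 u" by (rule l2_cases)
  obtain v where v: "v \<in> L2" "y = abs_l2 v" by (rule l2_cases)
  obtain w where w: "w \<in> L2" "z = abs_l2 w" by (rule l2_cases)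
  note [simp] = plus_abs_l2 minus_abs_l2 scaleR_abs_l2 inner_abs_l2 uminus_l2_def zero_l2_def
  show "x + y + z = x + (y + z)" by (simp add: u v w add.assoc)
  show "x + y = y + x" by (simp add: u v add.commute)
  show "0 + x = x" by (simp add: u)
  show "- x + x = 0" using u(1) L2_scale[of u "-1"] by (simp add: u)
  show "x - y = x + - y" using v(1) L2_scale[of v "-1"] by (simp add: u v)
  show "c *\<^sub>R (x + y) = c *\<^sub>R x + c *\<^sub>R y" by (simp add: u v algebra_simps)
  show "(c + d) *\<^sub>R x = c *\<^sub>R x + d *\<^sub>R x" by (simp add: u algebra_simps)
  show "c *\<^sub>R d *\<^sub>R x = (c * d) *\<^sub>R x" by (simp add: u algebra_simps)
  show "1 *\<^sub>R x = x" by (simp add: u)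
  show "x \<bullet> y = y \<bullet> x" by (simp add: u v mult.commute)
  show "(x + y) \<bullet> z = x \<bullet> z + y \<bullet> z"
    using L2_mult_integrable u v w by (simp add: algebra_simps)
  show "c *\<^sub>R x \<bullet> y = c * (x \<bullet> y)" by (simp add: u v mult.assoc)
  show "0 \<le> x \<bullet> x" by (simp add: u)
  show "(x \<bullet> x = 0) = (x = 0)"
    using integral_nonneg_eq_0_iff_AE[OF L2_integrable_square[OF u(1)]] u(1)
    by (simp add: u abs_l2_eq_iff ae_eq_def power2_eq_square)
qed (rule norm_l2_def sgn_l2_def dist_l2_def uniformity_l2_def open_l2_def)+

end

lemma norm_abs_l2: "u \<in> L2 \<Longrightarrow> norm (abs_l2 u) = L2_norm {0<..<1} u"
  by (simp add: norm_l2_def inner_abs_l2 L2_norm_def power2_eq_square)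

lemma norm_abs_l2_sq: "u \<in> L2 \<Longrightarrow> (norm (abs_l2 u))\<^sup>2 = (LINT x|M01. (u x)\<^sup>2)"
  unfolding power2_norm_eq_inner by (simp add: inner_abs_l2 power2_eq_square)

lemma abs_l2_zero: "abs_l2 (\<lambda>x. 0) = 0"
  by (simp add: zero_l2_def)

lemma norm_abs_l2_le:
  assumes "u \<in> L2" "w \<in> L2" "AE x in M01. \<bar>u x\<bar> \<le> \<bar>w x\<bar>"
  shows "norm (abs_l2 u) \<le> norm (abs_l2 w)"
proof (rule power2_le_imp_le)
  show "(norm (abs_l2 u))\<^sup>2 \<le> (norm (abs_l2 w))\<^sup>2"
    unfolding norm_abs_l2_sq[OF assms(1)] norm_abs_l2_sq[OF assms(2)]
    by (rule integral_mono_AE) (use assms L2_integrable_square in \<open>auto simp: abs_le_square_iff\<close>)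
qed simp

text \<open>Cauchy-Schwarz against the constant 1, which has norm 1 since (0, 1) has measure
  1.\<close>

lemma integral_abs_le_norm:
  assumes "u \<in> L2"
  shows "(LINT x|M01. \<bar>u x\<bar>) \<le> norm (abs_l2 u)"
proof -
  have a: "(\<lambda>x. \<bar>u x\<bar>) \<in> L2"
    by (rule L2_dominated[OF _ assms, of _ 1]) (use assms in \<open>auto dest: L2_measurable\<close>)
  have "(LINT x|M01. \<bar>u x\<bar>) = abs_l2 (\<lambda>x. \<bar>u x\<bar>) \<bullet> abs_l2 (\<lambda>x. 1)"
    using a by (simp add: inner_abs_l2)
  also have "\<dots> \<le> norm (abs_l2 (\<lambda>x. \<bar>u x\<bar>)) * norm (abs_l2 (\<lambda>x. 1))" by (rule norm_cauchy_schwarz)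
  also have "norm (abs_l2 (\<lambda>x. 1)) = 1"
    using measure_M01_space by (simp add: norm_abs_l2 L2_norm_def)
  also have "norm (abs_l2 (\<lambda>x. \<bar>u x\<bar>)) = norm (abs_l2 u)"
    using a assms by (simp add: norm_abs_l2 L2_norm_def)
  finally show ?thesis by simp
qed

text \<open>Along a subsequence with increments below 2^-n the sum of the absolute increments is
  integrable, so the functions converge almost everywhere. Fatou's lemma turns the Cauchy bound into
  a bound for the distance to the limit.\<close>

instance l2 :: complete_space
proof
  fix X :: "nat \<Rightarrow> l2" assume X: "Cauchy X"
  have "\<forall>n. \<exists>N. \<forall>i\<ge>N. \<forall>j\<ge>N. norm (X i - X j) < (1/2)^n"
    using CauchyD[OF X] by (meson zero_less_power half_gt_zero zero_less_one)
  then obtain N where N: "\<And>n i j. i \<ge> N n \<Longrightarrow> j \<ge> N n \<Longrightarrow> norm (X i - X j) < (1/2)^n" by metis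
  \<comment> \<open>The sum makes \<open>r n\<close> dominate \<open>N k\<close> for all k up to n;
    the summand \<open>n\<close> makes \<open>r\<close> strictly increasing.\<close>
  define r where "r n = (\<Sum>k\<le>n. N k) + n" for n
  have rs: "strict_mono r" unfolding strict_mono_Suc_iff r_def by simp
  have rN: "r n \<ge> N n" for n unfolding r_def using member_le_sum[of n "{..n}" N] by simp
  have rmono: "r m \<ge> N n" if "m \<ge> n" for m n
    using rN[of n] strict_mono_less_eq[OF rs, of n m] that by linarith
  define f where "f n = rep_l2 (X (r n))" for n
  have f: "f n \<in> L2" "X (r n) = abs_l2 (f n)" for n by (simp_all add: f_def)
  have fm [measurable]: "f n \<in> borel_measurable M01" for n using f L2_measurable by blast
  have nd: "norm (abs_l2 (\<lambda>x. f i x - f j x)) < (1/2)^n" if "i \<ge> n" "j \<ge> n" for i j n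
    using N[OF rmono[OF that(1)] rmono[OF that(2)]] f by (simp add: minus_abs_l2)
  have d: "(\<integral>\<^sup>+x. ennreal \<bar>f (Suc n) x - f n x\<bar> \<partial>M01) \<le> ennreal ((1/2)^n)" for n
  proof -
    have L: "(\<lambda>x. f (Suc n) x - f n x) \<in> L2" using f by simp
    have "(\<integral>\<^sup>+x. ennreal \<bar>f (Suc n) x - f n x\<bar> \<partial>M01) = ennreal (LINT x|M01. \<bar>f (Suc n) x - f n x\<bar>)"
      by (rule nn_integral_eq_integral) (use L2_integrable[OF L] in auto)
    also have "\<dots> \<le> ennreal ((1/2)^n)"
      using integral_abs_le_norm[OF L] nd[of n "Suc n" n] by (intro ennreal_leI) simp
    finally show ?thesis .
  qed
  have "(\<integral>\<^sup>+x. (\<Sum>n. ennreal \<bar>f (Suc n) x - f n x\<bar>) \<partial>M01)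
      = (\<Sum>n. \<integral>\<^sup>+x. ennreal \<bar>f (Suc n) x - f n x\<bar> \<partial>M01)"
    by (rule nn_integral_suminf) simp
  also have "\<dots> \<le> (\<Sum>n. ennreal ((1/2)^n))" by (rule suminf_le[OF d]) auto
  also have "\<dots> = ennreal (\<Sum>n. (1/2)^n)" by (rule suminf_ennreal2) (auto intro: summable_geometric)
  finally have "(\<integral>\<^sup>+x. (\<Sum>n. ennreal \<bar>f (Suc n) x - f n x\<bar>) \<partial>M01) \<noteq> \<infinity>"
    using neq_top_trans[OF ennreal_neq_top] unfolding infinity_ennreal_def by blast
  then have "AE x in M01. (\<Sum>n. ennreal \<bar>f (Suc n) x - f n x\<bar>) \<noteq> \<infinity>"
    by (intro nn_integral_PInf_AE) simp_all
  then have conv: "AE x in M01. convergent (\<lambda>n. f n x)"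
  proof eventually_elim
    case (elim x)
    then have "summable (\<lambda>n. \<bar>f (Suc n) x - f n x\<bar>)" by (intro summable_suminf_not_top) auto
    then have "summable (\<lambda>n. f (Suc n) x - f n x)" by (rule summable_rabs_cancel)
    then have "convergent (\<lambda>n. \<Sum>k<n. f (Suc k) x - f k x)" by (simp add: summable_iff_convergent)
    then have "convergent (\<lambda>n. f n x - f 0 x)" by (simp only: sum_lessThan_telescope[of "\<lambda>k. f k x"])
    then show ?case using convergent_add[OF _ convergent_const[of "f 0 x"]] by force
  qed
  define g where "g x = lim (\<lambda>n. f n x)" for x
  have gm [measurable]: "g \<in> borel_measurable M01" unfolding g_def by measurable
  have lim: "AE x in M01. (\<lambda>n. f n x) \<longlonglongrightarrow> g x"
    using conv by eventually_elim (simp add: g_def convergent_LIMSEQ_iff)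
  have bound: "(\<integral>\<^sup>+x. ennreal ((g x - f m x)\<^sup>2) \<partial>M01) \<le> ennreal (((1/2)^m)\<^sup>2)" for m
  proof -
    have "(\<integral>\<^sup>+x. ennreal ((g x - f m x)\<^sup>2) \<partial>M01)
        = (\<integral>\<^sup>+x. liminf (\<lambda>n. ennreal ((f n x - f m x)\<^sup>2)) \<partial>M01)"
    proof (rule nn_integral_cong_AE, use lim in eventually_elim)
      case (elim x)
      have "(\<lambda>n. ennreal ((f n x - f m x)\<^sup>2)) \<longlonglongrightarrow> ennreal ((g x - f m x)\<^sup>2)"
        by (intro tendsto_ennrealI tendsto_intros elim)
      then show ?case by (metis lim_imp_Liminf trivial_limit_sequentially)
    qed
    also have "\<dots> \<le> liminf (\<lambda>n. \<integral>\<^sup>+x. ennreal ((f n x - f m x)\<^sup>2) \<partial>M01)"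
      by (rule nn_integral_liminf) simp
    also have "\<dots> \<le> ennreal (((1/2)^m)\<^sup>2)"
    proof (rule Liminf_le)
      show "\<forall>\<^sub>F n in sequentially. (\<integral>\<^sup>+x. ennreal ((f n x - f m x)\<^sup>2) \<partial>M01) \<le> ennreal (((1/2)^m)\<^sup>2)"
      proof (rule eventually_sequentiallyI[of m])
        fix n assume n: "m \<le> n"
        have L: "(\<lambda>x. f n x - f m x) \<in> L2" using f by simp
        have "(\<integral>\<^sup>+x. ennreal ((f n x - f m x)\<^sup>2) \<partial>M01) = ennreal (LINT x|M01. (f n x - f m x)\<^sup>2)"
          by (rule nn_integral_eq_integral) (use L2_integrable_square[OF L] in auto)
        also have "\<dots> = ennreal ((norm (abs_l2 (\<lambda>x. f n x - f m x)))\<^sup>2)"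
          using norm_abs_l2_sq[OF L] by simp
        also have "\<dots> \<le> ennreal (((1/2)^m)\<^sup>2)"
          using nd[OF n order_refl] by (intro ennreal_leI power_mono) auto
        finally show "(\<integral>\<^sup>+x. ennreal ((f n x - f m x)\<^sup>2) \<partial>M01) \<le> ennreal (((1/2)^m)\<^sup>2)" .
      qed
    qed simp
    finally show ?thesis .
  qed
  have gfL: "(\<lambda>x. g x - f m x) \<in> L2" for m
  proof (rule L2_I)
    show "integrable M01 (\<lambda>x. (g x - f m x)\<^sup>2)"
      by (rule integrableI_nonneg) (use bound[of m] in \<open>auto simp: order_le_less_trans\<close>)
  qed simp
  have gL: "g \<in> L2" using L2_add[OF gfL[of 0] f(1)[of 0]] by simp
  have "norm (X (r m) - abs_l2 g) \<le> (1/2)^m" for m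
  proof (rule power2_le_imp_le)
    have "ennreal ((norm (abs_l2 (\<lambda>x. g x - f m x)))\<^sup>2) = (\<integral>\<^sup>+x. ennreal ((g x - f m x)\<^sup>2) \<partial>M01)"
      unfolding norm_abs_l2_sq[OF gfL]
      by (rule nn_integral_eq_integral[symmetric]) (use L2_integrable_square[OF gfL] in auto)
    also note bound
    finally have "(norm (abs_l2 (\<lambda>x. g x - f m x)))\<^sup>2 \<le> ((1/2)^m)\<^sup>2" by simp
    then show "(norm (X (r m) - abs_l2 g))\<^sup>2 \<le> ((1/2)^m)\<^sup>2"
      using f gL by (simp add: minus_abs_l2[symmetric] norm_minus_commute)
  qed simp
  then have "(\<lambda>m. X (r m) - abs_l2 g) \<longlonglongrightarrow> 0"
    by (intro Lim_null_comparison[OF always_eventually LIMSEQ_power_zero[of "1/2::real"]]) auto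
  then have "(X \<circ> r) \<longlonglongrightarrow> abs_l2 g" by (simp add: LIM_zero_iff o_def)
  then show "convergent X" using Cauchy_converges_subseq[OF X rs] convergent_def by blast
qed

section \<open>The beam equation in abstract form\<close>

text \<open>\<open>T_dense\<close> states density of the range as triviality of its orthogonal
  complement; in this form it makes the adjoint injective and T R strictly positive.\<close>

locale energy_space =
  fixes N :: "'a::{real_inner,complete_space} set" and T :: "'a \<Rightarrow> 'a"
  assumes closed_N: "closed N" and subspace_N: "subspace N"
    and bl_T: "bounded_linear T"
    and T_inj: "\<And>x. x \<in> N \<Longrightarrow> T x = 0 \<Longrightarrow> x = 0"
    and T_dense: "\<And>x. (\<And>c. c \<in> N \<Longrightarrow> x \<bullet> T c = 0) \<Longrightarrow> x = 0"
    and T_compact: "\<And>x :: nat \<Rightarrow> 'a. (\<And>n. norm (x n) \<le> 1) \<Longrightarrow>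
          \<exists>r l. strict_mono r \<and> (\<lambda>n. T (x (r n))) \<longlonglongrightarrow> l"
begin

sublocale T: bounded_linear T by (rule bl_T)

lemma riesz_T: "\<exists>!v. v \<in> N \<and> (\<forall>c\<in>N. v \<bullet> c = y \<bullet> T c)"
proof -
  obtain k where k: "\<And>x. norm (T x) \<le> norm x * k" using T.bounded by blast
  have "\<exists>v\<in>N. \<forall>c\<in>N. y \<bullet> T c = v \<bullet> c"
  proof (rule riesz_representation[OF closed_N subspace_N, where C = "norm y * k"])
    fix x
    have "\<bar>y \<bullet> T x\<bar> \<le> norm y * norm (T x)" by (rule Cauchy_Schwarz_ineq2)
    also have "\<dots> \<le> norm y * (norm x * k)" by (intro mult_left_mono k) simp
    finally show "\<bar>y \<bullet> T x\<bar> \<le> norm y * k * norm x" by (simp add: mult.commute mult.left_commute)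
  qed (simp_all add: T.add T.scale inner_add_right)
  then obtain v where v: "v \<in> N" "\<forall>c\<in>N. v \<bullet> c = y \<bullet> T c" by force
  have "w = v" if "w \<in> N" "\<forall>c\<in>N. w \<bullet> c = y \<bullet> T c" for w
  proof -
    have "w - v \<in> N" using that v subspace_N by (simp add: subspace_diff)
    then have "(w - v) \<bullet> (w - v) = 0" using that v by (simp add: inner_diff_left)
    then show ?thesis by simp
  qed
  then show ?thesis using v by blast
qed

text \<open>The adjoint of \<open>T\<close> restricted to \<open>N\<close>. In the application
  \<open>R y\<close> is u'' for the variational solution of a u'''' = sqrt a y with clamped
  ends.\<close>

definition R :: "'a \<Rightarrow> 'a" where "R y = (THE v. v \<in> N \<and> (\<forall>c\<in>N. v \<bullet> c = y \<bullet> T c))"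

lemma R_in: "R y \<in> N" and R_inner: "c \<in> N \<Longrightarrow> R y \<bullet> c = y \<bullet> T c"
  using theI'[OF riesz_T[of y]] unfolding R_def by blast+

lemma R_eqI: "v \<in> N \<Longrightarrow> (\<And>c. c \<in> N \<Longrightarrow> v \<bullet> c = y \<bullet> T c) \<Longrightarrow> R y = v"
  using riesz_T[of y] R_in R_inner by blast

lemma linear_R: "linear R"
proof (rule linearI)
  show "R (x + y) = R x + R y" for x y
    by (rule R_eqI) (simp_all add: R_in R_inner subspace_N subspace_add inner_add_left)
  show "R (c *\<^sub>R x) = c *\<^sub>R R x" for c x
    by (rule R_eqI) (simp_all add: R_in R_inner subspace_N subspace_scale)
qed

sublocale R: bounded_linear R
proof -
  obtain k where k: "\<And>x. norm (T x) \<le> norm x * k" using T.bounded by blast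
  have "norm (R y) \<le> norm y * k" for y
  proof (cases "R y = 0")
    case True
    have "0 \<le> norm y * k" using k[of y] norm_ge_zero order_trans by blast
    then show ?thesis using True by simp
  next
    case False
    have "norm (R y) * norm (R y) = y \<bullet> T (R y)"
      using R_inner[OF R_in, of y y] by (simp add: power2_norm_eq_inner[symmetric] power2_eq_square)
    also have "\<dots> \<le> norm y * norm (T (R y))" by (rule norm_cauchy_schwarz)
    also have "\<dots> \<le> norm y * (norm (R y) * k)" by (intro mult_left_mono k) simp
    finally have "norm (R y) * norm (R y) \<le> (norm y * k) * norm (R y)" by (simp add: mult_ac)
    then show ?thesis using False by (metis mult_le_cancel_right norm_le_zero_iff norm_ge_zero not_le)
  qed
  then show "bounded_linear R"
    using linear_R by (intro bounded_linear_intro[of R k]) (auto simp: linear_add linear_scale)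
qed

lemma TR_symmetric: "T (R x) \<bullet> y = x \<bullet> T (R y)"
  using R_inner[OF R_in, of y x] R_inner[OF R_in, of x y] by (simp add: inner_commute)

lemma TR_positive:
  assumes "x \<noteq> 0" shows "x \<bullet> T (R x) > 0"
proof -
  have "R x \<noteq> 0" using T_dense[of x] R_inner[of _ x] assms by force
  then show ?thesis using R_inner[OF R_in, of x x] by (metis inner_gt_zero_iff)
qed

lemma TR_compact:
  fixes x :: "nat \<Rightarrow> 'a"
  assumes "\<And>n. norm (x n) \<le> 1"
  shows "\<exists>r l. strict_mono r \<and> (\<lambda>n. T (R (x (r n)))) \<longlonglongrightarrow> l"
proof -
  obtain k where k: "k > 0" "\<And>x. norm (R x) \<le> norm x * k" using R.pos_bounded by blast
  have "norm ((1/k) *\<^sub>R R (x n)) \<le> 1" for n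
  proof -
    have "norm (R (x n)) \<le> 1 * k"
      using k(2)[of "x n"] mult_right_mono[OF assms[of n], of k] k(1) by linarith
    then show ?thesis using k(1) by (simp add: field_simps)
  qed
  then obtain r l where r: "strict_mono r" "(\<lambda>n. T ((1/k) *\<^sub>R R (x (r n)))) \<longlonglongrightarrow> l"
    using T_compact[of "\<lambda>n. (1/k) *\<^sub>R R (x n)"] by blast
  have "(\<lambda>n. k *\<^sub>R T ((1/k) *\<^sub>R R (x (r n)))) \<longlonglongrightarrow> k *\<^sub>R l" by (intro tendsto_intros r)
  then show ?thesis using r(1) k(1) by (auto simp: T.scale)
qed

section \<open>Modes and frequencies\<close>

definition modes :: "'a set" where
  "modes = (SOME B. orthonormal_basis UNIV B (\<lambda>v. v) \<and> (\<forall>v\<in>B. \<exists>\<mu>>0. T (R v) = \<mu> *\<^sub>R v))"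

lemma modes_ex: "orthonormal_basis UNIV modes (\<lambda>v. v) \<and> (\<forall>v\<in>modes. \<exists>\<mu>>0. T (R v) = \<mu> *\<^sub>R v)"
  unfolding modes_def
proof (rule someI_ex, rule compact_operator_eigenbasis)
  show "bounded_linear (\<lambda>v. T (R v))" by (rule bounded_linear_compose[OF bl_T R.bounded_linear_axioms])
qed (use TR_symmetric TR_positive TR_compact in auto)

text \<open>T R is the inverse of the beam operator, so its eigenvalue is the reciprocal of a
  squared frequency.\<close>

definition freq :: "'a \<Rightarrow> real" where "freq v = (SOME w. w > 0 \<and> T (R v) = (1 / w\<^sup>2) *\<^sub>R v)"

lemma freq:
  assumes "v \<in> modes" shows "freq v > 0" "T (R v) = (1 / (freq v)\<^sup>2) *\<^sub>R v"
proof -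
  obtain \<mu> where "\<mu> > 0" "T (R v) = \<mu> *\<^sub>R v" using modes_ex assms by blast
  then have "\<exists>w>0. T (R v) = (1 / w\<^sup>2) *\<^sub>R v"
    by (intro exI[of _ "1 / sqrt \<mu>"]) (auto simp: power_divide)
  then have "freq v > 0 \<and> T (R v) = (1 / (freq v)\<^sup>2) *\<^sub>R v"
    unfolding freq_def by (rule someI_ex)
  then show "freq v > 0" "T (R v) = (1 / (freq v)\<^sup>2) *\<^sub>R v" by auto
qed

text \<open>\<open>mode v\<close> and \<open>v\<close> are paired singular vectors of
  \<open>T\<close>: T (mode v) = v / freq v and R v = mode v / freq v. The factor normalises, since
  <R v, R v> = <v, T R v> = 1 / freq^2 for a unit eigenvector.\<close>

definition mode :: "'a \<Rightarrow> 'a" where "mode v = freq v *\<^sub>R R v"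

lemma mode_in: "mode v \<in> N"
  by (simp add: mode_def R_in subspace_N subspace_scale)

lemma R_mode: "v \<in> modes \<Longrightarrow> R v = (1 / freq v) *\<^sub>R mode v"
  using freq(1)[of v] by (simp add: mode_def)

lemma T_mode: "v \<in> modes \<Longrightarrow> T (mode v) = (1 / freq v) *\<^sub>R v"
  using freq[of v] by (simp add: mode_def T.scale power2_eq_square)

lemma T_inner_mode: "c \<in> N \<Longrightarrow> v \<in> modes \<Longrightarrow> T c \<bullet> v = (c \<bullet> mode v) / freq v"
  using R_inner[of c v] by (simp add: R_mode inner_commute)

lemma R_inner_mode: "v \<in> modes \<Longrightarrow> R y \<bullet> mode v = (y \<bullet> v) / freq v"
  by (simp add: R_inner mode_in T_mode)

sublocale H: orthonormal_basis UNIV modes "\<lambda>v. v"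
  using modes_ex by blast

text \<open>Orthonormality is carried over from the eigenvectors by \<open>T_inner_mode\<close>. For
  totality, an \<open>x\<close> orthogonal to every \<open>mode i\<close> has \<open>T x\<close>
  orthogonal to every eigenvector, and \<open>T\<close> is injective on \<open>N\<close>.\<close>

sublocale V: orthonormal_basis N modes mode
proof
  show "closed N" by (rule closed_N)
  show "subspace N" by (rule subspace_N)
  show "mode i \<in> N" for i by (rule mode_in)
  fix i j assume ij: "i \<in> modes" "j \<in> modes"
  have "mode i \<bullet> mode j = freq j * (T (mode i) \<bullet> j)"
    using T_inner_mode[OF mode_in ij(2), of i] freq(1)[OF ij(2)] by simp
  then show "mode i \<bullet> mode j = (if i = j then 1 else 0)"
    using H.e_orth[OF ij] freq(1)[OF ij(1)] freq(1)[OF ij(2)] by (simp add: T_mode ij)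
next
  fix x assume x: "x \<in> N" "\<And>i. i \<in> modes \<Longrightarrow> x \<bullet> mode i = 0"
  have "T x = 0" by (rule H.e_total) (use x T_inner_mode in auto)
  then show "x = 0" using T_inj x by blast
qed

end

text \<open>In the application \<open>tr (\<surd>a u\<^sub>x\<^sub>x\<^sub>x\<^sub>x)\<close> is \<open>u\<^sub>x\<^sub>x(1)\<close>; the assumptions \<open>multiplier\<close> and \<open>transport\<close> are the two
  integrations by parts that arise from the multiplier \<open>(2x - 1)\<^sub>+\<^sup>2 u\<^sub>x\<close>, and \<open>M u\<^sub>x\<^sub>x\<close> is the
  multiplier divided by \<open>\<surd>a\<close>.\<close>

locale abstract_beam = energy_space +
  fixes M Q D :: "'a \<Rightarrow> 'a" and tr :: "'a \<Rightarrow> real"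
  assumes bl_M: "bounded_linear M" and bl_Q: "bounded_linear Q" and bl_D: "bounded_linear D"
    and tr_add: "\<And>x y. tr (x + y) = tr x + tr y"
    and tr_scale: "\<And>c x. tr (c *\<^sub>R x) = c * tr x"
    and multiplier: "\<And>y. (tr y)\<^sup>2 / 2 = Q (R y) \<bullet> R y - y \<bullet> M (R y)"
    and transport: "\<And>c. c \<in> N \<Longrightarrow> T c \<bullet> M c = D (T c) \<bullet> T c"
begin

sublocale M: bounded_linear M by (rule bl_M)
sublocale Q: bounded_linear Q by (rule bl_Q)
sublocale D: bounded_linear D by (rule bl_D)

text \<open>\<open>v\<close>, \<open>w\<close> and \<open>y\<close> stand for \<open>u\<^sub>x\<^sub>x\<close>, \<open>u\<^sub>t\<^sub>x\<^sub>x\<close> and \<open>\<surd>a u\<^sub>x\<^sub>x\<^sub>x\<^sub>x\<close>.\<close>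

definition classical :: "(real \<Rightarrow> 'a) \<Rightarrow> (real \<Rightarrow> 'a) \<Rightarrow> (real \<Rightarrow> 'a) \<Rightarrow> bool" where
  "classical v w y \<longleftrightarrow> continuous_on {0..} y \<and> continuous_on {0..} w \<and>
     (\<forall>t\<ge>0. w t \<in> N \<and> v t = R (y t) \<and>
        (v has_vector_derivative w t) (at t within {0..}) \<and>
        ((\<lambda>s. T (w s)) has_vector_derivative - y t) (at t within {0..}))"

lemma classical_diff:
  assumes "classical v w y" "classical v' w' y'"
  shows "classical (\<lambda>t. v t - v' t) (\<lambda>t. w t - w' t) (\<lambda>t. y t - y' t)"
proof -
  have "((\<lambda>s. T (w s - w' s)) has_vector_derivative - (y t - y' t)) (at t within {0..})" if "t \<ge> 0" for t
    using has_vector_derivative_diff[of "\<lambda>s. T (w s)" "- y t" "at t within {0..}" "\<lambda>s. T (w' s)" "- y' t"]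
      assms that by (auto simp: classical_def T.diff)
  then show ?thesis using assms unfolding classical_def
    by (auto simp: R.diff subspace_N subspace_diff
        intro!: continuous_intros has_vector_derivative_diff)
qed

lemma has_real_derivative_inner:
  fixes f g :: "real \<Rightarrow> 'a"
  assumes "(f has_vector_derivative f') (at t within S)" "(g has_vector_derivative g') (at t within S)"
  shows "((\<lambda>s. f s \<bullet> g s) has_real_derivative (f t \<bullet> g' + f' \<bullet> g t)) (at t within S)"
  unfolding has_field_derivative_def
  by (rule has_derivative_eq_rhs[OF has_derivative_inner[OF assms[unfolded has_vector_derivative_def]]])
    (auto simp: algebra_simps inner_commute)

text \<open>The terms <v, w> = <R y, w> and <T w, - y> in the derivative cancel by the definition of
  \<open>R\<close>.\<close>

lemma energy_conservation:
  assumes "classical v w y" "t \<ge> 0" "s \<ge> 0"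
  shows "(norm (v t))\<^sup>2 + (norm (T (w t)))\<^sup>2 = (norm (v s))\<^sup>2 + (norm (T (w s)))\<^sup>2"
proof -
  let ?E = "\<lambda>t. v t \<bullet> v t + T (w t) \<bullet> T (w t)"
  have "(?E has_real_derivative 0) (at r within {0..})" if "r \<ge> 0" for r
  proof -
    have c: "w r \<in> N" "v r = R (y r)" "(v has_vector_derivative w r) (at r within {0..})"
      "((\<lambda>s. T (w s)) has_vector_derivative - y r) (at r within {0..})"
      using assms(1) that by (auto simp: classical_def)
    have e: "(v r \<bullet> w r + w r \<bullet> v r) + (T (w r) \<bullet> - y r + - y r \<bullet> T (w r)) = 0"
      using R_inner[OF c(1), of "y r"] c(2) by (simp add: inner_commute)
    show ?thesis
      using DERIV_add[OF has_real_derivative_inner[OF c(3) c(3)] has_real_derivative_inner[OF c(4) c(4)]]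
      unfolding e .
  qed
  then obtain c where "\<And>r. r \<in> {0..} \<Longrightarrow> ?E r = c"
    using has_field_derivative_zero_constant[of "{0..}" ?E] by auto
  then have "?E t = ?E s" using assms(2,3) by simp
  then show ?thesis by (simp add: power2_norm_eq_inner)
qed

lemma classical_continuous:
  assumes "classical v w y"
  shows "continuous_on {0..} v" "continuous_on {0..} (\<lambda>t. T (w t))"
  using assms unfolding classical_def continuous_on_eq_continuous_within
  by (metis atLeast_iff has_vector_derivative_continuous)+

text \<open>Continuity comes from \<open>multiplier\<close>, which expresses the square of the trace
  through quantities that depend continuously on time; \<open>tr\<close> by itself is merely
  linear.\<close>

lemma trace_continuous:
  assumes "classical v w y"
  shows "continuous_on {0..} (\<lambda>t. (tr (y t))\<^sup>2)"
proof -
  have "continuous_on {0..} (\<lambda>t. 2 * (Q (v t) \<bullet> v t - y t \<bullet> M (v t)))"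
    using classical_continuous[OF assms] assms
    by (intro continuous_intros Q.continuous_on M.continuous_on) (auto simp: classical_def)
  moreover have "2 * (Q (v t) \<bullet> v t - y t \<bullet> M (v t)) = (tr (y t))\<^sup>2" if "t \<in> {0..}" for t
    using multiplier[of "y t"] assms that by (auto simp: classical_def)
  ultimately show ?thesis by (rule continuous_on_eq)
qed

text \<open>Differentiate \<open>T (w r) \<bullet> M (v r)\<close> and integrate.
  \<open>multiplier\<close> turns the part with \<open>y\<close> into tr^2 / 2 minus a form in
  \<open>v\<close>. The part with \<open>w\<close> is not bounded by the energy as it stands;
  \<open>transport\<close> rewrites it as a form in \<open>T w\<close>, which is. What remains is at
  most a multiple of the energy times 1 + t.\<close>

theorem hidden_regularity:
  "\<exists>C\<ge>0. \<forall>v w y t s. classical v w y \<longrightarrow> t \<ge> 0 \<longrightarrow> s \<ge> 0 \<longrightarrow>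
     integral {0..t} (\<lambda>r. (tr (y r))\<^sup>2) \<le> C * (1 + t) * ((norm (v s))\<^sup>2 + (norm (T (w s)))\<^sup>2)"
proof -
  obtain kM where kM: "kM > 0" "\<And>x. norm (M x) \<le> norm x * kM" using M.pos_bounded by blast
  obtain kQ where kQ: "kQ > 0" "\<And>x. norm (Q x) \<le> norm x * kQ" using Q.pos_bounded by blast
  obtain kD where kD: "kD > 0" "\<And>x. norm (D x) \<le> norm x * kD" using D.pos_bounded by blast
  \<comment> \<open>The trace enters with the factor 1/2, so everything doubles: the two endpoint
    values of the multiplier term give 4 kM, the forms under the integral 2 (kQ + kD).\<close>
  define C where "C = 4 * kM + 2 * (kQ + kD)"
  have "integral {0..t} (\<lambda>r. (tr (y r))\<^sup>2) \<le> C * (1 + t) * ((norm (v s))\<^sup>2 + (norm (T (w s)))\<^sup>2)"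
    if cl: "classical v w y" and ts: "t \<ge> 0" "s \<ge> 0" for v w y t s
  proof -
    define E where "E = (norm (v s))\<^sup>2 + (norm (T (w s)))\<^sup>2"
    have E: "(norm (v r))\<^sup>2 + (norm (T (w r)))\<^sup>2 = E" if "r \<ge> 0" for r
      using energy_conservation[OF cl that ts(2)] E_def by simp
    have E0: "E \<ge> 0" unfolding E_def by simp
    \<comment> \<open>Serves two cases: the mixed term, where \<open>c\<close> and \<open>b\<close>
      share the energy, and the diagonal forms, where \<open>c = b\<close>.\<close>
    have quad: "\<bar>a \<bullet> b\<bar> \<le> k * E" if "norm a \<le> norm c * k" "(norm c)\<^sup>2 + (norm b)\<^sup>2 \<le> E \<or> (c = b \<and> (norm b)\<^sup>2 \<le> E)" "k > 0" for a b c :: 'a and k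
    proof -
      have "norm c * norm b \<le> E"
      proof (cases "c = b \<and> (norm b)\<^sup>2 \<le> E")
        case True then show ?thesis by (simp add: power2_eq_square)
      next
        case False
        have "0 \<le> (norm c - norm b)\<^sup>2" by simp
        then have "2 * (norm c * norm b) \<le> (norm c)\<^sup>2 + (norm b)\<^sup>2" by (simp add: power2_diff)
        then have "2 * (norm c * norm b) \<le> E" using False that(2) by linarith
        moreover have "0 \<le> norm c * norm b" by simp
        ultimately show ?thesis by linarith
      qed
      have "\<bar>a \<bullet> b\<bar> \<le> norm a * norm b" by (rule Cauchy_Schwarz_ineq2)
      also have "\<dots> \<le> (norm c * k) * norm b" by (intro mult_right_mono that) simp
      also have "\<dots> = k * (norm c * norm b)" by simp
      also have "\<dots> \<le> k * E" using \<open>norm c * norm b \<le> E\<close> that(3) by (intro mult_left_mono) auto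
      finally show ?thesis .
    qed
    let ?g = "\<lambda>r. Q (v r) \<bullet> v r - D (T (w r)) \<bullet> T (w r)"
    let ?G = "\<lambda>r. T (w r) \<bullet> M (v r)"
    have dG: "(?G has_real_derivative ((tr (y r))\<^sup>2 / 2 - ?g r)) (at r within {0..})" if r: "r \<ge> 0" for r
    proof -
      have c: "w r \<in> N" "v r = R (y r)" "(v has_vector_derivative w r) (at r within {0..})"
        "((\<lambda>s. T (w s)) has_vector_derivative - y r) (at r within {0..})"
        using cl r by (auto simp: classical_def)
      have "((\<lambda>s. M (v s)) has_vector_derivative M (w r)) (at r within {0..})"
        by (rule M.has_vector_derivative[OF c(3)])
      from has_real_derivative_inner[OF c(4) this]
      have "(?G has_real_derivative (T (w r) \<bullet> M (w r) + - y r \<bullet> M (v r))) (at r within {0..})" .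
      moreover have "T (w r) \<bullet> M (w r) + - y r \<bullet> M (v r) = (tr (y r))\<^sup>2 / 2 - ?g r"
        using multiplier[of "y r"] c(2) transport[OF c(1)] by (simp add: field_simps)
      ultimately show ?thesis by simp
    qed
    have cg: "continuous_on {0..t} ?g"
      by (rule continuous_on_subset[of "{0..}"])
        (auto intro!: continuous_intros Q.continuous_on D.continuous_on classical_continuous[OF cl])
    have ctr: "continuous_on {0..t} (\<lambda>r. (tr (y r))\<^sup>2)"
      using continuous_on_subset[OF trace_continuous[OF cl]] by auto
    have "((\<lambda>r. (tr (y r))\<^sup>2 / 2 - ?g r) has_integral (?G t - ?G 0)) {0..t}"
    proof (rule fundamental_theorem_of_calculus[OF ts(1)])
      fix r assume "r \<in> {0..t}"
      then show "(?G has_vector_derivative ((tr (y r))\<^sup>2 / 2 - ?g r)) (at r within {0..t})"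
        using has_field_derivative_subset[OF dG[of r], of "{0..t}"]
        by (auto simp: has_real_derivative_iff_has_vector_derivative)
    qed
    then have "integral {0..t} (\<lambda>r. (tr (y r))\<^sup>2 / 2 - ?g r) = ?G t - ?G 0" by (rule integral_unique)
    moreover have "integral {0..t} (\<lambda>r. (tr (y r))\<^sup>2 / 2 - ?g r)
        = integral {0..t} (\<lambda>r. (tr (y r))\<^sup>2 / 2) - integral {0..t} ?g"
      by (rule Henstock_Kurzweil_Integration.integral_diff)
        (intro integrable_continuous_interval continuous_intros ctr cg; simp)+
    moreover have "integral {0..t} (\<lambda>r. (tr (y r))\<^sup>2 / 2) = integral {0..t} (\<lambda>r. (tr (y r))\<^sup>2) / 2"
      by (rule integral_divide)
    moreover have "\<bar>integral {0..t} ?g\<bar> \<le> ((kQ + kD) * E) * (t - 0)"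
    proof -
      have "norm (?g r) \<le> (kQ + kD) * E" if r: "r \<in> {0..t}" for r
      proof -
        have vE: "(norm (v r))\<^sup>2 \<le> E" "(norm (T (w r)))\<^sup>2 \<le> E"
          using E[of r] r zero_le_power2[of "norm (v r)"] zero_le_power2[of "norm (T (w r))"] by auto
        have "\<bar>Q (v r) \<bullet> v r\<bar> \<le> kQ * E" by (rule quad[OF kQ(2) _ kQ(1)]) (use vE in auto)
        moreover have "\<bar>D (T (w r)) \<bullet> T (w r)\<bar> \<le> kD * E" by (rule quad[OF kD(2) _ kD(1)]) (use vE in auto)
        ultimately show ?thesis by (simp add: distrib_right)
      qed
      then show ?thesis using integral_bound[OF ts(1) cg] by simp
    qed
    moreover have "\<bar>?G r\<bar> \<le> kM * E" if "r \<ge> 0" for r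
      using quad[OF kM(2), of "v r" "T (w r)"] kM(1) E[OF that] by (simp add: inner_commute)
    then have "\<bar>?G t\<bar> \<le> kM * E" "\<bar>?G 0\<bar> \<le> kM * E" using ts by auto
    ultimately have "integral {0..t} (\<lambda>r. (tr (y r))\<^sup>2) \<le> 4 * kM * E + 2 * ((kQ + kD) * E * t)"
      by (simp add: abs_le_iff field_simps)
    also have "\<dots> \<le> C * (1 + t) * E"
      using kM(1) kQ(1) kD(1) ts(1) E0 by (simp add: C_def algebra_simps)
    finally show ?thesis unfolding E_def .
  qed
  moreover have "C \<ge> 0" using kM kQ kD by (simp add: C_def)
  ultimately show ?thesis by blast
qed

text \<open>The trace that belongs to the i-th mode, because \<open>mode i\<close> is
  \<open>R (freq i *\<^sub>R i)\<close>.\<close>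

definition trace_coeff :: "'a \<Rightarrow> real" where "trace_coeff i = freq i * tr i"

lemma tr_sum: "finite F \<Longrightarrow> tr (\<Sum>i\<in>F. c i *\<^sub>R x i) = (\<Sum>i\<in>F. c i * tr (x i))"
proof (induction F rule: finite_induct)
  case empty
  show ?case using tr_scale[of 0 0] by simp
qed (simp add: tr_add tr_scale)

text \<open>In the orthonormal systems \<open>mode i\<close> and \<open>i\<close> the state (v, T w)
  has coefficients with alpha' = freq beta and beta' = - freq alpha: each mode rotates in its own
  plane. The factors \<open>freq i\<close> in \<open>w\<close> and \<open>y\<close> are the ones
  that \<open>T\<close> and \<open>R\<close> divide out.\<close>

lemma classical_modes:
  fixes A B :: "'a \<Rightarrow> real"
  assumes F: "finite F" "F \<subseteq> modes"
  defines "\<alpha> \<equiv> \<lambda>i t. A i * cos (freq i * t) + B i * sin (freq i * t)"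
    and "\<beta> \<equiv> \<lambda>i t. B i * cos (freq i * t) - A i * sin (freq i * t)"
  shows "classical (\<lambda>t. \<Sum>i\<in>F. \<alpha> i t *\<^sub>R mode i) (\<lambda>t. \<Sum>i\<in>F. (freq i * \<beta> i t) *\<^sub>R mode i)
           (\<lambda>t. \<Sum>i\<in>F. (freq i * \<alpha> i t) *\<^sub>R i)"
    and "T (\<Sum>i\<in>F. (freq i * \<beta> i t) *\<^sub>R mode i) = (\<Sum>i\<in>F. \<beta> i t *\<^sub>R i)"
    and "tr (\<Sum>i\<in>F. (freq i * \<alpha> i t) *\<^sub>R i) = (\<Sum>i\<in>F. trace_coeff i * \<alpha> i t)"
proof -
  have Tw: "T (\<Sum>i\<in>F. (freq i * \<beta> i t) *\<^sub>R mode i) = (\<Sum>i\<in>F. \<beta> i t *\<^sub>R i)" for t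
    unfolding T.sum by (rule sum.cong) (use F freq(1) in \<open>auto simp: T.scale T_mode subset_iff less_imp_neq[symmetric]\<close>)
  then show "T (\<Sum>i\<in>F. (freq i * \<beta> i t) *\<^sub>R mode i) = (\<Sum>i\<in>F. \<beta> i t *\<^sub>R i)" .
  show "tr (\<Sum>i\<in>F. (freq i * \<alpha> i t) *\<^sub>R i) = (\<Sum>i\<in>F. trace_coeff i * \<alpha> i t)"
    using F by (simp add: tr_sum trace_coeff_def algebra_simps)
  have Ry: "(\<Sum>i\<in>F. \<alpha> i t *\<^sub>R mode i) = R (\<Sum>i\<in>F. (freq i * \<alpha> i t) *\<^sub>R i)" for t
    unfolding R.sum by (rule sum.cong) (use F freq(1) in \<open>auto simp: R.scale R_mode subset_iff less_imp_neq[symmetric]\<close>)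
  have d\<alpha>: "(\<alpha> i has_real_derivative freq i * \<beta> i t) (at t within S)" for i t S
    unfolding \<alpha>_def \<beta>_def by (auto intro!: derivative_eq_intros simp: algebra_simps)
  have d\<beta>: "(\<beta> i has_real_derivative - (freq i * \<alpha> i t)) (at t within S)" for i t S
    unfolding \<alpha>_def \<beta>_def by (auto intro!: derivative_eq_intros simp: algebra_simps)
  have c: "continuous_on S (\<alpha> i)" "continuous_on S (\<beta> i)" for S i
    unfolding \<alpha>_def \<beta>_def by (auto intro!: continuous_intros)
  have d: "((\<lambda>t. \<Sum>i\<in>F. g i t *\<^sub>R x i) has_vector_derivative (\<Sum>i\<in>F. g' i *\<^sub>R x i)) (at t within S)"
    if "\<And>i. (g i has_real_derivative g' i) (at t within S)" for g :: "'a \<Rightarrow> real \<Rightarrow> real" and g' and x :: "'a \<Rightarrow> 'a" and t S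
    by (rule has_vector_derivative_sum)
      (use has_vector_derivative_scaleR[OF that has_vector_derivative_const] in auto)
  show "classical (\<lambda>t. \<Sum>i\<in>F. \<alpha> i t *\<^sub>R mode i) (\<lambda>t. \<Sum>i\<in>F. (freq i * \<beta> i t) *\<^sub>R mode i)
           (\<lambda>t. \<Sum>i\<in>F. (freq i * \<alpha> i t) *\<^sub>R i)"
    unfolding classical_def Tw
  proof (intro conjI allI impI)
    fix t :: real
    show "(\<Sum>i\<in>F. (freq i * \<beta> i t) *\<^sub>R mode i) \<in> N" by (rule V.sum_basis_in[OF F(2)])
    show "(\<Sum>i\<in>F. \<alpha> i t *\<^sub>R mode i) = R (\<Sum>i\<in>F. (freq i * \<alpha> i t) *\<^sub>R i)" by (rule Ry)
    show "((\<lambda>t. \<Sum>i\<in>F. \<alpha> i t *\<^sub>R mode i) has_vector_derivative (\<Sum>i\<in>F. (freq i * \<beta> i t) *\<^sub>R mode i)) (at t within {0..})"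
      by (rule d[OF d\<alpha>])
    show "((\<lambda>s. \<Sum>i\<in>F. \<beta> i s *\<^sub>R i) has_vector_derivative - (\<Sum>i\<in>F. (freq i * \<alpha> i t) *\<^sub>R i)) (at t within {0..})"
      using d[OF d\<beta>, where x = "\<lambda>i. i" and t = t and S = "{0..}"] by (simp add: sum_negf)
  qed (intro continuous_intros c)+
qed

text \<open>Hidden regularity for mode sums with a constant independent of \<open>F\<close>. The
  amplitudes stay arbitrary so that the forcing integrals can be inserted for them.\<close>

definition admissibility_constant :: "real \<Rightarrow> bool" where
  "admissibility_constant C \<longleftrightarrow> C \<ge> 0 \<and> (\<forall>t F A B. t \<ge> 0 \<longrightarrow> finite F \<longrightarrow> F \<subseteq> modes \<longrightarrow>
     integral {0..t} (\<lambda>r. (\<Sum>i\<in>F. trace_coeff i * (A i * cos (freq i * r) + B i * sin (freq i * r)))\<^sup>2)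
       \<le> C * (1 + t) * (\<Sum>i\<in>F. (A i)\<^sup>2 + (B i)\<^sup>2))"

lemma admissibility: "\<exists>C. admissibility_constant C"
proof -
  obtain C where C: "C \<ge> 0" and h: "\<And>v w y t s. classical v w y \<Longrightarrow> t \<ge> 0 \<Longrightarrow> s \<ge> 0 \<Longrightarrow>
     integral {0..t} (\<lambda>r. (tr (y r))\<^sup>2) \<le> C * (1 + t) * ((norm (v s))\<^sup>2 + (norm (T (w s)))\<^sup>2)"
    using hidden_regularity by blast
  show ?thesis unfolding admissibility_constant_def
  proof (intro exI[of _ C] conjI C allI impI)
    fix t :: real and F :: "'a set" and A B :: "'a \<Rightarrow> real" assume t: "0 \<le> t" and F: "finite F" "F \<subseteq> modes"
    note m = classical_modes[OF F, where A = A and B = B]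
    show "integral {0..t} (\<lambda>r. (\<Sum>i\<in>F. trace_coeff i * (A i * cos (freq i * r) + B i * sin (freq i * r)))\<^sup>2)
       \<le> C * (1 + t) * (\<Sum>i\<in>F. (A i)\<^sup>2 + (B i)\<^sup>2)"
      using h[OF m(1) t order_refl]
      unfolding m(2) m(3) using V.norm_sum_basis[OF F, of A] H.norm_sum_basis[OF F, of B]
      by (simp add: sum.distrib)
  qed
qed

end

section \<open>Square integrable functions on intervals\<close>

lemma L2_on_subset:
  assumes "f \<in> L2_on S" "S \<in> sets lebesgue" "A \<in> sets lebesgue" "A \<subseteq> S"
  shows "f \<in> L2_on A"
proof -
  have "set_integrable lebesgue S (\<lambda>x. (f x)\<^sup>2)"
    using assms(1,2) by (simp add: L2_on_def set_integrable_def integrable_restrict_space)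
  then have "set_integrable lebesgue A (\<lambda>x. (f x)\<^sup>2)" using assms(3,4) by (rule set_integrable_subset)
  then have "integrable (lebesgue_on A) (\<lambda>x. (f x)\<^sup>2)"
    using assms(3) by (simp add: set_integrable_def integrable_restrict_space)
  moreover have "f \<in> borel_measurable (lebesgue_on A)"
    using assms(1,4) measurable_restrict_mono by (auto simp: L2_on_def)
  ultimately show ?thesis by (simp add: L2_on_def)
qed

lemma L2_on_mult_integrable:
  assumes "f \<in> L2_on S" "g \<in> L2_on S"
  shows "integrable (lebesgue_on S) (\<lambda>x. f x * g x)"
proof (rule Bochner_Integration.integrable_bound)
  show "integrable (lebesgue_on S) (\<lambda>x. (f x)\<^sup>2 + (g x)\<^sup>2)"
    using assms by (auto simp: L2_on_def)
  show "(\<lambda>x. f x * g x) \<in> borel_measurable (lebesgue_on S)" using assms by (auto simp: L2_on_def)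
  show "AE x in lebesgue_on S. norm (f x * g x) \<le> norm ((f x)\<^sup>2 + (g x)\<^sup>2)"
  proof (rule AE_I2)
    fix x
    have "2 * (\<bar>f x\<bar> * \<bar>g x\<bar>) \<le> (f x)\<^sup>2 + (g x)\<^sup>2"
      using zero_le_power2[of "\<bar>f x\<bar> - \<bar>g x\<bar>"] by (simp add: power2_diff)
    moreover have "0 \<le> \<bar>f x\<bar> * \<bar>g x\<bar>" by simp
    ultimately have "\<bar>f x\<bar> * \<bar>g x\<bar> \<le> (f x)\<^sup>2 + (g x)\<^sup>2" by linarith
    then show "norm (f x * g x) \<le> norm ((f x)\<^sup>2 + (g x)\<^sup>2)" by (simp add: abs_mult)
  qed
qed

lemma L2_on_lincomb:
  assumes "f \<in> L2_on S" "g \<in> L2_on S"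
  shows "(\<lambda>x. a * f x + b * g x) \<in> L2_on S"
proof -
  have e: "(\<lambda>x. (a * f x + b * g x)\<^sup>2) = (\<lambda>x. a\<^sup>2 * (f x)\<^sup>2 + (2 * a * b) * (f x * g x) + b\<^sup>2 * (g x)\<^sup>2)"
    by (auto simp: power2_eq_square algebra_simps)
  have "integrable (lebesgue_on S) (\<lambda>x. (a * f x + b * g x)\<^sup>2)" unfolding e
    using assms L2_on_mult_integrable[OF assms]
    by (intro Bochner_Integration.integrable_add Bochner_Integration.integrable_mult_right) (auto simp: L2_on_def)
  then show ?thesis using assms by (auto simp: L2_on_def)
qed

text \<open>A quadratic in \<open>t\<close> stays nonnegative, so its discriminant is not positive;
  the case of a vanishing leading coefficient \<open>F\<close> is separate.\<close>

lemma cauchy_schwarz_integral: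
  assumes f: "f \<in> L2_on {a..b}" and g: "g \<in> L2_on {a..b}"
  shows "(integral {a..b} (\<lambda>x. f x * g x))\<^sup>2
          \<le> integral {a..b} (\<lambda>x. (f x)\<^sup>2) * integral {a..b} (\<lambda>x. (g x)\<^sup>2)"
proof -
  have S: "{a..b} \<in> sets lebesgue" by simp
  define F X G where "F = integral {a..b} (\<lambda>x. (f x)\<^sup>2)" and "X = integral {a..b} (\<lambda>x. f x * g x)"
    and "G = integral {a..b} (\<lambda>x. (g x)\<^sup>2)"
  have i: "(\<lambda>x. (f x)\<^sup>2) integrable_on {a..b}" "(\<lambda>x. f x * g x) integrable_on {a..b}" "(\<lambda>x. (g x)\<^sup>2) integrable_on {a..b}"
    using f g L2_on_mult_integrable[OF f g] by (auto simp: L2_on_def intro!: integrable_on_lebesgue_on)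
  have q: "0 \<le> t\<^sup>2 * F - 2 * t * X + G" for t
  proof -
    have "(\<lambda>x. (t * f x - g x)\<^sup>2) = (\<lambda>x. (t\<^sup>2 * (f x)\<^sup>2 - (2 * t) * (f x * g x)) + (g x)\<^sup>2)"
      by (auto simp: power2_eq_square algebra_simps)
    moreover have "((\<lambda>x. (t\<^sup>2 * (f x)\<^sup>2 - (2 * t) * (f x * g x)) + (g x)\<^sup>2) has_integral t\<^sup>2 * F - 2 * t * X + G) {a..b}"
      unfolding F_def X_def G_def
      by (intro has_integral_add has_integral_diff has_integral_mult_right integrable_integral i)
    ultimately have "integral {a..b} (\<lambda>x. (t * f x - g x)\<^sup>2) = t\<^sup>2 * F - 2 * t * X + G"
      by (simp add: integral_unique)
    moreover have "0 \<le> integral {a..b} (\<lambda>x. (t * f x - g x)\<^sup>2)"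
      by (rule Henstock_Kurzweil_Integration.integral_nonneg)
        (use L2_on_lincomb[OF f g, of t "-1"] in \<open>auto simp: L2_on_def intro!: integrable_on_lebesgue_on\<close>)
    ultimately show ?thesis by simp
  qed
  have F0: "F \<ge> 0" unfolding F_def by (rule Henstock_Kurzweil_Integration.integral_nonneg[OF i(1)]) simp
  have "X\<^sup>2 \<le> F * G"
  proof (cases "F = 0")
    case True
    have "X = 0"
    proof (rule ccontr)
      assume "X \<noteq> 0"
      \<comment> \<open>For \<open>F = 0\<close> the quadratic is affine in \<open>t\<close>, and t
        = (G + 1) / X would give it the value - G - 2.\<close>
      have "2 * ((G + 1) / X) * X = 2 * (G + 1)" using \<open>X \<noteq> 0\<close> by simp
      moreover have "0 \<le> ((G + 1) / X)\<^sup>2 * 0 - 2 * ((G + 1) / X) * X + G" using q[of "(G + 1) / X"] unfolding True .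
      ultimately have "0 \<le> - 2 * (G + 1) + G" by linarith
      moreover have "G \<ge> 0" using q[of 0] by simp
      ultimately show False by simp
    qed
    then show ?thesis using True by simp
  next
    case False
    then show ?thesis using q[of "X / F"] F0 by (simp add: power2_eq_square field_simps)
  qed
  then show ?thesis by (simp add: F_def X_def G_def)
qed

lemma L2_on_continuous:
  fixes g :: fn
  assumes "continuous_on {a..b} g" shows "g \<in> L2_on {a..b}"
  using continuous_imp_integrable_real[OF assms]
    continuous_imp_integrable_real[of a b "\<lambda>x. (g x)\<^sup>2"] assms
  by (auto simp: L2_on_def intro!: continuous_intros)

lemma continuous_on_half_line:
  fixes \<phi> :: "real \<Rightarrow> 'b::topological_space"
  assumes "\<And>b. b > 0 \<Longrightarrow> continuous_on {0..b} \<phi>"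
  shows "continuous_on {0..} \<phi>"
  unfolding continuous_on_eq_continuous_within
proof
  fix t :: real assume "t \<in> {0..}"
  then have "continuous (at t within {0..t+1}) \<phi>"
    using assms[of "t+1"] by (auto simp: continuous_on_eq_continuous_within)
  moreover have "at t within {0..t+1} = at t within {0..}"
    by (rule at_within_nhd[of t "{..<t+1}"]) auto
  ultimately show "continuous (at t within {0..}) \<phi>" by simp
qed

section \<open>Modal construction of the solution\<close>

locale forced_beam = abstract_beam +
  fixes f :: fn and y0 x0 :: 'a \<comment> \<open>\<open>y0\<close> represents \<open>u\<^sub>1\<close>, and \<open>x0\<close> is \<open>u\<^sub>0 / \<surd>a\<close>\<close>
  assumes f: "f \<in> L2_loc" and y0: "y0 \<in> N"
begin

lemma f_L2: "0 \<le> s \<Longrightarrow> f \<in> L2_on {s..t}"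
proof -
  assume s: "0 \<le> s"
  have "f \<in> L2_on {0..max t 1}" using f by (simp add: L2_loc_def)
  then show ?thesis by (rule L2_on_subset) (use s in auto)
qed

lemma f_mult_integrable:
  fixes g :: fn
  assumes "0 \<le> s" "continuous_on UNIV g"
  shows "(\<lambda>r. f r * g r) integrable_on {s..t}"
    and "(\<lambda>r. \<bar>f r\<bar> * g r) integrable_on {s..t}"
    and "(\<lambda>r. (f r)\<^sup>2) integrable_on {s..t}"
proof -
  have g: "g \<in> L2_on {s..t}" using assms(2) continuous_on_subset by (intro L2_on_continuous) blast
  have f': "(\<lambda>r. \<bar>f r\<bar>) \<in> L2_on {s..t}" using f_L2[OF assms(1), of t] by (auto simp: L2_on_def)
  show "(\<lambda>r. f r * g r) integrable_on {s..t}"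
    using L2_on_mult_integrable[OF f_L2[OF assms(1)] g] by (intro integrable_on_lebesgue_on) auto
  show "(\<lambda>r. \<bar>f r\<bar> * g r) integrable_on {s..t}"
    using L2_on_mult_integrable[OF f' g] by (intro integrable_on_lebesgue_on) auto
  show "(\<lambda>r. (f r)\<^sup>2) integrable_on {s..t}"
    using f_L2[OF assms(1), of t] by (intro integrable_on_lebesgue_on) (auto simp: L2_on_def)
qed

lemmas f_abs_integrable = f_mult_integrable(2)[where g = "\<lambda>_. 1", simplified]

definition fcos :: "'a \<Rightarrow> real \<Rightarrow> real \<Rightarrow> real" where
  "fcos i s t = integral {s..t} (\<lambda>r. f r * cos (freq i * r))"

definition fsin :: "'a \<Rightarrow> real \<Rightarrow> real \<Rightarrow> real" where
  "fsin i s t = integral {s..t} (\<lambda>r. f r * sin (freq i * r))"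

lemma int_cos: "0 \<le> s \<Longrightarrow> (\<lambda>r. f r * cos (freq i * r)) integrable_on {s..t}"
  and int_sin: "0 \<le> s \<Longrightarrow> (\<lambda>r. f r * sin (freq i * r)) integrable_on {s..t}"
  by (rule f_mult_integrable; auto intro!: continuous_intros)+

lemma fcos_combine: "0 \<le> s \<Longrightarrow> s \<le> t \<Longrightarrow> fcos i 0 t = fcos i 0 s + fcos i s t"
  and fsin_combine: "0 \<le> s \<Longrightarrow> s \<le> t \<Longrightarrow> fsin i 0 t = fsin i 0 s + fsin i s t"
  unfolding fcos_def fsin_def
  by (rule Henstock_Kurzweil_Integration.integral_combine[symmetric]; simp add: int_cos int_sin)+

lemma forced_modes_integral:
  assumes "finite F" "0 \<le> s"
  shows "integral {s..t} (\<lambda>r. f r * (\<Sum>i\<in>F. trace_coeff i * (A i * cos (freq i * r) + B i * sin (freq i * r))))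
    = (\<Sum>i\<in>F. trace_coeff i * (A i * fcos i s t + B i * fsin i s t))"
proof (rule integral_unique)
  have "((\<lambda>r. \<Sum>i\<in>F. trace_coeff i * (A i * (f r * cos (freq i * r)) + B i * (f r * sin (freq i * r)))) has_integral
      (\<Sum>i\<in>F. trace_coeff i * (A i * fcos i s t + B i * fsin i s t))) {s..t}"
    unfolding fcos_def fsin_def
    by (intro has_integral_sum assms has_integral_add has_integral_mult_right integrable_integral int_cos int_sin)
  moreover have "(\<lambda>r. \<Sum>i\<in>F. trace_coeff i * (A i * (f r * cos (freq i * r)) + B i * (f r * sin (freq i * r))))
    = (\<lambda>r. f r * (\<Sum>i\<in>F. trace_coeff i * (A i * cos (freq i * r) + B i * sin (freq i * r))))"
    by (auto simp: sum_distrib_left algebra_simps intro!: sum.cong)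
  ultimately show "((\<lambda>r. f r * (\<Sum>i\<in>F. trace_coeff i * (A i * cos (freq i * r) + B i * sin (freq i * r)))) has_integral
      (\<Sum>i\<in>F. trace_coeff i * (A i * fcos i s t + B i * fsin i s t))) {s..t}" by simp
qed

definition energy_f :: "real \<Rightarrow> real" where "energy_f t = integral {0..t} (\<lambda>r. (f r)\<^sup>2)"

lemma energy_f_combine: "0 \<le> s \<Longrightarrow> s \<le> t \<Longrightarrow> integral {s..t} (\<lambda>r. (f r)\<^sup>2) = energy_f t - energy_f s"
  unfolding energy_f_def
  using Henstock_Kurzweil_Integration.integral_combine[of 0 s t "\<lambda>r. (f r)\<^sup>2"] f_mult_integrable(3)[of 0 "\<lambda>_. 0" t] by simp

lemma continuous_energy_f: "continuous_on {0..} energy_f"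
  unfolding energy_f_def
  by (intro continuous_on_half_line indefinite_integral_continuous_1 f_mult_integrable(3)[where g = "\<lambda>_. 0"]) auto

text \<open>Duality: call the sum \<open>S\<close> and use the forcing coefficients themselves as
  amplitudes of a mode sum with trace \<open>?h\<close>. Then \<open>S\<close> is the integral of f
  times \<open>?h\<close>, and S^2 is at most (integral of f^2) times C (1 + t) S. Cancelling one
  \<open>S\<close> leaves a bound that is uniform in \<open>F\<close>.\<close>

lemma forcing_bound:
  "\<exists>C\<ge>0. \<forall>s t F. 0 \<le> s \<longrightarrow> s \<le> t \<longrightarrow> finite F \<longrightarrow> F \<subseteq> modes \<longrightarrow>
     (\<Sum>i\<in>F. (trace_coeff i)\<^sup>2 * ((fcos i s t)\<^sup>2 + (fsin i s t)\<^sup>2)) \<le> C * (1 + t) * (energy_f t - energy_f s)"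
proof -
  obtain C where adm_C: "admissibility_constant C" using admissibility by blast
  have C: "C \<ge> 0" using adm_C by (simp add: admissibility_constant_def)
  have adm: "integral {0..t} (\<lambda>r. (\<Sum>i\<in>F. trace_coeff i * (A i * cos (freq i * r) + B i * sin (freq i * r)))\<^sup>2)
       \<le> C * (1 + t) * (\<Sum>i\<in>F. (A i)\<^sup>2 + (B i)\<^sup>2)"
    if "t \<ge> 0" "finite F" "F \<subseteq> modes" for t F A B
    using adm_C that by (simp add: admissibility_constant_def)
  have "(\<Sum>i\<in>F. (trace_coeff i)\<^sup>2 * ((fcos i s t)\<^sup>2 + (fsin i s t)\<^sup>2)) \<le> C * (1 + t) * (energy_f t - energy_f s)"
    if st: "0 \<le> s" "s \<le> t" and F: "finite F" "F \<subseteq> modes" for s t F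
  proof -
    let ?A = "\<lambda>i. trace_coeff i * fcos i s t" and ?B = "\<lambda>i. trace_coeff i * fsin i s t"
    let ?h = "\<lambda>r. \<Sum>i\<in>F. trace_coeff i * (?A i * cos (freq i * r) + ?B i * sin (freq i * r))"
    define S where "S = (\<Sum>i\<in>F. (trace_coeff i)\<^sup>2 * ((fcos i s t)\<^sup>2 + (fsin i s t)\<^sup>2))"
    have S: "S = (\<Sum>i\<in>F. (?A i)\<^sup>2 + (?B i)\<^sup>2)"
      unfolding S_def by (rule sum.cong) (auto simp: power_mult_distrib algebra_simps)
    have S0: "S \<ge> 0" unfolding S_def by (intro sum_nonneg) simp
    have hc: "continuous_on U ?h" for U by (intro continuous_intros)
    have "integral {s..t} (\<lambda>r. f r * ?h r) = S"
      unfolding forced_modes_integral[OF F(1) st(1)] S_def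
      by (rule sum.cong) (auto simp: power2_eq_square algebra_simps)
    then have "S\<^sup>2 \<le> (energy_f t - energy_f s) * integral {s..t} (\<lambda>r. (?h r)\<^sup>2)"
      using cauchy_schwarz_integral[OF f_L2[OF st(1), of t] L2_on_continuous[OF hc]] energy_f_combine[OF st] by simp
    also have "\<dots> \<le> (energy_f t - energy_f s) * (C * (1 + t) * S)"
    proof (rule mult_left_mono)
      have "integral {s..t} (\<lambda>r. (?h r)\<^sup>2) \<le> integral {0..t} (\<lambda>r. (?h r)\<^sup>2)"
        using st by (intro integral_subset_le integrable_continuous_interval continuous_intros) auto
      also have "\<dots> \<le> C * (1 + t) * S" unfolding S using st by (intro adm F) auto
      finally show "integral {s..t} (\<lambda>r. (?h r)\<^sup>2) \<le> C * (1 + t) * S" .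
      show "0 \<le> energy_f t - energy_f s"
        using f_mult_integrable(3)[OF st(1), of "\<lambda>_. 0" t] energy_f_combine[OF st]
          Henstock_Kurzweil_Integration.integral_nonneg[of "\<lambda>r. (f r)\<^sup>2" "{s..t}"] by simp
    qed
    finally have "S * S \<le> (C * (1 + t) * (energy_f t - energy_f s)) * S" by (simp add: power2_eq_square mult_ac)
    moreover have "0 \<le> C * (1 + t) * (energy_f t - energy_f s)"
        using f_mult_integrable(3)[OF st(1), of "\<lambda>_. 0" t] energy_f_combine[OF st] C st
          Henstock_Kurzweil_Integration.integral_nonneg[of "\<lambda>r. (f r)\<^sup>2" "{s..t}"] by simp
    ultimately have "S \<le> C * (1 + t) * (energy_f t - energy_f s)"
      using S0 by (cases "S = 0") (auto simp: mult_le_cancel_right)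
    then show ?thesis by (simp add: S_def)
  qed
  then show ?thesis using C by blast
qed

text \<open>In the rotating frame of each mode only the forcing changes the state; the complex number
  \<open>\<zeta> i t\<close> has the coefficient of \<open>u\<^sub>t\<close> as real and that of \<open>u\<close> as imaginary part.\<close>

definition frame :: "'a \<Rightarrow> real \<Rightarrow> complex" where
  "frame i t = Complex (y0 \<bullet> mode i - trace_coeff i * fcos i 0 t) (x0 \<bullet> i + trace_coeff i * fsin i 0 t)"

definition \<zeta> :: "'a \<Rightarrow> real \<Rightarrow> complex" where "\<zeta> i t = cis (freq i * t) * frame i t"

text \<open>The difference of two frames contains only the forcing between the two times; initial
  data and rotation have dropped out. \<open>max\<close> and the absolute value make the bound
  symmetric in \<open>s\<close> and \<open>t\<close>.\<close>

lemma frame_diff_sum: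
  obtains C where "C \<ge> 0" "\<And>s t F. 0 \<le> s \<Longrightarrow> 0 \<le> t \<Longrightarrow> finite F \<Longrightarrow> F \<subseteq> modes \<Longrightarrow>
     (\<Sum>i\<in>F. (cmod (frame i s - frame i t))\<^sup>2) \<le> C * (1 + max s t) * \<bar>energy_f s - energy_f t\<bar>"
proof -
  obtain C where C: "C \<ge> 0" "\<And>s t F. 0 \<le> s \<Longrightarrow> s \<le> t \<Longrightarrow> finite F \<Longrightarrow> F \<subseteq> modes \<Longrightarrow>
     (\<Sum>i\<in>F. (trace_coeff i)\<^sup>2 * ((fcos i s t)\<^sup>2 + (fsin i s t)\<^sup>2)) \<le> C * (1 + t) * (energy_f t - energy_f s)"
    using forcing_bound by blast
  have w: "(\<Sum>i\<in>F. (cmod (frame i s - frame i t))\<^sup>2) \<le> C * (1 + max s t) * \<bar>energy_f s - energy_f t\<bar>"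
    if "0 \<le> s" "s \<le> t" "finite F" "F \<subseteq> modes" for s t F
  proof -
    have "(\<Sum>i\<in>F. (cmod (frame i s - frame i t))\<^sup>2) = (\<Sum>i\<in>F. (trace_coeff i)\<^sup>2 * ((fcos i s t)\<^sup>2 + (fsin i s t)\<^sup>2))"
      unfolding cmod_power2 by (rule sum.cong) (auto simp: frame_def fcos_combine[OF that(1,2)] fsin_combine[OF that(1,2)]
          power2_eq_square algebra_simps)
    also have "\<dots> \<le> C * (1 + t) * (energy_f t - energy_f s)" using C(2) that by blast
    also have "\<dots> \<le> C * (1 + t) * \<bar>energy_f s - energy_f t\<bar>" using C(1) that by (intro mult_left_mono) auto
    finally show ?thesis using that by (simp add: max_def)
  qed
  show ?thesis
  proof (rule that[OF C(1)])
    fix s t F assume "0 \<le> (s::real)" "0 \<le> (t::real)" "finite F" "F \<subseteq> modes"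
    then show "(\<Sum>i\<in>F. (cmod (frame i s - frame i t))\<^sup>2) \<le> C * (1 + max s t) * \<bar>energy_f s - energy_f t\<bar>"
      using w[of s t F] w[of t s F] by (cases "s \<le> t") (auto simp: norm_minus_commute abs_minus_commute max.commute)
  qed
qed

lemma cmod_add_sq: "(cmod (a + b))\<^sup>2 \<le> 2 * (cmod a)\<^sup>2 + 2 * (cmod b)\<^sup>2"
proof -
  have "(cmod (a + b))\<^sup>2 \<le> (cmod a + cmod b)\<^sup>2" by (intro power_mono norm_triangle_ineq) simp
  also have "\<dots> \<le> 2 * (cmod a)\<^sup>2 + 2 * (cmod b)\<^sup>2"
    using zero_le_power2[of "cmod a - cmod b"] by (simp add: power2_sum power2_diff)
  finally show ?thesis .
qed

lemma cmod_\<zeta>: "cmod (\<zeta> i t) = cmod (frame i t)"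
  by (simp add: \<zeta>_def norm_mult)

lemma frame_sum_bounded:
  assumes "t \<ge> 0"
  obtains C where "\<And>F. finite F \<Longrightarrow> F \<subseteq> modes \<Longrightarrow> (\<Sum>i\<in>F. (cmod (frame i t))\<^sup>2) \<le> C"
proof -
  obtain C where C: "C \<ge> 0" "\<And>s t F. 0 \<le> s \<Longrightarrow> 0 \<le> t \<Longrightarrow> finite F \<Longrightarrow> F \<subseteq> modes \<Longrightarrow>
     (\<Sum>i\<in>F. (cmod (frame i s - frame i t))\<^sup>2) \<le> C * (1 + max s t) * \<bar>energy_f s - energy_f t\<bar>"
    using frame_diff_sum by blast
  define W where "W = C * (1 + max t 0) * \<bar>energy_f t - energy_f 0\<bar>"
  have "(\<Sum>i\<in>F. (cmod (frame i t))\<^sup>2) \<le> 2 * W + 2 * ((norm y0)\<^sup>2 + (norm x0)\<^sup>2)"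
    if F: "finite F" "F \<subseteq> modes" for F
  proof -
    have "(cmod (frame i 0))\<^sup>2 = (y0 \<bullet> mode i)\<^sup>2 + (x0 \<bullet> i)\<^sup>2" for i
      by (simp add: frame_def cmod_def fcos_def fsin_def)
    then have "(\<Sum>i\<in>F. (cmod (frame i 0))\<^sup>2) \<le> (norm y0)\<^sup>2 + (norm x0)\<^sup>2"
      using V.bessel[OF F, of y0] H.bessel[OF F, of x0] by (simp add: sum.distrib)
    moreover have "(\<Sum>i\<in>F. (cmod (frame i t))\<^sup>2)
        \<le> 2 * (\<Sum>i\<in>F. (cmod (frame i t - frame i 0))\<^sup>2) + 2 * (\<Sum>i\<in>F. (cmod (frame i 0))\<^sup>2)"
      unfolding sum_distrib_left sum.distrib[symmetric]
      using cmod_add_sq[of "frame i t - frame i 0" "frame i 0" for i] by (intro sum_mono) simp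
    moreover have "(\<Sum>i\<in>F. (cmod (frame i t - frame i 0))\<^sup>2) \<le> W"
      unfolding W_def by (rule C(2)) (use assms F in auto)
    moreover have "2 * D + 2 * E \<le> 2 * W + 2 * n" if "D \<le> W" "E \<le> n" for D E n :: real using that by simp
    ultimately show ?thesis by (meson order_trans)
  qed
  then show ?thesis using that by blast
qed

text \<open>The frequencies may be unbounded, so the rotations alone are not equicontinuous. The
  change of the frames is controlled by the integral of f^2. The rotation acting on the frame at
  time \<open>t\<close> is small for the finitely many modes in \<open>F0\<close>, and the other
  modes carry little of that frame.\<close>

lemma \<zeta>_equicontinuous:
  assumes t: "t \<ge> 0" and e: "e > 0"
  shows "\<forall>\<^sub>F s in at t within {0..}. \<forall>F. finite F \<longrightarrow> F \<subseteq> modes \<longrightarrow> (\<Sum>i\<in>F. (cmod (\<zeta> i s - \<zeta> i t))\<^sup>2) \<le> e"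
proof -
  obtain C where C: "C \<ge> 0" "\<And>s t F. 0 \<le> s \<Longrightarrow> 0 \<le> t \<Longrightarrow> finite F \<Longrightarrow> F \<subseteq> modes \<Longrightarrow>
     (\<Sum>i\<in>F. (cmod (frame i s - frame i t))\<^sup>2) \<le> C * (1 + max s t) * \<bar>energy_f s - energy_f t\<bar>"
    using frame_diff_sum by blast
  obtain C' where C': "\<And>F. finite F \<Longrightarrow> F \<subseteq> modes \<Longrightarrow> (\<Sum>i\<in>F. (cmod (frame i t))\<^sup>2) \<le> C'"
    using frame_sum_bounded[OF t] by blast
  \<comment> \<open>The budget: e/4 for the change of the frames, e/8 for the rotation on
    \<open>F0\<close>, 4 * e/32 for the tail, all doubled in \<open>main\<close>.\<close>
  obtain F0 where F0: "finite F0" "F0 \<subseteq> modes"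
    and tail: "\<And>G. finite G \<Longrightarrow> G \<subseteq> modes - F0 \<Longrightarrow> (\<Sum>i\<in>G. (cmod (frame i t))\<^sup>2) < e / 32"
    using bounded_sums_tail[OF C', where \<epsilon> = "e/32"] e by auto
  let ?rot = "\<lambda>i s. (cmod (cis (freq i * s) - cis (freq i * t)))\<^sup>2 * (cmod (frame i t))\<^sup>2"
  have "(energy_f \<longlongrightarrow> energy_f t) (at t within {0..})"
    using continuous_energy_f t by (auto simp: continuous_on_def)
  then have "((\<lambda>s. C * (1 + max s t) * \<bar>energy_f s - energy_f t\<bar>) \<longlongrightarrow> C * (1 + max t t) * \<bar>energy_f t - energy_f t\<bar>) (at t within {0..})"
    by (intro tendsto_intros)
  then have "((\<lambda>s. C * (1 + max s t) * \<bar>energy_f s - energy_f t\<bar>) \<longlongrightarrow> 0) (at t within {0..})" by simp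
  from order_tendstoD(2)[OF this, of "e/4"]
  have ev1: "\<forall>\<^sub>F s in at t within {0..}. C * (1 + max s t) * \<bar>energy_f s - energy_f t\<bar> < e / 4" using e by simp
  have "((\<lambda>s. cis (freq i * s)) \<longlongrightarrow> cis (freq i * t)) (at t within {0..})" for i
    unfolding cis_conv_exp by (intro tendsto_intros)
  then have "((\<lambda>s. \<Sum>i\<in>F0. ?rot i s) \<longlongrightarrow> (\<Sum>i\<in>F0. ?rot i t)) (at t within {0..})"
    by (intro tendsto_sum tendsto_mult tendsto_power tendsto_norm tendsto_diff tendsto_const)
  then have "((\<lambda>s. \<Sum>i\<in>F0. ?rot i s) \<longlongrightarrow> 0) (at t within {0..})" by simp
  from order_tendstoD(2)[OF this, of "e/8"]
  have ev2: "\<forall>\<^sub>F s in at t within {0..}. (\<Sum>i\<in>F0. ?rot i s) < e / 8" using e by simp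
  have ev3: "\<forall>\<^sub>F s in at t within {0..}. s \<in> {0..}" by (simp add: eventually_at_filter)
  show ?thesis
    using ev1 ev2 ev3
  proof eventually_elim
    case (elim s)
    have s0: "0 \<le> s" using elim(3) by simp
    show ?case
    proof (intro allI impI)
      fix F assume F: "finite F" "F \<subseteq> modes"
      have "(cmod (\<zeta> i s - \<zeta> i t))\<^sup>2 \<le> 2 * (cmod (frame i s - frame i t))\<^sup>2 + 2 * ?rot i s" for i
      proof -
        have "\<zeta> i s - \<zeta> i t = cis (freq i * s) * (frame i s - frame i t) + (cis (freq i * s) - cis (freq i * t)) * frame i t"
          by (simp add: \<zeta>_def algebra_simps)
        then show ?thesis
          using cmod_add_sq[of "cis (freq i * s) * (frame i s - frame i t)" "(cis (freq i * s) - cis (freq i * t)) * frame i t"]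
          by (simp add: norm_mult power_mult_distrib)
      qed
      then have "(\<Sum>i\<in>F. (cmod (\<zeta> i s - \<zeta> i t))\<^sup>2) \<le> (\<Sum>i\<in>F. 2 * (cmod (frame i s - frame i t))\<^sup>2 + 2 * ?rot i s)"
        by (intro sum_mono) simp
      also have "\<dots> = 2 * (\<Sum>i\<in>F. (cmod (frame i s - frame i t))\<^sup>2) + 2 * (\<Sum>i\<in>F. ?rot i s)"
        by (simp add: sum.distrib sum_distrib_left)
      finally have main: "(\<Sum>i\<in>F. (cmod (\<zeta> i s - \<zeta> i t))\<^sup>2) \<le> 2 * (\<Sum>i\<in>F. (cmod (frame i s - frame i t))\<^sup>2) + 2 * (\<Sum>i\<in>F. ?rot i s)" .
      have "(\<Sum>i\<in>F. (cmod (frame i s - frame i t))\<^sup>2) \<le> e / 4"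
        using C(2)[OF _ t F, of s] elim(1) s0 by (meson less_imp_le order_trans)
      moreover have "(\<Sum>i\<in>F. ?rot i s) = (\<Sum>i\<in>F \<inter> F0. ?rot i s) + (\<Sum>i\<in>F - F0. ?rot i s)"
        by (rule sum.Int_Diff[OF F(1)])
      moreover have "(\<Sum>i\<in>F \<inter> F0. ?rot i s) \<le> (\<Sum>i\<in>F0. ?rot i s)"
        by (rule sum_mono2) (use F0 in auto)
      moreover have "(\<Sum>i\<in>F - F0. ?rot i s) \<le> (\<Sum>i\<in>F - F0. 4 * (cmod (frame i t))\<^sup>2)"
      proof (rule sum_mono, rule mult_right_mono)
        fix i
        have "cmod (cis (freq i * s) - cis (freq i * t)) \<le> 2"
          using norm_triangle_ineq4[of "cis (freq i * s)" "cis (freq i * t)"] by simp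
        from power_mono[OF this, of 2] show "(cmod (cis (freq i * s) - cis (freq i * t)))\<^sup>2 \<le> 4" by simp
      qed simp
      moreover have "(\<Sum>i\<in>F - F0. 4 * (cmod (frame i t))\<^sup>2) < e / 8"
        using tail[OF finite_Diff[OF F(1)] Diff_mono[OF F(2) subset_refl]] by (simp add: sum_distrib_left[symmetric])
      ultimately show "(\<Sum>i\<in>F. (cmod (\<zeta> i s - \<zeta> i t))\<^sup>2) \<le> e" using main elim(2) by linarith
    qed
  qed
qed

text \<open>\<open>Y t\<close> represents u_t(t) as a functional of second derivatives, and
  \<open>X t\<close> is u(t) / sqrt a. Riesz-Fischer provides both for \<open>t \<ge> 0\<close>,
  where the coefficients are square summable.\<close>

definition Y :: "real \<Rightarrow> 'a" where "Y t = (SOME y. y \<in> N \<and> (\<forall>i\<in>modes. y \<bullet> mode i = Re (\<zeta> i t)))"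
definition X :: "real \<Rightarrow> 'a" where "X t = (SOME x. \<forall>i\<in>modes. x \<bullet> i = Im (\<zeta> i t))"

lemma YX:
  assumes t: "t \<ge> 0"
  shows Y_in: "Y t \<in> N" and Y_coeff: "\<And>i. i \<in> modes \<Longrightarrow> Y t \<bullet> mode i = Re (\<zeta> i t)"
    and X_coeff: "\<And>i. i \<in> modes \<Longrightarrow> X t \<bullet> i = Im (\<zeta> i t)"
proof -
  obtain C where C: "\<And>F. finite F \<Longrightarrow> F \<subseteq> modes \<Longrightarrow> (\<Sum>i\<in>F. (cmod (frame i t))\<^sup>2) \<le> C"
    using frame_sum_bounded[OF t] by blast
  have re: "(\<Sum>i\<in>F. (Re (\<zeta> i t))\<^sup>2) \<le> C" and im: "(\<Sum>i\<in>F. (Im (\<zeta> i t))\<^sup>2) \<le> C" if F: "finite F" "F \<subseteq> modes" for F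
  proof -
    have "(\<Sum>i\<in>F. (Re (\<zeta> i t))\<^sup>2) \<le> (\<Sum>i\<in>F. (cmod (frame i t))\<^sup>2)" "(\<Sum>i\<in>F. (Im (\<zeta> i t))\<^sup>2) \<le> (\<Sum>i\<in>F. (cmod (frame i t))\<^sup>2)"
      by (auto intro!: sum_mono simp: cmod_\<zeta>[symmetric] cmod_power2)
    then show "(\<Sum>i\<in>F. (Re (\<zeta> i t))\<^sup>2) \<le> C" "(\<Sum>i\<in>F. (Im (\<zeta> i t))\<^sup>2) \<le> C" using C[OF F] by auto
  qed
  have "\<exists>y. y \<in> N \<and> (\<forall>i\<in>modes. y \<bullet> mode i = Re (\<zeta> i t))"
    using V.riesz_fischer[of "\<lambda>i. Re (\<zeta> i t)", OF re] by blast
  from someI_ex[OF this] show "Y t \<in> N" "\<And>i. i \<in> modes \<Longrightarrow> Y t \<bullet> mode i = Re (\<zeta> i t)"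
    unfolding Y_def by auto
  have "\<exists>x. \<forall>i\<in>modes. x \<bullet> i = Im (\<zeta> i t)"
    using H.riesz_fischer[of "\<lambda>i. Im (\<zeta> i t)", OF im] by blast
  from someI_ex[OF this] show "\<And>i. i \<in> modes \<Longrightarrow> X t \<bullet> i = Im (\<zeta> i t)"
    unfolding X_def by auto
qed

lemma YX_continuous:
  assumes t: "t \<ge> 0"
  shows Y_tendsto: "(Y \<longlongrightarrow> Y t) (at t within {0..})" and X_tendsto: "(X \<longlongrightarrow> X t) (at t within {0..})"
proof -
  have *: "\<forall>\<^sub>F s in at t within {0..}. dist (Y s) (Y t) < e \<and> dist (X s) (X t) < e" if e: "e > 0" for e
  proof -
    have ev3: "\<forall>\<^sub>F s in at t within {0..}. s \<in> {0..}" by (simp add: eventually_at_filter)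
    have "(e/2)\<^sup>2 > 0" using e by simp
    from \<zeta>_equicontinuous[OF t this] ev3 show ?thesis
    proof eventually_elim
      case (elim s)
      then have s: "s \<ge> 0" by simp
      have b: "(\<Sum>i\<in>F. (Re (\<zeta> i s - \<zeta> i t))\<^sup>2) \<le> (e/2)\<^sup>2" "(\<Sum>i\<in>F. (Im (\<zeta> i s - \<zeta> i t))\<^sup>2) \<le> (e/2)\<^sup>2"
        if F: "finite F" "F \<subseteq> modes" for F
      proof -
        have "(\<Sum>i\<in>F. (Re (\<zeta> i s - \<zeta> i t))\<^sup>2) \<le> (\<Sum>i\<in>F. (cmod (\<zeta> i s - \<zeta> i t))\<^sup>2)"
             "(\<Sum>i\<in>F. (Im (\<zeta> i s - \<zeta> i t))\<^sup>2) \<le> (\<Sum>i\<in>F. (cmod (\<zeta> i s - \<zeta> i t))\<^sup>2)"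
          by (intro sum_mono; simp only: cmod_power2; simp)+
        moreover have "(\<Sum>i\<in>F. (cmod (\<zeta> i s - \<zeta> i t))\<^sup>2) \<le> (e/2)\<^sup>2" using elim(1) F by blast
        ultimately show "(\<Sum>i\<in>F. (Re (\<zeta> i s - \<zeta> i t))\<^sup>2) \<le> (e/2)\<^sup>2" "(\<Sum>i\<in>F. (Im (\<zeta> i s - \<zeta> i t))\<^sup>2) \<le> (e/2)\<^sup>2"
          by linarith+
      qed
      have "norm (Y s - Y t) \<le> e/2"
      proof (rule V.norm_le_if_sums_le)
        show "Y s - Y t \<in> N" using Y_in[OF s] Y_in[OF t] subspace_N by (simp add: subspace_diff)
        fix F assume F: "finite F" "F \<subseteq> modes"
        have "(\<Sum>i\<in>F. ((Y s - Y t) \<bullet> mode i)\<^sup>2) = (\<Sum>i\<in>F. (Re (\<zeta> i s - \<zeta> i t))\<^sup>2)"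
          by (rule sum.cong) (use F Y_coeff[OF s] Y_coeff[OF t] in \<open>auto simp: inner_diff_left\<close>)
        then show "(\<Sum>i\<in>F. ((Y s - Y t) \<bullet> mode i)\<^sup>2) \<le> (e/2)\<^sup>2" using b(1)[OF F] by simp
      qed (use e in simp)
      moreover have "norm (X s - X t) \<le> e/2"
      proof (rule H.norm_le_if_sums_le)
        fix F assume F: "finite F" "F \<subseteq> modes"
        have "(\<Sum>i\<in>F. ((X s - X t) \<bullet> i)\<^sup>2) = (\<Sum>i\<in>F. (Im (\<zeta> i s - \<zeta> i t))\<^sup>2)"
          by (rule sum.cong) (use F X_coeff[OF s] X_coeff[OF t] in \<open>auto simp: inner_diff_left\<close>)
        then show "(\<Sum>i\<in>F. ((X s - X t) \<bullet> i)\<^sup>2) \<le> (e/2)\<^sup>2" using b(2)[OF F] by simp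
      qed (use e in auto)
      ultimately show ?case using e by (simp add: dist_norm)
    qed
  qed
  show "(Y \<longlongrightarrow> Y t) (at t within {0..})"
    by (rule tendstoI) (rule eventually_mono[OF *], auto)
  show "(X \<longlongrightarrow> X t) (at t within {0..})"
    by (rule tendstoI) (rule eventually_mono[OF *], auto)
qed

text \<open>The two integrals combine to the integral of f(r) sin(freq (p - r)). The kernel vanishes
  at r = p, so the increment is of higher order than b - a although f is only square
  integrable.\<close>

lemma forcing_increment:
  assumes "0 \<le> a" "a \<le> b" "p \<in> {a..b}" "i \<in> modes"
  shows "\<bar>sin (freq i * p) * fcos i a b - cos (freq i * p) * fsin i a b\<bar>
           \<le> freq i * (b - a) * integral {a..b} (\<lambda>r. \<bar>f r\<bar>)"
proof -
  have w: "freq i > 0" using freq(1)[OF assms(4)] .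
  have I: "sin (freq i * p) * fcos i a b - cos (freq i * p) * fsin i a b
     = integral {a..b} (\<lambda>r. sin (freq i * p) * (f r * cos (freq i * r)) - cos (freq i * p) * (f r * sin (freq i * r)))"
    unfolding fcos_def fsin_def
    by (rule integral_unique[symmetric])
      (intro has_integral_diff has_integral_mult_right integrable_integral int_cos int_sin assms(1))
  have "\<bar>integral {a..b} (\<lambda>r. sin (freq i * p) * (f r * cos (freq i * r)) - cos (freq i * p) * (f r * sin (freq i * r)))\<bar>
      \<le> integral {a..b} (\<lambda>r. freq i * (b - a) * \<bar>f r\<bar>)"
  proof (rule Henstock_Kurzweil_Integration.integral_norm_bound_integral[where 'a = real, unfolded real_norm_def])
    show "(\<lambda>r. sin (freq i * p) * (f r * cos (freq i * r)) - cos (freq i * p) * (f r * sin (freq i * r))) integrable_on {a..b}"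
      using assms(1) by (intro integrable_diff integrable_on_mult_right int_cos int_sin)
    show "(\<lambda>r. freq i * (b - a) * \<bar>f r\<bar>) integrable_on {a..b}"
      using assms(1) by (intro integrable_on_mult_right f_abs_integrable)
    fix r assume r: "r \<in> {a..b}"
    have "sin (freq i * p) * (f r * cos (freq i * r)) - cos (freq i * p) * (f r * sin (freq i * r))
      = f r * sin (freq i * p - freq i * r)" by (simp add: sin_diff algebra_simps)
    moreover have "\<bar>sin (freq i * p - freq i * r)\<bar> \<le> \<bar>freq i * p - freq i * r\<bar>" by (rule abs_sin_x_le_abs_x)
    moreover have "\<bar>freq i * p - freq i * r\<bar> = freq i * \<bar>p - r\<bar>"
      using w by (simp add: right_diff_distrib[symmetric] abs_mult)
    moreover have "freq i * \<bar>p - r\<bar> \<le> freq i * (b - a)" using w r assms(3) by (intro mult_left_mono) auto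
    ultimately have "\<bar>sin (freq i * p - freq i * r)\<bar> \<le> freq i * (b - a)"
      and e: "sin (freq i * p) * (f r * cos (freq i * r)) - cos (freq i * p) * (f r * sin (freq i * r))
        = f r * sin (freq i * p - freq i * r)" by linarith+
    from mult_right_mono[OF this(1), of "\<bar>f r\<bar>"]
    show "\<bar>sin (freq i * p) * (f r * cos (freq i * r)) - cos (freq i * p) * (f r * sin (freq i * r))\<bar> \<le> freq i * (b - a) * \<bar>f r\<bar>"
      unfolding e by (simp add: abs_mult mult.commute)
  qed
  then show ?thesis unfolding I by simp
qed

text \<open>Freezing the frame at time \<open>t\<close> gives the asserted derivative. The remainder
  \<open>h\<close> is at most a constant times |s - t| |\<open>\<Psi>\<close> s -
  \<open>\<Psi>\<close> t|, and \<open>\<Psi>\<close>, a primitive of |f|, is continuous. This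
  yields differentiability at every time, not just almost everywhere.\<close>

lemma Im_\<zeta>_has_derivative:
  assumes t: "t \<ge> 0" and i: "i \<in> modes"
  shows "((\<lambda>s. Im (\<zeta> i s)) has_real_derivative freq i * Re (\<zeta> i t)) (at t within {0..})"
proof -
  define P where "P s = y0 \<bullet> mode i - trace_coeff i * fcos i 0 s" for s
  define Qc where "Qc s = x0 \<bullet> i + trace_coeff i * fsin i 0 s" for s
  have z: "Im (\<zeta> i s) = sin (freq i * s) * P s + cos (freq i * s) * Qc s"
    "Re (\<zeta> i s) = cos (freq i * s) * P s - sin (freq i * s) * Qc s" for s
    by (simp_all add: \<zeta>_def frame_def P_def Qc_def)
  define h where "h s = sin (freq i * s) * (P s - P t) + cos (freq i * s) * (Qc s - Qc t)" for s
  define \<Psi> where "\<Psi> s = integral {0..s} (\<lambda>r. \<bar>f r\<bar>)" for s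
  have \<Psi>c: "continuous_on {0..} \<Psi>" unfolding \<Psi>_def
    by (intro continuous_on_half_line indefinite_integral_continuous_1 f_abs_integrable) simp
  have \<Psi>d: "integral {a..b} (\<lambda>r. \<bar>f r\<bar>) = \<Psi> b - \<Psi> a" if "0 \<le> a" "a \<le> b" for a b
    unfolding \<Psi>_def using Henstock_Kurzweil_Integration.integral_combine[OF that f_abs_integrable] by simp
  have hb: "\<bar>h s\<bar> \<le> \<bar>trace_coeff i\<bar> * freq i * \<bar>s - t\<bar> * \<bar>\<Psi> s - \<Psi> t\<bar>" if s: "s \<ge> 0" for s
  proof (cases "t \<le> s")
    case True
    have "h s = - (trace_coeff i * (sin (freq i * s) * fcos i t s - cos (freq i * s) * fsin i t s))"
      unfolding h_def P_def Qc_def fcos_combine[OF t True] fsin_combine[OF t True] by (simp add: algebra_simps)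
    then have "\<bar>h s\<bar> = \<bar>trace_coeff i\<bar> * \<bar>sin (freq i * s) * fcos i t s - cos (freq i * s) * fsin i t s\<bar>"
      by (simp add: abs_mult)
    also have "\<dots> \<le> \<bar>trace_coeff i\<bar> * (freq i * (s - t) * integral {t..s} (\<lambda>r. \<bar>f r\<bar>))"
      using True t i by (intro mult_left_mono forcing_increment) auto
    also have "\<dots> \<le> \<bar>trace_coeff i\<bar> * (freq i * (s - t) * \<bar>\<Psi> s - \<Psi> t\<bar>)"
      unfolding \<Psi>d[OF t True] using True freq(1)[OF i] by (intro mult_left_mono) auto
    finally show ?thesis using True by (simp add: mult.assoc)
  next
    case False
    then have st: "s \<le> t" by simp
    have "h s = trace_coeff i * (sin (freq i * s) * fcos i s t - cos (freq i * s) * fsin i s t)"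
      unfolding h_def P_def Qc_def fcos_combine[OF s st] fsin_combine[OF s st] by (simp add: algebra_simps)
    then have "\<bar>h s\<bar> = \<bar>trace_coeff i\<bar> * \<bar>sin (freq i * s) * fcos i s t - cos (freq i * s) * fsin i s t\<bar>"
      by (simp add: abs_mult)
    also have "\<dots> \<le> \<bar>trace_coeff i\<bar> * (freq i * (t - s) * integral {s..t} (\<lambda>r. \<bar>f r\<bar>))"
      using st s i by (intro mult_left_mono forcing_increment) auto
    also have "\<dots> \<le> \<bar>trace_coeff i\<bar> * (freq i * (t - s) * \<bar>\<Psi> s - \<Psi> t\<bar>)"
      unfolding \<Psi>d[OF s st] using st freq(1)[OF i] by (intro mult_left_mono) auto
    finally show ?thesis using st by (simp add: mult.assoc)
  qed
  have "(h has_real_derivative 0) (at t within {0..})"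
    unfolding has_field_derivative_iff
  proof (rule Lim_null_comparison)
    have "((\<lambda>s. \<bar>trace_coeff i\<bar> * freq i * \<bar>\<Psi> s - \<Psi> t\<bar>) \<longlongrightarrow> \<bar>trace_coeff i\<bar> * freq i * \<bar>\<Psi> t - \<Psi> t\<bar>) (at t within {0..})"
      using \<Psi>c t by (intro tendsto_intros) (auto simp: continuous_on_def)
    then show "((\<lambda>s. \<bar>trace_coeff i\<bar> * freq i * \<bar>\<Psi> s - \<Psi> t\<bar>) \<longlongrightarrow> 0) (at t within {0..})" by simp
    show "\<forall>\<^sub>F s in at t within {0..}. norm ((h s - h t) / (s - t)) \<le> \<bar>trace_coeff i\<bar> * freq i * \<bar>\<Psi> s - \<Psi> t\<bar>"
      unfolding eventually_at_filter
    proof (rule always_eventually, intro allI impI)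
      fix s assume s: "s \<noteq> t" "s \<in> {0..}"
      have "h t = 0" by (simp add: h_def)
      then have "norm ((h s - h t) / (s - t)) = \<bar>h s\<bar> / \<bar>s - t\<bar>" by simp
      also have "\<dots> \<le> \<bar>trace_coeff i\<bar> * freq i * \<bar>\<Psi> s - \<Psi> t\<bar>"
        using hb[of s] s by (simp add: divide_le_eq mult_ac)
      finally show "norm ((h s - h t) / (s - t)) \<le> \<bar>trace_coeff i\<bar> * freq i * \<bar>\<Psi> s - \<Psi> t\<bar>" .
    qed
  qed
  moreover have "((\<lambda>s. sin (freq i * s) * P t + cos (freq i * s) * Qc t) has_real_derivative freq i * Re (\<zeta> i t)) (at t within {0..})"
    unfolding z by (auto intro!: derivative_eq_intros simp: algebra_simps)
  ultimately have "((\<lambda>s. h s + (sin (freq i * s) * P t + cos (freq i * s) * Qc t)) has_real_derivative 0 + freq i * Re (\<zeta> i t)) (at t within {0..})"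
    by (rule DERIV_add)
  moreover have "(\<lambda>s. h s + (sin (freq i * s) * P t + cos (freq i * s) * Qc t)) = (\<lambda>s. Im (\<zeta> i s))"
    unfolding z h_def by (auto simp: algebra_simps)
  ultimately show ?thesis by simp
qed

text \<open>u is to be differentiated in the dual space, so the difference quotient is tested with
  \<open>c\<close>, uniformly relative to \<open>norm c\<close>. For finite combinations of modes
  the bound is the mean value inequality together with continuity of \<open>Y\<close>; their density
  extends it to \<open>N\<close>. Multiplying by s - t makes it meaningful at \<open>s = t\<close>
  too.\<close>

lemma X_weak_derivative:
  assumes t: "t \<ge> 0" and e: "e > 0"
  shows "\<exists>d>0. \<forall>s\<ge>0. \<bar>s - t\<bar> < d \<longrightarrow>
           (\<forall>c\<in>N. \<bar>(X s - X t) \<bullet> T c - (s - t) * (Y t \<bullet> c)\<bar> \<le> e * norm c * \<bar>s - t\<bar>)"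
proof -
  from Y_tendsto[OF t] have "\<forall>\<^sub>F s in at t within {0..}. dist (Y s) (Y t) < e"
    using e tendstoD by blast
  then obtain d where d: "d > 0" "\<And>s. s \<ge> 0 \<Longrightarrow> s \<noteq> t \<Longrightarrow> dist s t < d \<Longrightarrow> dist (Y s) (Y t) < e"
    unfolding eventually_at by auto
  have Yd: "norm (Y s - Y t) \<le> e" if "s \<ge> 0" "\<bar>s - t\<bar> < d" for s
    using d(2)[of s] that e by (cases "s = t") (auto simp: dist_norm)
  have fin: "\<bar>(X s - X t) \<bullet> T c - (s - t) * (Y t \<bullet> c)\<bar> \<le> e * norm c * \<bar>s - t\<bar>"
    if s: "s \<ge> 0" "\<bar>s - t\<bar> < d" and F: "finite F" "F \<subseteq> modes" and c: "c = (\<Sum>i\<in>F. k i *\<^sub>R mode i)" for s F c k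
  proof -
    define \<phi> where "\<phi> r = X r \<bullet> T c - r * (Y t \<bullet> c)" for r
    define S where "S = {r. r \<ge> 0 \<and> \<bar>r - t\<bar> < d}"
    have cS: "convex S"
    proof -
      have "S = {0..} \<inter> ball t d" by (auto simp: S_def dist_real_def)
      then show ?thesis by (simp add: convex_Int convex_ball)
    qed
    have T_c: "T c = (\<Sum>i\<in>F. (k i / freq i) *\<^sub>R i)"
      unfolding c T.sum by (rule sum.cong) (use F T_mode in \<open>auto simp: T.scale\<close>)
    have der: "(\<phi> has_real_derivative (Y r - Y t) \<bullet> c) (at r within S)" if r: "r \<in> S" for r
    proof -
      have r0: "r \<ge> 0" using r S_def by simp
      have "((\<lambda>s. \<Sum>i\<in>F. (k i / freq i) * Im (\<zeta> i s)) has_real_derivative (\<Sum>i\<in>F. (k i / freq i) * (freq i * Re (\<zeta> i r)))) (at r within {0..})"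
        by (intro DERIV_sum DERIV_cmult Im_\<zeta>_has_derivative[OF r0]) (use F in auto)
      moreover have "(\<Sum>i\<in>F. (k i / freq i) * (freq i * Re (\<zeta> i r))) = Y r \<bullet> c"
        unfolding c inner_sum_right by (rule sum.cong) (use F Y_coeff[OF r0] freq(1) in \<open>auto simp: subset_iff less_imp_neq[symmetric]\<close>)
      ultimately have "((\<lambda>s. \<Sum>i\<in>F. (k i / freq i) * Im (\<zeta> i s)) has_real_derivative Y r \<bullet> c) (at r within S)"
        using has_field_derivative_subset[of _ _ r "{0..}" S] by (auto simp: S_def)
      then have "((\<lambda>s. X s \<bullet> T c) has_real_derivative Y r \<bullet> c) (at r within S)"
      proof (rule has_field_derivative_transform_within[OF _ zero_less_one r])
        fix s assume "s \<in> S"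
        then have s0: "s \<ge> 0" by (simp add: S_def)
        show "(\<Sum>i\<in>F. (k i / freq i) * Im (\<zeta> i s)) = X s \<bullet> T c"
          unfolding T_c inner_sum_right by (rule sum.cong) (use F X_coeff[OF s0] in auto)
      qed
      then show ?thesis unfolding \<phi>_def
        by (auto intro!: derivative_eq_intros simp: inner_diff_left)
    qed
    have "norm (\<phi> s - \<phi> t) \<le> (e * norm c) * norm (s - t)"
    proof (rule field_differentiable_bound[OF cS der])
      fix r assume "r \<in> S"
      then have "norm (Y r - Y t) \<le> e" using Yd S_def by simp
      then have "norm (Y r - Y t) * norm c \<le> e * norm c" by (rule mult_right_mono) simp
      then show "norm ((Y r - Y t) \<bullet> c) \<le> e * norm c"
        using Cauchy_Schwarz_ineq2[of "Y r - Y t" c] by simp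
    qed (use s t d in \<open>auto simp: S_def\<close>)
    moreover have "\<phi> s - \<phi> t = (X s - X t) \<bullet> T c - (s - t) * (Y t \<bullet> c)"
      by (simp add: \<phi>_def inner_diff_left algebra_simps)
    ultimately show ?thesis by simp
  qed
  show ?thesis
  proof (intro exI[of _ d] conjI d(1) allI impI ballI)
    fix s c assume s: "0 \<le> s" "\<bar>s - t\<bar> < d" and c: "c \<in> N"
    have "\<exists>F. finite F \<and> F \<subseteq> modes \<and> norm (c - (\<Sum>j\<in>F. (c \<bullet> mode j) *\<^sub>R mode j)) < 1 / (real n + 1)" for n
      using V.approx[OF c, of "1 / (real n + 1)"] by (metis divide_pos_pos of_nat_0_le_iff add_nonneg_pos zero_less_one)
    then obtain F where F: "\<And>n. finite (F n)" "\<And>n. F n \<subseteq> modes"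
      and Fc: "\<And>n. norm (c - (\<Sum>j\<in>F n. (c \<bullet> mode j) *\<^sub>R mode j)) < 1 / (real n + 1)" by metis
    define cn where "cn n = (\<Sum>j\<in>F n. (c \<bullet> mode j) *\<^sub>R mode j)" for n
    have "(\<lambda>n. c - cn n) \<longlonglongrightarrow> 0"
    proof (rule Lim_null_comparison)
      show "\<forall>\<^sub>F n in sequentially. norm (c - cn n) \<le> inverse (real (Suc n))"
        using Fc by (auto simp: cn_def inverse_eq_divide add.commute less_imp_le)
      show "(\<lambda>n. inverse (real (Suc n))) \<longlonglongrightarrow> 0" by (rule LIMSEQ_inverse_real_of_nat)
    qed
    from tendsto_diff[OF tendsto_const[of c] this] have lim: "cn \<longlonglongrightarrow> c" by simp
    show "\<bar>(X s - X t) \<bullet> T c - (s - t) * (Y t \<bullet> c)\<bar> \<le> e * norm c * \<bar>s - t\<bar>"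
    proof (rule LIMSEQ_le)
      show "(\<lambda>n. \<bar>(X s - X t) \<bullet> T (cn n) - (s - t) * (Y t \<bullet> cn n)\<bar>) \<longlonglongrightarrow> \<bar>(X s - X t) \<bullet> T c - (s - t) * (Y t \<bullet> c)\<bar>"
        by (intro tendsto_intros T.tendsto lim)
      show "(\<lambda>n. e * norm (cn n) * \<bar>s - t\<bar>) \<longlonglongrightarrow> e * norm c * \<bar>s - t\<bar>"
        by (intro tendsto_intros lim)
      show "\<exists>M. \<forall>n\<ge>M. \<bar>(X s - X t) \<bullet> T (cn n) - (s - t) * (Y t \<bullet> cn n)\<bar> \<le> e * norm (cn n) * \<bar>s - t\<bar>"
        using fin[OF s F cn_def] by blast
    qed
  qed
qed

section \<open>Mild solutions and the transposition identity\<close>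

text \<open>(p, T q) is the primitive of the state (v, z) that vanishes at \<open>t0\<close>; it
  lies in the domain of the generator, which maps it to (q, - y).\<close>

definition mild :: "real \<Rightarrow> 'a \<Rightarrow> 'a \<Rightarrow> (real \<Rightarrow> 'a) \<Rightarrow> (real \<Rightarrow> 'a) \<Rightarrow> bool" where
  "mild t0 vT zT v z \<longleftrightarrow> (\<exists>p q y. p t0 = 0 \<and> q t0 = 0 \<and>
     (\<forall>t\<ge>0. p t = R (y t) \<and> q t \<in> N \<and> v t = vT + q t \<and> z t = zT - y t \<and>
        (p has_vector_derivative v t) (at t within {0..}) \<and>
        ((\<lambda>s. T (q s)) has_vector_derivative z t) (at t within {0..})))"

text \<open>A mild solution need not be differentiable, but its coefficients are:
  \<open>\<alpha>\<close> and \<open>\<beta>\<close> are read off from the primitives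
  \<open>T q\<close> and \<open>p\<close> and obey the rotation equations. Undoing the rotation
  gives two constants of motion, compared at the times 0 and \<open>t0\<close>.\<close>

lemma mild_coeff:
  assumes m: "mild t0 vT zT v z" and t0: "t0 \<ge> 0" and i: "i \<in> modes"
  shows "v 0 \<bullet> mode i = cos (freq i * t0) * (vT \<bullet> mode i) - sin (freq i * t0) * (zT \<bullet> i)"
    and "z 0 \<bullet> i = sin (freq i * t0) * (vT \<bullet> mode i) + cos (freq i * t0) * (zT \<bullet> i)"
proof -
  obtain p q y where pq0: "p t0 = 0" "q t0 = 0" and
    h: "\<And>t. t \<ge> 0 \<Longrightarrow> p t = R (y t) \<and> q t \<in> N \<and> v t = vT + q t \<and> z t = zT - y t \<and>
        (p has_vector_derivative v t) (at t within {0..}) \<and>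
        ((\<lambda>s. T (q s)) has_vector_derivative z t) (at t within {0..})"
    using m unfolding mild_def by blast
  have w: "freq i > 0" using freq(1)[OF i] .
  define \<alpha> where "\<alpha> t = vT \<bullet> mode i + freq i * (T (q t) \<bullet> i)" for t
  define \<beta> where "\<beta> t = zT \<bullet> i - freq i * (p t \<bullet> mode i)" for t
  have \<alpha>: "\<alpha> t = v t \<bullet> mode i" and \<beta>: "\<beta> t = z t \<bullet> i" if "t \<ge> 0" for t
  proof -
    show "\<alpha> t = v t \<bullet> mode i"
      using h[OF that] T_inner_mode[of "q t" i] i w by (simp add: \<alpha>_def inner_add_left)
    show "\<beta> t = z t \<bullet> i"
      using h[OF that] R_inner_mode[OF i, of "y t"] w by (simp add: \<beta>_def inner_diff_left)
  qed
  have d\<alpha>: "(\<alpha> has_real_derivative freq i * \<beta> t) (at t within {0..})" if t: "t \<ge> 0" for t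
    using has_real_derivative_inner[OF h[OF t, THEN conjunct2, THEN conjunct2, THEN conjunct2, THEN conjunct2, THEN conjunct2] has_vector_derivative_const[of i]]
    unfolding \<alpha>_def \<beta>[OF t] by (auto intro!: derivative_eq_intros)
  have d\<beta>: "(\<beta> has_real_derivative - (freq i * \<alpha> t)) (at t within {0..})" if t: "t \<ge> 0" for t
    using has_real_derivative_inner[OF h[OF t, THEN conjunct2, THEN conjunct2, THEN conjunct2, THEN conjunct2, THEN conjunct1] has_vector_derivative_const[of "mode i"]]
    unfolding \<beta>_def \<alpha>[OF t] by (auto intro!: derivative_eq_intros)
  have "\<exists>k. \<forall>t\<in>{0..}. \<alpha> t * cos (freq i * t) - \<beta> t * sin (freq i * t) = k"
    by (rule has_field_derivative_zero_constant)
      (auto intro!: derivative_eq_intros d\<alpha> d\<beta> simp: algebra_simps)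
  then have 1: "\<alpha> 0 = \<alpha> t0 * cos (freq i * t0) - \<beta> t0 * sin (freq i * t0)"
    using t0 by (metis atLeast_iff cos_zero diff_zero mult.right_neutral mult_zero_right order_refl sin_zero)
  have "\<exists>k. \<forall>t\<in>{0..}. \<alpha> t * sin (freq i * t) + \<beta> t * cos (freq i * t) = k"
    by (rule has_field_derivative_zero_constant)
      (auto intro!: derivative_eq_intros d\<alpha> d\<beta> simp: algebra_simps)
  then have 2: "\<beta> 0 = \<alpha> t0 * sin (freq i * t0) + \<beta> t0 * cos (freq i * t0)"
    using t0 by (metis atLeast_iff cos_zero add_0 mult.right_neutral mult_zero_right order_refl sin_zero)
  have e: "\<alpha> t0 = vT \<bullet> mode i" "\<beta> t0 = zT \<bullet> i" using pq0 by (simp_all add: \<alpha>_def \<beta>_def T.zero)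
  show "v 0 \<bullet> mode i = cos (freq i * t0) * (vT \<bullet> mode i) - sin (freq i * t0) * (zT \<bullet> i)"
    using 1 e \<alpha>[of 0] by (simp add: mult.commute)
  show "z 0 \<bullet> i = sin (freq i * t0) * (vT \<bullet> mode i) + cos (freq i * t0) * (zT \<bullet> i)"
    using 2 e \<beta>[of 0] by (simp add: mult.commute)
qed

text \<open>One finite \<open>F\<close> truncates \<open>vT\<close>, \<open>zT\<close>,
  \<open>v 0\<close> and \<open>z 0\<close> to within e. The truncation is an explicit mode sum, for
  which the identity is exact. Its trace \<open>h\<close> is close to \<open>g\<close> because both
  are close to \<open>rn n\<close> for a suitable n: the difference of \<open>vn n\<close> and the
  mode sum is a classical solution whose data at \<open>t0\<close> have components of size at most 2
  e, so hidden regularity applies.\<close>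

theorem transposition_formula:
  fixes rn :: "nat \<Rightarrow> fn"
  assumes t0: "t0 > 0" and vT: "vT \<in> N" and v0: "v 0 \<in> N" and m: "mild t0 vT zT v z"
    and g: "g \<in> L2_on {0..t0}"
    and cl: "\<And>n. classical (vn n) (wn n) (yn n)"
    and rn: "\<And>n. rn n \<in> L2_on {0..t0}" "\<And>n t. t \<in> {0..t0} \<Longrightarrow> rn n t = tr (yn n t)"
    and lim_v: "(\<lambda>n. vn n t0) \<longlonglongrightarrow> vT" and lim_w: "(\<lambda>n. T (wn n t0)) \<longlonglongrightarrow> zT"
    and lim_r: "(\<lambda>n. integral {0..t0} (\<lambda>t. (rn n t - g t)\<^sup>2)) \<longlonglongrightarrow> 0"
  shows "Y t0 \<bullet> vT - X t0 \<bullet> zT = y0 \<bullet> v 0 - x0 \<bullet> z 0 - integral {0..t0} (\<lambda>t. f t * g t)"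
proof -
  obtain C where C: "C \<ge> 0" and hr: "\<And>v w y t s. classical v w y \<Longrightarrow> t \<ge> 0 \<Longrightarrow> s \<ge> 0 \<Longrightarrow>
     integral {0..t} (\<lambda>r. (tr (y r))\<^sup>2) \<le> C * (1 + t) * ((norm (v s))\<^sup>2 + (norm (T (w s)))\<^sup>2)"
    using hidden_regularity by blast
  \<comment> \<open>K e will bound the integral of f (h - g). Passing from \<open>h\<close> to
    \<open>g\<close> through \<open>rn n\<close> doubles both squared distances: 2 * 8 C (1 + t0)
    e^2 from hidden regularity and 2 e^2 from the convergence of \<open>rn\<close>.\<close>
  define K where "K = sqrt (integral {0..t0} (\<lambda>r. (f r)\<^sup>2) * (16 * C * (1 + t0) + 2))"
  define \<Delta> where "\<Delta> = Y t0 \<bullet> vT - X t0 \<bullet> zT - (y0 \<bullet> v 0 - x0 \<bullet> z 0 - integral {0..t0} (\<lambda>t. f t * g t))"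
  have t00: "t0 \<ge> 0" using t0 by simp
  have bound: "\<bar>\<Delta>\<bar> \<le> (norm (Y t0) + norm (X t0) + norm y0 + norm x0 + K) * e" if e: "e > 0" for e
  proof -
    let ?S = "\<lambda>(F::'a set) x. \<Sum>j\<in>F. (x \<bullet> mode j) *\<^sub>R mode j" and ?U = "\<lambda>(F::'a set) x. \<Sum>j\<in>F. (x \<bullet> j) *\<^sub>R j"
    obtain F1 where F1: "finite F1" "F1 \<subseteq> modes" "norm (vT - ?S F1 vT) < e" using V.approx[OF vT e] by blast
    obtain F2 where F2: "finite F2" "F2 \<subseteq> modes" "norm (v 0 - ?S F2 (v 0)) < e" using V.approx[OF v0 e] by blast
    obtain F3 where F3: "finite F3" "F3 \<subseteq> modes" "norm (zT - ?U F3 zT) < e" using H.approx[of zT, OF UNIV_I e] by blast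
    obtain F4 where F4: "finite F4" "F4 \<subseteq> modes" "norm (z 0 - ?U F4 (z 0)) < e" using H.approx[of "z 0", OF UNIV_I e] by blast
    define F where "F = F1 \<union> F2 \<union> F3 \<union> F4"
    have F: "finite F" "F \<subseteq> modes" using F1 F2 F3 F4 by (auto simp: F_def)
    have sub: "F1 \<subseteq> F" "F2 \<subseteq> F" "F3 \<subseteq> F" "F4 \<subseteq> F" unfolding F_def by blast+
    have a1: "norm (vT - ?S F vT) < e" using V.norm_minus_sum_mono[OF F(1) sub(1) F(2), of vT] F1(3) by linarith
    have a2: "norm (v 0 - ?S F (v 0)) < e" using V.norm_minus_sum_mono[OF F(1) sub(2) F(2), of "v 0"] F2(3) by linarith
    have a3: "norm (zT - ?U F zT) < e" using H.norm_minus_sum_mono[OF F(1) sub(3) F(2), of zT] F3(3) by linarith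
    have a4: "norm (z 0 - ?U F (z 0)) < e" using H.norm_minus_sum_mono[OF F(1) sub(4) F(2), of "z 0"] F4(3) by linarith
    \<comment> \<open>Amplitudes of the mild solution itself at time 0; \<open>fT\<close> rotates
      them to the coefficients at \<open>t0\<close>, so one mode sum matches the truncations at both
      times.\<close>
    define A where "A i = v 0 \<bullet> mode i" for i
    define B where "B i = z 0 \<bullet> i" for i
    have AB: "A i = cos (freq i * t0) * (vT \<bullet> mode i) - sin (freq i * t0) * (zT \<bullet> i)"
      "B i = sin (freq i * t0) * (vT \<bullet> mode i) + cos (freq i * t0) * (zT \<bullet> i)" if "i \<in> F" for i
      using mild_coeff[OF m t00, of i] that F by (auto simp: A_def B_def)
    have fT: "A i * cos (freq i * t0) + B i * sin (freq i * t0) = vT \<bullet> mode i"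
      "B i * cos (freq i * t0) - A i * sin (freq i * t0) = zT \<bullet> i" if i: "i \<in> F" for i
    proof -
      have sc: "(sin (freq i * t0))\<^sup>2 = 1 - (cos (freq i * t0))\<^sup>2" by (simp add: sin_squared_eq)
      show "A i * cos (freq i * t0) + B i * sin (freq i * t0) = vT \<bullet> mode i"
        "B i * cos (freq i * t0) - A i * sin (freq i * t0) = zT \<bullet> i"
        unfolding AB[OF i] using sc by (algebra, algebra)
    qed
    note cm = classical_modes[OF F, where A = A and B = B]
    define h where "h r = (\<Sum>i\<in>F. trace_coeff i * (A i * cos (freq i * r) + B i * sin (freq i * r)))" for r
    have hc: "continuous_on U h" for U unfolding h_def by (intro continuous_intros)
    have hL: "h \<in> L2_on {0..t0}" by (rule L2_on_continuous[OF hc])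
    have id: "Y t0 \<bullet> ?S F vT - X t0 \<bullet> ?U F zT = y0 \<bullet> ?S F (v 0) - x0 \<bullet> ?U F (z 0) - integral {0..t0} (\<lambda>t. f t * h t)"
    proof -
      have I: "integral {0..t0} (\<lambda>r. f r * h r) = (\<Sum>i\<in>F. trace_coeff i * (A i * fcos i 0 t0 + B i * fsin i 0 t0))"
        unfolding h_def by (rule forced_modes_integral[OF F(1) order_refl])
      have "Y t0 \<bullet> ?S F vT - X t0 \<bullet> ?U F zT = (\<Sum>i\<in>F. (vT \<bullet> mode i) * Re (\<zeta> i t0) - (zT \<bullet> i) * Im (\<zeta> i t0))"
        unfolding inner_sum_right sum_subtractf[symmetric]
        by (rule sum.cong) (use F Y_coeff[OF t00] X_coeff[OF t00] in auto)
      also have "\<dots> = (\<Sum>i\<in>F. (y0 \<bullet> mode i) * A i - (x0 \<bullet> i) * B i - trace_coeff i * (A i * fcos i 0 t0 + B i * fsin i 0 t0))"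
      proof (rule sum.cong[OF refl])
        fix i assume i: "i \<in> F"
        show "(vT \<bullet> mode i) * Re (\<zeta> i t0) - (zT \<bullet> i) * Im (\<zeta> i t0)
           = (y0 \<bullet> mode i) * A i - (x0 \<bullet> i) * B i - trace_coeff i * (A i * fcos i 0 t0 + B i * fsin i 0 t0)"
          unfolding AB[OF i] by (simp add: \<zeta>_def frame_def algebra_simps)
      qed
      also have "\<dots> = y0 \<bullet> ?S F (v 0) - x0 \<bullet> ?U F (z 0) - integral {0..t0} (\<lambda>r. f r * h r)"
        unfolding I inner_sum_right sum_subtractf by (simp add: A_def B_def mult.commute)
      finally show ?thesis .
    qed
    obtain n where n: "norm (vn n t0 - vT) < e" "norm (T (wn n t0) - zT) < e" "integral {0..t0} (\<lambda>t. (rn n t - g t)\<^sup>2) < e\<^sup>2"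
    proof -
      have "\<forall>\<^sub>F n in sequentially. dist (vn n t0) vT < e" by (rule tendstoD[OF lim_v e])
      moreover have "\<forall>\<^sub>F n in sequentially. dist (T (wn n t0)) zT < e" by (rule tendstoD[OF lim_w e])
      moreover have "\<forall>\<^sub>F n in sequentially. integral {0..t0} (\<lambda>t. (rn n t - g t)\<^sup>2) < e\<^sup>2"
        by (rule order_tendstoD(2)[OF lim_r]) (use e in simp)
      ultimately have "\<forall>\<^sub>F n in sequentially. dist (vn n t0) vT < e \<and> dist (T (wn n t0)) zT < e \<and> integral {0..t0} (\<lambda>t. (rn n t - g t)\<^sup>2) < e\<^sup>2"
        by eventually_elim simp
      then obtain n where "dist (vn n t0) vT < e \<and> dist (T (wn n t0)) zT < e \<and> integral {0..t0} (\<lambda>t. (rn n t - g t)\<^sup>2) < e\<^sup>2"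
        using eventually_happens trivial_limit_sequentially by blast
      then show ?thesis using that[of n] unfolding dist_norm by blast
    qed
    have i2: "(\<lambda>t. (u t)\<^sup>2) integrable_on {0..t0}" if "u \<in> L2_on {0..t0}" for u
      using that by (auto simp: L2_on_def intro!: integrable_on_lebesgue_on)
    have rh: "(\<lambda>t. rn n t - h t) \<in> L2_on {0..t0}" using L2_on_lincomb[OF rn(1) hL, of 1 n "-1"] by simp
    have rg: "(\<lambda>t. rn n t - g t) \<in> L2_on {0..t0}" using L2_on_lincomb[OF rn(1) g, of 1 n "-1"] by simp
    have hg: "(\<lambda>t. h t - g t) \<in> L2_on {0..t0}" using L2_on_lincomb[OF hL g, of 1 "-1"] by simp
    have "integral {0..t0} (\<lambda>t. (rn n t - h t)\<^sup>2) \<le> C * (1 + t0) * (8 * e\<^sup>2)"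
    proof -
      let ?v = "\<lambda>t. \<Sum>i\<in>F. (A i * cos (freq i * t) + B i * sin (freq i * t)) *\<^sub>R mode i"
      let ?w = "\<lambda>t. \<Sum>i\<in>F. (freq i * (B i * cos (freq i * t) - A i * sin (freq i * t))) *\<^sub>R mode i"
      let ?y = "\<lambda>t. \<Sum>i\<in>F. (freq i * (A i * cos (freq i * t) + B i * sin (freq i * t))) *\<^sub>R i"
      have "integral {0..t0} (\<lambda>t. (rn n t - h t)\<^sup>2) = integral {0..t0} (\<lambda>t. (tr (yn n t - ?y t))\<^sup>2)"
      proof (rule integral_cong)
        fix t assume "t \<in> {0..t0}"
        moreover have "tr (yn n t - ?y t) = tr (yn n t) - tr (?y t)"
          using tr_add[of "yn n t" "(-1) *\<^sub>R ?y t"] tr_scale[of "-1" "?y t"] by simp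
        ultimately show "(rn n t - h t)\<^sup>2 = (tr (yn n t - ?y t))\<^sup>2" using rn(2)[of t n] cm(3)[of t] by (simp add: h_def)
      qed
      also have "\<dots> \<le> C * (1 + t0) * ((norm (vn n t0 - ?v t0))\<^sup>2 + (norm (T (wn n t0 - ?w t0)))\<^sup>2)"
        by (rule hr[OF classical_diff[OF cl[of n] cm(1)] t00 t00])
      also have "?v t0 = ?S F vT" by (rule sum.cong) (use fT in auto)
      also have "T (wn n t0 - ?w t0) = T (wn n t0) - ?U F zT" unfolding T.diff cm(2)
        by (intro arg_cong2[of _ _ _ _ minus] refl sum.cong) (use fT in auto)
      also have "C * (1 + t0) * ((norm (vn n t0 - ?S F vT))\<^sup>2 + (norm (T (wn n t0) - ?U F zT))\<^sup>2) \<le> C * (1 + t0) * (8 * e\<^sup>2)"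
      proof (rule mult_left_mono)
        have "norm (vn n t0 - ?S F vT) \<le> 2 * e"
          using norm_triangle_ineq[of "vn n t0 - vT" "vT - ?S F vT"] n(1) a1 by simp
        from power_mono[OF this, of 2] have "(norm (vn n t0 - ?S F vT))\<^sup>2 \<le> 4 * e\<^sup>2" by (simp add: power_mult_distrib)
        moreover have "norm (T (wn n t0) - ?U F zT) \<le> 2 * e"
          using norm_triangle_ineq[of "T (wn n t0) - zT" "zT - ?U F zT"] n(2) a3 by simp
        from power_mono[OF this, of 2] have "(norm (T (wn n t0) - ?U F zT))\<^sup>2 \<le> 4 * e\<^sup>2" by (simp add: power_mult_distrib)
        ultimately show "(norm (vn n t0 - ?S F vT))\<^sup>2 + (norm (T (wn n t0) - ?U F zT))\<^sup>2 \<le> 8 * e\<^sup>2" by simp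
      qed (use C t00 in simp)
      finally show ?thesis .
    qed
    moreover have "integral {0..t0} (\<lambda>t. (h t - g t)\<^sup>2) \<le> integral {0..t0} (\<lambda>t. 2 * (rn n t - h t)\<^sup>2 + 2 * (rn n t - g t)\<^sup>2)"
    proof (rule integral_le)
      show "(\<lambda>t. 2 * (rn n t - h t)\<^sup>2 + 2 * (rn n t - g t)\<^sup>2) integrable_on {0..t0}"
        by (intro integrable_add integrable_on_mult_right i2 rh rg)
      fix t
      show "(h t - g t)\<^sup>2 \<le> 2 * (rn n t - h t)\<^sup>2 + 2 * (rn n t - g t)\<^sup>2"
        using zero_le_power2[of "(rn n t - h t) + (rn n t - g t)"] by (simp add: power2_eq_square algebra_simps)
    qed (rule i2[OF hg])
    moreover have "integral {0..t0} (\<lambda>t. 2 * (rn n t - h t)\<^sup>2 + 2 * (rn n t - g t)\<^sup>2)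
        = 2 * integral {0..t0} (\<lambda>t. (rn n t - h t)\<^sup>2) + 2 * integral {0..t0} (\<lambda>t. (rn n t - g t)\<^sup>2)"
      by (subst Henstock_Kurzweil_Integration.integral_add) (use i2[OF rh] i2[OF rg] integrable_on_mult_right in auto)
    ultimately have hgb: "integral {0..t0} (\<lambda>t. (h t - g t)\<^sup>2) \<le> (16 * C * (1 + t0) + 2) * e\<^sup>2"
      using n(3) by (simp add: algebra_simps)
    have "(integral {0..t0} (\<lambda>t. f t * (h t - g t)))\<^sup>2 \<le> integral {0..t0} (\<lambda>r. (f r)\<^sup>2) * integral {0..t0} (\<lambda>t. (h t - g t)\<^sup>2)"
      by (rule cauchy_schwarz_integral[OF f_L2[OF order_refl] hg])
    also have "\<dots> \<le> integral {0..t0} (\<lambda>r. (f r)\<^sup>2) * ((16 * C * (1 + t0) + 2) * e\<^sup>2)"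
      by (intro mult_left_mono hgb Henstock_Kurzweil_Integration.integral_nonneg f_mult_integrable(3)[of _ "\<lambda>_. 0"]) auto
    finally have "\<bar>integral {0..t0} (\<lambda>t. f t * (h t - g t))\<bar> \<le> sqrt (integral {0..t0} (\<lambda>r. (f r)\<^sup>2) * ((16 * C * (1 + t0) + 2) * e\<^sup>2))"
      using real_le_rsqrt[of "\<bar>integral {0..t0} (\<lambda>t. f t * (h t - g t))\<bar>"] by (simp del: real_sqrt_mult)
    also have "\<dots> = K * e" using e by (simp add: K_def real_sqrt_mult mult.assoc)
    finally have fb: "\<bar>integral {0..t0} (\<lambda>t. f t * (h t - g t))\<bar> \<le> K * e" .
    have fi: "(\<lambda>t. f t * u t) integrable_on {0..t0}" if "u \<in> L2_on {0..t0}" for u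
      using L2_on_mult_integrable[OF f_L2[OF order_refl] that] by (intro integrable_on_lebesgue_on) auto
    have "integral {0..t0} (\<lambda>t. f t * (h t - g t)) = integral {0..t0} (\<lambda>t. f t * h t) - integral {0..t0} (\<lambda>t. f t * g t)"
      by (simp add: right_diff_distrib Henstock_Kurzweil_Integration.integral_diff[OF fi[OF hL] fi[OF g]])
    then have "\<Delta> = Y t0 \<bullet> (vT - ?S F vT) - X t0 \<bullet> (zT - ?U F zT) - y0 \<bullet> (v 0 - ?S F (v 0)) + x0 \<bullet> (z 0 - ?U F (z 0))
        - integral {0..t0} (\<lambda>t. f t * (h t - g t))"
      using id by (simp add: \<Delta>_def inner_diff_right)
    moreover have cs: "\<bar>a \<bullet> b\<bar> \<le> norm a * e" if "norm b < e" for a b :: 'a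
      using Cauchy_Schwarz_ineq2[of a b] mult_left_mono[OF less_imp_le[OF that], of "norm a"] by simp
    ultimately have "\<bar>\<Delta>\<bar> \<le> norm (Y t0) * e + norm (X t0) * e + norm y0 * e + norm x0 * e + K * e"
      using cs[OF a1, of "Y t0"] cs[OF a3, of "X t0"] cs[OF a2, of y0] cs[OF a4, of x0] fb by linarith
    then show ?thesis by (simp add: algebra_simps)
  qed
  have "\<Delta> = 0"
  proof (rule ccontr)
    assume "\<Delta> \<noteq> 0"
    define k where "k = norm (Y t0) + norm (X t0) + norm y0 + norm x0 + K"
    have "K \<ge> 0" unfolding K_def
      by (intro real_sqrt_ge_zero mult_nonneg_nonneg Henstock_Kurzweil_Integration.integral_nonneg f_mult_integrable(3)[of _ "\<lambda>_. 0"])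
        (use C t00 in auto)
    then have k: "k \<ge> 0" by (simp add: k_def)
    \<comment> \<open>\<open>bound\<close> holds for every positive e; this choice pushes its
      right-hand side down to |\<open>\<Delta>\<close>| / 2.\<close>
    have pos: "\<bar>\<Delta>\<bar> / (2 * (k + 1)) > 0" using \<open>\<Delta> \<noteq> 0\<close> k by simp
    have "\<bar>\<Delta>\<bar> \<le> k * (\<bar>\<Delta>\<bar> / (2 * (k + 1)))" using bound[OF pos] by (simp add: k_def)
    also have "\<dots> \<le> (k + 1) * (\<bar>\<Delta>\<bar> / (2 * (k + 1)))" using pos by (intro mult_right_mono) auto
    also have "\<dots> = \<bar>\<Delta>\<bar> / 2" using k by (simp add: field_simps)
    finally show False using \<open>\<Delta> \<noteq> 0\<close> by simp
  qed
  then show ?thesis by (simp add: \<Delta>_def)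
qed

end

section \<open>Test functions\<close>

definition smooth :: "fn \<Rightarrow> bool" where
  "smooth \<phi> \<longleftrightarrow> (\<forall>k x. (deriv ^^ k) \<phi> differentiable (at x))"

lemma funpow_deriv_Suc: "(deriv ^^ Suc k) \<phi> = (deriv ^^ k) (deriv \<phi>)"
  by (simp add: funpow_swap1)

lemma smooth_deriv: "smooth \<phi> \<Longrightarrow> smooth (deriv \<phi>)"
  unfolding smooth_def funpow_deriv_Suc[symmetric] by blast

lemma smooth_DERIV: "smooth \<phi> \<Longrightarrow> (\<phi> has_real_derivative deriv \<phi> x) (at x)"
  using spec[OF spec[of "\<lambda>k. \<forall>x. (deriv ^^ k) \<phi> differentiable (at x)" 0]]
  by (auto simp: smooth_def DERIV_deriv_iff_real_differentiable)

lemma smooth_continuous: "smooth \<phi> \<Longrightarrow> continuous_on S \<phi>"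
  by (intro continuous_at_imp_continuous_on ballI DERIV_isCont[OF smooth_DERIV])

text \<open>Smoothness by coinduction: exhibiting a set invariant under differentiation avoids
  closed formulas for higher derivatives.\<close>

lemma smooth_coinduct:
  assumes "f \<in> A" and A: "\<And>g. g \<in> A \<Longrightarrow> \<exists>g'\<in>A. \<forall>x. (g has_real_derivative g' x) (at x)"
  shows "smooth f"
proof -
  have d: "deriv g \<in> A \<and> (\<forall>x. g differentiable (at x))" if gA: "g \<in> A" for g
  proof -
    obtain g' where g': "g' \<in> A" "\<And>x. (g has_real_derivative g' x) (at x)" using A[OF gA] by blast
    then have "deriv g = g'" using DERIV_imp_deriv by blast
    then show ?thesis using g' real_differentiable_def by blast
  qed
  have "(deriv ^^ k) f \<in> A" for k by (induction k) (use assms(1) d in auto)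
  then show ?thesis using d smooth_def by blast
qed

text \<open>The derivative of a product is a sum of products, so an invariant set for
  \<open>smooth_coinduct\<close> has to be closed under both operations.\<close>

inductive_set smooth_algebra :: "fn set" where
  base: "smooth f \<Longrightarrow> f \<in> smooth_algebra"
| add: "f \<in> smooth_algebra \<Longrightarrow> g \<in> smooth_algebra \<Longrightarrow> (\<lambda>x. f x + g x) \<in> smooth_algebra"
| mult: "f \<in> smooth_algebra \<Longrightarrow> g \<in> smooth_algebra \<Longrightarrow> (\<lambda>x. f x * g x) \<in> smooth_algebra"

lemma smooth_algebra_smooth:
  assumes "f \<in> smooth_algebra" shows "smooth f"
proof (rule smooth_coinduct[OF assms])
  fix g assume "g \<in> smooth_algebra"
  then show "\<exists>g'\<in>smooth_algebra. \<forall>x. (g has_real_derivative g' x) (at x)"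
  proof induction
    case (base f)
    then show ?case
      by (intro bexI[of _ "deriv f"] allI smooth_DERIV smooth_algebra.base smooth_deriv)
  next
    case (add f g)
    then obtain f' g' where "f' \<in> smooth_algebra" "g' \<in> smooth_algebra"
      "\<And>x. (f has_real_derivative f' x) (at x)" "\<And>x. (g has_real_derivative g' x) (at x)" by blast
    then show ?case by (intro bexI[of _ "\<lambda>x. f' x + g' x"]) (auto intro: smooth_algebra.add DERIV_add)
  next
    case (mult f g)
    then obtain f' g' where h: "f' \<in> smooth_algebra" "g' \<in> smooth_algebra"
      "\<And>x. (f has_real_derivative f' x) (at x)" "\<And>x. (g has_real_derivative g' x) (at x)" by blast
    show ?case
    proof (intro bexI[of _ "\<lambda>x. f' x * g x + g' x * f x"] allI)
      show "((\<lambda>x. f x * g x) has_real_derivative f' x * g x + g' x * f x) (at x)" for x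
        by (rule DERIV_mult[OF h(3,4)])
      show "(\<lambda>x. f' x * g x + g' x * f x) \<in> smooth_algebra"
        using h mult by (intro smooth_algebra.add smooth_algebra.mult)
    qed
  qed
qed

lemma smooth_const: "smooth (\<lambda>x. c)"
proof (rule smooth_coinduct[where A = "range (\<lambda>c x. c)"])
  fix g :: fn assume "g \<in> range (\<lambda>c x. c)"
  then show "\<exists>g'\<in>range (\<lambda>c x. c). \<forall>x. (g has_real_derivative g' x) (at x)"
    by (auto intro!: derivative_eq_intros)
qed auto

lemma smooth_add: "smooth f \<Longrightarrow> smooth g \<Longrightarrow> smooth (\<lambda>x. f x + g x)"
  by (rule smooth_algebra_smooth[OF smooth_algebra.add[OF smooth_algebra.base smooth_algebra.base]])

lemma smooth_mult: "smooth f \<Longrightarrow> smooth g \<Longrightarrow> smooth (\<lambda>x. f x * g x)"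
  by (rule smooth_algebra_smooth[OF smooth_algebra.mult[OF smooth_algebra.base smooth_algebra.base]])

lemma smooth_scale: "smooth f \<Longrightarrow> smooth (\<lambda>x. c * f x)"
  using smooth_mult[OF smooth_const] .

lemma smooth_affine:
  assumes "smooth f" shows "smooth (\<lambda>x. f (a * x + b))"
proof (rule smooth_coinduct[where A = "{\<lambda>x. c * g (a * x + b) | c g. smooth g}"])
  show "(\<lambda>x. f (a * x + b)) \<in> {\<lambda>x. c * g (a * x + b) | c g. smooth g}"
    using assms by (auto intro!: exI[of _ 1] exI[of _ f])
  fix h assume "h \<in> {\<lambda>x. c * g (a * x + b) | c g. smooth g}"
  then obtain c g where h: "h = (\<lambda>x. c * g (a * x + b))" "smooth g" by blast
  show "\<exists>g'\<in>{\<lambda>x. c * g (a * x + b) | c g. smooth g}. \<forall>x. (h has_real_derivative g' x) (at x)"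
  proof (intro bexI[of _ "\<lambda>x. (c * a) * deriv g (a * x + b)"] allI)
    show "(h has_real_derivative (c * a) * deriv g (a * x + b)) (at x)" for x
    proof -
      have "((\<lambda>x. a * x + b) has_real_derivative a) (at x)" by (auto intro!: derivative_eq_intros)
      from DERIV_chain2[OF smooth_DERIV[OF h(2)] this]
      show ?thesis unfolding h(1) using DERIV_cmult by (fastforce simp: mult_ac)
    qed
    show "(\<lambda>x. (c * a) * deriv g (a * x + b)) \<in> {\<lambda>x. c * g (a * x + b) | c g. smooth g}"
      using smooth_deriv[OF h(2)] by blast
  qed
qed

definition flat_exp :: fn where "flat_exp x = (if x \<le> 0 then 0 else exp (- (1 / x)))"

lemma poly_exp_tendsto_0: "((\<lambda>y::real. poly p y * exp (- y)) \<longlongrightarrow> 0) at_top"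
proof -
  have "((\<lambda>y::real. \<Sum>i\<le>degree p. coeff p i * (y ^ i / exp y)) \<longlongrightarrow> (\<Sum>i\<le>degree p. coeff p i * 0)) at_top"
    by (intro tendsto_intros tendsto_power_div_exp_0)
  then show ?thesis
    by (simp add: poly_altdef sum_distrib_right exp_minus divide_inverse mult.assoc)
qed

text \<open>The invariant set consists of the functions p(1/x) exp(- 1/x), extended by 0, for
  polynomials p. Differentiation replaces p by X^2 (p - p'), where \<open>[:0, 0, 1:]\<close> is
  X^2.\<close>

lemma flat_exp_smooth: "smooth flat_exp"
proof -
  define D where "D p x = (if x \<le> 0 then 0 else poly p (1 / x) * exp (- (1 / x)))" for p :: "real poly" and x :: real
  have der: "(D p has_real_derivative D ([:0, 0, 1:] * (p - pderiv p)) x) (at x)" for p x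
  proof -
    consider "x < 0" | "x > 0" | "x = 0" by linarith
    then show ?thesis
    proof cases
      case 1
      have "((\<lambda>x. 0) has_real_derivative D ([:0, 0, 1:] * (p - pderiv p)) x) (at x)"
        using 1 by (simp add: D_def)
      then show ?thesis
        by (rule has_field_derivative_transform_within_open[of _ _ _ "{..<0}"]) (use 1 in \<open>auto simp: D_def\<close>)
    next
      case 2
      have i: "((\<lambda>x. 1 / x) has_real_derivative - (1 / x\<^sup>2)) (at x)"
        using 2 by (auto intro!: derivative_eq_intros simp: power2_eq_square divide_inverse)
      have "((\<lambda>x. poly p (1 / x) * exp (- (1 / x))) has_real_derivative
          poly (pderiv p) (1 / x) * (- (1 / x\<^sup>2)) * exp (- (1 / x)) + exp (- (1 / x)) * (1 / x\<^sup>2) * poly p (1 / x)) (at x)"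
        using DERIV_mult[OF DERIV_chain2[OF poly_DERIV i] DERIV_chain2[OF DERIV_exp DERIV_minus[OF i]]] by simp
      moreover have "poly (pderiv p) (1 / x) * (- (1 / x\<^sup>2)) * exp (- (1 / x)) + exp (- (1 / x)) * (1 / x\<^sup>2) * poly p (1 / x)
        = D ([:0, 0, 1:] * (p - pderiv p)) x"
        using 2 by (simp add: D_def algebra_simps power2_eq_square)
      ultimately have "((\<lambda>x. poly p (1 / x) * exp (- (1 / x))) has_real_derivative D ([:0, 0, 1:] * (p - pderiv p)) x) (at x)"
        by simp
      then show ?thesis
        by (rule has_field_derivative_transform_within_open[of _ _ _ "{0<..}"]) (use 2 in \<open>auto simp: D_def\<close>)
    next
      case 3
      have "((\<lambda>h. D p h / h) \<longlongrightarrow> 0) (at_left 0)"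
      proof (rule tendsto_eventually)
        show "\<forall>\<^sub>F h in at_left 0. D p h / h = 0"
          by (auto simp: D_def eventually_at_filter)
      qed
      moreover have "((\<lambda>h. D p h / h) \<longlongrightarrow> 0) (at_right 0)"
      proof -
        \<comment> \<open>Dividing by h multiplies the polynomial in 1/h by its variable, hence
          \<open>pCons 0 p\<close>.\<close>
        have "((\<lambda>h. poly (pCons 0 p) (inverse h) * exp (- inverse h)) \<longlongrightarrow> 0) (at_right 0)"
          by (rule filterlim_compose[OF poly_exp_tendsto_0 filterlim_inverse_at_top_right])
        then show ?thesis
          by (rule Lim_transform_eventually)
            (auto simp: D_def eventually_at_filter inverse_eq_divide)
      qed
      ultimately have "((\<lambda>h. D p h / h) \<longlongrightarrow> 0) (at 0)" by (rule filterlim_split_at)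
      moreover have "D p 0 = 0" "D ([:0, 0, 1:] * (p - pderiv p)) 0 = 0" by (simp_all add: D_def)
      ultimately show ?thesis using 3 by (simp add: has_field_derivative_iff)
    qed
  qed
  show ?thesis
  proof (rule smooth_coinduct[where A = "range D"])
    show "flat_exp \<in> range D" by (rule range_eqI[of _ _ 1]) (auto simp: flat_exp_def D_def)
  qed (use der in blast)
qed

text \<open>Two rescaled cutoffs whose product tends pointwise to the indicator of (c, d). Values in
  [0, 1] make dominated convergence available, which replaces mollification.\<close>

definition plateau :: "real \<Rightarrow> real \<Rightarrow> nat \<Rightarrow> fn" where
  "plateau c d n x = flat_exp (real (Suc n) * (x - c)) * flat_exp (real (Suc n) * (d - x))"

lemma smooth_plateau: "smooth (plateau c d n)"
proof -
  have "smooth (\<lambda>x. flat_exp (real (Suc n) * x + (- real (Suc n) * c)) * flat_exp ((- real (Suc n)) * x + real (Suc n) * d))"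
    by (intro smooth_mult smooth_affine flat_exp_smooth)
  then show ?thesis by (simp add: plateau_def[abs_def] algebra_simps)
qed

lemma flat_exp_bounds: "0 \<le> flat_exp x" "flat_exp x \<le> 1"
  by (auto simp: flat_exp_def)

lemma plateau_bounds: "0 \<le> plateau c d n x" "plateau c d n x \<le> 1"
  by (auto simp: plateau_def flat_exp_bounds mult_le_one)

lemma plateau_zero: "x \<notin> {c<..<d} \<Longrightarrow> plateau c d n x = 0"
  by (auto simp: plateau_def flat_exp_def mult_le_0_iff)

lemma plateau_limit: "(\<lambda>n. plateau c d n x) \<longlonglongrightarrow> indicator {c<..<d} x"
proof (cases "x \<in> {c<..<d}")
  case True
  have e: "(\<lambda>n. flat_exp (real (Suc n) * y)) \<longlonglongrightarrow> 1" if "y > 0" for y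
  proof -
    have "(\<lambda>n. exp (- (inverse (real (Suc n)) * (1 / y)))) \<longlonglongrightarrow> exp (- (0 * (1 / y)))"
      by (intro tendsto_intros LIMSEQ_inverse_real_of_nat)
    moreover have "exp (- (inverse (real (Suc n)) * (1 / y))) = flat_exp (real (Suc n) * y)" for n
      using that by (auto simp: flat_exp_def divide_inverse mult_le_0_iff)
    ultimately show ?thesis by simp
  qed
  have "(\<lambda>n. plateau c d n x) \<longlonglongrightarrow> 1 * 1"
    unfolding plateau_def by (intro tendsto_mult e) (use True in auto)
  then show ?thesis using True by simp
qed (simp add: plateau_zero)

lemma plateau_test: "0 < c \<Longrightarrow> d < 1 \<Longrightarrow> plateau c d n \<in> test_functions"
  using smooth_plateau[of c d n] plateau_zero[of _ c d n]
  unfolding test_functions_def smooth_def by fastforce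

lemma test_smooth: "\<phi> \<in> test_functions \<Longrightarrow> smooth \<phi>"
  by (simp add: test_functions_def smooth_def)

lemma test_support:
  assumes "\<phi> \<in> test_functions"
  obtains c d where "0 < c" "c < d" "d < 1" "\<And>x. x \<notin> {c<..<d} \<Longrightarrow> \<phi> x = 0"
proof -
  obtain c d where cd: "0 < c" "d < 1" "\<And>x. x \<notin> {c..d} \<Longrightarrow> \<phi> x = 0"
    using assms unfolding test_functions_def by blast
  \<comment> \<open>Pulling 1/2 into the interior makes the interval nondegenerate even for the zero
    function; enlarging it makes the function vanish at the new endpoints.\<close>
  define c' d' where "c' = min c (1/2) / 2" and "d' = (max d (1/2) + 1) / 2"
  have "0 < c'" "c' < c" "d < d'" "d' < 1" "c' < d'" using cd by (auto simp: c'_def d'_def min_def max_def)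
  then show ?thesis using that[of c' d'] cd(3) by force
qed

lemma test_I:
  assumes "smooth \<phi>" "0 < c" "d < 1" "\<And>x. x \<notin> {c..d} \<Longrightarrow> \<phi> x = 0"
  shows "\<phi> \<in> test_functions"
  using assms unfolding test_functions_def smooth_def by blast

lemma test_deriv:
  assumes "\<phi> \<in> test_functions" shows "deriv \<phi> \<in> test_functions"
proof -
  obtain c d where cd: "0 < c" "c < d" "d < 1" "\<And>x. x \<notin> {c<..<d} \<Longrightarrow> \<phi> x = 0"
    using test_support[OF assms] by blast
  show ?thesis
  proof (rule test_I[OF smooth_deriv[OF test_smooth[OF assms]] cd(1,3)])
    fix x assume x: "x \<notin> {c..d}"
    have "((\<lambda>x. 0) has_real_derivative 0) (at x)" by simp
    then have "(\<phi> has_real_derivative 0) (at x)"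
    proof (rule has_field_derivative_transform_within_open)
      show "open (- {c..d})" "x \<in> - {c..d}" using x by auto
      show "0 = \<phi> y" if "y \<in> - {c..d}" for y using cd(4)[of y] that by auto
    qed
    then show "deriv \<phi> x = 0" by (rule DERIV_imp_deriv)
  qed
qed

lemma test_zero_outside: "\<phi> \<in> test_functions \<Longrightarrow> x \<notin> {0<..<1} \<Longrightarrow> \<phi> x = 0"
  by (erule test_support) (metis greaterThanLessThan_iff less_trans)

lemma test_scale: "\<phi> \<in> test_functions \<Longrightarrow> (\<lambda>x. c * \<phi> x) \<in> test_functions"
  by (rule test_support, assumption, rule test_I[OF smooth_scale[OF test_smooth]]) auto

lemma test_add:
  assumes "\<phi> \<in> test_functions" "\<psi> \<in> test_functions"
  shows "(\<lambda>x. \<phi> x + \<psi> x) \<in> test_functions"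
proof -
  obtain c d where cd: "0 < c" "c < d" "d < 1" "\<And>x. x \<notin> {c<..<d} \<Longrightarrow> \<phi> x = 0"
    using test_support[OF assms(1)] by blast
  obtain c' d' where cd': "0 < c'" "c' < d'" "d' < 1" "\<And>x. x \<notin> {c'<..<d'} \<Longrightarrow> \<psi> x = 0"
    using test_support[OF assms(2)] by blast
  show ?thesis
  proof (rule test_I[OF smooth_add[OF assms[THEN test_smooth]], of "min c c'" "max d d'"])
    fix x assume "x \<notin> {min c c'..max d d'}"
    then have "x \<notin> {c<..<d}" "x \<notin> {c'<..<d'}" by auto
    then show "\<phi> x + \<psi> x = 0" using cd(4) cd'(4) by simp
  qed (use cd cd' in auto)
qed

lemma test_bounded:
  assumes "\<phi> \<in> test_functions" obtains B where "B \<ge> 0" "\<And>x. \<bar>\<phi> x\<bar> \<le> B"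
proof -
  have "compact (\<phi> ` {0..1})"
    by (intro compact_continuous_image smooth_continuous test_smooth assms compact_Icc)
  then obtain B where B: "\<And>x. x \<in> {0..1} \<Longrightarrow> \<bar>\<phi> x\<bar> \<le> B"
    by (metis bounded_iff compact_imp_bounded imageI real_norm_def)
  have "\<bar>\<phi> x\<bar> \<le> max B 0" for x
    using B[of x] test_zero_outside[OF assms, of x] by (cases "x \<in> {0..1}") auto
  then show ?thesis using that[of "max B 0"] by auto
qed

lemma smooth_measurable: "smooth \<phi> \<Longrightarrow> \<phi> \<in> borel_measurable (lebesgue_on S)"
  using borel_measurable_continuous_onI[OF smooth_continuous, of \<phi>]
  by (intro measurable_restrict_space1 measurable_completion) simp

lemma test_L2: "\<phi> \<in> test_functions \<Longrightarrow> \<phi> \<in> L2"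
  by (rule test_bounded, assumption, rule L2_dominated[OF smooth_measurable[OF test_smooth] L2_const[of 1]]) auto

section \<open>The fundamental lemma of the calculus of variations\<close>

text \<open>Lebesgue differentiation: at almost every x the averages over [x, x + h] converge to
  g(x), and all of them vanish.\<close>

lemma AE_zero_if_interval_integrals_zero:
  fixes g :: fn
  assumes g: "integrable lebesgue g" and z: "\<And>a b. integral {a..b} g = 0"
  shows "AE x in lebesgue. g x = 0"
proof -
  have i: "g integrable_on cbox a b" for a b
    using integrable_on_lebesgue[OF g] integrable_on_subcbox[of g UNIV] by blast
  obtain N where N: "negligible N"
    and k: "\<And>x e. x \<notin> N \<Longrightarrow> 0 < e \<Longrightarrow> \<exists>d>0. \<forall>h. 0 < h \<and> h < d \<longrightarrow>
              norm (integral (cbox x (x + h *\<^sub>R One)) g /\<^sub>R h ^ DIM(real) - g x) < e"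
    using integrable_ccontinuous_explicit[OF i] by blast
  have "g x = 0" if x: "x \<notin> N" for x
  proof (rule ccontr)
    assume "g x \<noteq> 0"
    then obtain d where d: "d > 0" "\<And>h. 0 < h \<Longrightarrow> h < d \<Longrightarrow>
      norm (integral (cbox x (x + h *\<^sub>R One)) g /\<^sub>R h ^ DIM(real) - g x) < \<bar>g x\<bar>"
      using k[OF x, of "\<bar>g x\<bar>"] by auto
    show False using d(2)[of "d/2"] d(1) z by simp
  qed
  then show ?thesis
    using N AE_I'[of N lebesgue "\<lambda>x. g x = 0"] by (auto simp: negligible_iff_null_sets)
qed

text \<open>Plateaus approximate indicators, so the integral of \<open>z\<close> over every interval
  compactly contained in (0, 1) vanishes. As \<open>z\<close> is integrable only locally, it is
  first restricted to such an interval; countably many of them exhaust (0, 1).\<close>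

lemma fundamental_lemma:
  assumes z: "locally_integrable z"
    and o: "\<And>\<phi>. \<phi> \<in> test_functions \<Longrightarrow> (LINT x|M01. z x * \<phi> x) = 0"
  shows "AE x in M01. z x = 0"
proof -
  have zi: "integrable lebesgue (\<lambda>x. indicator {c..d} x * z x)" if "0 < c" "d < 1" for c d
    using z that by (auto simp: locally_integrable_def integrable_restrict_space)
  have zi': "integrable lebesgue (\<lambda>x. indicator {c<..<d} x * z x)" if "0 < c" "d < 1" for c d
  proof (rule Bochner_Integration.integrable_bound[OF zi[OF that]])
    have "(\<lambda>x. indicator {c<..<d} x * (indicator {c..d} x * z x)) \<in> borel_measurable lebesgue"
      by (rule borel_measurable_times[OF borel_measurable_indicator borel_measurable_integrable[OF zi[OF that]]]) simp
    moreover have "(\<lambda>x. indicator {c<..<d} x * (indicator {c..d} x * z x)) = (\<lambda>x. indicator {c<..<d} x * z x)"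
      by (auto simp: indicator_def)
    ultimately show "(\<lambda>x. indicator {c<..<d} x * z x) \<in> borel_measurable lebesgue" by simp
  qed (auto simp: indicator_def)
  have step: "(LINT x|lebesgue. indicator {c<..<d} x * z x) = 0" if cd: "0 < c" "d < 1" for c d
  proof -
    have lim: "(\<lambda>n. LINT x|lebesgue. plateau c d n x * z x) \<longlonglongrightarrow> (LINT x|lebesgue. indicator {c<..<d} x * z x)"
    proof (rule integral_dominated_convergence)
      show "integrable lebesgue (\<lambda>x. \<bar>indicator {c<..<d} x * z x\<bar>)" using zi'[OF cd] by simp
      show "(\<lambda>x. indicator {c<..<d} x * z x) \<in> borel_measurable lebesgue" using zi'[OF cd] by auto
      have e: "(\<lambda>x. plateau c d n x * z x) = (\<lambda>x. plateau c d n x * (indicator {c<..<d} x * z x))" for n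
        using plateau_zero[of _ c d n] by (intro ext) (auto simp: indicator_def)
      have "plateau c d n \<in> borel_measurable lebesgue" for n
        using smooth_measurable[OF smooth_plateau, of c d n UNIV] by (simp add: lebesgue_on_UNIV_eq)
      then show "(\<lambda>x. plateau c d n x * z x) \<in> borel_measurable lebesgue" for n
        unfolding e by (rule borel_measurable_times[OF _ borel_measurable_integrable[OF zi'[OF cd]]])
      show "AE x in lebesgue. (\<lambda>n. plateau c d n x * z x) \<longlonglongrightarrow> indicator {c<..<d} x * z x"
        by (intro AE_I2 tendsto_intros plateau_limit)
      show "AE x in lebesgue. norm (plateau c d n x * z x) \<le> \<bar>indicator {c<..<d} x * z x\<bar>" for n
      proof (rule AE_I2)
        fix x
        show "norm (plateau c d n x * z x) \<le> \<bar>indicator {c<..<d} x * z x\<bar>"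
          using plateau_zero[of x c d n] plateau_bounds[of c d n x]
          by (cases "x \<in> {c<..<d}") (auto simp: abs_mult mult_left_le_one_le)
      qed
    qed
    have "(LINT x|lebesgue. plateau c d n x * z x) = 0" for n
    proof -
      have "(LINT x|M01. z x * plateau c d n x) = (LINT x|lebesgue. indicator {0<..<1} x *\<^sub>R (z x * plateau c d n x))"
        by (rule integral_restrict_space) simp
      also have "\<dots> = (LINT x|lebesgue. plateau c d n x * z x)"
        using test_zero_outside[OF plateau_test[OF cd]]
        by (intro Bochner_Integration.integral_cong) (auto simp: indicator_def)
      finally show ?thesis using o[OF plateau_test[OF cd]] by simp
    qed
    then show ?thesis using lim by (simp add: LIMSEQ_const_iff)
  qed
  have "AE x in lebesgue. indicator {c<..<d} x * z x = 0" if cd: "0 < c" "d < 1" for c d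
  proof (rule AE_zero_if_interval_integrals_zero[OF zi'[OF cd]])
    fix a b
    let ?g = "\<lambda>x. indicator {c<..<d} x * z x"
    have "integral {a..b} ?g = integral {a<..<b} ?g"
      by (simp add: integral_open_interval_real)
    also have "\<dots> = integral UNIV (\<lambda>x. if x \<in> {a<..<b} then ?g x else 0)"
      by (rule integral_restrict_UNIV[symmetric])
    also have "(\<lambda>x. if x \<in> {a<..<b} then ?g x else 0) = (\<lambda>x. indicator {max a c<..<min b d} x * z x)"
      by (auto simp: indicator_def)
    also have "integral UNIV \<dots> = (LINT x|lebesgue. indicator {max a c<..<min b d} x * z x)"
      using cd by (intro integral_unique has_integral_integral_lebesgue zi') auto
    also have "\<dots> = 0" using cd by (intro step) auto
    finally show "integral {a..b} ?g = 0" .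
  qed
  \<comment> \<open>The offset 2 keeps both endpoints inside (0, 1), also for
    \<open>n = 0\<close>.\<close>
  then have "AE x in lebesgue. \<forall>n::nat. indicator {1 / real (n + 2)<..<1 - 1 / real (n + 2)} x * z x = 0"
    by (intro AE_all_countable[THEN iffD2] allI) (auto simp: field_simps)
  then have "AE x in lebesgue. x \<in> {0<..<1} \<longrightarrow> z x = 0"
  proof eventually_elim
    case (elim x)
    show ?case
    proof
      assume x: "x \<in> {0<..<1}"
      then have "min x (1 - x) > 0" by simp
      then obtain n where n: "inverse (real (Suc n)) < min x (1 - x)" using reals_Archimedean by blast
      have "1 / real (n + 2) < inverse (real (Suc n))" by (simp add: field_simps)
      then have "x \<in> {1 / real (n + 2)<..<1 - 1 / real (n + 2)}" using n by auto
      then show "z x = 0" using elim by (metis indicator_simps(1) mult_1)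
    qed
  qed
  then show ?thesis by (simp add: AE_restrict_space_iff)
qed

section \<open>Integration over the unit interval\<close>

lemma ident_measurable_M01: "(\<lambda>x. x) \<in> borel_measurable M01"
  using id_borel_measurable_lebesgue_on by (simp add: id_def)

lemma continuous_measurable_M01:
  assumes "continuous_on {0<..<1} u" shows "u \<in> borel_measurable M01"
  by (rule continuous_imp_measurable_on_sets_lebesgue[OF assms]) simp

lemma AE_M01_neq: "AE s in M01. s \<noteq> a"
  by (simp add: AE_restrict_space_iff) (intro eventually_mono[OF AE_completion[OF AE_lborel_singleton[of a]]], auto)

lemma continuous_L2: "continuous_on {0..1} u \<Longrightarrow> u \<in> L2"
  by (rule L2_on_subset[OF L2_on_continuous, of 0 1 u "{0<..<1}"]) auto

lemma indicator_measurable_M01: "A \<in> sets borel \<Longrightarrow> indicator A \<in> borel_measurable M01"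
  by (intro measurable_restrict_space1 measurable_completion) simp

lemma indicator_mult_integrable:
  fixes w :: fn
  assumes "integrable M01 w" "A \<in> sets borel"
  shows "integrable M01 (\<lambda>s. indicator A s * w s)"
  by (rule Bochner_Integration.integrable_bound[OF assms(1)])
    (use assms indicator_measurable_M01 in \<open>auto simp: indicator_def[abs_def] abs_mult intro!: borel_measurable_times\<close>)

lemma M01_integral_Ioo:
  fixes u :: fn
  assumes "0 \<le> a" "b \<le> 1" "continuous_on {a..b} u"
  shows "(LINT x|M01. indicator {a<..<b} x * u x) = integral {a..b} u"
proof -
  have "(LINT x|M01. indicator {a<..<b} x * u x) = (LINT x|lebesgue. indicator {0<..<1} x *\<^sub>R (indicator {a<..<b} x * u x))"
    by (rule integral_restrict_space) simp
  also have "\<dots> = (LINT x|lebesgue. indicator {a<..<b} x *\<^sub>R u x)"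
    by (rule Bochner_Integration.integral_cong) (use assms in \<open>auto simp: indicator_def\<close>)
  also have "\<dots> = (LINT x|lebesgue_on {a<..<b}. u x)"
    by (rule integral_restrict_space[symmetric]) simp
  also have "\<dots> = integral {a<..<b} u"
  proof (rule lebesgue_integral_eq_integral)
    have "integrable (lebesgue_on {a..b}) u" by (rule continuous_imp_integrable_real[OF assms(3)])
    then have "set_integrable lebesgue {a..b} u"
      by (simp add: set_integrable_def integrable_restrict_space)
    then have "set_integrable lebesgue {a<..<b} u" by (rule set_integrable_subset) auto
    then show "integrable (lebesgue_on {a<..<b}) u"
      by (simp add: set_integrable_def integrable_restrict_space)
  qed simp
  finally show ?thesis by (simp add: integral_open_interval_real)
qed

lemma M01_integral:
  fixes u :: fn
  assumes "continuous_on {0..1} u" shows "(LINT x|M01. u x) = integral {0..1} u"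
proof -
  have "(LINT x|M01. u x) = (LINT x|M01. indicator {0<..<1} x * u x)"
    by (rule Bochner_Integration.integral_cong) auto
  then show ?thesis using M01_integral_Ioo[OF _ _ assms] by simp
qed

text \<open>Fubini on the triangle s < x. It is the integration by parts formula for primitives of
  functions that are merely integrable.\<close>

lemma triangle_fubini:
  fixes u w :: fn
  assumes u: "integrable M01 u" and w: "integrable M01 w"
  shows "(LINT x|M01. u x * (LINT s|M01. indicator {..<x} s * w s))
       = (LINT s|M01. w s * (LINT x|M01. indicator {s<..} x * u x))"
proof -
  interpret finite_measure M01 by (rule finite_measure_M01)
  interpret pair_sigma_finite M01 M01 ..
  define f where "f x s = u x * (indicator {..<x} s * w s)" for x s
  have id[measurable]: "(\<lambda>x. x) \<in> borel_measurable M01" by (rule ident_measurable_M01)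
  have um[measurable]: "u \<in> borel_measurable M01" "w \<in> borel_measurable M01" using u w by auto
  have "(\<lambda>p. fst p) \<in> borel_measurable (M01 \<Otimes>\<^sub>M M01)" "(\<lambda>p. snd p) \<in> borel_measurable (M01 \<Otimes>\<^sub>M M01)"
    using measurable_compose[OF measurable_fst id] measurable_compose[OF measurable_snd id] by auto
  then have "(\<lambda>p. if snd p < fst p then u (fst p) * w (snd p) else 0) \<in> borel_measurable (M01 \<Otimes>\<^sub>M M01)"
    by (intro measurable_If borel_measurable_times measurable_compose[OF measurable_fst um(1)]
        measurable_compose[OF measurable_snd um(2)] measurable_const borel_measurable_less) auto
  moreover have "(\<lambda>p. if snd p < fst p then u (fst p) * w (snd p) else 0) = case_prod f"
    by (auto simp: f_def)
  ultimately have fm[measurable]: "case_prod f \<in> borel_measurable (M01 \<Otimes>\<^sub>M M01)" by simp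
  have wi: "integrable M01 (\<lambda>s. f x s)" for x
    unfolding f_def using indicator_mult_integrable[OF w, of "{..<x}"] by simp
  have "integrable (M01 \<Otimes>\<^sub>M M01) (case_prod f)"
  proof (rule Fubini_integrable)
    show "AE x in M01. integrable M01 (\<lambda>s. case_prod f (x, s))" using wi by simp
    show "integrable M01 (\<lambda>x. LINT s|M01. norm (case_prod f (x, s)))"
    proof (rule Bochner_Integration.integrable_bound)
      show "integrable M01 (\<lambda>x. (LINT s|M01. \<bar>w s\<bar>) * u x)" using u by simp
      show "(\<lambda>x. LINT s|M01. norm (case_prod f (x, s))) \<in> borel_measurable M01" by measurable
      show "AE x in M01. norm (LINT s|M01. norm (case_prod f (x, s))) \<le> norm ((LINT s|M01. \<bar>w s\<bar>) * u x)"
      proof (rule AE_I2)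
        fix x
        have "(LINT s|M01. norm (case_prod f (x, s))) \<le> (LINT s|M01. \<bar>u x\<bar> * \<bar>w s\<bar>)"
        proof (rule integral_mono)
          show "integrable M01 (\<lambda>s. norm (case_prod f (x, s)))" using integrable_norm[OF wi[of x]] by simp
          show "integrable M01 (\<lambda>s. \<bar>u x\<bar> * \<bar>w s\<bar>)" using w by simp
        qed (auto simp: f_def abs_mult indicator_def)
        moreover have "0 \<le> (LINT s|M01. norm (case_prod f (x, s)))" by simp
        ultimately show "norm (LINT s|M01. norm (case_prod f (x, s))) \<le> norm ((LINT s|M01. \<bar>w s\<bar>) * u x)"
          by (simp add: abs_mult mult.commute)
      qed
    qed
  qed simp
  from Fubini_integral[OF this]
  have "(LINT s|M01. (LINT x|M01. f x s)) = (LINT x|M01. (LINT s|M01. f x s))" .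
  moreover have "(LINT x|M01. f x s) = w s * (LINT x|M01. indicator {s<..} x * u x)" for s
  proof -
    have "(LINT x|M01. f x s) = (LINT x|M01. w s * (indicator {s<..} x * u x))"
      by (rule Bochner_Integration.integral_cong) (auto simp: f_def indicator_def)
    then show ?thesis by simp
  qed
  moreover have "(LINT s|M01. f x s) = u x * (LINT s|M01. indicator {..<x} s * w s)" for x
    unfolding f_def by simp
  ultimately show ?thesis by simp
qed

section \<open>Primitives of square integrable functions\<close>

text \<open>\<open>step\<close> and \<open>ramp\<close> are the kernels of the primitives:
  \<open>J1 g\<close> is the integral of g from 0, and \<open>J g\<close> the double primitive with
  vanishing value and slope at 0. Written as inner products they are linear and bounded in g at
  once, and differentiation in x becomes differentiation of the kernel in L^2.\<close>

definition ramp :: "real \<Rightarrow> l2" where "ramp x = abs_l2 (\<lambda>s. max 0 (x - s))"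
definition step :: "real \<Rightarrow> l2" where "step x = abs_l2 (indicator {..<x})"
definition J :: "l2 \<Rightarrow> fn" where "J g x = ramp x \<bullet> g"
definition J1 :: "l2 \<Rightarrow> fn" where "J1 g x = step x \<bullet> g"

lemma ramp_L2: "(\<lambda>s. max 0 (x - s)) \<in> L2"
  by (intro continuous_L2 continuous_intros)

lemma step_L2: "indicator {..<x} \<in> L2"
  by (rule L2_dominated[OF indicator_measurable_M01 L2_const[of 1], of _ 1]) (auto simp: indicator_def)

lemma J1_abs: "w \<in> L2 \<Longrightarrow> J1 (abs_l2 w) x = (LINT s|M01. indicator {..<x} s * w s)"
  by (simp add: J1_def step_def inner_abs_l2 step_L2)

lemma J_abs: "w \<in> L2 \<Longrightarrow> J (abs_l2 w) x = (LINT s|M01. max 0 (x - s) * w s)"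
  by (simp add: J_def ramp_def inner_abs_l2 ramp_L2)

lemma J_linear: "J (g + h) x = J g x + J h x" "J (c *\<^sub>R g) x = c * J g x" "J (g - h) x = J g x - J h x"
  and J1_linear: "J1 (g + h) x = J1 g x + J1 h x" "J1 (c *\<^sub>R g) x = c * J1 g x" "J1 (g - h) x = J1 g x - J1 h x"
  by (simp_all add: J_def J1_def inner_add_right inner_diff_right)

text \<open>The difference is the indicator of an interval of length |y - x|; this makes
  \<open>J1 g\<close> Hoelder continuous with exponent 1/2.\<close>

lemma norm_step_diff:
  assumes "x \<in> {0..1}" "y \<in> {0..1}"
  shows "(norm (step y - step x))\<^sup>2 = \<bar>y - x\<bar>"
proof -
  have w: "(norm (step y - step x))\<^sup>2 = y - x" if "x \<in> {0..1}" "y \<in> {0..1}" "x \<le> y" for x y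
  proof -
    have "(norm (step y - step x))\<^sup>2 = (LINT s|M01. (indicator {..<y} s - indicator {..<x} s)\<^sup>2)"
      unfolding step_def minus_abs_l2[OF step_L2 step_L2] by (rule norm_abs_l2_sq[OF L2_diff[OF step_L2 step_L2]])
    also have "\<dots> = (LINT s|M01. indicator {x..<y} s *\<^sub>R 1)"
      by (rule Bochner_Integration.integral_cong) (use that in \<open>auto simp: indicator_def\<close>)
    also have "\<dots> = (LINT s|M01. indicator {x<..<y} s * 1)"
    proof (rule integral_cong_AE)
      show "AE s in M01. indicator {x..<y} s *\<^sub>R 1 = indicator {x<..<y} s * (1::real)"
        using AE_M01_neq[of x] by eventually_elim (auto simp: indicator_def)
    qed (auto intro: indicator_measurable_M01)
    also have "\<dots> = integral {x..y} (\<lambda>_. 1)" using that by (intro M01_integral_Ioo) auto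
    finally show ?thesis using that by simp
  qed
  show ?thesis using w[OF assms] w[OF assms(2,1)] by (cases "x \<le> y") (auto simp: norm_minus_commute)
qed

lemma step_0: "step 0 = 0"
  unfolding step_def abs_l2_zero[symmetric]
  by (subst abs_l2_eq_iff) (auto simp: step_L2 ae_eq_def intro!: AE_I2)

lemma ramp_0: "ramp 0 = 0"
  unfolding ramp_def abs_l2_zero[symmetric]
  by (subst abs_l2_eq_iff) (use ramp_L2[of 0] in \<open>auto simp: ae_eq_def intro!: AE_I2\<close>)

lemma norm_step: "x \<in> {0..1} \<Longrightarrow> (norm (step x))\<^sup>2 = x"
  using norm_step_diff[of 0 x] by (simp add: step_0)

lemma step_tendsto:
  assumes "x \<in> {0..1}" shows "(step \<longlongrightarrow> step x) (at x within {0..1})"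
proof -
  have "((\<lambda>y. sqrt \<bar>y - x\<bar>) \<longlongrightarrow> sqrt \<bar>x - x\<bar>) (at x within {0..1})" by (intro tendsto_intros)
  then have l: "((\<lambda>y. sqrt \<bar>y - x\<bar>) \<longlongrightarrow> 0) (at x within {0..1})" by simp
  have ev: "\<forall>\<^sub>F y in at x within {0..1}. norm (step y - step x) \<le> sqrt \<bar>y - x\<bar>"
    unfolding eventually_at_filter
    by (intro always_eventually allI impI real_le_rsqrt) (use norm_step_diff[OF assms] in auto)
  have "((\<lambda>y. step y - step x) \<longlongrightarrow> 0) (at x within {0..1})"
    by (rule Lim_null_comparison[OF ev l])
  then show ?thesis by (simp add: LIM_zero_iff)
qed

text \<open>Pointwise, the function on the left vanishes outside the interval between x and y and is
  at most |y - x| inside.\<close>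

lemma ramp_increment:
  "norm (ramp y - ramp x - (y - x) *\<^sub>R step x) \<le> \<bar>y - x\<bar> * norm (step y - step x)"
proof -
  have e: "ramp y - ramp x - (y - x) *\<^sub>R step x
      = abs_l2 (\<lambda>s. max 0 (y - s) - max 0 (x - s) - (y - x) * indicator {..<x} s)"
    unfolding ramp_def step_def by (simp only: minus_abs_l2 scaleR_abs_l2 L2_diff L2_scale ramp_L2 step_L2)
  have f: "(y - x) *\<^sub>R (step y - step x) = abs_l2 (\<lambda>s. (y - x) * (indicator {..<y} s - indicator {..<x} s))"
    unfolding step_def by (simp only: minus_abs_l2 scaleR_abs_l2 L2_diff step_L2)
  have "norm (ramp y - ramp x - (y - x) *\<^sub>R step x) \<le> norm ((y - x) *\<^sub>R (step y - step x))"
    unfolding e f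
  proof (rule norm_abs_l2_le)
    show "(\<lambda>s. max 0 (y - s) - max 0 (x - s) - (y - x) * indicator {..<x} s) \<in> L2"
      "(\<lambda>s. (y - x) * (indicator {..<y} s - indicator {..<x} s)) \<in> L2"
      by (intro L2_diff L2_scale ramp_L2 step_L2)+
  qed (auto simp: indicator_def abs_if max_def intro!: AE_I2)
  then show ?thesis by simp
qed

lemma ramp_derivative:
  assumes "x \<in> {0..1}" shows "(ramp has_vector_derivative step x) (at x within {0..1})"
  unfolding has_vector_derivative_def has_derivative_within
proof
  show "bounded_linear (\<lambda>r. r *\<^sub>R step x)" by (rule bounded_linear_scaleR_left)
  have "((\<lambda>y. norm (step y - step x)) \<longlongrightarrow> norm (step x - step x)) (at x within {0..1})"
    by (intro tendsto_intros step_tendsto[OF assms])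
  then have "((\<lambda>y. norm (step y - step x)) \<longlongrightarrow> 0) (at x within {0..1})" by simp
  then show "((\<lambda>y. (1 / norm (y - x)) *\<^sub>R (ramp y - (ramp x + (y - x) *\<^sub>R step x))) \<longlongrightarrow> 0) (at x within {0..1})"
  proof (rule Lim_null_comparison[rotated])
    show "\<forall>\<^sub>F y in at x within {0..1}. norm ((1 / norm (y - x)) *\<^sub>R (ramp y - (ramp x + (y - x) *\<^sub>R step x))) \<le> norm (step y - step x)"
      unfolding eventually_at_filter
    proof (intro always_eventually allI impI)
      fix y assume "y \<noteq> x"
      then show "norm ((1 / norm (y - x)) *\<^sub>R (ramp y - (ramp x + (y - x) *\<^sub>R step x))) \<le> norm (step y - step x)"
        using ramp_increment[of y x] by (simp add: divide_le_eq mult.commute diff_diff_eq)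
    qed
  qed
qed

lemma J_derivative:
  assumes "x \<in> {0..1}" shows "(J g has_real_derivative J1 g x) (at x within {0..1})"
proof -
  have "((\<lambda>y. ramp y \<bullet> g) has_derivative (\<lambda>h. (h *\<^sub>R step x) \<bullet> g)) (at x within {0..1})"
    using ramp_derivative[OF assms] unfolding has_vector_derivative_def
    by (rule has_derivative_inner_left)
  then show ?thesis
    by (simp add: has_field_derivative_def J_def[abs_def] J1_def mult.commute[of _ "step x \<bullet> g"])
qed

lemma J1_continuous: "continuous_on {0..1} (J1 g)"
  unfolding continuous_on_def J1_def by (intro ballI tendsto_inner tendsto_const step_tendsto)

lemma J_continuous: "continuous_on {0..1} (J g)"
  unfolding continuous_on_eq_continuous_within
  by (intro ballI DERIV_continuous[OF J_derivative])

lemma J_0: "J g 0 = 0" and J1_0: "J1 g 0 = 0"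
  by (simp_all add: J_def J1_def ramp_0 step_0)

lemma J1_bound:
  assumes "x \<in> {0..1}" shows "\<bar>J1 g x\<bar> \<le> norm g"
proof -
  have "(norm (step x))\<^sup>2 \<le> 1\<^sup>2" using norm_step[OF assms] assms by simp
  then have "norm (step x) \<le> 1" by (rule power2_le_imp_le) simp
  then show ?thesis
    using Cauchy_Schwarz_ineq2[of "step x" g] mult_right_mono[of "norm (step x)" 1 "norm g"]
    unfolding J1_def by simp
qed

text \<open>The linear rate in x compensates for the vanishing of sqrt a at 0; this is what keeps J
  g / sqrt a bounded.\<close>

lemma J_bound:
  assumes "x \<in> {0..1}" shows "\<bar>J g x\<bar> \<le> x * norm g"
proof -
  have "norm (J g x - J g 0) \<le> norm g * norm (x - 0)"
  proof (rule field_differentiable_bound[of "{0..1}" "J g" "J1 g"])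
    show "(J g has_field_derivative J1 g z) (at z within {0..1})" if "z \<in> {0..1}" for z
      by (rule J_derivative[OF that])
    show "norm (J1 g z) \<le> norm g" if "z \<in> {0..1}" for z using J1_bound[OF that] by simp
  qed (use assms in auto)
  then show ?thesis using assms by (simp add: J_0 mult.commute)
qed

lemma J_L2: "J g \<in> L2" and J1_L2: "J1 g \<in> L2"
  by (intro continuous_L2 J_continuous J1_continuous)+

lemma J1_eq_integral:
  assumes "w \<in> L2" "0 \<le> a" "a \<le> x" "x \<le> 1" "continuous_on {a..x} w"
  shows "J1 (abs_l2 w) x = J1 (abs_l2 w) a + integral {a..x} w"
proof -
  have wi: "integrable M01 w" by (rule L2_integrable[OF assms(1)])
  have "J1 (abs_l2 w) x = (LINT s|M01. indicator {..<a} s * w s + indicator {a..<x} s * w s)"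
    unfolding J1_abs[OF assms(1)]
    by (rule Bochner_Integration.integral_cong) (use assms in \<open>auto simp: indicator_def\<close>)
  also have "\<dots> = J1 (abs_l2 w) a + (LINT s|M01. indicator {a..<x} s * w s)"
    unfolding J1_abs[OF assms(1)]
    by (intro Bochner_Integration.integral_add indicator_mult_integrable[OF wi]) auto
  also have "(LINT s|M01. indicator {a..<x} s * w s) = (LINT s|M01. indicator {a<..<x} s * w s)"
  proof (rule integral_cong_AE)
    show "AE s in M01. indicator {a..<x} s * w s = indicator {a<..<x} s * w s"
      using AE_M01_neq[of a] by eventually_elim (auto simp: indicator_def)
  qed (use indicator_mult_integrable[OF wi] in \<open>auto intro!: borel_measurable_integrable\<close>)
  also have "\<dots> = integral {a..x} w" by (rule M01_integral_Ioo) (use assms in auto)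
  finally show ?thesis .
qed

text \<open>\<open>w\<close> need not be continuous, so \<open>triangle_fubini\<close> replaces the
  classical integration by parts.\<close>

lemma J1_weak_derivative:
  assumes "w \<in> L2" "\<phi> \<in> test_functions"
  shows "(LINT x|M01. J1 (abs_l2 w) x * deriv \<phi> x) = - (LINT x|M01. w x * \<phi> x)"
proof -
  have "(LINT x|M01. J1 (abs_l2 w) x * deriv \<phi> x) = (LINT x|M01. deriv \<phi> x * (LINT s|M01. indicator {..<x} s * w s))"
    by (simp add: J1_abs[OF assms(1)] mult.commute)
  also have "\<dots> = (LINT s|M01. w s * (LINT x|M01. indicator {s<..} x * deriv \<phi> x))"
    by (intro triangle_fubini L2_integrable assms test_L2 test_deriv)
  also have "\<dots> = (LINT s|M01. - (w s * \<phi> s))"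
  proof (rule Bochner_Integration.integral_cong[OF refl])
    fix s assume "s \<in> space M01"
    then have s: "0 < s" "s < 1" by auto
    have "(LINT x|M01. indicator {s<..} x * deriv \<phi> x) = (LINT x|M01. indicator {s<..<1} x * deriv \<phi> x)"
      by (rule Bochner_Integration.integral_cong) (auto simp: indicator_def)
    also have "\<dots> = integral {s..1} (deriv \<phi>)"
      using s by (intro M01_integral_Ioo smooth_continuous test_smooth test_deriv assms) auto
    also have "\<dots> = \<phi> 1 - \<phi> s"
      using s by (intro integral_unique fundamental_theorem_of_calculus)
        (auto simp: has_real_derivative_iff_has_vector_derivative[symmetric] intro!: has_field_derivative_at_within smooth_DERIV test_smooth assms)
    finally show "w s * (LINT x|M01. indicator {s<..} x * deriv \<phi> x) = - (w s * \<phi> s)"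
      using test_zero_outside[OF assms(2), of 1] by simp
  qed
  finally show ?thesis by simp
qed

lemma J_weak_derivative:
  assumes "\<phi> \<in> test_functions"
  shows "(LINT x|M01. J g x * deriv \<phi> x) = - (LINT x|M01. J1 g x * \<phi> x)"
proof -
  have c: "continuous_on {0..1} \<phi>" "continuous_on {0..1} (deriv \<phi>)"
    by (intro smooth_continuous test_smooth test_deriv assms)+
  have "((\<lambda>x. J g x * deriv \<phi> x + J1 g x * \<phi> x) has_integral (J g 1 * \<phi> 1 - J g 0 * \<phi> 0)) {0..1}"
  proof (rule fundamental_theorem_of_calculus)
    fix x :: real assume x: "x \<in> {0..1}"
    have "((\<lambda>x. J g x * \<phi> x) has_real_derivative (J1 g x * \<phi> x + deriv \<phi> x * J g x)) (at x within {0..1})"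
      by (rule DERIV_mult[OF J_derivative[OF x] has_field_derivative_at_within[OF smooth_DERIV[OF test_smooth[OF assms]]]])
    then show "((\<lambda>x. J g x * \<phi> x) has_vector_derivative (J g x * deriv \<phi> x + J1 g x * \<phi> x)) (at x within {0..1})"
      by (simp add: has_real_derivative_iff_has_vector_derivative algebra_simps)
  qed simp
  then have "integral {0..1} (\<lambda>x. J g x * deriv \<phi> x + J1 g x * \<phi> x) = 0"
    using test_zero_outside[OF assms] by (simp add: integral_unique)
  then have "(LINT x|M01. J g x * deriv \<phi> x + J1 g x * \<phi> x) = 0"
    by (subst M01_integral) (auto intro!: continuous_intros c J_continuous J1_continuous)
  moreover have "(LINT x|M01. J g x * deriv \<phi> x + J1 g x * \<phi> x) = (LINT x|M01. J g x * deriv \<phi> x) + (LINT x|M01. J1 g x * \<phi> x)"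
    by (intro Bochner_Integration.integral_add L2_mult_integrable J_L2 J1_L2 test_L2 test_deriv assms)
  ultimately show ?thesis by simp
qed

abbreviation second_deriv :: "fn \<Rightarrow> l2" where "second_deriv \<phi> \<equiv> abs_l2 (deriv (deriv \<phi>))"

lemma J1_second_deriv:
  assumes \<phi>: "\<phi> \<in> test_functions" and x: "x \<in> {0..1}"
  shows "J1 (second_deriv \<phi>) x = deriv \<phi> x"
proof -
  have "J1 (second_deriv \<phi>) x = 0 + integral {0..x} (deriv (deriv \<phi>))"
    using J1_eq_integral[OF test_L2[OF test_deriv[OF test_deriv[OF \<phi>]]], of 0 x] x
    by (simp add: J1_0 smooth_continuous test_smooth test_deriv \<phi>)
  also have "integral {0..x} (deriv (deriv \<phi>)) = deriv \<phi> x - deriv \<phi> 0"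
    using x by (intro integral_unique fundamental_theorem_of_calculus)
      (auto simp: has_real_derivative_iff_has_vector_derivative[symmetric] intro!: has_field_derivative_at_within smooth_DERIV test_smooth test_deriv \<phi>)
  also have "deriv \<phi> 0 = 0" by (rule test_zero_outside[OF test_deriv[OF \<phi>]]) simp
  finally show ?thesis by simp
qed

lemma J_eqI:
  assumes x: "x \<in> {0..1}" and F: "F 0 = 0"
    and d: "\<And>y. y \<in> {0..1} \<Longrightarrow> (F has_real_derivative J1 g y) (at y within {0..1})"
  shows "J g x = F x"
proof -
  have "\<exists>c. \<forall>y\<in>{0..1}. J g y - F y = c"
  proof (rule has_field_derivative_zero_constant)
    show "((\<lambda>y. J g y - F y) has_field_derivative 0) (at y within {0..1})" if "y \<in> {0..1}" for y
      using DERIV_diff[OF J_derivative[OF that, of g] d[OF that]] by simp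
  qed simp
  then obtain c where c: "\<And>y. y \<in> {0..1} \<Longrightarrow> J g y - F y = c" by blast
  show ?thesis using c[OF x] c[of 0] F J_0[of g] by simp
qed

lemma J_second_deriv:
  assumes \<phi>: "\<phi> \<in> test_functions" and x: "x \<in> {0..1}"
  shows "J (second_deriv \<phi>) x = \<phi> x"
proof (rule J_eqI[OF x])
  show "\<phi> 0 = 0" using test_zero_outside[OF \<phi>, of 0] by simp
  show "(\<phi> has_real_derivative J1 (second_deriv \<phi>) y) (at y within {0..1})" if "y \<in> {0..1}" for y
    unfolding J1_second_deriv[OF \<phi> that] by (rule has_field_derivative_at_within[OF smooth_DERIV[OF test_smooth[OF \<phi>]]])
qed

text \<open>Integrating \<open>\<psi>\<close> twice from 0 leaves, to the right of its support, an
  affine function whose coefficients are the two moments up to sign. Vanishing moments therefore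
  give compact support.\<close>

lemma test_second_antiderivative:
  assumes \<psi>: "\<psi> \<in> test_functions" and m0: "(LINT x|M01. \<psi> x) = 0" and m1: "(LINT x|M01. x * \<psi> x) = 0"
  obtains \<phi> where "\<phi> \<in> test_functions" "deriv (deriv \<phi>) = \<psi>"
proof -
  obtain c d where cd: "0 < c" "c < d" "d < 1" "\<And>x. x \<notin> {c<..<d} \<Longrightarrow> \<psi> x = 0"
    using test_support[OF \<psi>] by blast
  have \<psi>L: "\<psi> \<in> L2" "continuous_on S \<psi>" for S by (intro test_L2 smooth_continuous test_smooth \<psi>)+
  have xL: "(\<lambda>x. x) \<in> L2" by (intro continuous_L2 continuous_intros)
  define g where "g = abs_l2 \<psi>"
  \<comment> \<open>Cut off outside (0, 1), since the derivative of \<open>J g\<close> is known only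
    on [0, 1]; \<open>der\<close> checks that the pieces fit together smoothly.\<close>
  define F1 where "F1 x = (if x \<in> {0<..<1} then J1 g x else 0)" for x
  define F0 where "F0 x = (if x \<in> {0<..<1} then J g x else 0)" for x
  have J1z: "J1 g x = 0" "J g x = 0" if x: "x \<in> {0<..<1}" "x \<notin> {c..d}" for x
  proof -
    consider "x < c" | "x > d" using x by force
    then have "(LINT s|M01. indicator {..<x} s * \<psi> s) = 0 \<and> (LINT s|M01. max 0 (x - s) * \<psi> s) = 0"
    proof cases
      case 1
      have "(LINT s|M01. indicator {..<x} s * \<psi> s) = (LINT s|M01. 0)"
        by (rule Bochner_Integration.integral_cong) (use 1 cd in \<open>auto simp: indicator_def\<close>)
      moreover have "(LINT s|M01. max 0 (x - s) * \<psi> s) = (LINT s|M01. 0)"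
        by (rule Bochner_Integration.integral_cong) (use 1 cd in \<open>auto simp: max_def\<close>)
      ultimately show ?thesis by simp
    next
      case 2
      have "(LINT s|M01. indicator {..<x} s * \<psi> s) = (LINT s|M01. \<psi> s)"
        by (rule Bochner_Integration.integral_cong) (use 2 cd in \<open>auto simp: indicator_def\<close>)
      moreover have "(LINT s|M01. max 0 (x - s) * \<psi> s) = (LINT s|M01. x * \<psi> s - s * \<psi> s)"
        by (rule Bochner_Integration.integral_cong) (use 2 cd in \<open>auto simp: max_def algebra_simps\<close>)
      moreover have "\<dots> = (LINT s|M01. x * \<psi> s) - (LINT s|M01. s * \<psi> s)"
        by (intro Bochner_Integration.integral_diff L2_mult_integrable[OF xL \<psi>L(1)])
          (use L2_integrable[OF \<psi>L(1)] in simp)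
      ultimately show ?thesis using m0 m1 by simp
    qed
    then show "J1 g x = 0" "J g x = 0" unfolding g_def J1_abs[OF \<psi>L(1)] J_abs[OF \<psi>L(1)] by auto
  qed
  have der: "(F has_real_derivative F' x) (at x)"
    if F: "F = (\<lambda>x. if x \<in> {0<..<1} then h x else 0)" and hz: "\<And>x. x \<in> {0<..<1} \<Longrightarrow> x \<notin> {c..d} \<Longrightarrow> h x = 0"
      and h: "\<And>x. x \<in> {0<..<1} \<Longrightarrow> (h has_real_derivative F' x) (at x)"
      and F'z: "\<And>x. x \<notin> {c..d} \<Longrightarrow> F' x = 0" for F F' h :: fn and x
  proof (cases "x \<in> {0<..<1}")
    case True
    show ?thesis
      by (rule has_field_derivative_transform_within_open[OF h[OF True], of "{0<..<1}"]) (use True F in auto)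
  next
    case False
    then have x: "x \<notin> {c..d}" using cd by auto
    have "((\<lambda>x. 0) has_real_derivative F' x) (at x)" using F'z[OF x] by simp
    then show ?thesis
      by (rule has_field_derivative_transform_within_open[of _ _ _ "- {c..d}"]) (use x F hz in auto)
  qed
  have d1: "(F1 has_real_derivative \<psi> x) (at x)" for x
  proof (rule der[of F1 "J1 g"])
    show "F1 = (\<lambda>x. if x \<in> {0<..<1} then J1 g x else 0)" by (simp add: F1_def[abs_def])
    fix x :: real
    show "x \<notin> {c..d} \<Longrightarrow> \<psi> x = 0" using cd(4)[of x] by auto
    show "x \<in> {0<..<1} \<Longrightarrow> x \<notin> {c..d} \<Longrightarrow> J1 g x = 0" by (rule J1z)
    assume x: "x \<in> {0<..<1}"
    have "((\<lambda>y. integral {0..y} \<psi>) has_real_derivative \<psi> x) (at x within {0..1})"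
      by (rule integral_has_real_derivative[OF \<psi>L(2)]) (use x in auto)
    then have "((\<lambda>y. integral {0..y} \<psi>) has_real_derivative \<psi> x) (at x)"
      using x at_within_Icc_at[of 0 x 1] by simp
    then show "(J1 g has_real_derivative \<psi> x) (at x)"
    proof (rule has_field_derivative_transform_within_open[of _ _ _ "{0<..<1}"])
      show "integral {0..y} \<psi> = J1 g y" if "y \<in> {0<..<1}" for y
        using J1_eq_integral[OF \<psi>L(1), of 0 y] that \<psi>L(2) by (simp add: J1_0 g_def)
    qed (use x in auto)
  qed
  have d0: "(F0 has_real_derivative F1 x) (at x)" for x
  proof (rule der[of F0 "J g"])
    show "F0 = (\<lambda>x. if x \<in> {0<..<1} then J g x else 0)" by (simp add: F0_def[abs_def])
    fix x :: real
    show "x \<notin> {c..d} \<Longrightarrow> F1 x = 0" using J1z(1)[of x] by (auto simp: F1_def)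
    show "x \<in> {0<..<1} \<Longrightarrow> x \<notin> {c..d} \<Longrightarrow> J g x = 0" by (rule J1z)
    assume x: "x \<in> {0<..<1}"
    then show "(J g has_real_derivative F1 x) (at x)"
      using J_derivative[of x g] at_within_Icc_at[of 0 x 1] by (simp add: F1_def)
  qed
  have "smooth F0"
  proof (rule smooth_coinduct[where A = "{F0, F1} \<union> {f. smooth f}"])
    fix h assume "h \<in> {F0, F1} \<union> {f. smooth f}"
    then consider "h = F0" | "h = F1" | "smooth h" by blast
    then show "\<exists>g'\<in>{F0, F1} \<union> {f. smooth f}. \<forall>x. (h has_real_derivative g' x) (at x)"
    proof cases
      case 1 then show ?thesis using d0 by (intro bexI[of _ F1]) auto
    next
      case 2 then show ?thesis using d1 test_smooth[OF \<psi>] by (intro bexI[of _ \<psi>]) auto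
    next
      case 3 then show ?thesis using smooth_DERIV smooth_deriv by (intro bexI[of _ "deriv h"]) auto
    qed
  qed simp
  then have "F0 \<in> test_functions"
  proof (rule test_I[OF _ cd(1,3)])
    fix x assume "x \<notin> {c..d}"
    then show "F0 x = 0" using J1z(2)[of x] by (auto simp: F0_def)
  qed
  moreover have "deriv F0 = F1" "deriv F1 = \<psi>" using d0 d1 DERIV_imp_deriv by blast+
  ultimately show ?thesis using that[of F0] by simp
qed

lemma L2_locally_integrable: "u \<in> L2 \<Longrightarrow> locally_integrable u"
proof -
  assume u: "u \<in> L2"
  show ?thesis unfolding locally_integrable_def
  proof (intro allI impI)
    fix c d :: real assume "0 < c \<and> d < 1"
    then have sub: "{c..d} \<subseteq> {0<..<1}" by auto
    have "set_integrable lebesgue {0<..<1} u"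
      using L2_integrable[OF u] by (simp add: set_integrable_def integrable_restrict_space)
    then have "set_integrable lebesgue {c..d} u" by (rule set_integrable_subset[OF _ _ sub]) simp
    then show "integrable (lebesgue_on {c..d}) u"
      by (simp add: set_integrable_def integrable_restrict_space)
  qed
qed

text \<open>The du Bois-Reymond lemma of second order. Subtracting a combination of two fixed test
  functions with moments (1, 0) and (0, 1) turns any \<open>\<psi>\<close> into the second
  derivative of a test function. Testing \<open>w\<close> with it shows that \<open>w\<close> minus
  an affine function annihilates all test functions.\<close>

theorem orthogonal_to_second_derivs:
  assumes "\<And>\<phi>. \<phi> \<in> test_functions \<Longrightarrow> z \<bullet> second_deriv \<phi> = 0"
  shows "\<exists>\<alpha> \<beta>. z = abs_l2 (\<lambda>x. \<alpha> + \<beta> * x)"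
proof -
  obtain w where w: "w \<in> L2" "z = abs_l2 w" by (rule l2_cases)
  have xL: "(\<lambda>x. x) \<in> L2" by (intro continuous_L2 continuous_intros)
  \<comment> \<open>Otherwise the fundamental lemma, applied to the constant 1, would give 1 =
    0.\<close>
  have "\<exists>b\<in>test_functions. (LINT x|M01. b x) \<noteq> 0"
  proof (rule ccontr)
    assume "\<not> (\<exists>b\<in>test_functions. (LINT x|M01. b x) \<noteq> 0)"
    then have "AE x in M01. (1::real) = 0"
      by (intro fundamental_lemma L2_locally_integrable L2_const) auto
    then have "AE x in M01. False" by simp
    then have "emeasure M01 {x \<in> space M01. True} = 0"
      by (intro emeasure_eq_0_AE) simp
    then have "emeasure M01 (space M01) = 0" by (simp only: Collect_mem_eq simp_thms)
    then show False using measure_M01_space by (simp add: measure_def)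
  qed
  then obtain b where b: "b \<in> test_functions" "(LINT x|M01. b x) \<noteq> 0" by blast
  define I where "I = (LINT x|M01. b x)"
  define m where "m = (LINT x|M01. x * b x)"
  have I: "I \<noteq> 0" using b I_def by simp
  have b'0: "(LINT x|M01. deriv b x) = 0" and b'1: "(LINT x|M01. x * deriv b x) = - I"
  proof -
    have c: "continuous_on {0..1} b" "continuous_on {0..1} (deriv b)"
      by (intro smooth_continuous test_smooth test_deriv b)+
    have i: "(deriv b has_integral (b 1 - b 0)) {0..1}"
      by (intro fundamental_theorem_of_calculus)
        (auto simp: has_real_derivative_iff_has_vector_derivative[symmetric] intro!: has_field_derivative_at_within smooth_DERIV test_smooth b)
    then show "(LINT x|M01. deriv b x) = 0"
      using M01_integral[OF c(2)] test_zero_outside[OF b(1)] by (simp add: integral_unique)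
    have "((\<lambda>x. x * deriv b x + b x) has_integral (1 * b 1 - 0 * b 0)) {0..1}"
    proof (rule fundamental_theorem_of_calculus)
      fix x :: real
      have "((\<lambda>x. x * b x) has_real_derivative (1 * b x + deriv b x * x)) (at x within {0..1})"
        by (rule DERIV_mult[OF DERIV_ident has_field_derivative_at_within[OF smooth_DERIV[OF test_smooth[OF b(1)]]]])
      then show "((\<lambda>x. x * b x) has_vector_derivative x * deriv b x + b x) (at x within {0..1})"
        by (simp add: has_real_derivative_iff_has_vector_derivative algebra_simps)
    qed simp
    then have "(LINT x|M01. x * deriv b x + b x) = 0"
      using test_zero_outside[OF b(1)]
      by (subst M01_integral) (auto intro!: continuous_intros c simp: integral_unique)
    moreover have "(LINT x|M01. x * deriv b x + b x) = (LINT x|M01. x * deriv b x) + I"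
      unfolding I_def by (intro Bochner_Integration.integral_add L2_mult_integrable xL test_L2 test_deriv b L2_integrable)
    ultimately show "(LINT x|M01. x * deriv b x) = - I" by simp
  qed
  \<comment> \<open>By \<open>b'0\<close> and \<open>b'1\<close> the function \<open>\<rho>1\<close>
    has moments 0 and 1; \<open>\<rho>0\<close> normalises the mean of \<open>b\<close> and uses
    \<open>\<rho>1\<close> to remove its first moment.\<close>
  define \<rho>1 where "\<rho>1 x = (- 1 / I) * deriv b x" for x
  define \<rho>0 where "\<rho>0 x = (1 / I) * b x + (- m / I) * \<rho>1 x" for x
  have \<rho>: "\<rho>1 \<in> test_functions" "\<rho>0 \<in> test_functions"
    unfolding \<rho>1_def[abs_def] \<rho>0_def[abs_def] by (intro test_add test_scale test_deriv b)+
  have lin: "(LINT x|M01. u x * (p * \<phi> x + q * \<psi> x)) = p * (LINT x|M01. u x * \<phi> x) + q * (LINT x|M01. u x * \<psi> x)"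
    if "u \<in> L2" "\<phi> \<in> test_functions" "\<psi> \<in> test_functions" for u \<phi> \<psi> p q
  proof -
    have "(\<lambda>x. u x * (p * \<phi> x + q * \<psi> x)) = (\<lambda>x. p * (u x * \<phi> x) + q * (u x * \<psi> x))" by (auto simp: algebra_simps)
    then show ?thesis using L2_mult_integrable[OF that(1) test_L2[OF that(2)]] L2_mult_integrable[OF that(1) test_L2[OF that(3)]]
      by simp
  qed
  have mom1: "(LINT x|M01. 1 * \<rho>1 x) = 0" "(LINT x|M01. x * \<rho>1 x) = 1"
    using lin[OF L2_const[of 1] test_deriv[OF b(1)] b(1), of "-1/I" 0] lin[OF xL test_deriv[OF b(1)] b(1), of "-1/I" 0] b'0 b'1 I
    by (simp_all add: \<rho>1_def)
  have mom0: "(LINT x|M01. 1 * \<rho>0 x) = 1" "(LINT x|M01. x * \<rho>0 x) = 0"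
    unfolding \<rho>0_def lin[OF L2_const b(1) \<rho>(1)] lin[OF xL b(1) \<rho>(1)] mom1 using I by (simp_all add: I_def[symmetric] m_def[symmetric])
  define \<alpha> where "\<alpha> = (LINT x|M01. w x * \<rho>0 x)"
  define \<beta> where "\<beta> = (LINT x|M01. w x * \<rho>1 x)"
  have affL: "(\<lambda>x. \<alpha> + \<beta> * x) \<in> L2" by (intro continuous_L2 continuous_intros)
  have "AE x in M01. w x - (\<alpha> + \<beta> * x) = 0"
  proof (rule fundamental_lemma[OF L2_locally_integrable[OF L2_diff[OF w(1) affL]]])
    fix \<psi> assume \<psi>: "\<psi> \<in> test_functions"
    define p q where "p = (LINT x|M01. 1 * \<psi> x)" and "q = (LINT x|M01. x * \<psi> x)"
    define \<kappa> where "\<kappa> x = 1 * \<psi> x + (-1) * (p * \<rho>0 x + q * \<rho>1 x)" for x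
    have pq: "(\<lambda>x. p * \<rho>0 x + q * \<rho>1 x) \<in> test_functions" by (intro test_add test_scale \<rho>)
    have \<kappa>: "\<kappa> \<in> test_functions" unfolding \<kappa>_def[abs_def] by (intro test_add test_scale \<rho> \<psi>)
    have e: "(LINT x|M01. u x * \<kappa> x) = (LINT x|M01. u x * \<psi> x) - (p * (LINT x|M01. u x * \<rho>0 x) + q * (LINT x|M01. u x * \<rho>1 x))"
      if "u \<in> L2" for u
      unfolding \<kappa>_def lin[OF that \<psi> pq] lin[OF that \<rho>(2,1)] by simp
    have "(LINT x|M01. 1 * \<kappa> x) = 0" "(LINT x|M01. x * \<kappa> x) = 0"
      unfolding e[OF L2_const] e[OF xL] mom0 mom1 by (simp_all add: p_def q_def)
    then obtain \<phi> where \<phi>: "\<phi> \<in> test_functions" "deriv (deriv \<phi>) = \<kappa>"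
      using test_second_antiderivative[OF \<kappa>] by auto
    have "(LINT x|M01. w x * \<kappa> x) = 0"
      using assms[OF \<phi>(1)] \<phi>(2) by (simp add: w inner_abs_l2 test_L2[OF \<kappa>])
    then have "(LINT x|M01. w x * \<psi> x) = \<alpha> * p + \<beta> * q"
      using e[OF w(1)] by (simp add: \<alpha>_def \<beta>_def algebra_simps)
    moreover have "(LINT x|M01. (w x - (\<alpha> + \<beta> * x)) * \<psi> x)
        = (LINT x|M01. w x * \<psi> x - (\<alpha> * (1 * \<psi> x) + \<beta> * (x * \<psi> x)))"
      by (rule Bochner_Integration.integral_cong) (auto simp: algebra_simps)
    moreover have "\<dots> = (LINT x|M01. w x * \<psi> x) - (\<alpha> * p + \<beta> * q)"
      unfolding p_def q_def
      using L2_mult_integrable[OF w(1) test_L2[OF \<psi>]] L2_mult_integrable[OF xL test_L2[OF \<psi>]] L2_integrable[OF test_L2[OF \<psi>]]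
      by simp
    ultimately show "(LINT x|M01. (w x - (\<alpha> + \<beta> * x)) * \<psi> x) = 0" by simp
  qed
  then have "ae_eq w (\<lambda>x. \<alpha> + \<beta> * x)" by (simp add: ae_eq_def)
  then have "z = abs_l2 (\<lambda>x. \<alpha> + \<beta> * x)" using w affL by (simp add: abs_l2_eq_iff)
  then show ?thesis by blast
qed

section \<open>The space of second derivatives and bounded operators on L^2\<close>

text \<open>Stands for H^2_0: its elements are the second derivatives, and \<open>J\<close> recovers
  the functions (\<open>H2_0_iff\<close>).\<close>

definition N :: "l2 set" where "N = closure (second_deriv ` test_functions)"

lemma second_deriv_in_N: "\<phi> \<in> test_functions \<Longrightarrow> second_deriv \<phi> \<in> N"
  unfolding N_def by (rule subsetD[OF closure_subset]) (rule imageI)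

lemma closed_N: "closed N"
  by (simp add: N_def)

lemma deriv_lincomb:
  assumes "smooth \<phi>" "smooth \<psi>"
  shows "deriv (\<lambda>x. \<phi> x + c * \<psi> x) = (\<lambda>x. deriv \<phi> x + c * deriv \<psi> x)"
  by (rule ext, rule DERIV_imp_deriv, intro DERIV_add DERIV_cmult smooth_DERIV assms)

lemma subspace_N: "subspace N"
proof -
  have lc: "second_deriv \<phi> + c *\<^sub>R second_deriv \<psi> \<in> second_deriv ` test_functions"
    if "\<phi> \<in> test_functions" "\<psi> \<in> test_functions" for \<phi> \<psi> c
  proof (rule image_eqI)
    show "(\<lambda>x. \<phi> x + c * \<psi> x) \<in> test_functions" using that by (intro test_add test_scale)
    have "deriv (deriv (\<lambda>x. \<phi> x + c * \<psi> x)) = (\<lambda>x. deriv (deriv \<phi>) x + c * deriv (deriv \<psi>) x)"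
      using that by (simp add: deriv_lincomb test_smooth smooth_deriv)
    then show "second_deriv \<phi> + c *\<^sub>R second_deriv \<psi> = second_deriv (\<lambda>x. \<phi> x + c * \<psi> x)"
      using that by (simp add: scaleR_abs_l2 plus_abs_l2 test_L2 test_deriv)
  qed
  have lc': "x + c *\<^sub>R y \<in> second_deriv ` test_functions"
    if "x \<in> second_deriv ` test_functions" "y \<in> second_deriv ` test_functions" for x y c
    using that by (elim imageE) (simp only: lc)
  have lcN: "x + c *\<^sub>R y \<in> N" if xy: "x \<in> N" "y \<in> N" for x y c
  proof -
    obtain f where f: "\<forall>n. f n \<in> second_deriv ` test_functions" "f \<longlonglongrightarrow> x"
      using xy(1) unfolding N_def closure_sequential by (elim exE conjE)
    obtain g where g: "\<forall>n. g n \<in> second_deriv ` test_functions" "g \<longlonglongrightarrow> y"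
      using xy(2) unfolding N_def closure_sequential by (elim exE conjE)
    have "(\<lambda>n. f n + c *\<^sub>R g n) \<longlonglongrightarrow> x + c *\<^sub>R y" by (intro tendsto_intros f g)
    moreover have "f n + c *\<^sub>R g n \<in> second_deriv ` test_functions" for n
      using lc' f(1) g(1) by simp
    ultimately show ?thesis unfolding N_def closure_sequential
      by (intro exI[of _ "\<lambda>n. f n + c *\<^sub>R g n"]) simp
  qed
  \<comment> \<open>Some element of \<open>N\<close> has to be exhibited before \<open>lcN\<close>
    can produce 0 from it.\<close>
  have "plateau (1/4) (3/4) 0 \<in> test_functions" by (rule plateau_test) auto
  from second_deriv_in_N[OF this] obtain x where x: "x \<in> N" by metis
  have z: "0 \<in> N" using lcN[OF x x, of "-1"] by simp
  show ?thesis unfolding subspace_def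
    using z lcN[of _ _ 1] lcN[OF z] by simp
qed

text \<open>The clamped conditions at 1 hold for test functions and are closed conditions on g;
  those at 0 are built into \<open>J\<close> and \<open>J1\<close>.\<close>

lemma N_boundary:
  assumes "g \<in> N" shows "J g 1 = 0" "J1 g 1 = 0"
proof -
  have "N \<subseteq> {g. ramp 1 \<bullet> g = 0}" "N \<subseteq> {g. step 1 \<bullet> g = 0}"
    unfolding N_def
    using J_second_deriv[of _ 1] J1_second_deriv[of _ 1] test_zero_outside[of _ 1] test_deriv
    by (intro closure_minimal; auto simp: J_def J1_def intro!: closed_Collect_eq continuous_intros)+
  then show "J g 1 = 0" "J1 g 1 = 0" using assms by (auto simp: J_def J1_def)
qed

lemma Ioo_subset_Icc: "{0<..<1::real} \<subseteq> {0..1}"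
  by auto

lemma norm_const_l2: "norm (abs_l2 (\<lambda>x. c)) = \<bar>c\<bar>"
  using measure_M01_space by (simp add: norm_abs_l2 L2_norm_def)

lemma L2_bounded:
  assumes "u \<in> borel_measurable M01" "\<And>x. x \<in> {0<..<1} \<Longrightarrow> \<bar>u x\<bar> \<le> C"
  shows "u \<in> L2" "norm (abs_l2 u) \<le> \<bar>C\<bar>"
proof -
  have b: "AE x in M01. \<bar>u x\<bar> \<le> \<bar>C\<bar>" using assms(2) by (intro AE_I2) force
  show L: "u \<in> L2"
    by (rule L2_dominated[OF assms(1) L2_const[of 1], of "\<bar>C\<bar>"]) (use b in simp)
  have "norm (abs_l2 u) \<le> norm (abs_l2 (\<lambda>x. C))" by (rule norm_abs_l2_le[OF L L2_const b])
  then show "norm (abs_l2 u) \<le> \<bar>C\<bar>" by (simp add: norm_const_l2)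
qed

text \<open>For operators into bounded functions: since (0, 1) has measure 1, a pointwise bound by
  \<open>norm g\<close> gives square integrability and boundedness on L^2 together.\<close>

lemma bounded_linear_pointwise:
  fixes K :: "l2 \<Rightarrow> fn"
  assumes meas: "\<And>g. K g \<in> borel_measurable M01"
    and lin: "\<And>g h x. K (g + h) x = K g x + K h x" "\<And>c g x. K (c *\<^sub>R g) x = c * K g x"
    and bd: "\<And>g x. x \<in> {0<..<1} \<Longrightarrow> \<bar>K g x\<bar> \<le> C * norm g" and C: "C \<ge> 0"
  shows "K g \<in> L2" "bounded_linear (\<lambda>g. abs_l2 (K g))"
proof -
  have L: "K g \<in> L2" for g by (rule L2_bounded[OF meas bd])
  then show "K g \<in> L2" .
  show "bounded_linear (\<lambda>g. abs_l2 (K g))"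
  proof (rule bounded_linear_intro[of _ C])
    show "abs_l2 (K (g + h)) = abs_l2 (K g) + abs_l2 (K h)" for g h
      by (simp add: plus_abs_l2 L lin[abs_def])
    show "abs_l2 (K (c *\<^sub>R g)) = c *\<^sub>R abs_l2 (K g)" for c g
      by (simp add: scaleR_abs_l2 L lin[abs_def])
    show "norm (abs_l2 (K g)) \<le> norm g * C" for g
      using L2_bounded(2)[OF meas bd, of g] C by (simp add: abs_mult mult.commute)
  qed
qed

definition mult_op :: "fn \<Rightarrow> l2 \<Rightarrow> l2" where "mult_op m g = abs_l2 (\<lambda>x. m x * rep_l2 g x)"

lemma mult_op:
  assumes m: "m \<in> borel_measurable M01" "\<And>x. x \<in> {0<..<1} \<Longrightarrow> \<bar>m x\<bar> \<le> C"
  shows mult_op_L2: "w \<in> L2 \<Longrightarrow> (\<lambda>x. m x * w x) \<in> L2"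
    and mult_op_abs: "w \<in> L2 \<Longrightarrow> mult_op m (abs_l2 w) = abs_l2 (\<lambda>x. m x * w x)"
    and mult_op_bounded_linear: "bounded_linear (mult_op m)"
proof -
  have L: "(\<lambda>x. m x * w x) \<in> L2" and b: "norm (abs_l2 (\<lambda>x. m x * w x)) \<le> norm (abs_l2 w) * \<bar>C\<bar>" if w: "w \<in> L2" for w
  proof -
    have ae: "AE x in M01. \<bar>m x * w x\<bar> \<le> \<bar>C\<bar> * \<bar>w x\<bar>"
    proof (rule AE_I2)
      fix x assume "x \<in> space M01"
      then have "\<bar>m x\<bar> \<le> \<bar>C\<bar>" using m(2)[of x] by simp
      then show "\<bar>m x * w x\<bar> \<le> \<bar>C\<bar> * \<bar>w x\<bar>" by (simp add: abs_mult mult_right_mono)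
    qed
    show L: "(\<lambda>x. m x * w x) \<in> L2"
      by (rule L2_dominated[OF _ w ae]) (intro borel_measurable_times m L2_measurable w)
    have "norm (abs_l2 (\<lambda>x. m x * w x)) \<le> norm (abs_l2 (\<lambda>x. \<bar>C\<bar> * w x))"
      by (rule norm_abs_l2_le[OF L L2_scale[OF w]]) (use ae in \<open>simp add: abs_mult\<close>)
    then show "norm (abs_l2 (\<lambda>x. m x * w x)) \<le> norm (abs_l2 w) * \<bar>C\<bar>"
      by (simp add: scaleR_abs_l2[OF w, symmetric] mult.commute)
  qed
  show "w \<in> L2 \<Longrightarrow> (\<lambda>x. m x * w x) \<in> L2" by (rule L)
  show ab: "mult_op m (abs_l2 w) = abs_l2 (\<lambda>x. m x * w x)" if w: "w \<in> L2" for w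
    unfolding mult_op_def using rep_abs_l2[OF w] w L by (subst abs_l2_eq_iff) (auto simp: ae_eq_def)
  show "bounded_linear (mult_op m)"
  proof (rule bounded_linear_intro[of _ "\<bar>C\<bar>"])
    fix g h :: l2 and c :: real
    obtain u where u: "u \<in> L2" "g = abs_l2 u" by (rule l2_cases)
    obtain v where v: "v \<in> L2" "h = abs_l2 v" by (rule l2_cases)
    show "mult_op m (g + h) = mult_op m g + mult_op m h"
      by (simp add: u v plus_abs_l2 ab L algebra_simps)
    show "mult_op m (c *\<^sub>R g) = c *\<^sub>R mult_op m g"
      by (simp add: u scaleR_abs_l2 ab L algebra_simps)
    show "norm (mult_op m g) \<le> norm g * \<bar>C\<bar>"
      using b[OF u(1)] by (simp add: u ab)
  qed
qed

lemma continuous_AE_eq: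
  fixes f g :: fn
  assumes c: "continuous_on {0<..<1} f" "continuous_on {0<..<1} g" and ae: "AE x in M01. f x = g x" and x: "x \<in> {0<..<1}"
  shows "f x = g x"
proof (rule ccontr)
  assume "f x \<noteq> g x"
  let ?S = "{0<..<1} \<inter> (\<lambda>x. f x - g x) -` (- {0})"
  have "open ?S" by (rule continuous_open_preimage) (auto intro!: continuous_intros c)
  moreover have "?S \<noteq> {}" using x \<open>f x \<noteq> g x\<close> by auto
  moreover have "negligible ?S"
  proof -
    have "AE x in lebesgue. x \<in> {0<..<1} \<longrightarrow> f x = g x" using ae by (simp add: AE_restrict_space_iff)
    then have "AE x in lebesgue. x \<notin> ?S" by eventually_elim auto
    then show ?thesis using AE_iff_null_sets[of ?S lebesgue] \<open>open ?S\<close>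
      by (simp add: negligible_iff_null_sets borel_open)
  qed
  ultimately show False using open_not_negligible by blast
qed

lemma J_test_weak:
  assumes "w \<in> L2" "\<phi> \<in> test_functions"
  shows "(LINT x|M01. J (abs_l2 w) x * deriv (deriv \<phi>) x) = (LINT x|M01. w x * \<phi> x)"
  using J_weak_derivative[OF test_deriv[OF assms(2)], of "abs_l2 w"] J1_weak_derivative[OF assms] by simp

lemma affine_L2: "(\<lambda>x. \<alpha> + \<beta> * x) \<in> L2"
  by (intro continuous_L2 continuous_intros)

text \<open>On (0, 1) the functions 1 and 1 - x are represented by \<open>step 1\<close> and
  \<open>ramp 1\<close>, so the inner product is a combination of the boundary values at 1.\<close>

lemma affine_orthogonal_N:
  assumes "g \<in> N" shows "abs_l2 (\<lambda>x. \<alpha> + \<beta> * x) \<bullet> g = 0"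
proof -
  have "abs_l2 (\<lambda>x. \<alpha> + \<beta> * x) = (\<alpha> + \<beta>) *\<^sub>R step 1 - \<beta> *\<^sub>R ramp 1"
  proof -
    have "(\<alpha> + \<beta>) *\<^sub>R step 1 - \<beta> *\<^sub>R ramp 1 = abs_l2 (\<lambda>x. (\<alpha> + \<beta>) * indicator {..<1} x - \<beta> * max 0 (1 - x))"
      unfolding step_def ramp_def by (simp only: minus_abs_l2 scaleR_abs_l2 L2_scale step_L2 ramp_L2)
    moreover have "ae_eq (\<lambda>x. \<alpha> + \<beta> * x) (\<lambda>x. (\<alpha> + \<beta>) * indicator {..<1} x - \<beta> * max 0 (1 - x))"
      unfolding ae_eq_def by (rule AE_I2) (auto simp: indicator_def algebra_simps)
    moreover have "(\<lambda>x. (\<alpha> + \<beta>) * indicator {..<1} x - \<beta> * max 0 (1 - x)) \<in> L2"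
      by (intro L2_diff L2_scale step_L2 ramp_L2)
    ultimately show ?thesis using affine_L2 by (simp add: abs_l2_eq_iff)
  qed
  then show ?thesis using N_boundary[OF assms] by (simp add: inner_diff_left J_def J1_def)
qed

lemma M01_integral_right_half:
  fixes F G :: fn
  assumes "\<And>x. x \<in> {0<..<1} \<Longrightarrow> F x = indicator {1/2<..<1} x * G x" "continuous_on {1/2..1} G"
  shows "(LINT x|M01. F x) = integral {1/2..1} G"
proof -
  have "(LINT x|M01. F x) = (LINT x|M01. indicator {1/2<..<1} x * G x)"
    by (rule Bochner_Integration.integral_cong) (use assms in auto)
  then show ?thesis using M01_integral_Ioo[OF _ _ assms(2)] by simp
qed

section \<open>The degenerate beam operator\<close>

text \<open>What both degeneracy classes share; \<open>a_lower\<close> is the form in which K < 2 is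
  used (\<open>degenerate_coefficientI\<close>).\<close>

locale degenerate_coefficient =
  fixes a a' :: fn
  assumes a_cont: "continuous_on {0..1} a"
    and a_pos: "\<And>x. x \<in> {0<..1} \<Longrightarrow> 0 < a x"
    and a_deriv: "\<And>x. x \<in> {0<..1} \<Longrightarrow> (a has_real_derivative a' x) (at x within {0..1})"
    and a'_cont: "continuous_on {0<..1} a'"
    and a_lower: "\<And>x. x \<in> {0<..1} \<Longrightarrow> a 1 * x\<^sup>2 \<le> a x"
begin

lemma a1: "0 < a 1" using a_pos[of 1] by simp

lemma sqrt_lower: "x \<in> {0<..1} \<Longrightarrow> sqrt (a 1) * x \<le> sqrt (a x)"
  using real_sqrt_le_mono[OF a_lower[of x]] by (simp add: real_sqrt_mult)

lemma inv_sqrt: "x \<in> {0<..1} \<Longrightarrow> x / sqrt (a x) \<le> 1 / sqrt (a 1)"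
  using sqrt_lower[of x] a1 a_pos[of x] by (simp add: field_simps)

lemma a_neq: "x \<in> {0<..1} \<Longrightarrow> a x \<noteq> 0"
  using a_pos[of x] by simp

lemma AE_sqrt_neq: "AE x in M01. sqrt (a x) \<noteq> 0"
proof (rule AE_I2)
  show "sqrt (a x) \<noteq> 0" if "x \<in> space M01" for x using a_neq[of x] that by simp
qed

lemma sqrt_cont: "continuous_on {0..1} (\<lambda>x. sqrt (a x))"
  by (intro continuous_intros a_cont)

lemma sqrt_measurable: "(\<lambda>x. sqrt (a x)) \<in> borel_measurable M01"
  by (rule continuous_measurable_M01[OF continuous_on_subset[OF sqrt_cont Ioo_subset_Icc]])

text \<open>The isometry of the weighted space onto L^2; \<open>unwt\<close> inverts it up to null
  sets.\<close>

definition wt :: "fn \<Rightarrow> l2" where "wt u = abs_l2 (\<lambda>x. u x / sqrt (a x))"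

definition opT :: "l2 \<Rightarrow> l2" where "opT g = wt (J g)"
definition opM :: "l2 \<Rightarrow> l2" where "opM g = abs_l2 (\<lambda>x. (max 0 (2*x - 1))\<^sup>2 * J1 g x / sqrt (a x))"
text \<open>With h = (2x - 1)_+^2, the coefficients 6 (2x - 1)_+ and 8 are (3/2) h' and h'': what
  remains besides u''(1)^2 / 2 when u''' (h u')' is integrated by parts.\<close>

definition opQ :: "l2 \<Rightarrow> l2" where
  "opQ g = mult_op (\<lambda>x. 6 * max 0 (2*x - 1)) g + abs_l2 (\<lambda>x. 8 * indicator {1/2<..} x * J1 g x)"
text \<open>This is - (1/2) a (h / a)' with h = (2x - 1)_+^2, so that multiplying (u / sqrt a)^2 by
  it gives - (1/2) (h / a)' u^2.\<close>

definition dmult :: fn where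
  "dmult x = - (1/2) * (4 * max 0 (2*x - 1) - (max 0 (2*x - 1))\<^sup>2 * (a' x / a x))"
definition opD :: "l2 \<Rightarrow> l2" where "opD = mult_op dmult"

lemma J_measurable: "J g \<in> borel_measurable M01" and J1_measurable: "J1 g \<in> borel_measurable M01"
  using L2_measurable J_L2 J1_L2 by blast+

lemma J_sqrt_bound:
  assumes "x \<in> {0<..<1}" shows "\<bar>J g x / sqrt (a x)\<bar> \<le> 1 / sqrt (a 1) * norm g"
proof -
  have sp: "sqrt (a x) > 0" using a_pos[of x] assms by simp
  have "\<bar>J g x / sqrt (a x)\<bar> = \<bar>J g x\<bar> / sqrt (a x)" using sp by (simp add: abs_divide)
  also have "\<dots> \<le> (x * norm g) / sqrt (a x)" using J_bound[of x g] assms sp by (intro divide_right_mono) auto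
  also have "\<dots> = (x / sqrt (a x)) * norm g" by simp
  also have "\<dots> \<le> 1 / sqrt (a 1) * norm g" using inv_sqrt[of x] assms by (intro mult_right_mono) auto
  finally show ?thesis .
qed

lemma opT_L2: "(\<lambda>x. J g x / sqrt (a x)) \<in> L2" and bounded_linear_opT: "bounded_linear opT"
proof -
  note p = bounded_linear_pointwise[where K = "\<lambda>g x. J g x / sqrt (a x)" and C = "1 / sqrt (a 1)"]
  show "(\<lambda>x. J g x / sqrt (a x)) \<in> L2"
    by (rule p(1)) (auto simp: J_linear add_divide_distrib a1 less_imp_le intro!: borel_measurable_divide J_measurable sqrt_measurable J_sqrt_bound[simplified])
  show "bounded_linear opT" unfolding opT_def[abs_def] wt_def
    by (rule p(2)) (auto simp: J_linear add_divide_distrib a1 less_imp_le intro!: borel_measurable_divide J_measurable sqrt_measurable J_sqrt_bound[simplified])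
qed

lemma max_measurable: "(\<lambda>x. max 0 (2 * x - 1)) \<in> borel_measurable M01"
  by (intro continuous_measurable_M01 continuous_intros)

lemma opM_bound:
  assumes x: "x \<in> {0<..<1}" shows "\<bar>(max 0 (2*x - 1))\<^sup>2 * J1 g x / sqrt (a x)\<bar> \<le> 2 / sqrt (a 1) * norm g"
proof (cases "x \<le> 1/2")
  case True
  then have "max 0 (2*x - 1) = 0" by simp
  then show ?thesis using a1 by simp
next
  case False
  have sp: "sqrt (a x) > 0" using a_pos[of x] x by simp
  have m: "(max 0 (2*x - 1))\<^sup>2 \<le> 1\<^sup>2" using x False by (intro power_mono) auto
  have "(max 0 (2*x - 1))\<^sup>2 / sqrt (a x) \<le> 1 / sqrt (a x)" using m sp by (intro divide_right_mono) auto
  \<comment> \<open>On the support of the multiplier x > 1/2, so 1 <= 2 x; this is the factor 2 in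
    the bound.\<close>
  also have "\<dots> \<le> 2 * (x / sqrt (a x))" using False sp by (simp add: field_simps)
  also have "\<dots> \<le> 2 / sqrt (a 1)" using inv_sqrt[of x] x by simp
  finally have "(max 0 (2*x - 1))\<^sup>2 / sqrt (a x) * \<bar>J1 g x\<bar> \<le> 2 / sqrt (a 1) * norm g"
    using J1_bound[of x g] x a1 by (intro mult_mono) auto
  then show ?thesis using sp by (simp add: abs_mult)
qed

lemma opM_L2: "(\<lambda>x. (max 0 (2*x - 1))\<^sup>2 * J1 g x / sqrt (a x)) \<in> L2" and bounded_linear_opM: "bounded_linear opM"
proof -
  note p = bounded_linear_pointwise[where K = "\<lambda>g x. (max 0 (2*x - 1))\<^sup>2 * J1 g x / sqrt (a x)" and C = "2 / sqrt (a 1)"]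
  have m: "(\<lambda>x. (max 0 (2*x - 1))\<^sup>2 * J1 g x / sqrt (a x)) \<in> borel_measurable M01" for g
    by (intro borel_measurable_divide borel_measurable_times borel_measurable_power max_measurable J1_measurable sqrt_measurable)
  show "(\<lambda>x. (max 0 (2*x - 1))\<^sup>2 * J1 g x / sqrt (a x)) \<in> L2"
    by (rule p(1)[OF m _ _ opM_bound]) (use a1 in \<open>auto simp: J1_linear add_divide_distrib algebra_simps\<close>)
  show "bounded_linear opM" unfolding opM_def[abs_def]
    by (rule p(2)[OF m _ _ opM_bound]) (use a1 in \<open>auto simp: J1_linear add_divide_distrib algebra_simps\<close>)
qed

lemma opQ_L2: "(\<lambda>x. 8 * indicator {1/2<..} x * J1 g x) \<in> L2" and bounded_linear_opQ: "bounded_linear opQ"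
proof -
  note p = bounded_linear_pointwise[where K = "\<lambda>g x. 8 * indicator {1/2<..} x * J1 g x" and C = 8]
  have m: "(\<lambda>x. 8 * indicator {1/2<..} x * J1 g x) \<in> borel_measurable M01" for g
    by (intro borel_measurable_times indicator_measurable_M01 J1_measurable borel_measurable_const) simp
  have b: "\<bar>8 * indicator {1/2<..} x * J1 g x\<bar> \<le> 8 * norm g" if "x \<in> {0<..<1}" for x g
    using J1_bound[of x g] that by (auto simp: indicator_def abs_mult)
  show "(\<lambda>x. 8 * indicator {1/2<..} x * J1 g x) \<in> L2"
    by (rule p(1)[OF m _ _ b]) (auto simp: J1_linear algebra_simps)
  have "bounded_linear (\<lambda>g. abs_l2 (\<lambda>x. 8 * indicator {1/2<..} x * J1 g x))"
    by (rule p(2)[OF m _ _ b]) (auto simp: J1_linear algebra_simps)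
  moreover have "bounded_linear (mult_op (\<lambda>x. 6 * max 0 (2*x - 1)))"
    by (rule mult_op_bounded_linear[where C = 6])
      (use borel_measurable_times[OF borel_measurable_const max_measurable] in auto)
  ultimately show "bounded_linear opQ" unfolding opQ_def[abs_def] by (intro bounded_linear_add)
qed

lemma dmult_measurable: "dmult \<in> borel_measurable M01"
proof (rule continuous_measurable_M01)
  have "continuous_on {0<..<1} a" "continuous_on {0<..<1} a'"
    by (rule continuous_on_subset[OF a_cont], force) (rule continuous_on_subset[OF a'_cont], force)
  moreover have "\<forall>x\<in>{0<..<1}. a x \<noteq> 0" using a_neq by simp
  ultimately show "continuous_on {0<..<1} dmult" unfolding dmult_def[abs_def]
    by (intro continuous_intros) auto
qed

lemma dmult_bounded: obtains C where "\<And>x. x \<in> {0<..<1} \<Longrightarrow> \<bar>dmult x\<bar> \<le> C"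
proof -
  have "continuous_on {1/2..1} a" "continuous_on {1/2..1} a'"
    by (rule continuous_on_subset[OF a_cont], force) (rule continuous_on_subset[OF a'_cont], force)
  moreover have "\<forall>x\<in>{1/2..1}. a x \<noteq> 0" using a_neq by simp
  ultimately have "continuous_on {1/2..1} dmult" unfolding dmult_def[abs_def]
    by (intro continuous_intros) auto
  then have "compact (dmult ` {1/2..1})" by (intro compact_continuous_image) auto
  then obtain C where C: "\<And>x. x \<in> {1/2..1} \<Longrightarrow> \<bar>dmult x\<bar> \<le> C"
    by (metis bounded_iff compact_imp_bounded imageI real_norm_def)
  show ?thesis
  proof (rule that[of "max C 0"])
    fix x :: real assume "x \<in> {0<..<1}"
    show "\<bar>dmult x\<bar> \<le> max C 0"
    proof (cases "x \<le> 1/2")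
      case True
      then have "max 0 (2*x - 1) = 0" by simp
      then show ?thesis by (simp add: dmult_def)
    next
      case False
      then show ?thesis using C[of x] \<open>x \<in> {0<..<1}\<close> by auto
    qed
  qed
qed

lemma bounded_linear_opD: "bounded_linear opD"
  unfolding opD_def by (rule dmult_bounded, rule mult_op_bounded_linear[OF dmult_measurable]) auto

text \<open>If \<open>J g\<close> vanishes almost everywhere, so does its weak second derivative
  g.\<close>

lemma opT_injective:
  assumes "opT g = 0" shows "g = 0"
proof -
  obtain w where w: "w \<in> L2" "g = abs_l2 w" by (rule l2_cases)
  have "ae_eq (\<lambda>x. J g x / sqrt (a x)) (\<lambda>x. 0)"
    using assms abs_l2_eq_iff[OF opT_L2[of g] L2_const[of 0]] by (simp add: opT_def wt_def abs_l2_zero)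
  then have "AE x in M01. J g x / sqrt (a x) = 0" by (simp add: ae_eq_def)
  moreover note AE_sqrt_neq
  ultimately have z: "AE x in M01. J g x = 0" by eventually_elim auto
  have "AE x in M01. w x = 0"
  proof (rule fundamental_lemma[OF L2_locally_integrable[OF w(1)]])
    fix \<phi> assume \<phi>: "\<phi> \<in> test_functions"
    have "(LINT x|M01. w x * \<phi> x) = (LINT x|M01. J g x * deriv (deriv \<phi>) x)"
      using J_test_weak[OF w(1) \<phi>] w(2) by simp
    also have "\<dots> = (LINT x|M01. 0)"
    proof (rule integral_cong_AE)
      show "AE x in M01. J g x * deriv (deriv \<phi>) x = 0" using z by eventually_elim simp
      show "(\<lambda>x. J g x * deriv (deriv \<phi>) x) \<in> borel_measurable M01"
        by (intro borel_measurable_times J_measurable smooth_measurable test_smooth test_deriv \<phi>)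
    qed simp
    finally show "(LINT x|M01. w x * \<phi> x) = 0" by simp
  qed
  then show ?thesis using w abs_l2_eq_iff[OF w(1) L2_const[of 0]] by (simp add: ae_eq_def abs_l2_zero)
qed

lemma locally_integrable_div_sqrt:
  assumes "w \<in> L2" shows "locally_integrable (\<lambda>x. w x / sqrt (a x))"
  unfolding locally_integrable_def
proof (intro allI impI)
  fix c d :: real assume cd: "0 < c \<and> d < 1"
  have w: "w \<in> L2_on {c..d}" by (rule L2_on_subset[OF assms]) (use cd in auto)
  have "continuous_on {c..d} (\<lambda>x. sqrt (a x))" by (rule continuous_on_subset[OF sqrt_cont]) (use cd in auto)
  moreover have "\<forall>x\<in>{c..d}. sqrt (a x) \<noteq> 0" using a_neq cd by simp
  ultimately have "(\<lambda>x. 1 / sqrt (a x)) \<in> L2_on {c..d}"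
    by (intro L2_on_continuous continuous_on_divide continuous_on_const)
  from L2_on_mult_integrable[OF w this] show "integrable (lebesgue_on {c..d}) (\<lambda>x. w x / sqrt (a x))" by simp
qed

lemma opT_second_deriv:
  assumes "\<phi> \<in> test_functions" shows "opT (second_deriv \<phi>) = wt \<phi>" "(\<lambda>x. \<phi> x / sqrt (a x)) \<in> L2"
proof -
  have e: "AE x in M01. J (second_deriv \<phi>) x / sqrt (a x) = \<phi> x / sqrt (a x)"
    by (rule AE_I2) (simp add: J_second_deriv[OF assms])
  show L: "(\<lambda>x. \<phi> x / sqrt (a x)) \<in> L2"
    by (rule ae_eq_L2[OF opT_L2[of "second_deriv \<phi>"] borel_measurable_divide[OF smooth_measurable[OF test_smooth[OF assms]] sqrt_measurable]])
      (use e in \<open>simp add: ae_eq_def\<close>)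
  show "opT (second_deriv \<phi>) = wt \<phi>"
    unfolding opT_def wt_def using e by (subst abs_l2_eq_iff[OF opT_L2 L]) (simp add: ae_eq_def)
qed

lemma inner_opT_second_deriv:
  assumes "w \<in> L2" "\<phi> \<in> test_functions"
  shows "abs_l2 w \<bullet> opT (second_deriv \<phi>) = (LINT x|M01. w x / sqrt (a x) * \<phi> x)"
  using opT_second_deriv[OF assms(2)] assms(1) by (simp add: wt_def inner_abs_l2)

text \<open>\<open>opT\<close> sends \<open>second_deriv \<phi>\<close> to phi / sqrt a, so
  orthogonality says that w / sqrt a annihilates all test functions.\<close>

lemma opT_dense:
  assumes "\<And>c. c \<in> N \<Longrightarrow> x \<bullet> opT c = 0" shows "x = 0"
proof -
  obtain w where w: "w \<in> L2" "x = abs_l2 w" by (rule l2_cases)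
  have "AE x in M01. w x / sqrt (a x) = 0"
  proof (rule fundamental_lemma[OF locally_integrable_div_sqrt[OF w(1)]])
    fix \<phi> assume \<phi>: "\<phi> \<in> test_functions"
    show "(LINT x|M01. w x / sqrt (a x) * \<phi> x) = 0"
      using inner_opT_second_deriv[OF w(1) \<phi>] assms[OF second_deriv_in_N[OF \<phi>]] w(2) by simp
  qed
  moreover note AE_sqrt_neq
  ultimately have "AE x in M01. w x = 0" by eventually_elim auto
  then show ?thesis using w abs_l2_eq_iff[OF w(1) L2_const[of 0]] by (simp add: ae_eq_def abs_l2_zero)
qed

text \<open>The functions \<open>J (g n)\<close> are equi-Lipschitz, so Arzela-Ascoli gives a
  uniformly convergent subsequence. This does not survive division by sqrt a directly, as 1 / a need
  not be integrable; but the quotients are uniformly bounded and converge pointwise, so dominated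
  convergence applies.\<close>

lemma opT_compact:
  fixes g :: "nat \<Rightarrow> l2"
  assumes g: "\<And>n. norm (g n) \<le> 1"
  shows "\<exists>r l. strict_mono r \<and> (\<lambda>n. opT (g (r n))) \<longlonglongrightarrow> l"
proof -
  have lip: "\<bar>J (g n) x - J (g n) y\<bar> \<le> \<bar>x - y\<bar>" if "x \<in> {0..1}" "y \<in> {0..1}" for n x y
  proof -
    have "norm (J (g n) x - J (g n) y) \<le> 1 * norm (x - y)"
    proof (rule field_differentiable_bound[of "{0..1}" "J (g n)" "J1 (g n)"])
      show "(J (g n) has_field_derivative J1 (g n) z) (at z within {0..1})" if "z \<in> {0..1}" for z
        by (rule J_derivative[OF that])
      show "norm (J1 (g n) z) \<le> 1" if "z \<in> {0..1}" for z using J1_bound[OF that, of "g n"] g[of n] by simp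
    qed (use that in auto)
    then show ?thesis by simp
  qed
  have "\<exists>d>0. \<forall>n y. y \<in> {0..1} \<and> norm (x - y) < d \<longrightarrow> norm (J (g n) x - J (g n) y) < e"
    if "x \<in> {0..1}" "0 < e" for x e
    using that lip[OF that(1)] by (intro exI[of _ e]) (auto intro: le_less_trans)
  moreover have "norm (J (g n) x) \<le> 1" if "x \<in> {0..1}" for n x
    using lip[of x 0 n] that by (simp add: J_0)
  ultimately obtain u k where u: "continuous_on {0..1} u" "strict_mono (k :: nat \<Rightarrow> nat)"
    and conv: "\<And>e. 0 < e \<Longrightarrow> \<exists>N. \<forall>n x. n \<ge> N \<and> x \<in> {0..1} \<longrightarrow> norm (J (g (k n)) x - u x) < e"
    using Arzela_Ascoli[of "{0..1}" "\<lambda>n. J (g n)" 1] by (metis compact_Icc)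
  have pt: "(\<lambda>n. J (g (k n)) x) \<longlonglongrightarrow> u x" if "x \<in> {0..1}" for x
    unfolding LIMSEQ_iff using conv that by blast
  let ?U = "\<lambda>x. u x / sqrt (a x)"
  have Tb: "\<bar>J (g (k n)) x / sqrt (a x)\<bar> \<le> 1 / sqrt (a 1)" if x: "x \<in> {0<..<1}" for n x
    using J_sqrt_bound[OF x, of "g (k n)"] mult_left_mono[OF g[of "k n"], of "1 / sqrt (a 1)"] a1 by simp
  have Ub: "\<bar>?U x\<bar> \<le> 1 / sqrt (a 1)" if x: "x \<in> {0<..<1}" for x
  proof (rule LIMSEQ_le_const2)
    show "(\<lambda>n. \<bar>J (g (k n)) x / sqrt (a x)\<bar>) \<longlonglongrightarrow> \<bar>u x / sqrt (a x)\<bar>"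
      using pt[of x] x a_pos[of x] by (intro tendsto_intros) auto
  qed (use Tb[OF x] in blast)
  have Um: "?U \<in> borel_measurable M01"
    by (intro borel_measurable_divide sqrt_measurable continuous_measurable_M01 continuous_on_subset[OF u(1) Ioo_subset_Icc])
  have UL: "?U \<in> L2" by (rule L2_bounded[OF Um Ub])
  let ?d = "\<lambda>n x. J (g (k n)) x / sqrt (a x) - ?U x"
  have dL: "?d n \<in> L2" for n by (rule L2_diff[OF opT_L2 UL])
  have "(\<lambda>n. LINT x|M01. (?d n x)\<^sup>2) \<longlonglongrightarrow> (LINT x|M01. 0)"
  proof (rule integral_dominated_convergence)
    show "integrable M01 (\<lambda>x. (2 / sqrt (a 1))\<^sup>2)" by (rule L2_integrable[OF L2_const])
    show "(\<lambda>x. (?d n x)\<^sup>2) \<in> borel_measurable M01" for n using L2_measurable[OF dL[of n]] by simp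
    show "AE x in M01. (\<lambda>n. (?d n x)\<^sup>2) \<longlonglongrightarrow> 0"
    proof (rule AE_I2)
      fix x assume "x \<in> space M01"
      then have x: "x \<in> {0..1}" "sqrt (a x) \<noteq> 0" using a_pos[of x] by auto
      have "(\<lambda>n. (?d n x)\<^sup>2) \<longlonglongrightarrow> (u x / sqrt (a x) - ?U x)\<^sup>2"
        by (intro tendsto_intros pt x)
      then show "(\<lambda>n. (?d n x)\<^sup>2) \<longlonglongrightarrow> 0" by simp
    qed
    show "AE x in M01. norm ((?d n x)\<^sup>2) \<le> (2 / sqrt (a 1))\<^sup>2" for n
    proof (rule AE_I2)
      fix x assume "x \<in> space M01"
      then have x: "x \<in> {0<..<1}" by simp
      have "2 / sqrt (a 1) = 1 / sqrt (a 1) + 1 / sqrt (a 1)" by simp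
      then have "\<bar>?d n x\<bar> \<le> 2 / sqrt (a 1)"
        using Tb[OF x, of n] Ub[OF x] abs_triangle_ineq4[of "J (g (k n)) x / sqrt (a x)" "?U x"] by linarith
      from power_mono[OF this, of 2] show "norm ((?d n x)\<^sup>2) \<le> (2 / sqrt (a 1))\<^sup>2" by simp
    qed
  qed simp
  moreover have "(LINT x|M01. (?d n x)\<^sup>2) = (norm (opT (g (k n)) - abs_l2 ?U))\<^sup>2" for n
    unfolding opT_def wt_def minus_abs_l2[OF opT_L2 UL] norm_abs_l2_sq[OF dL] ..
  ultimately have "(\<lambda>n. (norm (opT (g (k n)) - abs_l2 ?U))\<^sup>2) \<longlonglongrightarrow> 0" by simp
  from tendsto_real_sqrt[OF this] have "(\<lambda>n. norm (opT (g (k n)) - abs_l2 ?U)) \<longlonglongrightarrow> 0" by simp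
  then have "(\<lambda>n. opT (g (k n))) \<longlonglongrightarrow> abs_l2 ?U"
    by (simp only: tendsto_norm_zero_iff LIM_zero_iff)
  then show ?thesis using u(2) by blast
qed

sublocale energy_space N opT
proof (rule energy_space.intro[OF closed_N subspace_N bounded_linear_opT])
  show "\<And>x. x \<in> N \<Longrightarrow> opT x = 0 \<Longrightarrow> x = 0" by (rule opT_injective)
  show "\<And>x. (\<And>c. c \<in> N \<Longrightarrow> x \<bullet> opT c = 0) \<Longrightarrow> x = 0" by (rule opT_dense)
  show "\<And>x :: nat \<Rightarrow> l2. (\<And>n. norm (x n) \<le> 1) \<Longrightarrow> \<exists>r l. strict_mono r \<and> (\<lambda>n. opT (x (r n))) \<longlonglongrightarrow> l"
    by (rule opT_compact)
qed

end

text \<open>Elements of the range of \<open>R\<close> are continuous away from the degenerate endpoint \<open>0\<close>, but not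
  in general up to it.\<close>

definition has_trace :: "l2 \<Rightarrow> real \<Rightarrow> bool" where
  "has_trace v r \<longleftrightarrow> (\<exists>p\<in>L2. continuous_on {0<..1} p \<and> v = abs_l2 p \<and> p 1 = r)"

lemma continuous_AE_eq_at_1:
  fixes p q :: fn
  assumes c: "continuous_on {0<..1} p" "continuous_on {0<..1} q" and ae: "AE x in M01. p x = q x"
  shows "p 1 = q 1"
proof -
  have s: "{0<..<1::real} \<subseteq> {0<..1}" "{1/2..1::real} \<subseteq> {0<..1}" by auto
  have "p x - q x = 0" if "x \<in> {0<..<1}" for x
    using continuous_AE_eq[OF c[THEN continuous_on_subset[OF _ s(1)]] ae that] by simp
  then have "\<forall>\<^sub>F x in at_left 1. p x - q x = 0"
    by (intro eventually_at_leftI[of 0]) auto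
  then have "((\<lambda>x. p x - q x) \<longlongrightarrow> 0) (at_left 1)" by (rule tendsto_eventually)
  moreover have "continuous_on {1/2..1} (\<lambda>x. p x - q x)"
    by (intro continuous_intros c[THEN continuous_on_subset[OF _ s(2)]])
  then have "((\<lambda>x. p x - q x) \<longlongrightarrow> p 1 - q 1) (at_left 1)"
    by (rule continuous_on_Icc_at_leftD) simp
  ultimately have "p 1 - q 1 = 0" by (intro tendsto_unique[OF trivial_limit_at_left_real])
  then show ?thesis by simp
qed

lemma has_trace_unique:
  assumes "has_trace v r" "has_trace v s" shows "r = s"
proof -
  obtain p where p: "p \<in> L2" "continuous_on {0<..1} p" "v = abs_l2 p" "p 1 = r" using assms(1) has_trace_def by blast
  obtain q where q: "q \<in> L2" "continuous_on {0<..1} q" "v = abs_l2 q" "q 1 = s" using assms(2) has_trace_def by blast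
  have "ae_eq p q" using abs_l2_eq_iff[OF p(1) q(1)] p(3) q(3) by simp
  then have "AE x in M01. p x = q x" by (simp add: ae_eq_def)
  from continuous_AE_eq_at_1[OF p(2) q(2) this] show ?thesis using p(4) q(4) by simp
qed

lemma has_trace_lincomb:
  assumes "has_trace v r" "has_trace w s" shows "has_trace (v + c *\<^sub>R w) (r + c * s)"
proof -
  obtain p where p: "p \<in> L2" "continuous_on {0<..1} p" "v = abs_l2 p" "p 1 = r" using assms(1) has_trace_def by blast
  obtain q where q: "q \<in> L2" "continuous_on {0<..1} q" "w = abs_l2 q" "q 1 = s" using assms(2) has_trace_def by blast
  show ?thesis unfolding has_trace_def
  proof (intro bexI[of _ "\<lambda>x. p x + c * q x"] conjI)
    show "continuous_on {0<..1} (\<lambda>x. p x + c * q x)" by (intro continuous_intros p q)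
    show "v + c *\<^sub>R w = abs_l2 (\<lambda>x. p x + c * q x)" using p q by (simp add: scaleR_abs_l2 plus_abs_l2)
  qed (use p q in auto)
qed

section \<open>The trace at the regular endpoint and the two multiplier identities\<close>

context degenerate_coefficient
begin

text \<open>w / sqrt a need not be integrable near 0; removing a neighbourhood of 0 makes it square
  integrable and changes nothing to the right.\<close>

definition cut :: "real \<Rightarrow> fn \<Rightarrow> fn" where
  "cut \<epsilon> w s = indicator {\<epsilon><..} s * (w s / sqrt (a s))"

lemma cut_L2:
  assumes w: "w \<in> L2" and e: "0 < \<epsilon>" "\<epsilon> < 1" shows "cut \<epsilon> w \<in> L2"
proof (rule L2_dominated[OF _ w])
  show "cut \<epsilon> w \<in> borel_measurable M01"
    unfolding cut_def[abs_def] using w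
    by (intro borel_measurable_times borel_measurable_divide indicator_measurable_M01 L2_measurable sqrt_measurable) auto
  show "AE s in M01. \<bar>cut \<epsilon> w s\<bar> \<le> 1 / (\<epsilon> * sqrt (a 1)) * \<bar>w s\<bar>"
  proof (rule AE_I2)
    fix s assume "s \<in> space M01"
    then have s: "s \<in> {0<..1}" by simp
    show "\<bar>cut \<epsilon> w s\<bar> \<le> 1 / (\<epsilon> * sqrt (a 1)) * \<bar>w s\<bar>"
    proof (cases "\<epsilon> < s")
      case True
      have sp: "sqrt (a s) > 0" using a_pos[OF s] by simp
      have "\<epsilon> * sqrt (a 1) \<le> s * sqrt (a 1)" using True a1 by (intro mult_right_mono) auto
      also have "\<dots> \<le> sqrt (a s)" using sqrt_lower[OF s] by (simp add: mult.commute)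
      finally have "1 / sqrt (a s) \<le> 1 / (\<epsilon> * sqrt (a 1))" using e a1 by (intro divide_left_mono) (use a_pos[OF s] in simp_all)
      from mult_right_mono[OF this, of "\<bar>w s\<bar>"] show ?thesis using True sp by (simp add: cut_def)
    next
      case False
      then show ?thesis using e a1 by (simp add: cut_def)
    qed
  qed
qed

text \<open>The second primitive of w / sqrt a, taken from 1 instead of 0. Its kernel is at most s,
  and s / sqrt (a s) is bounded, so the function stays bounded near 0.\<close>

definition prim :: "fn \<Rightarrow> fn" where
  "prim w x = (LINT s|M01. max 0 (s - x) * (w s / sqrt (a s)))"

text \<open>Uses (s - x)_+ = (s - x) + (x - s)_+ for s > \<open>\<epsilon>\<close>; smaller s
  contribute nothing when x is at least \<open>\<epsilon>\<close>. So primitives from 1 and from 0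
  differ by an affine function.\<close>

lemma prim_eq:
  assumes w: "w \<in> L2" and e: "0 < \<epsilon>" "\<epsilon> < 1" and x: "\<epsilon> \<le> x"
  shows "prim w x = (LINT s|M01. s * cut \<epsilon> w s) - x * (LINT s|M01. cut \<epsilon> w s) + J (abs_l2 (cut \<epsilon> w)) x"
proof -
  note c = cut_L2[OF w e]
  have xL: "(\<lambda>x. x) \<in> L2" by (intro continuous_L2 continuous_intros)
  have "prim w x = (LINT s|M01. (s * cut \<epsilon> w s - x * cut \<epsilon> w s) + max 0 (x - s) * cut \<epsilon> w s)"
    unfolding prim_def
  proof (rule Bochner_Integration.integral_cong[OF refl])
    fix s
    define k where "k = w s / sqrt (a s)"
    show "max 0 (s - x) * (w s / sqrt (a s)) = (s * cut \<epsilon> w s - x * cut \<epsilon> w s) + max 0 (x - s) * cut \<epsilon> w s"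
      using x unfolding cut_def k_def[symmetric] by (auto simp: indicator_def max_def algebra_simps)
  qed
  also have "\<dots> = (LINT s|M01. s * cut \<epsilon> w s) - x * (LINT s|M01. cut \<epsilon> w s) + (LINT s|M01. max 0 (x - s) * cut \<epsilon> w s)"
    using L2_mult_integrable[OF xL c] L2_mult_integrable[OF ramp_L2 c, of x] L2_integrable[OF c] by simp
  finally show ?thesis by (simp add: J_abs[OF c])
qed

lemma prim_continuous:
  assumes w: "w \<in> L2" shows "continuous_on {0<..1} (prim w)"
  unfolding continuous_on_eq_continuous_within
proof
  fix x :: real assume x: "x \<in> {0<..1}"
  define \<epsilon> where "\<epsilon> = x / 2"
  have e: "0 < \<epsilon>" "\<epsilon> < 1" "\<epsilon> < x" using x by (auto simp: \<epsilon>_def)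
  have "continuous_on {\<epsilon>..1} (\<lambda>x. (LINT s|M01. s * cut \<epsilon> w s) - x * (LINT s|M01. cut \<epsilon> w s) + J (abs_l2 (cut \<epsilon> w)) x)"
    by (intro continuous_intros continuous_on_subset[OF J_continuous]) (use e in auto)
  then have "continuous_on {\<epsilon>..1} (prim w)"
    by (rule continuous_on_eq) (use prim_eq[OF w e(1,2)] in auto)
  then have "continuous (at x within {\<epsilon>..1}) (prim w)"
    using x e by (auto simp: continuous_on_eq_continuous_within)
  moreover have "at x within {\<epsilon>..1} = at x within {0<..1}"
    by (rule at_within_nhd[of x "{\<epsilon><..}"]) (use e in auto)
  ultimately show "continuous (at x within {0<..1}) (prim w)" by simp
qed

lemma prim_L2:
  assumes w: "w \<in> L2" shows "prim w \<in> L2"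
proof (rule L2_bounded(1))
  have "{0<..<1::real} \<subseteq> {0<..1}" by auto
  then show "prim w \<in> borel_measurable M01"
    by (intro continuous_measurable_M01 continuous_on_subset[OF prim_continuous[OF w]])
  fix x :: real assume x: "x \<in> {0<..<1}"
  have b: "\<bar>max 0 (s - x) * (w s / sqrt (a s))\<bar> \<le> 1 / sqrt (a 1) * \<bar>w s\<bar>" if "s \<in> {0<..<1}" for s
  proof -
    have sp: "sqrt (a s) > 0" using a_pos[of s] that by simp
    have "max 0 (s - x) / sqrt (a s) \<le> s / sqrt (a s)" using that x sp by (intro divide_right_mono) auto
    also have "\<dots> \<le> 1 / sqrt (a 1)" using inv_sqrt[of s] that by simp
    finally have "max 0 (s - x) / sqrt (a s) * \<bar>w s\<bar> \<le> 1 / sqrt (a 1) * \<bar>w s\<bar>" by (rule mult_right_mono) simp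
    then show ?thesis using sp by (simp add: abs_mult)
  qed
  have "\<bar>prim w x\<bar> \<le> (LINT s|M01. \<bar>max 0 (s - x) * (w s / sqrt (a s))\<bar>)"
    unfolding prim_def by (rule integral_abs_bound)
  also have "\<dots> \<le> (LINT s|M01. 1 / sqrt (a 1) * \<bar>w s\<bar>)"
  proof (rule integral_mono')
    show "integrable M01 (\<lambda>s. 1 / sqrt (a 1) * \<bar>w s\<bar>)" using L2_integrable[OF w] by simp
  qed (use b a1 in auto)
  finally show "\<bar>prim w x\<bar> \<le> (LINT s|M01. 1 / sqrt (a 1) * \<bar>w s\<bar>)" .
qed

lemma prim_weak:
  assumes w: "w \<in> L2" and \<phi>: "\<phi> \<in> test_functions"
  shows "(LINT x|M01. prim w x * deriv (deriv \<phi>) x) = (LINT x|M01. w x / sqrt (a x) * \<phi> x)"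
proof -
  obtain c d where cd: "0 < c" "c < d" "d < 1" "\<And>x. x \<notin> {c<..<d} \<Longrightarrow> \<phi> x = 0"
    using test_support[OF \<phi>] by blast
  obtain c' d' where cd': "0 < c'" "c' < d'" "d' < 1" "\<And>x. x \<notin> {c'<..<d'} \<Longrightarrow> deriv (deriv \<phi>) x = 0"
    using test_support[OF test_deriv[OF test_deriv[OF \<phi>]]] by blast
  \<comment> \<open>The formula for \<open>prim w\<close> must be valid on the support of phi'', and
    the truncation invisible on that of phi; hence the minimum.\<close>
  define \<epsilon> where "\<epsilon> = min c c'"
  have e: "0 < \<epsilon>" "\<epsilon> < 1" using cd cd' by (auto simp: \<epsilon>_def)
  note q = cut_L2[OF w e]
  define m1 where "m1 = (LINT s|M01. s * cut \<epsilon> w s)"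
  define m0 where "m0 = (LINT s|M01. cut \<epsilon> w s)"
  have \<phi>2: "deriv (deriv \<phi>) \<in> L2" by (intro test_L2 test_deriv \<phi>)
  have "(LINT x|M01. prim w x * deriv (deriv \<phi>) x)
      = (LINT x|M01. (m1 + - m0 * x) * deriv (deriv \<phi>) x + J (abs_l2 (cut \<epsilon> w)) x * deriv (deriv \<phi>) x)"
  proof (rule Bochner_Integration.integral_cong[OF refl])
    fix x
    show "prim w x * deriv (deriv \<phi>) x = (m1 + - m0 * x) * deriv (deriv \<phi>) x + J (abs_l2 (cut \<epsilon> w)) x * deriv (deriv \<phi>) x"
    proof (cases "\<epsilon> \<le> x")
      case True
      have pe: "prim w x = m1 - x * m0 + J (abs_l2 (cut \<epsilon> w)) x"
        unfolding m1_def m0_def by (rule prim_eq[OF w e True])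
      show ?thesis unfolding pe by (simp add: algebra_simps)
    next
      case False
      then have "x \<notin> {c'<..<d'}" by (auto simp: \<epsilon>_def)
      then show ?thesis using cd'(4) by simp
    qed
  qed
  also have "\<dots> = (LINT x|M01. (m1 + - m0 * x) * deriv (deriv \<phi>) x) + (LINT x|M01. J (abs_l2 (cut \<epsilon> w)) x * deriv (deriv \<phi>) x)"
    by (intro Bochner_Integration.integral_add L2_mult_integrable affine_L2 \<phi>2 J_L2)
  also have "(LINT x|M01. (m1 + - m0 * x) * deriv (deriv \<phi>) x) = 0"
    using affine_orthogonal_N[OF second_deriv_in_N[OF \<phi>], of m1 "- m0"] inner_abs_l2[OF affine_L2[of m1 "- m0"] \<phi>2] by simp
  also have "(LINT x|M01. J (abs_l2 (cut \<epsilon> w)) x * deriv (deriv \<phi>) x) = (LINT x|M01. cut \<epsilon> w x * \<phi> x)"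
    by (rule J_test_weak[OF q \<phi>])
  also have "\<dots> = (LINT x|M01. w x / sqrt (a x) * \<phi> x)"
    by (rule Bochner_Integration.integral_cong) (use cd(4) in \<open>auto simp: cut_def indicator_def \<epsilon>_def min_less_iff_disj\<close>)
  finally show ?thesis by simp
qed

text \<open>\<open>R (abs_l2 w)\<close> and \<open>prim w\<close> have the same inner product with
  every second derivative of a test function, so they differ by an affine function. The formula on
  [1/2, 1] is the one that \<open>trace_multiplier\<close> differentiates.\<close>

lemma regular_representative:
  assumes w: "w \<in> L2"
  obtains p \<alpha> \<beta> where "p \<in> L2" "continuous_on {0<..1} p" "R (abs_l2 w) = abs_l2 p"
    "\<And>x. x \<in> {1/2..1} \<Longrightarrow> p x = J (abs_l2 (cut (1/2) w)) x + (\<alpha> + \<beta> * x)"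
proof -
  let ?v = "R (abs_l2 w)"
  note P = prim_L2[OF w]
  have "\<exists>\<alpha> \<beta>. ?v - abs_l2 (prim w) = abs_l2 (\<lambda>x. \<alpha> + \<beta> * x)"
  proof (rule orthogonal_to_second_derivs)
    fix \<phi> assume \<phi>: "\<phi> \<in> test_functions"
    have "?v \<bullet> second_deriv \<phi> = abs_l2 w \<bullet> opT (second_deriv \<phi>)" by (rule R_inner[OF second_deriv_in_N[OF \<phi>]])
    also have "\<dots> = abs_l2 (prim w) \<bullet> second_deriv \<phi>"
      unfolding inner_opT_second_deriv[OF w \<phi>] prim_weak[OF w \<phi>, symmetric]
      by (rule inner_abs_l2[OF P, symmetric]) (intro test_L2 test_deriv \<phi>)
    finally show "(?v - abs_l2 (prim w)) \<bullet> second_deriv \<phi> = 0" by (simp add: inner_diff_left)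
  qed
  then obtain \<alpha> \<beta> where ab: "?v - abs_l2 (prim w) = abs_l2 (\<lambda>x. \<alpha> + \<beta> * x)" by blast
  define p where "p x = prim w x + (\<alpha> + \<beta> * x)" for x
  define m1 where "m1 = (LINT s|M01. s * cut (1/2) w s)"
  define m0 where "m0 = (LINT s|M01. cut (1/2) w s)"
  show ?thesis
  \<comment> \<open>Rewriting \<open>prim w\<close> by \<open>prim_eq\<close> with
    \<open>\<epsilon> = 1/2\<close> adds m1 - m0 x to the affine part.\<close>
  proof (rule that[of p "m1 + \<alpha>" "\<beta> - m0"])
    show "p \<in> L2" unfolding p_def[abs_def] by (rule L2_add[OF P affine_L2])
    show "continuous_on {0<..1} p" unfolding p_def[abs_def] by (intro continuous_intros prim_continuous w)
    have "?v = abs_l2 (prim w) + abs_l2 (\<lambda>x. \<alpha> + \<beta> * x)" using ab by (simp add: algebra_simps)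
    then show "?v = abs_l2 p" unfolding p_def[abs_def] plus_abs_l2[OF P affine_L2] .
    show "p x = J (abs_l2 (cut (1/2) w)) x + (m1 + \<alpha> + (\<beta> - m0) * x)" if "x \<in> {1/2..1}" for x
      using prim_eq[OF w, of "1/2" x] that by (simp add: p_def m1_def m0_def algebra_simps)
  qed
qed

definition trace :: "l2 \<Rightarrow> real" where "trace y = (THE r. has_trace (R y) r)"

lemma has_trace_R: "has_trace (R y) (trace y)"
proof -
  obtain w where w: "w \<in> L2" "y = abs_l2 w" by (rule l2_cases)
  obtain p \<alpha> \<beta> where "p \<in> L2" "continuous_on {0<..1} p" "R (abs_l2 w) = abs_l2 p"
    using regular_representative[OF w(1)] by blast
  then have "has_trace (R y) (p 1)" using w(2) has_trace_def by blast
  then show ?thesis unfolding trace_def by (rule theI) (rule has_trace_unique[OF _ \<open>has_trace (R y) (p 1)\<close>])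
qed

lemma trace_eqI: "has_trace (R y) r \<Longrightarrow> trace y = r"
  using has_trace_R has_trace_unique by blast

lemma trace_add: "trace (x + y) = trace x + trace y"
  using has_trace_lincomb[OF has_trace_R[of x] has_trace_R[of y], of 1] by (intro trace_eqI) (simp add: R.add)

lemma trace_scale: "trace (c *\<^sub>R x) = c * trace x"
proof (rule trace_eqI)
  have "has_trace 0 0"
    unfolding has_trace_def by (rule bexI[of _ "\<lambda>x. 0"]) (auto simp: abs_l2_zero)
  from has_trace_lincomb[OF this has_trace_R[of x], of c] show "has_trace (R (c *\<^sub>R x)) (c * trace x)"
    by (simp add: R.scale)
qed

text \<open>With p = u'' and h = (2x - 1)^2 on [1/2, 1], the inner product of \<open>y\<close> with
  the multiplier is the integral of u'''' h u'. The first integration by parts leads to u''' (h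
  u')', the second uses the classical product rule. Since h and h' vanish at 1/2 and u' vanishes at
  1, the only boundary term left is u''(1)^2 / 2.\<close>

lemma trace_multiplier: "(trace y)\<^sup>2 / 2 = opQ (R y) \<bullet> R y - y \<bullet> opM (R y)"
proof -
  obtain w where w: "w \<in> L2" "y = abs_l2 w" by (rule l2_cases)
  obtain p \<alpha> \<beta> where p: "p \<in> L2" "continuous_on {0<..1} p" "R (abs_l2 w) = abs_l2 p"
    and pJ: "\<And>x. x \<in> {1/2..1} \<Longrightarrow> p x = J (abs_l2 (cut (1/2) w)) x + (\<alpha> + \<beta> * x)"
    using regular_representative[OF w(1)] by blast
  define v where "v = R y"
  have v: "v = abs_l2 p" "v \<in> N" using p(3) w(2) R_in[of y] by (simp_all add: v_def)
  have tr: "trace y = p 1"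
    using p w(2) by (intro trace_eqI) (auto simp: has_trace_def)
  define q where "q = cut (1/2) w"
  have q: "q \<in> L2" unfolding q_def by (rule cut_L2[OF w(1)]) auto
  define u1 where "u1 = J1 v"
  define h h' :: fn where "h x = (2*x - 1)\<^sup>2" and "h' x = 4 * (2*x - 1)" for x
  \<comment> \<open>This is u''' on [1/2, 1]: there \<open>q\<close> is u'''', and
    \<open>\<beta>\<close> is the slope of the affine part.\<close>
  define p1 where "p1 x = J1 (abs_l2 q) x + \<beta>" for x
  define \<theta>' where "\<theta>' x = h' x * u1 x + h x * p x" for x
  have sub: "{1/2..1::real} \<subseteq> {0..1}" "{1/2..1::real} \<subseteq> {0<..1}" by auto
  have cont: "continuous_on {1/2..1} p" "continuous_on {1/2..1} u1" "continuous_on {1/2..1} p1"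
    "continuous_on {1/2..1} h" "continuous_on {1/2..1} h'" "continuous_on {1/2..1} (J1 (abs_l2 q))"
    unfolding p1_def[abs_def] u1_def h_def[abs_def] h'_def[abs_def]
    by (intro continuous_intros continuous_on_subset[OF p(2) sub(2)] continuous_on_subset[OF J1_continuous sub(1)])+
  have c\<theta>: "continuous_on {1/2..1} \<theta>'" unfolding \<theta>'_def[abs_def] by (intro continuous_intros cont)
  have u1_1: "u1 1 = 0" unfolding u1_def by (rule N_boundary[OF v(2)])
  have dh: "(h has_real_derivative h' x) (at x within S)" "(h' has_real_derivative 8) (at x within S)" for x S
    unfolding h_def h'_def by (auto intro!: derivative_eq_intros simp: algebra_simps)
  have du1: "(u1 has_real_derivative p x) (at x within {1/2..1})" if x: "x \<in> {1/2..1}" for x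
  proof -
    have "((\<lambda>x. u1 (1/2) + integral {1/2..x} p) has_real_derivative 0 + p x) (at x within {1/2..1})"
      by (intro DERIV_add DERIV_const integral_has_real_derivative cont x)
    then have "((\<lambda>x. u1 (1/2) + integral {1/2..x} p) has_real_derivative p x) (at x within {1/2..1})" by simp
    then show ?thesis
    proof (rule has_field_derivative_transform_within[OF _ zero_less_one x])
      fix z :: real assume z: "z \<in> {1/2..1}"
      have "{1/2..z} \<subseteq> {1/2..1}" using z by auto
      then have "continuous_on {1/2..z} p" by (rule continuous_on_subset[OF cont(1)])
      then show "u1 (1/2) + integral {1/2..z} p = u1 z"
        using J1_eq_integral[OF p(1), of "1/2" z] z by (simp add: u1_def v(1))
    qed
  qed
  have dp: "(p has_real_derivative p1 x) (at x within {1/2..1})" if x: "x \<in> {1/2..1}" for x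
  proof -
    have x': "x \<in> {0..1}" using x by auto
    have "((\<lambda>x. \<alpha> + \<beta> * x) has_real_derivative \<beta>) (at x within {1/2..1})" by (auto intro!: derivative_eq_intros)
    from DERIV_add[OF has_field_derivative_subset[OF J_derivative[OF x', of "abs_l2 q"] sub(1)] this]
    have "((\<lambda>x. J (abs_l2 q) x + (\<alpha> + \<beta> * x)) has_real_derivative p1 x) (at x within {1/2..1})"
      unfolding p1_def .
    then show ?thesis
      by (rule has_field_derivative_transform_within[OF _ zero_less_one x]) (use pJ in \<open>auto simp: q_def\<close>)
  qed
  have d\<theta>: "((\<lambda>x. h x * u1 x) has_real_derivative \<theta>' x) (at x within {1/2..1})" if x: "x \<in> {1/2..1}" for x
    using DERIV_mult[OF dh(1) du1[OF x]] by (simp add: \<theta>'_def algebra_simps)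
  have int\<theta>: "integral {s..1} \<theta>' = - (h s * u1 s)" if s: "s \<in> {1/2..1}" for s
  proof -
    have "(\<theta>' has_integral (h 1 * u1 1 - h s * u1 s)) {s..1}"
    proof (rule fundamental_theorem_of_calculus)
      fix x assume "x \<in> {s..1}"
      then have x: "x \<in> {1/2..1}" using s by auto
      have "{s..1} \<subseteq> {1/2..1}" using s by auto
      from has_field_derivative_subset[OF d\<theta>[OF x] this]
      show "((\<lambda>x. h x * u1 x) has_vector_derivative \<theta>' x) (at x within {s..1})"
        by (simp add: has_real_derivative_iff_has_vector_derivative)
    qed (use s in simp)
    then show ?thesis using u1_1 by (simp add: integral_unique)
  qed
  \<comment> \<open>(3/2) h' p^2 + h'' u' p, the terms that the second integration by parts leaves;
    \<open>I4\<close> recognises them as \<open>opQ\<close>.\<close>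
  define G where "G x = 6 * (2*x - 1) * (p x)\<^sup>2 + 8 * u1 x * p x" for x
  have cG: "continuous_on {1/2..1} G" unfolding G_def[abs_def] by (intro continuous_intros cont)
  have "((\<lambda>x. p1 x * \<theta>' x + G x) has_integral
      ((1/2 * (h 1 * (p 1)\<^sup>2) + h' 1 * u1 1 * p 1) - (1/2 * (h (1/2) * (p (1/2))\<^sup>2) + h' (1/2) * u1 (1/2) * p (1/2)))) {1/2..1}"
  proof (rule fundamental_theorem_of_calculus)
    fix x :: real assume x: "x \<in> {1/2..1}"
    have "((\<lambda>x. 1/2 * (h x * (p x)\<^sup>2) + h' x * u1 x * p x) has_real_derivative
        1/2 * (h' x * (p x)\<^sup>2 + (2 * p x * p1 x) * h x) + ((8 * u1 x + p x * h' x) * p x + p1 x * (h' x * u1 x))) (at x within {1/2..1})"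
      using DERIV_add[OF DERIV_cmult[OF DERIV_mult[OF dh(1) DERIV_power[OF dp[OF x], of 2]], of "1/2"] DERIV_mult[OF DERIV_mult[OF dh(2) du1[OF x]] dp[OF x]]]
      by (simp add: algebra_simps)
    moreover have "1/2 * (h' x * (p x)\<^sup>2 + (2 * p x * p1 x) * h x) + ((8 * u1 x + p x * h' x) * p x + p1 x * (h' x * u1 x)) = p1 x * \<theta>' x + G x"
      unfolding \<theta>'_def G_def h'_def by (simp add: field_simps power2_eq_square)
    ultimately show "((\<lambda>x. 1/2 * (h x * (p x)\<^sup>2) + h' x * u1 x * p x) has_vector_derivative p1 x * \<theta>' x + G x) (at x within {1/2..1})"
      by (simp add: has_real_derivative_iff_has_vector_derivative)
  qed simp
  then have "((\<lambda>x. p1 x * \<theta>' x + G x) has_integral (p 1)\<^sup>2 / 2) {1/2..1}"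
    using u1_1 by (simp add: h_def h'_def)
  then have I1: "(p 1)\<^sup>2 / 2 = integral {1/2..1} (\<lambda>x. p1 x * \<theta>' x) + integral {1/2..1} G"
    by (subst Henstock_Kurzweil_Integration.integral_add[symmetric])
      (auto simp: integral_unique intro!: integrable_continuous_interval continuous_intros cont c\<theta> cG)
  \<comment> \<open>The constant \<open>\<beta>\<close> in u''' drops out because h u' vanishes at
    both ends of [1/2, 1].\<close>
  have I2: "integral {1/2..1} (\<lambda>x. p1 x * \<theta>' x) = integral {1/2..1} (\<lambda>x. J1 (abs_l2 q) x * \<theta>' x)"
  proof -
    have "integral {1/2..1} (\<lambda>x. p1 x * \<theta>' x) = integral {1/2..1} (\<lambda>x. J1 (abs_l2 q) x * \<theta>' x + \<beta> * \<theta>' x)"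
      by (simp add: p1_def algebra_simps)
    also have "\<dots> = integral {1/2..1} (\<lambda>x. J1 (abs_l2 q) x * \<theta>' x) + \<beta> * integral {1/2..1} \<theta>'"
      by (subst Henstock_Kurzweil_Integration.integral_add)
        (auto intro!: integrable_continuous_interval continuous_intros cont c\<theta>)
    also have "integral {1/2..1} \<theta>' = 0" using int\<theta>[of "1/2"] by (simp add: h_def)
    finally show ?thesis by simp
  qed
  \<comment> \<open>\<open>q\<close> is only square integrable, so the primitive
    \<open>J1 (abs_l2 q)\<close> is handled by \<open>triangle_fubini\<close>; the inner integral of
    \<open>\<theta>'\<close> from s to 1 is - h u'.\<close>
  have I3: "integral {1/2..1} (\<lambda>x. J1 (abs_l2 q) x * \<theta>' x) = - (y \<bullet> opM v)"
  proof -
    define u where "u x = indicator {1/2<..<1} x * \<theta>' x" for x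
    have "compact (\<theta>' ` {1/2..1})" by (rule compact_continuous_image[OF c\<theta>]) simp
    then obtain C where C: "\<And>x. x \<in> {1/2..1} \<Longrightarrow> \<bar>\<theta>' x\<bar> \<le> C"
      by (metis bounded_iff compact_imp_bounded imageI real_norm_def)
    have ui: "integrable M01 u"
    proof -
      have "integrable (lebesgue_on {1/2..1}) \<theta>'" by (rule continuous_imp_integrable_real[OF c\<theta>])
      then have "set_integrable lebesgue {1/2..1} \<theta>'" by (simp add: set_integrable_def integrable_restrict_space)
      then have "set_integrable lebesgue {1/2<..<1} \<theta>'" by (rule set_integrable_subset) auto
      then have "integrable lebesgue u" by (simp add: set_integrable_def u_def[abs_def])
      moreover have "(\<lambda>x. indicator {0<..<1} x *\<^sub>R u x) = u" by (auto simp: u_def indicator_def)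
      ultimately show ?thesis by (simp add: integrable_restrict_space)
    qed
    have "integral {1/2..1} (\<lambda>x. J1 (abs_l2 q) x * \<theta>' x) = (LINT x|M01. u x * J1 (abs_l2 q) x)"
      by (rule M01_integral_right_half[symmetric])
        (auto simp: u_def intro!: continuous_intros cont c\<theta>)
    also have "\<dots> = (LINT x|M01. u x * (LINT s|M01. indicator {..<x} s * q s))"
      by (simp add: J1_abs[OF q])
    also have "\<dots> = (LINT s|M01. q s * (LINT x|M01. indicator {s<..} x * u x))"
      by (rule triangle_fubini[OF ui L2_integrable[OF q]])
    also have "\<dots> = (LINT s|M01. - (w s * ((max 0 (2 * s - 1))\<^sup>2 * J1 v s / sqrt (a s))))"
    proof (rule Bochner_Integration.integral_cong[OF refl])
      fix s assume "s \<in> space M01"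
      then have s: "0 < s" "s < 1" by auto
      show "q s * (LINT x|M01. indicator {s<..} x * u x) = - (w s * ((max 0 (2 * s - 1))\<^sup>2 * J1 v s / sqrt (a s)))"
      proof (cases "1/2 < s")
        case True
        have "(LINT x|M01. indicator {s<..} x * u x) = (LINT x|M01. indicator {s<..<1} x * \<theta>' x)"
          by (rule Bochner_Integration.integral_cong) (use True in \<open>auto simp: u_def indicator_def\<close>)
        also have "\<dots> = integral {s..1} \<theta>'"
          using True s by (intro M01_integral_Ioo continuous_on_subset[OF c\<theta>]) auto
        also have "\<dots> = - (h s * u1 s)" using int\<theta>[of s] True s by simp
        finally have e: "(LINT x|M01. indicator {s<..} x * u x) = - (h s * u1 s)" .
        show ?thesis unfolding e using True by (simp add: q_def cut_def h_def u1_def)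
      next
        case False
        then have "max 0 (2 * s - 1) = 0" by simp
        then show ?thesis using False by (simp add: q_def cut_def)
      qed
    qed
    also have "\<dots> = - (y \<bullet> opM v)"
      unfolding w(2) opM_def by (simp add: inner_abs_l2[OF w(1) opM_L2])
    finally show ?thesis .
  qed
  have I4: "integral {1/2..1} G = opQ v \<bullet> v"
  proof -
    have m: "(\<lambda>x. 6 * max 0 (2*x - 1)) \<in> borel_measurable M01"
      by (rule borel_measurable_times[OF borel_measurable_const max_measurable])
    have mb: "\<bar>6 * max 0 (2*x - 1)\<bar> \<le> 6" if "x \<in> {0<..<1}" for x :: real using that by auto
    note mo = mult_op_L2[OF m mb p(1)] mult_op_abs[OF m mb p(1)]
    have "opQ v = abs_l2 (\<lambda>x. 6 * max 0 (2*x - 1) * p x + 8 * indicator {1/2<..} x * J1 v x)"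
      unfolding opQ_def using plus_abs_l2[OF mo(1) opQ_L2[of v]] mo(2) v(1) by simp
    then have "opQ v \<bullet> v = (LINT x|M01. (6 * max 0 (2*x - 1) * p x + 8 * indicator {1/2<..} x * J1 v x) * p x)"
      using inner_abs_l2[OF L2_add[OF mo(1) opQ_L2[of v]] p(1)] v(1) by simp
    also have "\<dots> = integral {1/2..1} G"
    proof (rule M01_integral_right_half[OF _ cG])
      fix x :: real assume x: "x \<in> {0<..<1}"
      show "(6 * max 0 (2*x - 1) * p x + 8 * indicator {1/2<..} x * J1 v x) * p x = indicator {1/2<..<1} x * G x"
      proof (cases "1/2 < x")
        case True
        then show ?thesis using x by (simp add: G_def u1_def algebra_simps power2_eq_square)
      next
        case False
        then have "max 0 (2*x - 1) = 0" by simp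
        then show ?thesis using False by simp
      qed
    qed
    finally show ?thesis by simp
  qed
  show ?thesis using I1 I2 I3 I4 tr by (simp add: v_def[symmetric])
qed

text \<open>With h = (2x - 1)^2, integrate (h / a) u u' = (h / (2 a)) (u^2)' by parts on [1/2, 1].
  The boundary terms vanish because h(1/2) = 0 and u(1) = 0.\<close>

lemma transport_identity:
  assumes c: "c \<in> N" shows "opT c \<bullet> opM c = opD (opT c) \<bullet> opT c"
proof -
  define u u1 where "u = J c" and "u1 = J1 c"
  define m :: fn where "m x = (2*x - 1)\<^sup>2 / a x" for x
  define m' :: fn where "m' x = (4 * (2*x - 1) * a x - (2*x - 1)\<^sup>2 * a' x) / (a x)\<^sup>2" for x
  have sub: "{1/2..1::real} \<subseteq> {0..1}" "{1/2..1::real} \<subseteq> {0<..1}" by auto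
  have an: "\<forall>x\<in>{1/2..1}. a x \<noteq> 0" using a_neq by simp
  have cont: "continuous_on {1/2..1} u" "continuous_on {1/2..1} u1" "continuous_on {1/2..1} a" "continuous_on {1/2..1} a'"
    unfolding u_def u1_def
    by (rule continuous_on_subset[OF J_continuous sub(1)] continuous_on_subset[OF J1_continuous sub(1)]
        continuous_on_subset[OF a_cont sub(1)] continuous_on_subset[OF a'_cont sub(2)])+
  have cm: "continuous_on {1/2..1} m" "continuous_on {1/2..1} m'"
    unfolding m_def[abs_def] m'_def[abs_def] using an by (intro continuous_intros cont; simp)+
  have u_1: "u 1 = 0" unfolding u_def by (rule N_boundary[OF c])
  have "((\<lambda>x. m x * u x * u1 x + 1/2 * m' x * (u x)\<^sup>2) has_integral (1/2 * (m 1 * (u 1)\<^sup>2) - 1/2 * (m (1/2) * (u (1/2))\<^sup>2))) {1/2..1}"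
  proof (rule fundamental_theorem_of_calculus)
    fix x :: real assume x: "x \<in> {1/2..1}"
    then have x': "x \<in> {0..1}" "x \<in> {0<..1}" by auto
    have du: "(u has_real_derivative u1 x) (at x within {1/2..1})"
      unfolding u_def u1_def by (rule has_field_derivative_subset[OF J_derivative[OF x'(1)] sub(1)])
    have da: "(a has_real_derivative a' x) (at x within {1/2..1})"
      by (rule has_field_derivative_subset[OF a_deriv[OF x'(2)] sub(1)])
    have "((\<lambda>x. (2*x - 1)\<^sup>2) has_real_derivative 4 * (2*x - 1)) (at x within {1/2..1})"
      by (auto intro!: derivative_eq_intros)
    from DERIV_divide[OF this da] have dm: "(m has_real_derivative m' x) (at x within {1/2..1})"
      using an x unfolding m_def[abs_def] m'_def by (simp add: power2_eq_square)
    have "((\<lambda>x. 1/2 * (m x * (u x)\<^sup>2)) has_real_derivative 1/2 * (m' x * (u x)\<^sup>2 + (2 * u x * u1 x) * m x)) (at x within {1/2..1})"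
      using DERIV_cmult[OF DERIV_mult[OF dm DERIV_power[OF du, of 2]], of "1/2"] by (simp add: algebra_simps)
    moreover have "1/2 * (m' x * (u x)\<^sup>2 + (2 * u x * u1 x) * m x) = m x * u x * u1 x + 1/2 * m' x * (u x)\<^sup>2"
      by (simp add: algebra_simps)
    ultimately show "((\<lambda>x. 1/2 * (m x * (u x)\<^sup>2)) has_vector_derivative m x * u x * u1 x + 1/2 * m' x * (u x)\<^sup>2) (at x within {1/2..1})"
      by (simp only: has_real_derivative_iff_has_vector_derivative)
  qed simp
  then have "integral {1/2..1} (\<lambda>x. m x * u x * u1 x + 1/2 * m' x * (u x)\<^sup>2) = 0"
    using u_1 by (simp add: integral_unique m_def)
  then have I: "integral {1/2..1} (\<lambda>x. m x * u x * u1 x) = integral {1/2..1} (\<lambda>x. - (1/2) * m' x * (u x)\<^sup>2)"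
    by (subst (asm) Henstock_Kurzweil_Integration.integral_add)
      (auto intro!: integrable_continuous_interval continuous_intros cont cm simp: algebra_simps)
  have "opT c \<bullet> opM c = (LINT x|M01. (J c x / sqrt (a x)) * ((max 0 (2*x - 1))\<^sup>2 * J1 c x / sqrt (a x)))"
    unfolding opT_def wt_def opM_def by (rule inner_abs_l2[OF opT_L2 opM_L2])
  also have "\<dots> = integral {1/2..1} (\<lambda>x. m x * u x * u1 x)"
  proof (rule M01_integral_right_half)
    show "continuous_on {1/2..1} (\<lambda>x. m x * u x * u1 x)" by (intro continuous_intros cont cm)
    fix x :: real assume x: "x \<in> {0<..<1}"
    then have ax: "sqrt (a x) * sqrt (a x) = a x" using a_pos[of x] by simp
    show "(J c x / sqrt (a x)) * ((max 0 (2*x - 1))\<^sup>2 * J1 c x / sqrt (a x)) = indicator {1/2<..<1} x * (m x * u x * u1 x)"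
    proof (cases "1/2 < x")
      case True
      then show ?thesis using x ax by (simp add: m_def u_def u1_def)
    next
      case False
      then have "max 0 (2*x - 1) = 0" by simp
      then show ?thesis using False by simp
    qed
  qed
  also have "\<dots> = (LINT x|M01. dmult x * (J c x / sqrt (a x)) * (J c x / sqrt (a x)))"
    unfolding I
  proof (rule M01_integral_right_half[symmetric])
    show "continuous_on {1/2..1} (\<lambda>x. - (1/2) * m' x * (u x)\<^sup>2)" by (intro continuous_intros cont cm)
    fix x :: real assume x: "x \<in> {0<..<1}"
    then have ax: "sqrt (a x) * sqrt (a x) = a x" "a x \<noteq> 0" using a_pos[of x] by auto
    show "dmult x * (J c x / sqrt (a x)) * (J c x / sqrt (a x)) = indicator {1/2<..<1} x * (- (1/2) * m' x * (u x)\<^sup>2)"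
    proof (cases "1/2 < x")
      case True
      have "dmult x * (J c x / sqrt (a x)) * (J c x / sqrt (a x)) = dmult x * (u x)\<^sup>2 / a x"
        using ax by (simp add: u_def power2_eq_square)
      also have "\<dots> = - (1/2) * m' x * (u x)\<^sup>2"
        using True ax(2) by (simp add: dmult_def m'_def field_simps power2_eq_square)
      finally show ?thesis using True x by simp
    next
      case False
      then have "max 0 (2*x - 1) = 0" by simp
      then show ?thesis using False by (simp add: dmult_def)
    qed
  qed
  also have "\<dots> = opD (opT c) \<bullet> opT c"
  proof -
    obtain C where C: "\<And>x. x \<in> {0<..<1} \<Longrightarrow> \<bar>dmult x\<bar> \<le> C" using dmult_bounded by blast
    note mo = mult_op_L2[OF dmult_measurable C opT_L2[of c]] mult_op_abs[OF dmult_measurable C opT_L2[of c]]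
    have e: "opD (opT c) = abs_l2 (\<lambda>x. dmult x * (J c x / sqrt (a x)))"
      unfolding opD_def opT_def wt_def by (rule mo(2))
    show ?thesis unfolding e unfolding opT_def wt_def
      by (rule inner_abs_l2[OF mo(1) opT_L2, symmetric])
  qed
  finally show ?thesis .
qed

sublocale abstract_beam N opT opM opQ opD trace
  by (intro abstract_beam.intro abstract_beam_axioms.intro energy_space_axioms bounded_linear_opM
      bounded_linear_opQ bounded_linear_opD trace_add trace_scale trace_multiplier transport_identity)

end

section \<open>Weighted Sobolev spaces and solutions\<close>

text \<open>Lebesgue measure is complete; through this lemma, membership in the function spaces
  depends only on the class.\<close>

lemma ae_eq_measurable:
  assumes "u \<in> borel_measurable M01" "ae_eq u v" shows "v \<in> borel_measurable M01"
proof -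
  have "(\<lambda>x. indicator {0<..<1} x *\<^sub>R u x) \<in> borel_measurable lebesgue"
    using assms(1) by (simp add: borel_measurable_restrict_space_iff)
  moreover have "AE x in lebesgue. indicator {0<..<1} x *\<^sub>R u x = indicator {0<..<1} x *\<^sub>R v x"
    using assms(2) by (auto simp: ae_eq_def AE_restrict_space_iff indicator_def elim!: eventually_mono)
  ultimately have "(\<lambda>x. indicator {0<..<1} x *\<^sub>R v x) \<in> borel_measurable lebesgue"
    by (rule borel_measurable_AE)
  then show ?thesis by (simp add: borel_measurable_restrict_space_iff)
qed

lemma ae_eq_in_L2: "u \<in> L2 \<Longrightarrow> ae_eq u v \<Longrightarrow> v \<in> L2"
  using ae_eq_L2 ae_eq_measurable L2_measurable by blast

lemma test_locally_integrable:
  assumes g: "locally_integrable g" and \<phi>: "\<phi> \<in> test_functions"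
  shows "integrable M01 (\<lambda>x. g x * \<phi> x)"
proof -
  obtain c d where cd: "0 < c" "c < d" "d < 1" "\<And>x. x \<notin> {c<..<d} \<Longrightarrow> \<phi> x = 0"
    using test_support[OF \<phi>] by blast
  obtain B where B: "B \<ge> 0" "\<And>x. \<bar>\<phi> x\<bar> \<le> B" using test_bounded[OF \<phi>] by blast
  have gi: "integrable lebesgue (\<lambda>x. indicator {c..d} x * g x)"
    using g cd by (auto simp: locally_integrable_def integrable_restrict_space)
  have \<phi>m: "\<phi> \<in> borel_measurable lebesgue"
    using smooth_measurable[OF test_smooth[OF \<phi>], of UNIV] by (simp add: lebesgue_on_UNIV_eq)
  have "integrable lebesgue (\<lambda>x. \<phi> x * (indicator {c..d} x * g x))"
  proof (rule Bochner_Integration.integrable_bound)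
    show "integrable lebesgue (\<lambda>x. B * (indicator {c..d} x * g x))" using gi by simp
    show "(\<lambda>x. \<phi> x * (indicator {c..d} x * g x)) \<in> borel_measurable lebesgue"
      by (rule borel_measurable_times[OF \<phi>m borel_measurable_integrable[OF gi]])
    show "AE x in lebesgue. norm (\<phi> x * (indicator {c..d} x * g x)) \<le> norm (B * (indicator {c..d} x * g x))"
      using B by (intro AE_I2) (simp add: abs_mult mult_right_mono)
  qed
  moreover have "(\<lambda>x. \<phi> x * (indicator {c..d} x * g x)) = (\<lambda>x. indicator {0<..<1} x *\<^sub>R (g x * \<phi> x))"
  proof
    fix x show "\<phi> x * (indicator {c..d} x * g x) = indicator {0<..<1} x *\<^sub>R (g x * \<phi> x)"
      using cd(1-3) cd(4)[of x] by (cases "x \<in> {c<..<d}") (auto simp: indicator_def)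
  qed
  ultimately show ?thesis by (simp add: integrable_restrict_space)
qed

lemma has_weak_deriv_unique:
  assumes "has_weak_deriv k u g" "has_weak_deriv k u h"
  shows "ae_eq g h"
proof -
  have l: "locally_integrable g" "locally_integrable h" using assms by (auto simp: has_weak_deriv_def)
  have "AE x in M01. g x - h x = 0"
  proof (rule fundamental_lemma)
    show "locally_integrable (\<lambda>x. g x - h x)" using l by (auto simp: locally_integrable_def)
    fix \<phi> assume \<phi>: "\<phi> \<in> test_functions"
    have "(- 1) ^ k * (LINT x|M01. g x * \<phi> x) = (- 1) ^ k * (LINT x|M01. h x * \<phi> x)"
      using assms \<phi> by (auto simp: has_weak_deriv_def)
    then have "(LINT x|M01. g x * \<phi> x) = (LINT x|M01. h x * \<phi> x)" by simp
    then show "(LINT x|M01. (g x - h x) * \<phi> x) = 0"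
      using test_locally_integrable[OF l(1) \<phi>] test_locally_integrable[OF l(2) \<phi>] by (simp add: left_diff_distrib)
  qed
  then show ?thesis by (simp add: ae_eq_def)
qed

lemma weak_deriv_has: "has_weak_deriv k u g \<Longrightarrow> has_weak_deriv k u (weak_deriv k u)"
  unfolding weak_deriv_def by (rule someI[of "has_weak_deriv k u"])

lemma weak_deriv_ae: "has_weak_deriv k u g \<Longrightarrow> ae_eq (weak_deriv k u) g"
  by (rule has_weak_deriv_unique[OF weak_deriv_has])

lemma integral_ae_eq_mult:
  assumes "ae_eq g h" "integrable M01 (\<lambda>x. g x * \<phi> x)" "integrable M01 (\<lambda>x. h x * \<phi> x)"
  shows "(LINT x|M01. g x * \<phi> x) = (LINT x|M01. h x * \<phi> x)"
  by (rule integral_cong_AE) (use assms in \<open>auto simp: ae_eq_def intro!: borel_measurable_integrable\<close>)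

lemma has_weak_deriv_cong:
  assumes "has_weak_deriv k u g" "locally_integrable h" "ae_eq g h"
  shows "has_weak_deriv k u h"
  unfolding has_weak_deriv_def
proof (intro conjI ballI)
  show "locally_integrable u" "locally_integrable h" using assms by (auto simp: has_weak_deriv_def)
  fix \<phi> assume \<phi>: "\<phi> \<in> test_functions"
  have "(LINT x|M01. g x * \<phi> x) = (LINT x|M01. h x * \<phi> x)"
    using assms by (intro integral_ae_eq_mult test_locally_integrable \<phi>) (auto simp: has_weak_deriv_def)
  then show "(LINT x|M01. u x * (deriv ^^ k) \<phi> x) = (- 1) ^ k * (LINT x|M01. h x * \<phi> x)"
    using assms \<phi> by (auto simp: has_weak_deriv_def)
qed

lemma deriv_2: "(deriv ^^ 2) \<phi> = deriv (deriv \<phi>)" and deriv_1: "(deriv ^^ 1) \<phi> = deriv \<phi>"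
  and deriv_4: "(deriv ^^ 4) \<phi> = deriv (deriv (deriv (deriv \<phi>)))"
  by (simp_all add: eval_nat_numeral)

text \<open>The coordinate that turns H^2_0 into \<open>N\<close>; working with classes hides the
  arbitrary choice in \<open>weak_deriv\<close>.\<close>

definition d2 :: "fn \<Rightarrow> l2" where "d2 u = abs_l2 (weak_deriv 2 u)"

lemma ae_eq_J_weak_derivs:
  assumes u: "u \<in> L2" "ae_eq u (J g)"
  shows "has_weak_deriv 1 u (J1 g)" "has_weak_deriv 2 u (rep_l2 g)"
proof -
  have li: "locally_integrable u" "locally_integrable (J1 g)" "locally_integrable (rep_l2 g)"
    by (intro L2_locally_integrable u J1_L2 rep_l2_L2)+
  have e: "(LINT x|M01. u x * \<phi> x) = (LINT x|M01. J g x * \<phi> x)" if "\<phi> \<in> test_functions" for \<phi>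
    by (rule integral_ae_eq_mult[OF u(2)]) (intro L2_mult_integrable u J_L2 test_L2 that)+
  show "has_weak_deriv 1 u (J1 g)"
    using li J_weak_derivative e[OF test_deriv] by (simp add: has_weak_deriv_def)
  show "has_weak_deriv 2 u (rep_l2 g)"
    using li J_test_weak[OF rep_l2_L2, of _ g] e[OF test_deriv[OF test_deriv]]
    by (simp add: has_weak_deriv_def deriv_2)
qed

lemma ae_eq_J:
  assumes u: "u \<in> L2" "ae_eq u (J g)"
  shows "u \<in> H2" "weak_deriv 2 u \<in> L2" "weak_deriv 1 u \<in> L2" "d2 u = g" "abs_l2 (weak_deriv 1 u) = abs_l2 (J1 g)"
proof -
  note w = ae_eq_J_weak_derivs[OF u]
  show "u \<in> H2" unfolding H2_def using u w J1_L2[of g] rep_l2_L2[of g] by auto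
  have a: "ae_eq (J1 g) (weak_deriv 1 u)" "ae_eq (rep_l2 g) (weak_deriv 2 u)"
    using weak_deriv_ae[OF w(1)] weak_deriv_ae[OF w(2)] by (auto intro: ae_eq_sym)
  show L: "weak_deriv 2 u \<in> L2" "weak_deriv 1 u \<in> L2"
    using ae_eq_in_L2[OF rep_l2_L2 a(2)] ae_eq_in_L2[OF J1_L2 a(1)] by auto
  show "d2 u = g" unfolding d2_def using abs_l2_eq_iff[OF rep_l2_L2 L(1), of g] a(2) by simp
  show "abs_l2 (weak_deriv 1 u) = abs_l2 (J1 g)" using abs_l2_eq_iff[OF J1_L2 L(2), of g] a(1) by simp
qed

lemma norm_J_le: "norm (abs_l2 (J g)) \<le> norm g" and norm_J1_le: "norm (abs_l2 (J1 g)) \<le> norm g"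
proof -
  have b: "\<bar>J g x\<bar> \<le> norm g" "\<bar>J1 g x\<bar> \<le> norm g" if "x \<in> {0<..<1}" for x
    using J_bound[of x g] J1_bound[of x g] that mult_right_mono[of x 1 "norm g"] by auto
  show "norm (abs_l2 (J g)) \<le> norm g" "norm (abs_l2 (J1 g)) \<le> norm g"
    using L2_bounded(2)[OF L2_measurable[OF J_L2] b(1)] L2_bounded(2)[OF L2_measurable[OF J1_L2] b(2)] by auto
qed

lemma H2_norm_J:
  assumes u: "u \<in> L2" "ae_eq u (J g)"
  shows "H2_norm u \<le> 2 * norm g"
proof -
  note j = ae_eq_J[OF u]
  have "abs_l2 u = abs_l2 (J g)" using u J_L2 by (simp add: abs_l2_eq_iff)
  then have "H2_norm u = sqrt ((norm (abs_l2 (J g)))\<^sup>2 + (norm (abs_l2 (J1 g)))\<^sup>2 + (norm g)\<^sup>2)"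
    unfolding H2_norm_def using j u by (simp add: norm_abs_l2[symmetric] d2_def)
  also have "\<dots> \<le> sqrt ((2 * norm g)\<^sup>2)"
  proof (rule real_sqrt_le_mono)
    have "(norm (abs_l2 (J g)))\<^sup>2 \<le> (norm g)\<^sup>2" "(norm (abs_l2 (J1 g)))\<^sup>2 \<le> (norm g)\<^sup>2"
      by (intro power_mono norm_J_le norm_J1_le norm_ge_zero)+
    \<comment> \<open>Three terms of size at most (norm g)^2 fit under 4 (norm g)^2, which explains
      the constant 2.\<close>
    moreover have "(2 * norm g)\<^sup>2 = 4 * (norm g)\<^sup>2" "0 \<le> (norm g)\<^sup>2" by (simp_all add: power_mult_distrib)
    ultimately show "(norm (abs_l2 (J g)))\<^sup>2 + (norm (abs_l2 (J1 g)))\<^sup>2 + (norm g)\<^sup>2 \<le> (2 * norm g)\<^sup>2" by linarith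
  qed
  finally show ?thesis by (simp only: real_sqrt_abs abs_mult abs_numeral abs_norm_cancel)
qed

lemma H2_weak:
  assumes "u \<in> H2" "k \<in> {1, 2}"
  shows "has_weak_deriv k u (weak_deriv k u)" "weak_deriv k u \<in> L2"
proof -
  obtain g where g: "g \<in> L2" "has_weak_deriv k u g" using assms by (auto simp: H2_def)
  show "has_weak_deriv k u (weak_deriv k u)" by (rule weak_deriv_has[OF g(2)])
  show "weak_deriv k u \<in> L2" using ae_eq_in_L2[OF g(1) ae_eq_sym[OF weak_deriv_ae[OF g(2)]]] .
qed

lemma test_ae_eq_J:
  assumes "\<phi> \<in> test_functions" shows "ae_eq \<phi> (J (second_deriv \<phi>))"
  unfolding ae_eq_def by (rule AE_I2) (simp add: J_second_deriv[OF assms])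

text \<open>The representative chosen by \<open>weak_deriv\<close> for a difference is first
  identified, up to a null set, with the difference of the weak derivatives; each norm on the left
  is then one summand of the H^2 norm.\<close>

lemma H2_diff_norm:
  assumes \<phi>: "\<phi> \<in> test_functions" and u: "u \<in> H2"
  shows "norm (second_deriv \<phi> - d2 u) \<le> H2_norm (\<phi> - u)" "norm (abs_l2 \<phi> - abs_l2 u) \<le> H2_norm (\<phi> - u)"
proof -
  have uL: "u \<in> L2" using u by (simp add: H2_def)
  note \<phi>w = ae_eq_J_weak_derivs(2)[OF test_L2[OF \<phi>] test_ae_eq_J[OF \<phi>]]
  note uw = H2_weak[OF u, of 2, simplified]
  have \<phi>2: "deriv (deriv \<phi>) \<in> L2" by (intro test_L2 test_deriv \<phi>)
  have e: "\<phi> - u = (\<lambda>x. \<phi> x - u x)" by (simp add: fun_diff_def)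
  have "has_weak_deriv 2 (\<phi> - u) (\<lambda>x. rep_l2 (second_deriv \<phi>) x - weak_deriv 2 u x)"
    unfolding has_weak_deriv_def e
  proof (intro conjI ballI)
    show "locally_integrable (\<lambda>x. \<phi> x - u x)" "locally_integrable (\<lambda>x. rep_l2 (second_deriv \<phi>) x - weak_deriv 2 u x)"
      by (intro L2_locally_integrable L2_diff test_L2 \<phi> uL rep_l2_L2 uw)+
    fix \<psi> assume \<psi>: "\<psi> \<in> test_functions"
    have \<psi>2: "(deriv ^^ 2) \<psi> \<in> L2" unfolding deriv_2 by (intro test_L2 test_deriv \<psi>)
    have "(LINT x|M01. (\<phi> x - u x) * (deriv ^^ 2) \<psi> x) = (LINT x|M01. \<phi> x * (deriv ^^ 2) \<psi> x) - (LINT x|M01. u x * (deriv ^^ 2) \<psi> x)"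
      using L2_mult_integrable[OF test_L2[OF \<phi>] \<psi>2] L2_mult_integrable[OF uL \<psi>2] by (simp add: left_diff_distrib)
    also have "\<dots> = (LINT x|M01. rep_l2 (second_deriv \<phi>) x * \<psi> x) - (LINT x|M01. weak_deriv 2 u x * \<psi> x)"
      using \<phi>w uw(1) \<psi> by (simp add: has_weak_deriv_def)
    also have "\<dots> = (LINT x|M01. (rep_l2 (second_deriv \<phi>) x - weak_deriv 2 u x) * \<psi> x)"
      using L2_mult_integrable[OF rep_l2_L2 test_L2[OF \<psi>], of "second_deriv \<phi>"] L2_mult_integrable[OF uw(2) test_L2[OF \<psi>]]
      by (simp add: left_diff_distrib)
    finally show "(LINT x|M01. (\<phi> x - u x) * (deriv ^^ 2) \<psi> x) = (- 1)\<^sup>2 * (LINT x|M01. (rep_l2 (second_deriv \<phi>) x - weak_deriv 2 u x) * \<psi> x)"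
      by simp
  qed
  from weak_deriv_ae[OF this] have ae: "ae_eq (weak_deriv 2 (\<phi> - u)) (\<lambda>x. rep_l2 (second_deriv \<phi>) x - weak_deriv 2 u x)" .
  have dL: "(\<lambda>x. rep_l2 (second_deriv \<phi>) x - weak_deriv 2 u x) \<in> L2" by (intro L2_diff rep_l2_L2 uw)
  have wL: "weak_deriv 2 (\<phi> - u) \<in> L2" using ae_eq_in_L2[OF dL ae_eq_sym[OF ae]] .
  have "second_deriv \<phi> - d2 u = abs_l2 (weak_deriv 2 (\<phi> - u))"
    unfolding d2_def
    using minus_abs_l2[OF rep_l2_L2 uw(2), of "second_deriv \<phi>"] abs_l2_eq_iff[OF wL dL] ae by simp
  then have 1: "norm (second_deriv \<phi> - d2 u) = L2_norm {0<..<1} (weak_deriv 2 (\<phi> - u))"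
    using norm_abs_l2[OF wL] by simp
  have 2: "norm (abs_l2 \<phi> - abs_l2 u) = L2_norm {0<..<1} (\<phi> - u)"
    unfolding minus_abs_l2[OF test_L2[OF \<phi>] uL] e by (rule norm_abs_l2[OF L2_diff[OF test_L2[OF \<phi>] uL]])
  show "norm (second_deriv \<phi> - d2 u) \<le> H2_norm (\<phi> - u)" "norm (abs_l2 \<phi> - abs_l2 u) \<le> H2_norm (\<phi> - u)"
    unfolding 1 2 H2_norm_def by (intro real_le_rsqrt; simp)+
qed

text \<open>Along an approximating sequence both phi_n and phi_n'' converge in L^2, and boundedness
  of \<open>J\<close> links the two limits. Conversely it suffices to approximate g in
  \<open>N\<close>, because the H^2 norm of a double primitive \<open>J g\<close> is at most 2
  \<open>norm g\<close>.\<close>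

theorem H2_0_iff: "u \<in> H2_0 \<longleftrightarrow> u \<in> L2 \<and> (\<exists>g\<in>N. ae_eq u (J g))"
proof
  assume "u \<in> H2_0"
  then obtain \<phi> where u: "u \<in> H2" and \<phi>: "\<And>n. \<phi> n \<in> test_functions" and lim: "(\<lambda>n. H2_norm (\<phi> n - u)) \<longlonglongrightarrow> 0"
    by (auto simp: H2_0_def)
  have uL: "u \<in> L2" using u by (simp add: H2_def)
  have l2: "(\<lambda>n. second_deriv (\<phi> n)) \<longlonglongrightarrow> d2 u"
    by (rule LIM_zero_cancel, rule Lim_null_comparison[OF always_eventually lim]) (use H2_diff_norm(1)[OF \<phi> u] in blast)
  have l0: "(\<lambda>n. abs_l2 (\<phi> n)) \<longlonglongrightarrow> abs_l2 u"
    by (rule LIM_zero_cancel, rule Lim_null_comparison[OF always_eventually lim]) (use H2_diff_norm(2)[OF \<phi> u] in blast)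
  have "d2 u \<in> N" using closed_sequentially[OF closed_N _ l2] second_deriv_in_N[OF \<phi>] by blast
  moreover have "(\<lambda>n. abs_l2 (\<phi> n)) \<longlonglongrightarrow> abs_l2 (J (d2 u))"
  proof (rule LIM_zero_cancel, rule Lim_null_comparison[OF always_eventually])
    show "(\<lambda>n. norm (second_deriv (\<phi> n) - d2 u)) \<longlonglongrightarrow> 0" using l2 by (simp add: LIM_zero tendsto_norm_zero)
    show "\<forall>n. norm (abs_l2 (\<phi> n) - abs_l2 (J (d2 u))) \<le> norm (second_deriv (\<phi> n) - d2 u)"
    proof
      fix n
      have "abs_l2 (\<phi> n) = abs_l2 (J (second_deriv (\<phi> n)))"
        using test_ae_eq_J[OF \<phi>[of n]] abs_l2_eq_iff[OF test_L2[OF \<phi>] J_L2] by blast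
      then have "abs_l2 (\<phi> n) - abs_l2 (J (d2 u)) = abs_l2 (J (second_deriv (\<phi> n) - d2 u))"
        by (simp add: minus_abs_l2 J_L2 J_linear[abs_def])
      then show "norm (abs_l2 (\<phi> n) - abs_l2 (J (d2 u))) \<le> norm (second_deriv (\<phi> n) - d2 u)" using norm_J_le by simp
    qed
  qed
  then have "abs_l2 u = abs_l2 (J (d2 u))" using LIMSEQ_unique[OF l0] by blast
  then have "ae_eq u (J (d2 u))" using abs_l2_eq_iff[OF uL J_L2] by blast
  ultimately show "u \<in> L2 \<and> (\<exists>g\<in>N. ae_eq u (J g))" using uL by blast
next
  assume "u \<in> L2 \<and> (\<exists>g\<in>N. ae_eq u (J g))"
  then obtain g where u: "u \<in> L2" and g: "g \<in> N" "ae_eq u (J g)" by blast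
  obtain s where s: "\<forall>n. s n \<in> second_deriv ` test_functions" "s \<longlonglongrightarrow> g"
    using g(1) unfolding N_def closure_sequential by (elim exE conjE)
  then have "\<forall>n. \<exists>\<phi>. \<phi> \<in> test_functions \<and> s n = second_deriv \<phi>" by (simp add: image_iff Bex_def)
  then obtain \<phi> where \<phi>: "\<And>n. \<phi> n \<in> test_functions" "\<And>n. s n = second_deriv (\<phi> n)" by metis
  have le: "H2_norm (\<phi> n - u) \<le> 2 * norm (s n - g)" for n
  proof (rule H2_norm_J)
    have e: "\<phi> n - u = (\<lambda>x. \<phi> n x - u x)" by (simp add: fun_diff_def)
    show "\<phi> n - u \<in> L2" unfolding e by (intro L2_diff test_L2 \<phi> u)
    show "ae_eq (\<phi> n - u) (J (s n - g))"
      using test_ae_eq_J[OF \<phi>(1)[of n]] g(2) unfolding e ae_eq_def \<phi>(2)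
      by eventually_elim (simp add: J_linear)
  qed
  have "(\<lambda>n. 2 * norm (s n - g)) \<longlonglongrightarrow> 2 * norm (g - g)"
    by (intro tendsto_intros s(2))
  then have lim: "(\<lambda>n. 2 * norm (s n - g)) \<longlonglongrightarrow> 0" by simp
  have "norm (H2_norm (\<phi> n - u)) \<le> 2 * norm (s n - g)" for n
    using le[of n] by (simp add: H2_norm_def)
  then have "(\<lambda>n. H2_norm (\<phi> n - u)) \<longlonglongrightarrow> 0"
    by (intro Lim_null_comparison[OF always_eventually lim] allI)
  then show "u \<in> H2_0" using ae_eq_J(1)[OF u g(2)] \<phi>(1) by (auto simp: H2_0_def)
qed

section \<open>The weighted spaces and the operator in the coordinates u'' and u / sqrt a\<close>

context degenerate_coefficient
begin

lemma L2w_iff: "u \<in> L2w a \<longleftrightarrow> u \<in> L2 \<and> (\<lambda>x. u x / sqrt (a x)) \<in> L2"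
proof -
  have "integrable M01 (\<lambda>x. (u x)\<^sup>2 / a x) \<longleftrightarrow> integrable M01 (\<lambda>x. (u x / sqrt (a x))\<^sup>2)"
    by (rule Bochner_Integration.integrable_cong) (use a_pos in \<open>auto simp: power_divide less_imp_le\<close>)
  then show ?thesis
    using borel_measurable_divide[OF _ sqrt_measurable, of u] by (auto simp: L2w_def L2_on_def)
qed

lemma L2w_inner_wt:
  assumes "u \<in> L2w a" "v \<in> L2w a" shows "L2w_inner a u v = wt u \<bullet> wt v"
proof -
  have "wt u \<bullet> wt v = (LINT x|M01. (u x / sqrt (a x)) * (v x / sqrt (a x)))"
    unfolding wt_def by (rule inner_abs_l2) (use assms L2w_iff in auto)
  also have "\<dots> = (LINT x|M01. u x * v x / a x)"
    by (rule Bochner_Integration.integral_cong) (use a_pos in \<open>auto simp: less_imp_le\<close>)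
  finally show ?thesis by (simp add: L2w_inner_def)
qed

lemma L2w_norm_wt: "u \<in> L2w a \<Longrightarrow> L2w_norm a u = norm (wt u)"
  using L2w_inner_wt[of u u] by (simp add: L2w_norm_def L2w_inner_def norm_eq_sqrt_inner power2_eq_square)

lemma L2w_lincomb:
  assumes "u \<in> L2w a" "v \<in> L2w a"
  shows "(\<lambda>x. u x + c * v x) \<in> L2w a" "wt (\<lambda>x. u x + c * v x) = wt u + c *\<^sub>R wt v"
proof -
  have e: "(\<lambda>x. (u x + c * v x) / sqrt (a x)) = (\<lambda>x. u x / sqrt (a x) + c * (v x / sqrt (a x)))"
    by (simp add: add_divide_distrib)
  show "(\<lambda>x. u x + c * v x) \<in> L2w a" using assms unfolding L2w_iff e by (intro conjI L2_add L2_scale) auto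
  show "wt (\<lambda>x. u x + c * v x) = wt u + c *\<^sub>R wt v"
    using assms unfolding wt_def e L2w_iff
    by (simp only: scaleR_abs_l2 plus_abs_l2 L2_scale)
qed

lemma L2w_zero: "(\<lambda>x. 0) \<in> L2w a" "wt (\<lambda>x. 0) = 0"
  by (auto simp: L2w_iff wt_def abs_l2_zero)

lemma L2w_minus: "u \<in> L2w a \<Longrightarrow> - u \<in> L2w a \<and> wt (- u) = - wt u"
  using L2w_lincomb[OF L2w_zero(1), of u "-1"] L2w_zero by (simp add: fun_Compl_def)

lemma L2w_diff: "u \<in> L2w a \<Longrightarrow> v \<in> L2w a \<Longrightarrow> u - v \<in> L2w a \<and> wt (u - v) = wt u - wt v"
  using L2w_lincomb[of u v "-1"] by (simp add: fun_diff_def)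

lemma L2w_add: "u \<in> L2w a \<Longrightarrow> v \<in> L2w a \<Longrightarrow> u + v \<in> L2w a \<and> wt (u + v) = wt u + wt v"
  using L2w_lincomb[of u v 1] by (simp add: plus_fun_def)

lemma L2w_scale: "u \<in> L2w a \<Longrightarrow> c *\<^sub>R u \<in> L2w a \<and> wt (c *\<^sub>R u) = c *\<^sub>R wt u"
  using L2w_lincomb[OF L2w_zero(1), of u c] L2w_zero by (simp add: scaleR_fun_def)

lemma wt_eq_iff:
  assumes "u \<in> L2w a" "v \<in> L2w a" shows "wt u = wt v \<longleftrightarrow> ae_eq u v"
proof -
  have "wt u = wt v \<longleftrightarrow> (AE x in M01. u x / sqrt (a x) = v x / sqrt (a x))"
    unfolding wt_def using assms by (subst abs_l2_eq_iff) (auto simp: L2w_iff ae_eq_def)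
  also have "\<dots> \<longleftrightarrow> (AE x in M01. u x = v x)"
    by (rule AE_cong) (use a_neq in auto)
  finally show ?thesis by (simp add: ae_eq_def)
qed

definition unwt :: "l2 \<Rightarrow> fn" where "unwt x = (\<lambda>s. sqrt (a s) * rep_l2 x s)"

lemma sqrt_mult_L2: "w \<in> L2 \<Longrightarrow> (\<lambda>s. sqrt (a s) * w s) \<in> L2"
proof -
  have "compact ((\<lambda>x. sqrt (a x)) ` {0..1})" by (rule compact_continuous_image[OF sqrt_cont]) simp
  then obtain C where C: "\<And>x. x \<in> {0..1} \<Longrightarrow> \<bar>sqrt (a x)\<bar> \<le> C"
    by (metis bounded_iff compact_imp_bounded imageI real_norm_def)
  show "(\<lambda>s. sqrt (a s) * w s) \<in> L2" if "w \<in> L2"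
    by (rule mult_op_L2[OF sqrt_measurable _ that, of C]) (use C in auto)
qed

lemma unwt: "unwt x \<in> L2w a" "wt (unwt x) = x"
proof -
  have ae: "ae_eq (rep_l2 x) (\<lambda>s. unwt x s / sqrt (a s))"
    unfolding ae_eq_def unwt_def using AE_sqrt_neq by eventually_elim simp
  have L: "(\<lambda>s. unwt x s / sqrt (a s)) \<in> L2" by (rule ae_eq_in_L2[OF rep_l2_L2 ae])
  show "unwt x \<in> L2w a" unfolding L2w_iff using L sqrt_mult_L2[OF rep_l2_L2] by (simp add: unwt_def)
  show "wt (unwt x) = x" unfolding wt_def using abs_l2_eq_iff[OF rep_l2_L2 L, of x] ae by simp
qed

lemma ae_eq_J_L2w:
  assumes "u \<in> L2" "ae_eq u (J g)" shows "u \<in> L2w a" "wt u = opT g"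
proof -
  have ae: "ae_eq (\<lambda>x. J g x / sqrt (a x)) (\<lambda>x. u x / sqrt (a x))"
    using assms(2) unfolding ae_eq_def by eventually_elim simp
  have L: "(\<lambda>x. u x / sqrt (a x)) \<in> L2" by (rule ae_eq_in_L2[OF opT_L2 ae])
  show "u \<in> L2w a" using assms(1) L by (simp add: L2w_iff)
  show "wt u = opT g" unfolding opT_def wt_def using abs_l2_eq_iff[OF opT_L2 L, of g] ae by simp
qed

text \<open>Functions in H^2_0 lie in the weighted space automatically, by the bound on J g / sqrt
  a.\<close>

lemma H2w_iff: "u \<in> H2w a \<longleftrightarrow> u \<in> L2 \<and> (\<exists>g\<in>N. ae_eq u (J g))"
  using ae_eq_J_L2w(1) by (auto simp: H2w_def H2_0_iff)

lemma H2w_props: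
  assumes "u \<in> H2w a"
  shows "u \<in> L2" "d2 u \<in> N" "ae_eq u (J (d2 u))" "u \<in> L2w a" "wt u = opT (d2 u)"
    "weak_deriv 2 u \<in> L2" "weak_deriv 1 u \<in> L2" "abs_l2 (weak_deriv 1 u) = abs_l2 (J1 (d2 u))"
proof -
  obtain g where g: "u \<in> L2" "g \<in> N" "ae_eq u (J g)" using assms H2w_iff by blast
  have e: "d2 u = g" by (rule ae_eq_J(4)[OF g(1,3)])
  show "u \<in> L2" "d2 u \<in> N" "ae_eq u (J (d2 u))" "u \<in> L2w a" "wt u = opT (d2 u)"
    "weak_deriv 2 u \<in> L2" "weak_deriv 1 u \<in> L2" "abs_l2 (weak_deriv 1 u) = abs_l2 (J1 (d2 u))"
    unfolding e using g ae_eq_J[OF g(1,3)] ae_eq_J_L2w[OF g(1,3)] by auto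
qed

lemma J_H2w: "g \<in> N \<Longrightarrow> J g \<in> H2w a" "d2 (J g) = g"
  using J_L2 ae_eq_J(4)[OF J_L2 ae_eq_refl] by (auto simp: H2w_iff intro: bexI[of _ g])

lemma H2w_lincomb:
  assumes "u \<in> H2w a" "v \<in> H2w a"
  shows "(\<lambda>x. u x + c * v x) \<in> H2w a" "d2 (\<lambda>x. u x + c * v x) = d2 u + c *\<^sub>R d2 v"
proof -
  note u = H2w_props[OF assms(1)] and v = H2w_props[OF assms(2)]
  have L: "(\<lambda>x. u x + c * v x) \<in> L2" using u v by simp
  have ae: "ae_eq (\<lambda>x. u x + c * v x) (J (d2 u + c *\<^sub>R d2 v))"
    using u(3) v(3) unfolding ae_eq_def by eventually_elim (simp add: J_linear)
  have "d2 u + c *\<^sub>R d2 v \<in> N" using u(2) v(2) subspace_N by (simp add: subspace_add subspace_scale)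
  then show "(\<lambda>x. u x + c * v x) \<in> H2w a" using L ae H2w_iff by blast
  show "d2 (\<lambda>x. u x + c * v x) = d2 u + c *\<^sub>R d2 v" by (rule ae_eq_J(4)[OF L ae])
qed

lemma H2w_zero: "(\<lambda>x. 0) \<in> H2w a" "d2 (\<lambda>x. 0) = 0"
proof -
  have ae: "ae_eq (\<lambda>x. 0) (J 0)" by (simp add: ae_eq_def J_def)
  show "(\<lambda>x. 0) \<in> H2w a" using H2w_iff ae subspace_0[OF subspace_N] L2_const by blast
  show "d2 (\<lambda>x. 0) = 0" by (rule ae_eq_J(4)[OF L2_const ae])
qed

lemma H2w_diff: "u \<in> H2w a \<Longrightarrow> v \<in> H2w a \<Longrightarrow> u - v \<in> H2w a \<and> d2 (u - v) = d2 u - d2 v"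
  using H2w_lincomb[of u v "-1"] by (simp add: fun_diff_def)

lemma H2w_add: "u \<in> H2w a \<Longrightarrow> v \<in> H2w a \<Longrightarrow> u + v \<in> H2w a \<and> d2 (u + v) = d2 u + d2 v"
  using H2w_lincomb[of u v 1] by (simp add: plus_fun_def)

lemma H2w_scale: "u \<in> H2w a \<Longrightarrow> c *\<^sub>R u \<in> H2w a \<and> d2 (c *\<^sub>R u) = c *\<^sub>R d2 u"
  using H2w_lincomb[OF H2w_zero(1), of u c] H2w_zero by (simp add: scaleR_fun_def)

lemma H2w_norm_eq:
  assumes "u \<in> H2w a"
  shows "H2w_norm a u = sqrt ((norm (opT (d2 u)))\<^sup>2 + (norm (abs_l2 (J1 (d2 u))))\<^sup>2 + (norm (d2 u))\<^sup>2)"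
  using H2w_props[OF assms] unfolding H2w_norm_def L2w_norm_wt[OF H2w_props(4)[OF assms]]
  by (simp add: norm_abs_l2[symmetric] d2_def)

lemma norm_d2_le: "u \<in> H2w a \<Longrightarrow> norm (d2 u) \<le> H2w_norm a u"
  unfolding H2w_norm_eq by (rule real_le_rsqrt) simp

text \<open>With \<open>norm_d2_le\<close> this makes the norm equivalent to that of u'', so that
  the dual of \<open>H2w a\<close> can be represented by \<open>N\<close>.\<close>

lemma H2w_norm_le: obtains K where "K \<ge> 0" "\<And>u. u \<in> H2w a \<Longrightarrow> H2w_norm a u \<le> K * norm (d2 u)"
proof -
  obtain k where k: "k > 0" "\<And>x. norm (opT x) \<le> norm x * k" using T.pos_bounded by blast
  show ?thesis
  proof (rule that[of "k + 2"])
    fix u assume u: "u \<in> H2w a"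
    have "(norm (opT (d2 u)))\<^sup>2 \<le> (norm (d2 u) * k)\<^sup>2" by (intro power_mono k) simp
    moreover have "(norm (abs_l2 (J1 (d2 u))))\<^sup>2 \<le> (norm (d2 u))\<^sup>2" by (intro power_mono norm_J1_le) simp
    moreover have "((k + 2) * norm (d2 u))\<^sup>2 = (norm (d2 u) * k)\<^sup>2 + 4 * (norm (d2 u))\<^sup>2 + 4 * k * (norm (d2 u))\<^sup>2"
      by (simp add: power2_eq_square algebra_simps)
    moreover have "0 \<le> 4 * k * (norm (d2 u))\<^sup>2" using k by simp
    moreover have "0 \<le> (norm (d2 u))\<^sup>2" by simp
    ultimately have "(norm (opT (d2 u)))\<^sup>2 + (norm (abs_l2 (J1 (d2 u))))\<^sup>2 + (norm (d2 u))\<^sup>2 \<le> ((k + 2) * norm (d2 u))\<^sup>2"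
      by linarith
    then show "H2w_norm a u \<le> (k + 2) * norm (d2 u)"
      unfolding H2w_norm_eq[OF u] using k by (intro real_le_lsqrt) auto
  qed (use k in simp)
qed

text \<open>\<open>weak_deriv\<close> chooses for each function separately; injectivity of
  \<open>opT\<close> shows that the class of u'' depends only on the class of u.\<close>

lemma ae_eq_d2:
  assumes "u \<in> H2w a" "v \<in> H2w a" "ae_eq u v" shows "d2 u = d2 v"
proof -
  have "wt u = wt v" using assms wt_eq_iff H2w_props(4) by blast
  then have "opT (d2 u - d2 v) = 0" using assms H2w_props(5) by (simp add: T.diff)
  then show ?thesis using opT_injective by fastforce
qed

lemma d2_inner_second_deriv:
  assumes "u \<in> H2w a" "\<phi> \<in> test_functions"
  shows "d2 u \<bullet> second_deriv \<phi> = (LINT x|M01. u x * (deriv ^^ 4) \<phi> x)"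
proof -
  note u = H2w_props[OF assms(1)]
  have \<phi>2: "deriv (deriv \<phi>) \<in> test_functions" by (intro test_deriv assms)
  have "has_weak_deriv 2 u (weak_deriv 2 u)" by (rule weak_deriv_has[OF ae_eq_J_weak_derivs(2)[OF u(1,3)]])
  then have "(LINT x|M01. u x * (deriv ^^ 2) (deriv (deriv \<phi>)) x) = (LINT x|M01. weak_deriv 2 u x * deriv (deriv \<phi>) x)"
    using \<phi>2 by (simp add: has_weak_deriv_def)
  also have "\<dots> = d2 u \<bullet> second_deriv \<phi>"
    unfolding d2_def by (rule inner_abs_l2[symmetric, OF u(6) test_L2[OF \<phi>2]])
  finally show ?thesis by (simp add: deriv_2 deriv_4)
qed

text \<open>Tested with phi, the weak fourth derivative satisfies the identity that defines
  \<open>R\<close>, on \<open>second_deriv \<phi>\<close>. Both sides are continuous, so it extends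
  to the closure \<open>N\<close>.\<close>

lemma A_dom_props:
  assumes u: "u \<in> A_dom a"
  shows "u \<in> H2w a" "A_op a u \<in> L2w a" "d2 u = R (wt (A_op a u))"
proof -
  show uH: "u \<in> H2w a" and AL: "A_op a u \<in> L2w a" using u by (auto simp: A_dom_def)
  obtain g where "has_weak_deriv 4 u g" using u by (auto simp: A_dom_def)
  then have w4: "has_weak_deriv 4 u (weak_deriv 4 u)" by (rule weak_deriv_has)
  have wL: "(\<lambda>x. A_op a u x / sqrt (a x)) \<in> L2" using AL L2w_iff by blast
  have e: "d2 u \<bullet> second_deriv \<phi> = wt (A_op a u) \<bullet> opT (second_deriv \<phi>)" if \<phi>: "\<phi> \<in> test_functions" for \<phi>
  proof -
    have "d2 u \<bullet> second_deriv \<phi> = (LINT x|M01. weak_deriv 4 u x * \<phi> x)"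
      using d2_inner_second_deriv[OF uH \<phi>] w4 \<phi> by (simp add: has_weak_deriv_def)
    also have "\<dots> = (LINT x|M01. (A_op a u x / sqrt (a x)) / sqrt (a x) * \<phi> x)"
    proof (rule Bochner_Integration.integral_cong[OF refl])
      fix x assume "x \<in> space M01"
      then have ax: "sqrt (a x) * sqrt (a x) = a x" "a x \<noteq> 0" using a_pos[of x] by auto
      have "(A_op a u x / sqrt (a x)) / sqrt (a x) = a x * weak_deriv 4 u x / (sqrt (a x) * sqrt (a x))"
        by (simp only: A_op_def divide_divide_eq_left)
      then have "(A_op a u x / sqrt (a x)) / sqrt (a x) = weak_deriv 4 u x"
        unfolding ax(1) using ax(2) by simp
      then show "weak_deriv 4 u x * \<phi> x = (A_op a u x / sqrt (a x)) / sqrt (a x) * \<phi> x" by simp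
    qed
    also have "\<dots> = wt (A_op a u) \<bullet> opT (second_deriv \<phi>)"
      unfolding wt_def by (rule inner_opT_second_deriv[OF wL \<phi>, symmetric])
    finally show ?thesis .
  qed
  have "N \<subseteq> {c. d2 u \<bullet> c = wt (A_op a u) \<bullet> opT c}"
    unfolding N_def
  proof (rule closure_minimal)
    show "closed {c. d2 u \<bullet> c = wt (A_op a u) \<bullet> opT c}"
      by (intro closed_Collect_eq continuous_intros T.continuous_on continuous_on_id)
  qed (use e in auto)
  then have "R (wt (A_op a u)) = d2 u" using H2w_props(2)[OF uH] by (intro R_eqI) auto
  then show "d2 u = R (wt (A_op a u))" by simp
qed

text \<open>The converse: the identity defining \<open>R y\<close> says that w / sqrt a is the weak
  fourth derivative, so A u = sqrt a w, which lies in the weighted space.\<close>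

lemma A_dom_I:
  assumes uH: "u \<in> H2w a" and e: "d2 u = R y"
  shows "u \<in> A_dom a" "wt (A_op a u) = y"
proof -
  obtain w where w: "w \<in> L2" "y = abs_l2 w" by (rule l2_cases)
  have w4: "has_weak_deriv 4 u (\<lambda>x. w x / sqrt (a x))"
    unfolding has_weak_deriv_def
  proof (intro conjI ballI)
    show "locally_integrable u" by (rule L2_locally_integrable[OF H2w_props(1)[OF uH]])
    show "locally_integrable (\<lambda>x. w x / sqrt (a x))" by (rule locally_integrable_div_sqrt[OF w(1)])
    fix \<phi> assume \<phi>: "\<phi> \<in> test_functions"
    have "(LINT x|M01. u x * (deriv ^^ 4) \<phi> x) = R y \<bullet> second_deriv \<phi>"
      using d2_inner_second_deriv[OF uH \<phi>] e by simp
    also have "\<dots> = (LINT x|M01. w x / sqrt (a x) * \<phi> x)"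
      unfolding R_inner[OF second_deriv_in_N[OF \<phi>]] w(2) by (rule inner_opT_second_deriv[OF w(1) \<phi>])
    finally show "(LINT x|M01. u x * (deriv ^^ 4) \<phi> x) = (- 1) ^ 4 * (LINT x|M01. w x / sqrt (a x) * \<phi> x)" by simp
  qed
  have ae0: "AE x in M01. weak_deriv 4 u x = w x / sqrt (a x)"
    using weak_deriv_ae[OF w4] by (simp add: ae_eq_def)
  have pos: "AE x in M01. sqrt (a x) \<noteq> 0 \<and> sqrt (a x) * sqrt (a x) = a x"
  proof (rule AE_I2)
    show "sqrt (a x) \<noteq> 0 \<and> sqrt (a x) * sqrt (a x) = a x" if "x \<in> space M01" for x using a_pos[of x] that by simp
  qed
  have ae1: "ae_eq (\<lambda>x. sqrt (a x) * w x) (A_op a u)"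
    unfolding ae_eq_def using ae0 pos
  proof eventually_elim
    case (elim x)
    have "A_op a u x = (sqrt (a x) * sqrt (a x)) * (w x / sqrt (a x))"
      unfolding A_op_def elim(1) using elim(2) by (simp only:)
    also have "\<dots> = sqrt (a x) * (sqrt (a x) * (w x / sqrt (a x)))" by (rule mult.assoc)
    also have "sqrt (a x) * (w x / sqrt (a x)) = w x" using elim(2) by simp
    finally show ?case by simp
  qed
  have ae2: "ae_eq w (\<lambda>x. A_op a u x / sqrt (a x))"
    using ae1 pos unfolding ae_eq_def by eventually_elim (metis nonzero_mult_div_cancel_left)
  have AL: "A_op a u \<in> L2w a"
    unfolding L2w_iff using ae_eq_in_L2[OF sqrt_mult_L2[OF w(1)] ae1] ae_eq_in_L2[OF w(1) ae2] by simp
  show "u \<in> A_dom a" using uH w4 AL by (auto simp: A_dom_def)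
  show "wt (A_op a u) = y"
    unfolding wt_def w(2) using abs_l2_eq_iff[OF w(1) ae_eq_in_L2[OF w(1) ae2]] ae2 by simp
qed

lemma second_deriv_trace_iff:
  assumes u: "u \<in> H2w a" shows "second_deriv_trace u r \<longleftrightarrow> has_trace (d2 u) r"
proof
  note up = H2w_props[OF u]
  have hw: "has_weak_deriv 2 u (weak_deriv 2 u)" by (rule weak_deriv_has[OF ae_eq_J_weak_derivs(2)[OF up(1,3)]])
  show "has_trace (d2 u) r" if st: "second_deriv_trace u r"
  proof -
    obtain g where g: "has_weak_deriv 2 u g" "continuous_on {0<..1} g" "g 1 = r"
      using st by (auto simp: second_deriv_trace_def)
    have ae: "ae_eq (weak_deriv 2 u) g" by (rule weak_deriv_ae[OF g(1)])
    have gL: "g \<in> L2" by (rule ae_eq_in_L2[OF up(6) ae])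
    have "d2 u = abs_l2 g" unfolding d2_def using abs_l2_eq_iff[OF up(6) gL] ae by simp
    then show ?thesis using g gL by (auto simp: has_trace_def)
  qed
  show "second_deriv_trace u r" if ht: "has_trace (d2 u) r"
  proof -
    obtain p where p: "p \<in> L2" "continuous_on {0<..1} p" "d2 u = abs_l2 p" "p 1 = r"
      using ht by (auto simp: has_trace_def)
    have "ae_eq (weak_deriv 2 u) p" using p(3) abs_l2_eq_iff[OF up(6) p(1)] by (simp add: d2_def)
    then have "has_weak_deriv 2 u p" by (rule has_weak_deriv_cong[OF hw L2_locally_integrable[OF p(1)]])
    then show ?thesis using p by (auto simp: second_deriv_trace_def)
  qed
qed

lemma A_dom_trace:
  assumes "u \<in> A_dom a" shows "second_deriv_trace u r \<longleftrightarrow> r = trace (wt (A_op a u))"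
  using second_deriv_trace_iff[OF A_dom_props(1)[OF assms]] A_dom_props(3)[OF assms]
    has_trace_R[of "wt (A_op a u)"] has_trace_unique by metis

end

section \<open>Translation of curves, functionals and modes between functions and classes\<close>

text \<open>Brings the vector derivative into the shape of \<open>curve_has_deriv\<close>.\<close>

lemma has_vector_derivative_iff_quotient:
  fixes f :: "real \<Rightarrow> 'b::real_normed_vector"
  shows "(f has_vector_derivative v) (at t within S) \<longleftrightarrow>
    ((\<lambda>s. norm ((f s - f t) /\<^sub>R (s - t) - v)) \<longlongrightarrow> 0) (at t within S)"
proof -
  have e: "norm ((1 / norm (s - t)) *\<^sub>R (f s - (f t + (s - t) *\<^sub>R v))) = norm ((f s - f t) /\<^sub>R (s - t) - v)"
    if "s \<noteq> t" for s
  proof -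
    have "f s - (f t + (s - t) *\<^sub>R v) = (s - t) *\<^sub>R ((f s - f t) /\<^sub>R (s - t) - v)"
      using that by (simp add: scaleR_diff_right)
    then have "norm (f s - (f t + (s - t) *\<^sub>R v)) = \<bar>s - t\<bar> * norm ((f s - f t) /\<^sub>R (s - t) - v)"
      by (simp only: norm_scaleR)
    then show ?thesis using that by simp
  qed
  have "(f has_vector_derivative v) (at t within S) \<longleftrightarrow>
    ((\<lambda>s. norm ((1 / norm (s - t)) *\<^sub>R (f s - (f t + (s - t) *\<^sub>R v)))) \<longlongrightarrow> 0) (at t within S)"
    unfolding has_vector_derivative_def has_derivative_within tendsto_norm_zero_iff
    by (simp add: bounded_linear_scaleR_left)
  also have "\<dots> \<longleftrightarrow> ((\<lambda>s. norm ((f s - f t) /\<^sub>R (s - t) - v)) \<longlongrightarrow> 0) (at t within S)"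
    by (rule filterlim_cong[OF refl refl]) (use e in \<open>auto simp: eventually_at_filter\<close>)
  finally show ?thesis .
qed

text \<open>K < 2 gives x a' <= 2 a, so a / x^2 has nonpositive derivative; comparing its values at
  x and 1 gives the quadratic lower bound.\<close>

lemma degenerate_coefficientI:
  assumes "weakly_degenerate a \<or> strongly_degenerate a"
  shows "\<exists>a'. degenerate_coefficient a a'"
proof -
  have "continuous_on {0..1} a \<and> (\<forall>x\<in>{0<..1}. 0 < a x) \<and>
     (\<exists>a'. (\<forall>x\<in>{0<..1}. (a has_real_derivative a' x) (at x within {0..1})) \<and>
           continuous_on {0<..1} a' \<and> degeneracy_const a a' < 2)"
    using assms
  proof
    assume w: "weakly_degenerate a"
    obtain a' where a': "\<forall>x\<in>{0<..1}. (a has_real_derivative a' x) (at x within {0..1})"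
      "continuous_on {0<..1} a'" "degeneracy_const a a' < 1" using w by (auto simp: weakly_degenerate_def)
    have "degeneracy_const a a' < 2" by (rule less_trans[OF a'(3)]) simp
    then show ?thesis using w a'(1,2) unfolding weakly_degenerate_def by blast
  next
    assume s: "strongly_degenerate a"
    obtain a' where a': "\<forall>x\<in>{0..1}. (a has_real_derivative a' x) (at x within {0..1})"
      "continuous_on {0..1} a'" "degeneracy_const a a' < 2" using s by (auto simp: strongly_degenerate_def)
    have "continuous_on {0..1} a"
      unfolding continuous_on_eq_continuous_within by (intro ballI DERIV_continuous[OF bspec[OF a'(1)]])
    moreover have "\<forall>x\<in>{0<..1}. (a has_real_derivative a' x) (at x within {0..1})" using a'(1) by auto
    moreover have "continuous_on {0<..1} a'" by (rule continuous_on_subset[OF a'(2)]) auto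
    ultimately show ?thesis using s a'(3) unfolding strongly_degenerate_def by blast
  qed
  then obtain a' where c: "continuous_on {0..1} a" and pos: "\<And>x. x \<in> {0<..1} \<Longrightarrow> 0 < a x"
    and d: "\<And>x. x \<in> {0<..1} \<Longrightarrow> (a has_real_derivative a' x) (at x within {0..1})"
    and c': "continuous_on {0<..1} a'" and K: "degeneracy_const a a' < 2" by blast
  have b: "x * a' x \<le> 2 * a x" if x: "x \<in> {0<..1}" for x
  proof -
    have "ereal (x * \<bar>a' x\<bar> / a x) \<le> degeneracy_const a a'"
      unfolding degeneracy_const_def using x by (rule SUP_upper)
    moreover have "degeneracy_const a a' < ereal 2" using K by simp
    ultimately have "ereal (x * \<bar>a' x\<bar> / a x) < ereal 2" by (rule le_less_trans)
    then have "x * \<bar>a' x\<bar> / a x < 2" by (simp only: less_ereal.simps)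
    then have "x * \<bar>a' x\<bar> < 2 * a x" using pos[OF x] by (simp add: pos_divide_less_eq)
    moreover have "x * a' x \<le> x * \<bar>a' x\<bar>" using x by (intro mult_left_mono) auto
    ultimately show ?thesis by simp
  qed
  have lower: "a 1 * x\<^sup>2 \<le> a x" if x: "x \<in> {0<..1}" for x
  proof -
    have "a 1 / 1\<^sup>2 \<le> a x / x\<^sup>2"
    proof (rule DERIV_nonpos_imp_decreasing_open[of x 1 "\<lambda>y. a y / y\<^sup>2"])
      show "x \<le> 1" using x by simp
      have "continuous_on {x..1} a" by (rule continuous_on_subset[OF c]) (use x in auto)
      then show "continuous_on {x..1} (\<lambda>y. a y / y\<^sup>2)"
        using x by (intro continuous_intros) auto
      fix y assume y: "x < y" "y < 1"
      then have y': "y \<in> {0<..1}" "0 < y" using x by auto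
      have "(a has_real_derivative a' y) (at y)"
        using d[OF y'(1)] at_within_Icc_at[of 0 y 1] y y' by simp
      then have "((\<lambda>y. a y / y\<^sup>2) has_real_derivative (a' y * y\<^sup>2 - a y * (2 * y)) / (y\<^sup>2 * y\<^sup>2)) (at y)"
        using y' by (auto intro!: derivative_eq_intros)
      moreover have "(a' y * y\<^sup>2 - a y * (2 * y)) / (y\<^sup>2 * y\<^sup>2) \<le> 0"
      proof (rule divide_nonpos_nonneg)
        have "y * (y * a' y) \<le> y * (2 * a y)" using b[OF y'(1)] y'(2) by (intro mult_left_mono) auto
        then show "a' y * y\<^sup>2 - a y * (2 * y) \<le> 0" by (simp add: power2_eq_square algebra_simps)
      qed simp
      ultimately show "\<exists>z. ((\<lambda>y. a y / y\<^sup>2) has_real_derivative z) (at y) \<and> z \<le> 0" by blast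
    qed
    then show ?thesis using x by (simp add: field_simps)
  qed
  have "degenerate_coefficient a a'"
    by unfold_locales (use c pos d c' lower in auto)
  then show ?thesis by blast
qed

context degenerate_coefficient
begin

text \<open>\<open>\<Psi>\<close> identifies \<^term>\<open>H0 a\<close>, up to equality almost everywhere, with \<open>N \<times> l2\<close>.\<close>

definition \<Psi> :: "fn \<times> fn \<Rightarrow> l2 \<times> l2" where "\<Psi> U = (d2 (fst U), wt (snd U))"

lemma H0_diff: "U \<in> H0 a \<Longrightarrow> V \<in> H0 a \<Longrightarrow> U - V \<in> H0 a \<and> \<Psi> (U - V) = \<Psi> U - \<Psi> V"
  using H2w_diff L2w_diff by (auto simp: H0_def \<Psi>_def mem_Times_iff)

lemma H0_scale: "U \<in> H0 a \<Longrightarrow> c *\<^sub>R U \<in> H0 a \<and> \<Psi> (c *\<^sub>R U) = c *\<^sub>R \<Psi> U"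
  using H2w_scale L2w_scale by (auto simp: H0_def \<Psi>_def mem_Times_iff)

lemma H0_norm_\<Psi>:
  assumes "U \<in> H0 a" shows "H0_norm a U = norm (\<Psi> U)"
proof -
  have U: "fst U \<in> H2w a" "snd U \<in> L2w a" using assms by (auto simp: H0_def mem_Times_iff)
  show ?thesis
    using norm_abs_l2[OF H2w_props(6)[OF U(1)]] L2w_norm_wt[OF U(2)]
    by (simp add: H0_norm_def \<Psi>_def d2_def norm_Pair)
qed

lemma curve_continuous_H0:
  assumes "\<And>t. t \<ge> 0 \<Longrightarrow> V t \<in> H0 a"
  shows "curve_continuous (H0_norm a) V \<longleftrightarrow> continuous_on {0..} (\<lambda>t. \<Psi> (V t))"
proof -
  have "((\<lambda>s. H0_norm a (V s - V t)) \<longlongrightarrow> 0) (at t within {0..}) \<longleftrightarrow> ((\<lambda>s. \<Psi> (V s)) \<longlongrightarrow> \<Psi> (V t)) (at t within {0..})"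
    if t: "t \<ge> 0" for t
  proof -
    have "((\<lambda>s. H0_norm a (V s - V t)) \<longlongrightarrow> 0) (at t within {0..}) \<longleftrightarrow> ((\<lambda>s. norm (\<Psi> (V s) - \<Psi> (V t))) \<longlongrightarrow> 0) (at t within {0..})"
      by (rule filterlim_cong[OF refl refl])
        (use assms t H0_diff H0_norm_\<Psi> in \<open>auto simp: eventually_at_filter\<close>)
    then show ?thesis by (simp only: tendsto_norm_zero_iff LIM_zero_iff)
  qed
  then show ?thesis by (auto simp: curve_continuous_def continuous_on_def)
qed

lemma curve_has_deriv_H0:
  assumes V: "\<And>t. t \<ge> 0 \<Longrightarrow> V t \<in> H0 a" and W: "\<And>t. t \<ge> 0 \<Longrightarrow> W t \<in> H0 a"
  shows "curve_has_deriv (H0_norm a) V W \<longleftrightarrow>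
    (\<forall>t\<ge>0. ((\<lambda>s. \<Psi> (V s)) has_vector_derivative \<Psi> (W t)) (at t within {0..}))"
proof -
  have "((\<lambda>s. H0_norm a ((V s - V t) /\<^sub>R (s - t) - W t)) \<longlongrightarrow> 0) (at t within {0..}) \<longleftrightarrow>
     ((\<lambda>s. \<Psi> (V s)) has_vector_derivative \<Psi> (W t)) (at t within {0..})" if t: "t \<ge> 0" for t
    unfolding has_vector_derivative_iff_quotient
  proof (rule filterlim_cong[OF refl refl])
    have "H0_norm a ((V s - V t) /\<^sub>R (s - t) - W t) = norm ((\<Psi> (V s) - \<Psi> (V t)) /\<^sub>R (s - t) - \<Psi> (W t))"
      if s: "s \<ge> 0" for s
    proof -
      have 1: "V s - V t \<in> H0 a" "\<Psi> (V s - V t) = \<Psi> (V s) - \<Psi> (V t)"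
        using H0_diff[OF V[OF s] V[OF t]] by auto
      have 2: "(V s - V t) /\<^sub>R (s - t) \<in> H0 a" "\<Psi> ((V s - V t) /\<^sub>R (s - t)) = \<Psi> (V s - V t) /\<^sub>R (s - t)"
        using H0_scale[OF 1(1)] by auto
      show ?thesis using H0_diff[OF 2(1) W[OF t]] H0_norm_\<Psi> 1(2) 2(2) by simp
    qed
    then show "\<forall>\<^sub>F s in at t within {0..}. H0_norm a ((V s - V t) /\<^sub>R (s - t) - W t) = norm ((\<Psi> (V s) - \<Psi> (V t)) /\<^sub>R (s - t) - \<Psi> (W t))"
      by (auto simp: eventually_at_filter)
  qed
  then show ?thesis by (simp add: curve_has_deriv_def)
qed

lemma has_vector_derivative_fst_snd:
  assumes "(f has_vector_derivative v) F"
  shows "((\<lambda>t. fst (f t)) has_vector_derivative fst v) F" "((\<lambda>t. snd (f t)) has_vector_derivative snd v) F"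
  by (rule bounded_linear.has_vector_derivative[OF bounded_linear_fst assms]
      bounded_linear.has_vector_derivative[OF bounded_linear_snd assms])+

lemma AA_dom_props:
  assumes "U \<in> AA_dom a"
  shows "U \<in> H0 a" "AA_op a U \<in> H0 a" "\<Psi> (AA_op a U) = (d2 (snd U), - wt (A_op a (fst U)))"
    "fst (\<Psi> U) = R (wt (A_op a (fst U)))" "snd (\<Psi> U) = opT (d2 (snd U))" "d2 (snd U) \<in> N"
proof -
  have U: "fst U \<in> A_dom a" "snd U \<in> H2w a" using assms by (auto simp: AA_dom_def mem_Times_iff)
  note A = A_dom_props[OF U(1)] and B = H2w_props[OF U(2)]
  show "U \<in> H0 a" using A B by (simp add: H0_def mem_Times_iff)
  show "AA_op a U \<in> H0 a" using U(2) L2w_minus[OF A(2)] by (simp add: H0_def AA_op_def)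
  show "\<Psi> (AA_op a U) = (d2 (snd U), - wt (A_op a (fst U)))" using L2w_minus[OF A(2)] by (simp add: \<Psi>_def AA_op_def)
  show "fst (\<Psi> U) = R (wt (A_op a (fst U)))" using A(3) by (simp add: \<Psi>_def)
  show "snd (\<Psi> U) = opT (d2 (snd U))" using B(5) by (simp add: \<Psi>_def)
  show "d2 (snd U) \<in> N" by (rule B(2))
qed

text \<open>The evolution equation read in the coordinates of \<open>\<Psi>\<close>; continuity of
  its right-hand side is continuity of u_txx and sqrt a u_xxxx.\<close>

lemma classical_solution_imp:
  assumes cs: "classical_solution a t0 X V"
  shows "classical (\<lambda>t. d2 (fst (V t))) (\<lambda>t. d2 (snd (V t))) (\<lambda>t. wt (A_op a (fst (V t))))"
proof -
  have dom: "V t \<in> AA_dom a" if "t \<ge> 0" for t using cs that by (simp add: classical_solution_def)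
  note p = AA_dom_props[OF dom]
  have der: "((\<lambda>s. \<Psi> (V s)) has_vector_derivative \<Psi> (AA_op a (V t))) (at t within {0..})" if "t \<ge> 0" for t
    using cs curve_has_deriv_H0[of V "\<lambda>t. AA_op a (V t)"] p(1,2) that by (simp add: classical_solution_def)
  have "continuous_on {0..} (\<lambda>t. \<Psi> (AA_op a (V t)))"
    using cs curve_continuous_H0[of "\<lambda>t. AA_op a (V t)"] p(2) by (simp add: classical_solution_def)
  then have "continuous_on {0..} (\<lambda>t. (d2 (snd (V t)), - wt (A_op a (fst (V t)))))"
    by (rule continuous_on_eq) (use p(3) in auto)
  from continuous_on_fst[OF this] continuous_on_minus[OF continuous_on_snd[OF this]]
  have c: "continuous_on {0..} (\<lambda>t. d2 (snd (V t)))" "continuous_on {0..} (\<lambda>t. wt (A_op a (fst (V t))))"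
    by simp_all
  show ?thesis unfolding classical_def
  proof (intro conjI allI impI c)
    fix t :: real assume t: "0 \<le> t"
    show "d2 (snd (V t)) \<in> N" by (rule p(6)[OF t])
    show "d2 (fst (V t)) = R (wt (A_op a (fst (V t))))" using p(4)[OF t] by (simp add: \<Psi>_def)
    note d = has_vector_derivative_fst_snd[OF der[OF t]]
    show "((\<lambda>t. d2 (fst (V t))) has_vector_derivative d2 (snd (V t))) (at t within {0..})"
      using d(1) p(3)[OF t] by (simp add: \<Psi>_def)
    have "((\<lambda>s. snd (\<Psi> (V s))) has_vector_derivative - wt (A_op a (fst (V t)))) (at t within {0..})"
      using d(2) p(3)[OF t] by simp
    then show "((\<lambda>s. opT (d2 (snd (V s)))) has_vector_derivative - wt (A_op a (fst (V t)))) (at t within {0..})"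
      by (rule has_vector_derivative_transform[rotated 2]) (use t p(5) in auto)
  qed
qed

text \<open>A real \<open>SUP\<close> is informative only over a nonempty set that is bounded above,
  so both are verified. The zero function also shows that the supremum is not negative, which gives
  the absolute value.\<close>

lemma dual_norm_le:
  assumes b: "\<And>v. v \<in> H2w a \<Longrightarrow> \<bar>\<xi> v\<bar> \<le> e * H2w_norm a v" and e: "e \<ge> 0"
  shows "\<bar>H2w_dual_norm a \<xi>\<bar> \<le> e"
proof -
  have z: "(\<lambda>x. 0) \<in> {v \<in> H2w a. H2w_norm a v \<le> 1}"
    using H2w_zero H2w_norm_eq[OF H2w_zero(1)] by (simp add: T.zero J1_def[abs_def] abs_l2_zero)
  have le: "\<bar>\<xi> v\<bar> \<le> e" if "v \<in> {v \<in> H2w a. H2w_norm a v \<le> 1}" for v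
    using b[of v] mult_left_mono[of "H2w_norm a v" 1 e] e that by simp
  have up: "H2w_dual_norm a \<xi> \<le> e"
    unfolding H2w_dual_norm_def by (rule cSUP_least) (use z le in auto)
  have "\<bar>\<xi> (\<lambda>x. 0)\<bar> \<le> H2w_dual_norm a \<xi>"
    unfolding H2w_dual_norm_def
    by (rule cSUP_upper[OF z]) (rule bdd_aboveI2[of _ _ e], rule le)
  then show ?thesis using up by simp
qed

text \<open>Riesz representation of g |-> u1 (J g) on \<open>N\<close>. A given \<open>u\<close>
  agrees with \<open>J (d2 u)\<close> only almost everywhere; their difference has vanishing second
  derivative, and the bound on \<open>u1\<close> makes it invisible.\<close>

lemma dual_representation:
  assumes u1: "u1 \<in> H2w_dual a"
  obtains y0 where "y0 \<in> N" "\<And>u. u \<in> H2w a \<Longrightarrow> u1 u = y0 \<bullet> d2 u"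
proof -
  have add: "\<And>u v. u \<in> H2w a \<Longrightarrow> v \<in> H2w a \<Longrightarrow> u1 (u + v) = u1 u + u1 v"
    and scale: "\<And>c u. u \<in> H2w a \<Longrightarrow> u1 (c *\<^sub>R u) = c * u1 u"
    using u1 by (auto simp: H2w_dual_def)
  obtain C where C: "\<And>u. u \<in> H2w a \<Longrightarrow> \<bar>u1 u\<bar> \<le> C * H2w_norm a u" using u1 unfolding H2w_dual_def by blast
  obtain K where K: "K \<ge> 0" "\<And>u. u \<in> H2w a \<Longrightarrow> H2w_norm a u \<le> K * norm (d2 u)" using H2w_norm_le by blast
  have bd: "\<bar>u1 u\<bar> \<le> \<bar>C\<bar> * K * norm (d2 u)" if u: "u \<in> H2w a" for u
  proof -
    have n0: "0 \<le> H2w_norm a u" by (rule order_trans[OF norm_ge_zero norm_d2_le[OF u]])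
    have "\<bar>u1 u\<bar> \<le> \<bar>C\<bar> * H2w_norm a u"
      by (rule order_trans[OF C[OF u]]) (use n0 in \<open>intro mult_right_mono; simp\<close>)
    also have "\<dots> \<le> \<bar>C\<bar> * (K * norm (d2 u))" by (intro mult_left_mono K u) simp
    finally show ?thesis by (simp add: mult.assoc)
  qed
  have "\<exists>y\<in>N. \<forall>g\<in>N. u1 (J g) = y \<bullet> g"
  proof (rule riesz_representation[OF closed_N subspace_N, where C = "\<bar>C\<bar> * K"])
    fix g h assume gh: "g \<in> N" "h \<in> N"
    have "J (g + h) = J g + J h" by (auto simp: plus_fun_def J_linear)
    then show "u1 (J (g + h)) = u1 (J g) + u1 (J h)" using add J_H2w gh by simp
  next
    fix c g assume g: "g \<in> N"
    have "J (c *\<^sub>R g) = c *\<^sub>R J g" by (auto simp: scaleR_fun_def J_linear)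
    then show "u1 (J (c *\<^sub>R g)) = c * u1 (J g)" using scale J_H2w g by simp
    show "\<bar>u1 (J g)\<bar> \<le> \<bar>C\<bar> * K * norm g" using bd[OF J_H2w(1)[OF g]] J_H2w(2) by simp
  qed
  then obtain y0 where y0: "y0 \<in> N" "\<And>g. g \<in> N \<Longrightarrow> u1 (J g) = y0 \<bullet> g" by blast
  show ?thesis
  proof (rule that[OF y0(1)])
    fix u assume u: "u \<in> H2w a"
    note g = H2w_props(2)[OF u]
    have m: "(-1) *\<^sub>R J (d2 u) \<in> H2w a" "d2 ((-1) *\<^sub>R J (d2 u)) = - d2 u"
      using H2w_scale[OF J_H2w(1)[OF g], of "-1"] J_H2w(2) by auto
    have s: "u + (-1) *\<^sub>R J (d2 u) \<in> H2w a" "d2 (u + (-1) *\<^sub>R J (d2 u)) = 0"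
      using H2w_add[OF u m(1)] m(2) by auto
    have "u1 (u + (-1) *\<^sub>R J (d2 u)) = 0" using bd[OF s(1)] s(2) by simp
    then show "u1 u = y0 \<bullet> d2 u"
      using add[OF u m(1)] scale[OF J_H2w(1)[OF g], of "-1"] y0(2)[OF g] by simp
  qed
qed

definition mode_fn :: "l2 \<Rightarrow> fn" where "mode_fn i = J (mode i)"

lemma mode_fn: "i \<in> modes \<Longrightarrow> mode_fn i \<in> H2w a" "d2 (mode_fn i) = mode i"
  "i \<in> modes \<Longrightarrow> wt (mode_fn i) = (1 / freq i) *\<^sub>R i"
  using J_H2w(1)[OF mode_in, of i] J_H2w(2) H2w_props(5)[OF J_H2w(1)[OF mode_in, of i]] T_mode[of i]
  by (auto simp: mode_fn_def)

lemma mode_fn_A_dom: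
  assumes i: "i \<in> modes"
  shows "c *\<^sub>R mode_fn i \<in> A_dom a" "wt (A_op a (c *\<^sub>R mode_fn i)) = (c * freq i) *\<^sub>R i"
proof -
  have H: "c *\<^sub>R mode_fn i \<in> H2w a" "d2 (c *\<^sub>R mode_fn i) = c *\<^sub>R mode i"
    using H2w_scale[OF mode_fn(1)[OF i], of c] mode_fn(2) by auto
  have "R ((c * freq i) *\<^sub>R i) = c *\<^sub>R mode i"
    using freq(1)[OF i] by (simp add: R.scale R_mode[OF i])
  then show "c *\<^sub>R mode_fn i \<in> A_dom a" "wt (A_op a (c *\<^sub>R mode_fn i)) = (c * freq i) *\<^sub>R i"
    using A_dom_I[OF H(1), of "(c * freq i) *\<^sub>R i"] H(2) by simp_all
qed

lemma mode_state:
  assumes i: "i \<in> modes"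
  shows "(p *\<^sub>R mode_fn i, q *\<^sub>R mode_fn i) \<in> AA_dom a"
    "\<Psi> (p *\<^sub>R mode_fn i, q *\<^sub>R mode_fn i) = (p *\<^sub>R mode i, (q / freq i) *\<^sub>R i)"
    "\<Psi> (AA_op a (p *\<^sub>R mode_fn i, q *\<^sub>R mode_fn i)) = (q *\<^sub>R mode i, - (p * freq i) *\<^sub>R i)"
proof -
  have H: "c *\<^sub>R mode_fn i \<in> H2w a" "d2 (c *\<^sub>R mode_fn i) = c *\<^sub>R mode i" for c
    using H2w_scale[OF mode_fn(1)[OF i], of c] mode_fn(2) by auto
  have W: "wt (c *\<^sub>R mode_fn i) = (c / freq i) *\<^sub>R i" for c
    using L2w_scale[OF H2w_props(4)[OF mode_fn(1)[OF i]], of c] mode_fn(3)[OF i] by simp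
  show d: "(p *\<^sub>R mode_fn i, q *\<^sub>R mode_fn i) \<in> AA_dom a"
    using mode_fn_A_dom[OF i] H(1) by (simp add: AA_dom_def)
  show "\<Psi> (p *\<^sub>R mode_fn i, q *\<^sub>R mode_fn i) = (p *\<^sub>R mode i, (q / freq i) *\<^sub>R i)"
    by (simp add: \<Psi>_def H W)
  show "\<Psi> (AA_op a (p *\<^sub>R mode_fn i, q *\<^sub>R mode_fn i)) = (q *\<^sub>R mode i, - (p * freq i) *\<^sub>R i)"
    using AA_dom_props(3)[OF d] mode_fn_A_dom[OF i] by (simp add: H)
qed

lemma pair_derivative:
  fixes x y :: l2
  assumes "(f has_real_derivative f') (at t within S)" "(g has_real_derivative g') (at t within S)"
  shows "((\<lambda>s. (f s *\<^sub>R x, g s *\<^sub>R y)) has_vector_derivative (f' *\<^sub>R x, g' *\<^sub>R y)) (at t within S)"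
  using has_vector_derivative_Pair[OF has_vector_derivative_scaleR[OF assms(1) has_vector_derivative_const[of x]]
      has_vector_derivative_scaleR[OF assms(2) has_vector_derivative_const[of y]]] by simp

text \<open>The test solutions for uniqueness. The velocity is scaled so that \<open>wt\<close> maps
  it to the unit vector \<open>i\<close>. The solution is classical, so the constant sequence serves
  as approximation in \<open>mild_trace\<close>.\<close>

lemma mode_solution:
  fixes t0 :: real
  assumes i: "i \<in> modes" and t0: "t0 > 0"
  defines "V \<equiv> \<lambda>t. (sin (freq i * (t - t0)) *\<^sub>R mode_fn i, (freq i * cos (freq i * (t - t0))) *\<^sub>R mode_fn i)"
  shows "mild_solution a t0 (0, freq i *\<^sub>R mode_fn i) V"
    "\<exists>g. mild_trace a t0 (0, freq i *\<^sub>R mode_fn i) g"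
proof -
  have w: "freq i > 0" using freq(1)[OF i] .
  let ?X = "(0, freq i *\<^sub>R mode_fn i)"
  note ms = mode_state[OF i]
  have dom: "V t \<in> AA_dom a" for t unfolding V_def by (rule ms(1))
  have \<Psi>V: "\<Psi> (V t) = (sin (freq i * (t - t0)) *\<^sub>R mode i, cos (freq i * (t - t0)) *\<^sub>R i)" for t
    unfolding V_def ms(2) using w by simp
  have \<Psi>AV: "\<Psi> (AA_op a (V t)) = ((freq i * cos (freq i * (t - t0))) *\<^sub>R mode i, (- (sin (freq i * (t - t0)) * freq i)) *\<^sub>R i)" for t
    unfolding V_def ms(3) by simp
  have VT: "V t0 = ?X" by (simp add: V_def)
  have X: "?X \<in> AA_dom a" using dom[of t0] VT by simp
  have H: "V t \<in> H0 a" "AA_op a (V t) \<in> H0 a" for t using AA_dom_props(1,2)[OF dom] by auto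
  have cs: "classical_solution a t0 ?X V"
    unfolding classical_solution_def
  proof (intro conjI allI impI)
    show "V t \<in> AA_dom a" for t by (rule dom)
    show "curve_has_deriv (H0_norm a) V (\<lambda>t. AA_op a (V t))"
      unfolding curve_has_deriv_H0[OF H] \<Psi>V \<Psi>AV
      by (intro allI impI pair_derivative) (auto intro!: derivative_eq_intros)
    show "curve_continuous (H0_norm a) (\<lambda>t. AA_op a (V t))"
      unfolding curve_continuous_H0[OF H(2)] \<Psi>AV by (intro continuous_intros)
    show "ae_eq2 (V t0) ?X" unfolding VT by (simp add: ae_eq2_def)
  qed
  \<comment> \<open>The primitive of \<open>V\<close> that vanishes at \<open>t0\<close>, computed
    from sin and cos.\<close>
  let ?P = "\<lambda>t. (((1 - cos (freq i * (t - t0))) / freq i) *\<^sub>R mode_fn i, sin (freq i * (t - t0)) *\<^sub>R mode_fn i)"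
  have Pdom: "?P t \<in> AA_dom a" for t by (rule ms(1))
  show "mild_solution a t0 ?X V"
    unfolding mild_solution_def
  proof (intro conjI allI impI exI[of _ ?P])
    show "V t \<in> H0 a" for t by (rule H)
    show "curve_continuous (H0_norm a) V" unfolding curve_continuous_H0[OF H(1)] \<Psi>V by (intro continuous_intros)
    show "?P t \<in> AA_dom a" for t by (rule Pdom)
    show "ae_eq2 (?P t0) 0" by (simp add: ae_eq2_def)
    show "curve_has_deriv (H0_norm a) ?P V"
      unfolding curve_has_deriv_H0[OF AA_dom_props(1)[OF Pdom] H(1)] \<Psi>V ms(2)
      by (intro allI impI pair_derivative) (use w in \<open>auto intro!: derivative_eq_intros simp: field_simps\<close>)
    fix t :: real
    have L: "mode_fn i \<in> L2w a" using H2w_props(4)[OF mode_fn(1)[OF i]] .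
    define c where "c = cos (freq i * (t - t0))"
    define A where "A = A_op a (((1 - c) / freq i) *\<^sub>R mode_fn i)"
    have A: "A \<in> L2w a" "wt A = (1 - c) *\<^sub>R i"
      unfolding A_def using A_dom_props(2)[OF mode_fn_A_dom(1)[OF i]] mode_fn_A_dom(2)[OF i] w by auto
    have 1: "freq i *\<^sub>R mode_fn i \<in> L2w a" "wt (freq i *\<^sub>R mode_fn i) = i"
      "(freq i * c) *\<^sub>R mode_fn i \<in> L2w a" "wt ((freq i * c) *\<^sub>R mode_fn i) = c *\<^sub>R i"
      using L2w_scale[OF L] mode_fn(3)[OF i] w by auto
    have 2: "- A \<in> L2w a" "wt (- A) = - wt A" using L2w_minus[OF A(1)] by auto
    have "wt ((freq i * c) *\<^sub>R mode_fn i) = wt (freq i *\<^sub>R mode_fn i + - A)"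
      using L2w_add[OF 1(1) 2(1)] 1 2 A(2) by (simp add: scaleR_diff_left)
    then have "ae_eq ((freq i * c) *\<^sub>R mode_fn i) (freq i *\<^sub>R mode_fn i + - A)"
      using wt_eq_iff[OF 1(3)] L2w_add[OF 1(1) 2(1)] by blast
    then show "ae_eq2 (V t) (?X + AA_op a (?P t))"
      by (simp add: ae_eq2_def V_def AA_op_def A_def c_def)
  qed
  define g where "g t = sin (freq i * (t - t0)) * trace (freq i *\<^sub>R i)" for t
  have gL: "g \<in> L2_on {0..t0}" unfolding g_def[abs_def] by (intro L2_on_continuous continuous_intros)
  have gt: "second_deriv_trace (fst (V t)) (g t)" for t
  proof -
    have d: "fst (V t) \<in> A_dom a" and e: "wt (A_op a (fst (V t))) = (sin (freq i * (t - t0)) * freq i) *\<^sub>R i"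
      using mode_fn_A_dom[OF i] by (auto simp: V_def)
    have "(sin (freq i * (t - t0)) * freq i) *\<^sub>R i = sin (freq i * (t - t0)) *\<^sub>R (freq i *\<^sub>R i)" by simp
    then show ?thesis unfolding A_dom_trace[OF d] e g_def by (simp only: trace_scale)
  qed
  have z: "H0_norm a (?X - ?X) = 0"
    using H0_norm_\<Psi>[of "?X - ?X"] H0_diff[OF AA_dom_props(1)[OF X] AA_dom_props(1)[OF X]] by simp
  show "\<exists>g. mild_trace a t0 ?X g"
    unfolding mild_trace_def
    by (intro exI[of _ g] conjI gL exI[of _ "\<lambda>_. ?X"] exI[of _ "\<lambda>_. V"] exI[of _ "\<lambda>_. g"] allI ballI X cs gt)
      (use z in \<open>auto simp: L2_norm_def\<close>)
qed

text \<open>The conclusion is the body of \<open>mild\<close>, written out because that predicate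
  belongs to \<open>forced_beam\<close>, which is interpreted only later.\<close>

lemma mild_solution_imp:
  assumes m: "mild_solution a t0 (vT0, vT1) V" and v: "vT0 \<in> H2w a" "vT1 \<in> L2w a" and t0: "t0 \<ge> 0"
  shows "\<exists>p q y. p t0 = 0 \<and> q t0 = 0 \<and>
     (\<forall>t\<ge>0. p t = R (y t) \<and> q t \<in> N \<and> d2 (fst (V t)) = d2 vT0 + q t \<and> wt (snd (V t)) = wt vT1 - y t \<and>
        (p has_vector_derivative d2 (fst (V t))) (at t within {0..}) \<and>
        ((\<lambda>s. opT (q s)) has_vector_derivative wt (snd (V t))) (at t within {0..}))"
    and "\<And>t. t \<ge> 0 \<Longrightarrow> V t \<in> H0 a"
proof -
  show VH: "\<And>t. t \<ge> 0 \<Longrightarrow> V t \<in> H0 a" using m by (simp add: mild_solution_def)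
  obtain P where P: "\<And>t. t \<ge> 0 \<Longrightarrow> P t \<in> AA_dom a" "ae_eq2 (P t0) 0" "curve_has_deriv (H0_norm a) P V"
    "\<And>t. t \<ge> 0 \<Longrightarrow> ae_eq2 (V t) ((vT0, vT1) + AA_op a (P t))"
    using m unfolding mild_solution_def by blast
  note p = AA_dom_props[OF P(1)]
  have der: "((\<lambda>s. \<Psi> (P s)) has_vector_derivative \<Psi> (V t)) (at t within {0..})" if "t \<ge> 0" for t
    using P(3) curve_has_deriv_H0[of P V, OF p(1) VH] that by simp
  have PH: "fst (P t) \<in> H2w a" "snd (P t) \<in> H2w a" "A_op a (fst (P t)) \<in> L2w a" if "t \<ge> 0" for t
    using P(1)[OF that] A_dom_props by (auto simp: AA_dom_def mem_Times_iff)
  have V': "fst (V t) \<in> H2w a" "snd (V t) \<in> L2w a" if "t \<ge> 0" for t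
    using VH[OF that] by (auto simp: H0_def mem_Times_iff)
  show "\<exists>p q y. p t0 = 0 \<and> q t0 = 0 \<and>
     (\<forall>t\<ge>0. p t = R (y t) \<and> q t \<in> N \<and> d2 (fst (V t)) = d2 vT0 + q t \<and> wt (snd (V t)) = wt vT1 - y t \<and>
        (p has_vector_derivative d2 (fst (V t))) (at t within {0..}) \<and>
        ((\<lambda>s. opT (q s)) has_vector_derivative wt (snd (V t))) (at t within {0..}))"
  proof (intro exI conjI allI impI)
    have z: "(0::fn) = (\<lambda>x. 0)" by (simp add: zero_fun_def)
    have "d2 (fst (P t0)) = d2 (\<lambda>x. 0)" "d2 (snd (P t0)) = d2 (\<lambda>x. 0)"
      by (rule ae_eq_d2[OF _ H2w_zero(1)]; use P(2) PH[OF t0] in \<open>simp add: ae_eq2_def z\<close>)+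
    then show "(\<lambda>t. d2 (fst (P t))) t0 = 0" "(\<lambda>t. d2 (snd (P t))) t0 = 0" using H2w_zero(2) by simp_all
    fix t :: real assume t: "0 \<le> t"
    show "d2 (fst (P t)) = R ((\<lambda>t. wt (A_op a (fst (P t)))) t)" using p(4)[OF t] by (simp add: \<Psi>_def)
    show "d2 (snd (P t)) \<in> N" by (rule p(6)[OF t])
    have ae: "ae_eq (fst (V t)) (vT0 + snd (P t))" "ae_eq (snd (V t)) (vT1 + - A_op a (fst (P t)))"
      using P(4)[OF t] by (auto simp: ae_eq2_def AA_op_def)
    have s0: "vT0 + snd (P t) \<in> H2w a" "d2 (vT0 + snd (P t)) = d2 vT0 + d2 (snd (P t))"
      using H2w_add[OF v(1) PH(2)[OF t]] by auto
    show "d2 (fst (V t)) = d2 vT0 + d2 (snd (P t))"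
      using ae_eq_d2[OF V'(1)[OF t] s0(1) ae(1)] s0(2) by simp
    have m0: "- A_op a (fst (P t)) \<in> L2w a" "wt (- A_op a (fst (P t))) = - wt (A_op a (fst (P t)))"
      using L2w_minus[OF PH(3)[OF t]] by auto
    have s1: "vT1 + - A_op a (fst (P t)) \<in> L2w a" "wt (vT1 + - A_op a (fst (P t))) = wt vT1 - wt (A_op a (fst (P t)))"
      using L2w_add[OF v(2) m0(1)] m0(2) by auto
    show "wt (snd (V t)) = wt vT1 - wt (A_op a (fst (P t)))"
      using wt_eq_iff[OF V'(2)[OF t] s1(1)] ae(2) s1(2) by simp
    note d = has_vector_derivative_fst_snd[OF der[OF t]]
    show "((\<lambda>t. d2 (fst (P t))) has_vector_derivative d2 (fst (V t))) (at t within {0..})"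
      using d(1) by (simp add: \<Psi>_def)
    have "((\<lambda>s. snd (\<Psi> (P s))) has_vector_derivative wt (snd (V t))) (at t within {0..})"
      using d(2) by (simp add: \<Psi>_def)
    then show "((\<lambda>s. opT (d2 (snd (P s)))) has_vector_derivative wt (snd (V t))) (at t within {0..})"
      by (rule has_vector_derivative_transform[rotated 2]) (use t p(5) in auto)
  qed
qed

section \<open>Uniqueness and existence\<close>

text \<open>Data with vanishing first component remove the term with u_t, which could differ between
  the two solutions; a mode as second component isolates one coefficient of u(T) / sqrt a. The
  identity speaks of positive times only, so t = 0 is reached by continuity.\<close>

lemma transposition_solution_unique:
  assumes u: "transposition_solution a f u0 u1 u" and w: "transposition_solution a f u0 u1 w" and t: "t \<ge> 0"
  shows "ae_eq (w t) (u t)"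
proof -
  have L: "u s \<in> L2w a" "w s \<in> L2w a" if "s \<ge> 0" for s using u w that by (auto simp: transposition_solution_def)
  have coeff: "wt (x t0) \<bullet> i = u1 (fst (V 0)) * (- 1) + L2w_inner a u0 (snd (V 0)) + (LINT t|lebesgue_on {0..t0}. f t * g t)"
    if x: "transposition_solution a f u0 u1 x" and i: "i \<in> modes" and t0: "t0 > 0"
      and V: "mild_solution a t0 (0, freq i *\<^sub>R mode_fn i) V" and g: "mild_trace a t0 (0, freq i *\<^sub>R mode_fn i) g"
    for x i t0 V g
  proof -
    from x obtain ut where ut: "\<forall>t\<ge>0. ut t \<in> H2w_dual a"
      and eq: "\<forall>T>0. \<forall>vT0\<in>H2w a. \<forall>vT1\<in>L2w a. \<forall>V g.
           mild_solution a T (vT0, vT1) V \<longrightarrow> mild_trace a T (vT0, vT1) g \<longrightarrow>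
             ut T vT0 - L2w_inner a (x T) vT1 =
             u1 (fst (V 0)) - L2w_inner a u0 (snd (V 0)) - (LINT t|lebesgue_on {0..T}. f t * g t)"
      unfolding transposition_solution_def by (elim conjE exE) (rule that)
    have z: "0 \<in> H2w a" using H2w_zero(1) by (simp add: zero_fun_def)
    have m: "freq i *\<^sub>R mode_fn i \<in> L2w a" "wt (freq i *\<^sub>R mode_fn i) = i"
      using L2w_scale[OF H2w_props(4)[OF mode_fn(1)[OF i]], of "freq i"] mode_fn(3)[OF i] freq(1)[OF i] by auto
    \<comment> \<open>\<open>ut t0\<close> is linear only on \<open>H2w a\<close>; homogeneity with
      the factor 0 gives its value at the zero function.\<close>
    have "ut t0 (0 *\<^sub>R 0) = 0 * ut t0 0" 
    proof -
      have "\<forall>c. \<forall>v\<in>H2w a. ut t0 (c *\<^sub>R v) = c * ut t0 v"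
        using ut[rule_format, of t0] t0 unfolding H2w_dual_def by simp
      from bspec[OF spec[OF this, of 0] z] show ?thesis .
    qed
    then have "ut t0 0 = 0" by simp
    moreover have "x t0 \<in> L2w a" using x t0 by (simp add: transposition_solution_def)
    ultimately show ?thesis using eq[rule_format, OF t0 z m(1) V g] L2w_inner_wt[of "x t0", OF _ m(1)] m(2) by simp
  qed
  have pos: "wt (w s) = wt (u s)" if s: "s > 0" for s
  proof -
    have "wt (w s) - wt (u s) = 0"
    proof (rule H.e_total)
      fix i assume i: "i \<in> modes"
      obtain V g where "mild_solution a s (0, freq i *\<^sub>R mode_fn i) V" "mild_trace a s (0, freq i *\<^sub>R mode_fn i) g"
        using mode_solution[OF i s] by blast
      then show "(wt (w s) - wt (u s)) \<bullet> i = 0"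
        using coeff[OF u i s] coeff[OF w i s] by (simp add: inner_diff_left)
    qed simp
    then show ?thesis by simp
  qed
  have lim: "((\<lambda>s. wt (x s)) \<longlongrightarrow> wt (x 0)) (at 0 within {0..})"
    if x: "curve_continuous (L2w_norm a) x" "\<And>s. s \<ge> 0 \<Longrightarrow> x s \<in> L2w a" for x
  proof -
    have "((\<lambda>s. L2w_norm a (x s - x 0)) \<longlongrightarrow> 0) (at 0 within {0..})" using x(1) by (simp add: curve_continuous_def)
    moreover have "\<forall>\<^sub>F s in at 0 within {0..}. L2w_norm a (x s - x 0) = norm (wt (x s) - wt (x 0))"
      using x(2) L2w_diff L2w_norm_wt by (auto simp: eventually_at_filter)
    ultimately have "((\<lambda>s. norm (wt (x s) - wt (x 0))) \<longlongrightarrow> 0) (at 0 within {0..})"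
      by (rule Lim_transform_eventually)
    then show ?thesis by (simp only: tendsto_norm_zero_iff LIM_zero_iff)
  qed
  have "wt (w 0) = wt (u 0)"
  proof (rule tendsto_unique)
    show "at (0::real) within {0..} \<noteq> bot" using trivial_limit_at_right_real[of 0]
      by (metis at_within_Ici_at_right)
    show "((\<lambda>s. wt (w s)) \<longlongrightarrow> wt (w 0)) (at 0 within {0..})"
      using w L by (intro lim) (auto simp: transposition_solution_def)
    have "((\<lambda>s. wt (u s)) \<longlongrightarrow> wt (u 0)) (at 0 within {0..})"
      using u L by (intro lim) (auto simp: transposition_solution_def)
    then show "((\<lambda>s. wt (w s)) \<longlongrightarrow> wt (u 0)) (at 0 within {0..})"
      by (rule Lim_transform_eventually) (use pos in \<open>auto simp: eventually_at_filter\<close>)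
  qed
  then have "wt (w t) = wt (u t)" using pos[of t] t by (cases "t = 0") auto
  then show ?thesis using wt_eq_iff L t by blast
qed

text \<open>u is \<open>X\<close> carried back to functions, and u_t(t) is the functional sending v
  to the inner product of \<open>Y t\<close> with v''. The estimate of
  \<open>X_weak_derivative\<close> is uniform over \<open>N\<close>, and the norm of v'' is at most
  \<open>H2w_norm a v\<close>; together they give differentiability in the dual norm.\<close>

lemma transposition_solution_exists:
  assumes f: "f \<in> L2_loc" and u0: "u0 \<in> L2w a" and u1: "u1 \<in> H2w_dual a"
  shows "\<exists>u. transposition_solution a f u0 u1 u"
proof -
  obtain y0 where y0: "y0 \<in> N" "\<And>u. u \<in> H2w a \<Longrightarrow> u1 u = y0 \<bullet> d2 u" using dual_representation[OF u1] by blast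
  interpret F: forced_beam N opT opM opQ opD trace f y0 "wt u0"
    by unfold_locales (use f y0 in auto)
  define u where "u t = unwt (F.X t)" for t
  define ut where "ut t v = F.Y t \<bullet> d2 v" for t :: real and v
  have u: "u t \<in> L2w a" "wt (u t) = F.X t" for t unfolding u_def by (rule unwt)+
  have inner_u: "L2w_inner a (u t) v = F.X t \<bullet> wt v" if "v \<in> L2w a" for t v
    using L2w_inner_wt[OF u(1) that] u(2) by simp
  have Yb: "\<bar>y \<bullet> d2 v\<bar> \<le> norm y * H2w_norm a v" if "v \<in> H2w a" for y v
    using Cauchy_Schwarz_ineq2[of y "d2 v"] mult_left_mono[OF norm_d2_le[OF that], of "norm y"] by simp
  have "transposition_solution a f u0 u1 u"
    unfolding transposition_solution_def
  proof (intro conjI exI[of _ ut] allI impI ballI)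
    show "u t \<in> L2w a" for t by (rule u(1))
    show "curve_continuous (L2w_norm a) u"
      unfolding curve_continuous_def
    proof (intro allI impI)
      fix t :: real assume t: "0 \<le> t"
      have "L2w_norm a (u s - u t) = norm (F.X s - F.X t)" for s
        using L2w_diff[OF u(1) u(1)] L2w_norm_wt u(2) by simp
      then show "((\<lambda>s. L2w_norm a (u s - u t)) \<longlongrightarrow> 0) (at t within {0..})"
        using F.X_tendsto[OF t] by (simp add: LIM_zero tendsto_norm_zero)
    qed
    show "ut t \<in> H2w_dual a" for t
      unfolding H2w_dual_def ut_def
    proof (intro CollectI conjI ballI allI exI[of _ "norm (F.Y t)"])
    qed (simp_all add: H2w_add H2w_scale inner_add_right Yb)
    show "curve_has_deriv (H2w_dual_norm a) (\<lambda>t. L2w_inner a (u t)) ut"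
      unfolding curve_has_deriv_def
    proof (intro allI impI)
      fix t :: real assume t: "0 \<le> t"
      show "((\<lambda>s. H2w_dual_norm a ((L2w_inner a (u s) - L2w_inner a (u t)) /\<^sub>R (s - t) - ut t)) \<longlongrightarrow> 0) (at t within {0..})"
      proof (rule tendstoI)
        fix e :: real assume e: "e > 0"
        then have e2: "e / 2 > 0" by simp
        obtain d where d: "d > 0" and db: "\<And>s c. s \<ge> 0 \<Longrightarrow> \<bar>s - t\<bar> < d \<Longrightarrow> c \<in> N \<Longrightarrow>
          \<bar>(F.X s - F.X t) \<bullet> opT c - (s - t) * (F.Y t \<bullet> c)\<bar> \<le> e / 2 * norm c * \<bar>s - t\<bar>"
          using F.X_weak_derivative[OF t e2] by blast
        have "\<bar>H2w_dual_norm a ((L2w_inner a (u s) - L2w_inner a (u t)) /\<^sub>R (s - t) - ut t)\<bar> \<le> e / 2"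
          if s: "s \<ge> 0" "s \<noteq> t" "\<bar>s - t\<bar> < d" for s
        proof (rule dual_norm_le)
          fix v assume v: "v \<in> H2w a"
          note vp = H2w_props[OF v]
          have "((L2w_inner a (u s) - L2w_inner a (u t)) /\<^sub>R (s - t) - ut t) v
              = ((F.X s - F.X t) \<bullet> opT (d2 v) - (s - t) * (F.Y t \<bullet> d2 v)) / (s - t)"
            using s(2) inner_u[OF vp(4)] vp(5)
            by (simp add: fun_diff_def scaleR_fun_def ut_def inner_diff_left field_simps)
          then have "\<bar>((L2w_inner a (u s) - L2w_inner a (u t)) /\<^sub>R (s - t) - ut t) v\<bar>
              = \<bar>(F.X s - F.X t) \<bullet> opT (d2 v) - (s - t) * (F.Y t \<bullet> d2 v)\<bar> / \<bar>s - t\<bar>" by simp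
          also have "\<dots> \<le> e / 2 * norm (d2 v)"
            using db[OF s(1,3) vp(2)] s(2) by (simp add: divide_le_eq)
          also have "\<dots> \<le> e / 2 * H2w_norm a v" using e norm_d2_le[OF v] by (intro mult_left_mono) auto
          finally show "\<bar>((L2w_inner a (u s) - L2w_inner a (u t)) /\<^sub>R (s - t) - ut t) v\<bar> \<le> e / 2 * H2w_norm a v" .
        qed (use e in simp)
        then have b: "dist (H2w_dual_norm a ((L2w_inner a (u s) - L2w_inner a (u t)) /\<^sub>R (s - t) - ut t)) 0 < e"
          if "s \<ge> 0" "s \<noteq> t" "\<bar>s - t\<bar> < d" for s
          using that e by (simp add: dist_real_def) (smt (verit) field_sum_of_halves)
        show "\<forall>\<^sub>F s in at t within {0..}. dist (H2w_dual_norm a ((L2w_inner a (u s) - L2w_inner a (u t)) /\<^sub>R (s - t) - ut t)) 0 < e"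
          unfolding eventually_at by (intro exI[of _ d] conjI d ballI impI b) (auto simp: dist_real_def)
      qed
    qed
    show "curve_continuous (H2w_dual_norm a) ut"
      unfolding curve_continuous_def
    proof (intro allI impI)
      fix t :: real assume t: "0 \<le> t"
      have b: "norm (H2w_dual_norm a (ut s - ut t)) \<le> norm (F.Y s - F.Y t)" for s
        unfolding real_norm_def
        by (rule dual_norm_le) (use Yb in \<open>auto simp: ut_def fun_diff_def inner_diff_left[symmetric]\<close>)
      have l: "((\<lambda>s. norm (F.Y s - F.Y t)) \<longlongrightarrow> 0) (at t within {0..})"
        using F.Y_tendsto[OF t] by (simp add: LIM_zero tendsto_norm_zero)
      show "((\<lambda>s. H2w_dual_norm a (ut s - ut t)) \<longlongrightarrow> 0) (at t within {0..})"
        by (rule Lim_null_comparison[OF always_eventually l]) (use b in blast)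
    qed
    fix t0 :: real and vT0 vT1 V g
    assume t0: "0 < t0" and v: "vT0 \<in> H2w a" "vT1 \<in> L2w a"
      and m: "mild_solution a t0 (vT0, vT1) V" and tr: "mild_trace a t0 (vT0, vT1) g"
    have t00: "t0 \<ge> 0" using t0 by simp
    note mi = mild_solution_imp[OF m v t00]
    have V0: "fst (V 0) \<in> H2w a" "snd (V 0) \<in> L2w a" using mi(2)[of 0] by (auto simp: H0_def mem_Times_iff)
    have am: "F.mild t0 (d2 vT0) (wt vT1) (\<lambda>t. d2 (fst (V t))) (\<lambda>t. wt (snd (V t)))"
      unfolding F.mild_def by (rule mi(1))
    obtain Xs Vs rs where gL: "g \<in> L2_on {0..t0}"
      and X: "\<And>n::nat. Xs n \<in> AA_dom a" and cs: "\<And>n. classical_solution a t0 (Xs n) (Vs n)"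
      and rL: "\<And>n. rs n \<in> L2_on {0..t0}" and rt: "\<And>n t. t \<in> {0..t0} \<Longrightarrow> second_deriv_trace (fst (Vs n t)) (rs n t)"
      and limX: "(\<lambda>n. H0_norm a (Xs n - (vT0, vT1))) \<longlonglongrightarrow> 0"
      and limr: "(\<lambda>n. L2_norm {0..t0} (rs n - g)) \<longlonglongrightarrow> 0"
      using tr unfolding mild_trace_def by blast
    have XH: "Xs n \<in> H0 a" for n by (rule AA_dom_props(1)[OF X])
    have TH: "(vT0, vT1) \<in> H0 a" using v by (simp add: H0_def)
    have Vdom: "Vs n t \<in> AA_dom a" if "t \<ge> 0" for n t using cs[of n] that by (simp add: classical_solution_def)
    have "(\<lambda>n. norm (\<Psi> (Xs n) - \<Psi> (vT0, vT1))) \<longlonglongrightarrow> 0"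
      using limX H0_diff[OF XH TH] H0_norm_\<Psi> by simp
    then have "(\<lambda>n. \<Psi> (Xs n)) \<longlonglongrightarrow> \<Psi> (vT0, vT1)" by (simp only: tendsto_norm_zero_iff LIM_zero_iff)
    from tendsto_fst[OF this] tendsto_snd[OF this]
    have lX: "(\<lambda>n. d2 (fst (Xs n))) \<longlonglongrightarrow> d2 vT0" "(\<lambda>n. wt (snd (Xs n))) \<longlonglongrightarrow> wt vT1" by (simp_all add: \<Psi>_def)
    have VT: "d2 (fst (Vs n t0)) = d2 (fst (Xs n))" "opT (d2 (snd (Vs n t0))) = wt (snd (Xs n))" for n
    proof -
      have ae: "ae_eq (fst (Vs n t0)) (fst (Xs n))" "ae_eq (snd (Vs n t0)) (snd (Xs n))"
        using cs[of n] by (auto simp: classical_solution_def ae_eq2_def)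
      have h: "fst (Vs n t0) \<in> H2w a" "snd (Vs n t0) \<in> L2w a" "fst (Xs n) \<in> H2w a" "snd (Xs n) \<in> L2w a"
        using AA_dom_props(1)[OF Vdom[OF t00]] XH[of n] by (auto simp: H0_def mem_Times_iff)
      show "d2 (fst (Vs n t0)) = d2 (fst (Xs n))" by (rule ae_eq_d2[OF h(1,3) ae(1)])
      show "opT (d2 (snd (Vs n t0))) = wt (snd (Xs n))"
        using AA_dom_props(5)[OF Vdom[OF t00, of n]] wt_eq_iff[OF h(2,4)] ae(2) by (simp add: \<Psi>_def)
    qed
    have lr: "(\<lambda>n. integral {0..t0} (\<lambda>t. (rs n t - g t)\<^sup>2)) \<longlonglongrightarrow> 0"
    proof -
      have "(L2_norm {0..t0} (rs n - g))\<^sup>2 = integral {0..t0} (\<lambda>t. (rs n t - g t)\<^sup>2)" for n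
      proof -
        have "(\<lambda>t. rs n t - g t) \<in> L2_on {0..t0}" using L2_on_lincomb[OF rL gL, of 1 n "-1"] by simp
        then have "(LINT t|lebesgue_on {0..t0}. (rs n t - g t)\<^sup>2) = integral {0..t0} (\<lambda>t. (rs n t - g t)\<^sup>2)"
          by (intro lebesgue_integral_eq_integral) (auto simp: L2_on_def)
        moreover have "0 \<le> integral {0..t0} (\<lambda>t. (rs n t - g t)\<^sup>2)" using calculation Bochner_Integration.integral_nonneg[of "lebesgue_on {0..t0}" "\<lambda>t. (rs n t - g t)\<^sup>2"] by simp
        ultimately show ?thesis by (simp add: L2_norm_def fun_diff_def)
      qed
      moreover have "(\<lambda>n. (L2_norm {0..t0} (rs n - g))\<^sup>2) \<longlonglongrightarrow> 0\<^sup>2" by (intro tendsto_intros limr)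
      ultimately show ?thesis by simp
    qed
    have main: "F.Y t0 \<bullet> d2 vT0 - F.X t0 \<bullet> wt vT1
        = y0 \<bullet> d2 (fst (V 0)) - wt u0 \<bullet> wt (snd (V 0)) - integral {0..t0} (\<lambda>t. f t * g t)"
    proof (rule F.transposition_formula[OF t0 H2w_props(2)[OF v(1)] H2w_props(2)[OF V0(1)] am gL classical_solution_imp[OF cs] rL])
      show "rs n t = trace (wt (A_op a (fst (Vs n t))))" if t: "t \<in> {0..t0}" for n t
      proof -
        have "fst (Vs n t) \<in> A_dom a" using Vdom[of t n] t by (auto simp: AA_dom_def mem_Times_iff)
        then show ?thesis using rt[OF t, of n] A_dom_trace by blast
      qed
      show "(\<lambda>n. d2 (fst (Vs n t0))) \<longlonglongrightarrow> d2 vT0" using lX(1) by (simp add: VT)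
      show "(\<lambda>n. opT (d2 (snd (Vs n t0)))) \<longlonglongrightarrow> wt vT1" using lX(2) by (simp add: VT)
      show "(\<lambda>n. integral {0..t0} (\<lambda>t. (rs n t - g t)\<^sup>2)) \<longlonglongrightarrow> 0" by (rule lr)
    qed
    have "(LINT t|lebesgue_on {0..t0}. f t * g t) = integral {0..t0} (\<lambda>t. f t * g t)"
      by (intro lebesgue_integral_eq_integral L2_on_mult_integrable F.f_L2 gL) auto
    then show "ut t0 vT0 - L2w_inner a (u t0) vT1 = u1 (fst (V 0)) - L2w_inner a u0 (snd (V 0)) - (LINT t|lebesgue_on {0..t0}. f t * g t)"
      using main inner_u[OF v(2)] y0(2)[OF V0(1)] L2w_inner_wt[OF u0 V0(2)] by (simp add: ut_def)
  qed
  then show ?thesis by blast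
qed

end

theorem mainTheorem6:
  fixes a f u0 :: "real \<Rightarrow> real" and u1 :: "(real \<Rightarrow> real) \<Rightarrow> real"
  assumes "weakly_degenerate a \<or> strongly_degenerate a"
    and "f \<in> L2_loc"
    and "u0 \<in> L2w a"
    and "u1 \<in> H2w_dual a"
  shows "\<exists>u. transposition_solution a f u0 u1 u \<and>
           (\<forall>w. transposition_solution a f u0 u1 w \<longrightarrow> (\<forall>t\<ge>0. ae_eq (w t) (u t)))"
proof -
  obtain a' where "degenerate_coefficient a a'" using degenerate_coefficientI[OF assms(1)] by blast
  then interpret degenerate_coefficient a a' .
  obtain u where u: "transposition_solution a f u0 u1 u" using transposition_solution_exists[OF assms(2-4)] by blast
  show ?thesis
  proof (intro exI[of _ u] conjI allI impI)
    show "transposition_solution a f u0 u1 u" by (rule u)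
    fix w :: "real \<Rightarrow> real \<Rightarrow> real" and t :: real
    assume "transposition_solution a f u0 u1 w" "0 \<le> t"
    then show "ae_eq (w t) (u t)" by (rule transposition_solution_unique[OF u])
  qed
qed

end
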